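(* Let $\mathcal E$ be a Grothendieck topos and $D:\underline{\mathcal A}_{\mathcal E}\to\underline{\mathcal E}_{\mathcal E}$ an $\mathcal E$-indexed functor, where the $\mathcal E$-indexed category $\underline{\mathcal A}_{\mathcal E}$ is equivalent to the $\mathcal E$-externalization of an internal category in $\mathcal E$. Then an $\mathcal E$-indexed cocone $\mu$ over $D$ with vertex $U$ is an indexed colimiting cocone for $D$ if and only if the following conditions are satisfied: (i) For any object $F$ of $\mathcal E$ and arrow $h:F\to U$ in $\mathcal E$, there exist an epimorphic family $\{f_i:F_i\to F\mid i\in I\}$ in $\mathcal E$ and for each $i\in I$ an object $x_i\in\mathcal A_{F_i}$ and an arrow $\alpha_i:1_{\mathcal E/F_i}\to D_{F_i}(x_i)$ in the topos $\mathcal E/F_i$ such that $\langle h\circ f_i,1_{F_i}\rangle=\mu_{F_i}(x_i)\circ\alpha_i$ as arrows $1_{\mathcal E/F_i}\to F_i^{\ast}(U)$ in $\mathcal E/F_i$ (where $F_i^{\ast}(U)$ is the projection $U\times F_i\to F_i$); (ii) For any object $E$ of $\mathcal E$, any arrow $f:F\to E$ in $\mathcal E$ and any pairs $(x,y)$ and $(x',y')$, where $x$ and $x'$ are objects of $\mathcal A_E$, $y$ is an arrow $(f:F\to E)\to D_E(x)$ in $\mathcal E/E$ and $y'$ is an arrow $(f:F\to E)\to D_E(x')$ in $\mathcal E/E$, we have $\mu_E(x)\circ y=\mu_E(x')\circ y'$ if and only if there exists an epimorphic family $\{f_i:F_i\to F\mid i\in I\}$ in $\mathcal E$ such that for every $i\in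 I$ the pair $\big((\mathcal A_{f\circ f_i}(x),f_i^{\ast}(y)),(\mathcal A_{f\circ f_i}(x'),f_i^{\ast}(y'))\big)$ belongs to the relation $\mathcal R^D_{F_i}$.
   Context: An $\mathcal E$-indexed category $\underline{\mathcal A}_{\mathcal E}$ assigns a category $\mathcal A_E$ to each object $E$ of $\mathcal E$ and a functor $\mathcal A_e:\mathcal A_E\to\mathcal A_{E'}$ to each arrow $e:E'\to E$, (pseudo)functorially. $\underline{\mathcal E}_{\mathcal E}$ is the indexed category with fibres $\mathcal E/E$ and pullback functors $e^{\ast}$. An $\mathcal E$-indexed functor $D$ consists of functors $D_E:\mathcal A_E\to\mathcal E/E$ with $D_{E'}\circ\mathcal A_e\cong e^{\ast}\circ D_E$ (coherently; identified below). The $\mathcal E$-externalization of an internal category $\mathbb C$ has fibre at $E$ the category whose objects are the arrows $E\to\mathbb C_0$ and whose morphisms $x\to x'$ are the arrows $h:E\to\mathbb C_1$ with domain $x$ and codomain $x'$. For an object $E$, $!_E^{\ast}:\mathcal E\to\mathcal E/E$ is pullback along $E\to1$. An indexed cocone $\mu$ over $D$ with vertex $U\in\mathcal E$ consists, for each $E$, of a cocone $\mu_E:D_E\to\Delta({!}_E^{\ast}(U))$ over $D_E$ such that $\alpha^{\ast}(\mu_E(x))=\mu_{E'}(\mathcal A_\alpha(x))$ for every $\alpha:E'\to E$ and $x\in\mathcal A_E$. It is a colimiting cocone if it is universal among such cocones, and an indexed colimiting cocone if moreover, for every object $I$ of $\mathcal E$, its localization $\mu/I$ (a cocone with vertex $!_I^{\ast}(U)$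 over the $\mathcal E/I$-indexed functor $D/I$ whose component at $e:E\to I$ is $D_E$) is a colimiting cocone. For an object $R$ of $\mathcal E$, $\mathcal I^D_R$ is the set of pairs $(x,y)$ with $x$ an object of $\mathcal A_R$ and $y$ an arrow $1_{\mathcal E/R}\to D_R(x)$ in $\mathcal E/R$. $\mathcal R^D_R$ is the equivalence relation on $\mathcal I^D_R$ generated by the pairs $((x,y),(x',y'))$ such that there exists an arrow $g:x\to x'$ in $\mathcal A_R$ with $y'=D_R(g)\circ y$. For $y:(f:F\to E)\to D_E(x)$ in $\mathcal E/E$ and $f_i:F_i\to F$, $f_i^{\ast}(y)$ denotes the arrow $1_{\mathcal E/F_i}\to D_{F_i}(\mathcal A_{f\circ f_i}(x))=(f\circ f_i)^{\ast}(D_E(x))$ in $\mathcal E/F_i$ corresponding, by the universal property of the pullback, to $y\circ f_i$. All epimorphic families are set-indexed. *)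

theory Defs
  imports Main "HOL-Library.FuncSet"
begin

unbundle cardinal_syntax

section \<open>Small sets\<close>

text \<open>
  Smallness is relative to a type \<open>'u\<close> whose cardinality is (strongly) inaccessible, i.e. to a
  Grothendieck universe.  Up to bijection, the small sets are the small subsets of \<open>'u\<close>.
\<close>

definition small :: "'u itself \<Rightarrow> 'b set \<Rightarrow> bool" where
  "small U A \<longleftrightarrow> |A| <o |UNIV :: 'u set|"

definition inaccessible :: "'u itself \<Rightarrow> bool" where
  "inaccessible U \<longleftrightarrow>
     |UNIV :: nat set| <o |UNIV :: 'u set| \<and>
     regularCard |UNIV :: 'u set| \<and>
     (\<forall>A :: 'u set. small U A \<longrightarrow> small U (Pow A))"


section \<open>Categories, functors, natural isomorphisms\<close>

record ('o, 'a) category =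
  Obj :: "'o set"
  Arr :: "'a set"
  Dom :: "'a \<Rightarrow> 'o"
  Cod :: "'a \<Rightarrow> 'o"
  Idn :: "'o \<Rightarrow> 'a"
  Comp :: "'a \<Rightarrow> 'a \<Rightarrow> 'a"  (infixl \<open>\<cdot>\<index>\<close> 70)

definition Hom :: "('o, 'a, 'z) category_scheme \<Rightarrow> 'o \<Rightarrow> 'o \<Rightarrow> 'a set" where
  "Hom C x y = {f \<in> Arr C. Dom C f = x \<and> Cod C f = y}"

locale category =
  fixes C :: "('o, 'a, 'z) category_scheme" (structure)
  assumes dom_obj: "f \<in> Arr C \<Longrightarrow> Dom C f \<in> Obj C"
    and cod_obj: "f \<in> Arr C \<Longrightarrow> Cod C f \<in> Obj C"
    and idn_hom: "x \<in> Obj C \<Longrightarrow> Idn C x \<in> Hom C x x"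
    and comp_hom: "f \<in> Hom C x y \<Longrightarrow> g \<in> Hom C y z \<Longrightarrow> g \<cdot> f \<in> Hom C x z"
    and comp_idn: "f \<in> Hom C x y \<Longrightarrow> f \<cdot> Idn C x = f"
    and idn_comp: "f \<in> Hom C x y \<Longrightarrow> Idn C y \<cdot> f = f"
    and comp_assoc: "f \<in> Hom C w x \<Longrightarrow> g \<in> Hom C x y \<Longrightarrow> h \<in> Hom C y z \<Longrightarrow>
                       (h \<cdot> g) \<cdot> f = h \<cdot> (g \<cdot> f)"

definition inverse_pair :: "('o, 'a, 'z) category_scheme \<Rightarrow> 'a \<Rightarrow> 'a \<Rightarrow> bool" where
  "inverse_pair C f g \<longleftrightarrow> f \<in> Arr C \<and> g \<in> Hom C (Cod C f) (Dom C f) \<and>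
     g \<cdot>\<^bsub>C\<^esub> f = Idn C (Dom C f) \<and> f \<cdot>\<^bsub>C\<^esub> g = Idn C (Cod C f)"

definition is_iso :: "('o, 'a, 'z) category_scheme \<Rightarrow> 'a \<Rightarrow> bool" where
  "is_iso C f \<longleftrightarrow> (\<exists>g. inverse_pair C f g)"

definition inverse_arr :: "('o, 'a, 'z) category_scheme \<Rightarrow> 'a \<Rightarrow> 'a" where
  "inverse_arr C f = (THE g. inverse_pair C f g)"

definition is_functor ::
  "('o, 'a, 'z) category_scheme \<Rightarrow> ('p, 'b, 'w) category_scheme \<Rightarrow>
   ('o \<Rightarrow> 'p) \<Rightarrow> ('a \<Rightarrow> 'b) \<Rightarrow> bool" where
  "is_functor A B FO FA \<longleftrightarrow> category A \<and> category B \<and>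
     (\<forall>x \<in> Obj A. FO x \<in> Obj B \<and> FA (Idn A x) = Idn B (FO x)) \<and>
     (\<forall>f \<in> Arr A. FA f \<in> Hom B (FO (Dom A f)) (FO (Cod A f))) \<and>
     (\<forall>f \<in> Arr A. \<forall>g \<in> Arr A. Dom A g = Cod A f \<longrightarrow>
        FA (g \<cdot>\<^bsub>A\<^esub> f) = FA g \<cdot>\<^bsub>B\<^esub> FA f)"

text \<open>\<open>\<theta>\<close> is a natural isomorphism from \<open>(FO, FA)\<close> to \<open>(GO, GA)\<close>.\<close>

definition is_nat_iso ::
  "('o, 'a, 'z) category_scheme \<Rightarrow> ('p, 'b, 'w) category_scheme \<Rightarrow>
   ('o \<Rightarrow> 'p) \<Rightarrow> ('a \<Rightarrow> 'b) \<Rightarrow> ('o \<Rightarrow> 'p) \<Rightarrow> ('a \<Rightarrow> 'b) \<Rightarrow> ('o \<Rightarrow> 'b) \<Rightarrow> bool" where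
  "is_nat_iso A B FO FA GO GA \<theta> \<longleftrightarrow>
     (\<forall>x \<in> Obj A. \<theta> x \<in> Hom B (FO x) (GO x) \<and> is_iso B (\<theta> x)) \<and>
     (\<forall>f \<in> Arr A. GA f \<cdot>\<^bsub>B\<^esub> \<theta> (Dom A f) = \<theta> (Cod A f) \<cdot>\<^bsub>B\<^esub> FA f)"

definition equivalent_categories ::
  "('o, 'a, 'z) category_scheme \<Rightarrow> ('p, 'b, 'w) category_scheme \<Rightarrow> bool" where
  "equivalent_categories A B \<longleftrightarrow>
     (\<exists>FO FA GO GA \<eta> \<epsilon>.
        is_functor A B FO FA \<and> is_functor B A GO GA \<and>
        is_nat_iso A A (GO \<circ> FO) (GA \<circ> FA) id id \<eta> \<and>
        is_nat_iso B B (FO \<circ> GO) (FA \<circ> GA) id id \<epsilon>)"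


section \<open>Sheaves on a site and Grothendieck toposes\<close>

definition sieve :: "('o, 'a, 'z) category_scheme \<Rightarrow> 'o \<Rightarrow> 'a set \<Rightarrow> bool" where
  "sieve C c S \<longleftrightarrow> S \<subseteq> {f \<in> Arr C. Cod C f = c} \<and>
     (\<forall>f \<in> S. \<forall>g \<in> Arr C. Cod C g = Dom C f \<longrightarrow> f \<cdot>\<^bsub>C\<^esub> g \<in> S)"

definition pullback_sieve :: "('o, 'a, 'z) category_scheme \<Rightarrow> 'a \<Rightarrow> 'a set \<Rightarrow> 'a set" where
  "pullback_sieve C h S = {g \<in> Arr C. Cod C g = Dom C h \<and> h \<cdot>\<^bsub>C\<^esub> g \<in> S}"

definition grothendieck_topology ::
  "('o, 'a, 'z) category_scheme \<Rightarrow> ('o \<Rightarrow> 'a set set) \<Rightarrow> bool" where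
  "grothendieck_topology C J \<longleftrightarrow>
     (\<forall>c \<in> Obj C. \<forall>S \<in> J c. sieve C c S) \<and>
     (\<forall>c \<in> Obj C. {f \<in> Arr C. Cod C f = c} \<in> J c) \<and>
     (\<forall>h \<in> Arr C. \<forall>S \<in> J (Cod C h). pullback_sieve C h S \<in> J (Dom C h)) \<and>
     (\<forall>c \<in> Obj C. \<forall>S \<in> J c. \<forall>R. sieve C c R \<longrightarrow>
        (\<forall>h \<in> S. pullback_sieve C h R \<in> J (Dom C h)) \<longrightarrow> R \<in> J c)"

text \<open>
  A presheaf is a pair of its values on objects and its restriction maps.  Its values outside the
  base category are left arbitrary, which only produces isomorphic copies of the same presheaf;
  morphisms, in contrast, are taken extensional, so that their equality is the right one.
\<close>

type_synonym ('o, 'a, 'u) presheaf = "('o \<Rightarrow> 'u set) \<times> ('a \<Rightarrow> 'u \<Rightarrow> 'u)"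

definition is_presheaf ::
  "('o, 'a, 'z) category_scheme \<Rightarrow> ('o, 'a, 'u) presheaf \<Rightarrow> bool" where
  "is_presheaf C P \<longleftrightarrow>
     (\<forall>c \<in> Obj C. small TYPE('u) (fst P c)) \<and>
     (\<forall>f \<in> Arr C. snd P f \<in> fst P (Cod C f) \<rightarrow> fst P (Dom C f)) \<and>
     (\<forall>c \<in> Obj C. \<forall>s \<in> fst P c. snd P (Idn C c) s = s) \<and>
     (\<forall>f \<in> Arr C. \<forall>g \<in> Arr C. Cod C g = Dom C f \<longrightarrow>
        (\<forall>s \<in> fst P (Cod C f). snd P (f \<cdot>\<^bsub>C\<^esub> g) s = snd P g (snd P f s)))"

definition matching_family ::
  "('o, 'a, 'z) category_scheme \<Rightarrow> ('o, 'a, 'u) presheaf \<Rightarrow> 'a set \<Rightarrow> ('a \<Rightarrow> 'u) \<Rightarrow> bool" where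
  "matching_family C P S s \<longleftrightarrow>
     (\<forall>f \<in> S. s f \<in> fst P (Dom C f)) \<and>
     (\<forall>f \<in> S. \<forall>g \<in> Arr C. Cod C g = Dom C f \<longrightarrow> s (f \<cdot>\<^bsub>C\<^esub> g) = snd P g (s f))"

definition is_sheaf ::
  "('o, 'a, 'z) category_scheme \<Rightarrow> ('o \<Rightarrow> 'a set set) \<Rightarrow> ('o, 'a, 'u) presheaf \<Rightarrow> bool" where
  "is_sheaf C J P \<longleftrightarrow> is_presheaf C P \<and>
     (\<forall>c \<in> Obj C. \<forall>S \<in> J c. \<forall>s. matching_family C P S s \<longrightarrow>
        (\<exists>!t. t \<in> fst P c \<and> (\<forall>f \<in> S. snd P f t = s f)))"

definition sheaf_category ::
  "('o, 'a, 'z) category_scheme \<Rightarrow> ('o \<Rightarrow> 'a set set) \<Rightarrow>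
   (('o, 'a, 'u) presheaf,
    ('o, 'a, 'u) presheaf \<times> ('o \<Rightarrow> 'u \<Rightarrow> 'u) \<times> ('o, 'a, 'u) presheaf) category" where
  "sheaf_category C J = \<lparr>
     Obj = {P. is_sheaf C J P},
     Arr = {(P, \<theta>, Q). is_sheaf C J P \<and> is_sheaf C J Q \<and>
              \<theta> \<in> (\<Pi>\<^sub>E c \<in> Obj C. fst P c \<rightarrow>\<^sub>E fst Q c) \<and>
              (\<forall>f \<in> Arr C. \<forall>s \<in> fst P (Cod C f).
                 \<theta> (Dom C f) (snd P f s) = snd Q f (\<theta> (Cod C f) s))},
     Dom = (\<lambda>(P, \<theta>, Q). P),
     Cod = (\<lambda>(P, \<theta>, Q). Q),
     Idn = (\<lambda>P. (P, \<lambda>c \<in> Obj C. \<lambda>s \<in> fst P c. s, P)),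
     Comp = (\<lambda>(Q', \<sigma>, R) (P, \<theta>, Q). (P, \<lambda>c \<in> Obj C. compose (fst P c) (\<sigma> c) (\<theta> c), R)) \<rparr>"

text \<open>Every small category is isomorphic to one whose objects and arrows are elements of \<open>'u\<close>.\<close>

definition grothendieck_topos :: "'u itself \<Rightarrow> ('o, 'a, 'z) category_scheme \<Rightarrow> bool" where
  "grothendieck_topos U E \<longleftrightarrow> category E \<and>
     (\<exists>(C :: ('u, 'u) category) J.
        category C \<and> small U (Obj C) \<and> small U (Arr C) \<and> grothendieck_topology C J \<and>
        equivalent_categories E
          (sheaf_category C J :: (('u, 'u, 'u) presheaf, _) category))"

definition epimorphic_family ::
  "('o, 'a, 'z) category_scheme \<Rightarrow> 'o \<Rightarrow> 'i set \<Rightarrow> ('i \<Rightarrow> 'a) \<Rightarrow> bool" where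
  "epimorphic_family C F I f \<longleftrightarrow>
     (\<forall>i \<in> I. f i \<in> Arr C \<and> Cod C (f i) = F) \<and>
     (\<forall>z. \<forall>g \<in> Hom C F z. \<forall>h \<in> Hom C F z.
        (\<forall>i \<in> I. g \<cdot>\<^bsub>C\<^esub> f i = h \<cdot>\<^bsub>C\<^esub> f i) \<longrightarrow> g = h)"


section \<open>Chosen finite limits and slices\<close>

text \<open>
  Pullback functors require a choice of pullbacks.  For \<open>e : E' \<rightarrow> E\<close> and \<open>p : X \<rightarrow> E\<close>, the chosen
  pullback square has left side \<open>Pb e p : P \<rightarrow> E'\<close> (this is \<open>e\<^sup>*(p)\<close>) and top side
  \<open>Pt e p : P \<rightarrow> X\<close>.
\<close>

record ('o, 'a) lex_category = "('o, 'a) category" +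
  One :: 'o
  Pb :: "'a \<Rightarrow> 'a \<Rightarrow> 'a"
  Pt :: "'a \<Rightarrow> 'a \<Rightarrow> 'a"

definition is_terminal :: "('o, 'a, 'z) category_scheme \<Rightarrow> 'o \<Rightarrow> bool" where
  "is_terminal C t \<longleftrightarrow> t \<in> Obj C \<and> (\<forall>x \<in> Obj C. \<exists>!f. f \<in> Hom C x t)"

definition is_pullback :: "('o, 'a, 'z) category_scheme \<Rightarrow> 'a \<Rightarrow> 'a \<Rightarrow> 'a \<Rightarrow> 'a \<Rightarrow> bool" where
  "is_pullback C e p s t \<longleftrightarrow>
     s \<in> Arr C \<and> t \<in> Arr C \<and> Dom C s = Dom C t \<and> Cod C s = Dom C e \<and> Cod C t = Dom C p \<and>
     e \<cdot>\<^bsub>C\<^esub> s = p \<cdot>\<^bsub>C\<^esub> t \<and>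
     (\<forall>z. \<forall>a \<in> Hom C z (Dom C e). \<forall>b \<in> Hom C z (Dom C p). e \<cdot>\<^bsub>C\<^esub> a = p \<cdot>\<^bsub>C\<^esub> b \<longrightarrow>
        (\<exists>!u. u \<in> Hom C z (Dom C s) \<and> s \<cdot>\<^bsub>C\<^esub> u = a \<and> t \<cdot>\<^bsub>C\<^esub> u = b))"

definition chosen_finite_limits :: "('o, 'a, 'z) lex_category_scheme \<Rightarrow> bool" where
  "chosen_finite_limits C \<longleftrightarrow> is_terminal C (One C) \<and>
     (\<forall>e \<in> Arr C. \<forall>p \<in> Arr C. Cod C e = Cod C p \<longrightarrow> is_pullback C e p (Pb C e p) (Pt C e p))"

definition bang :: "('o, 'a, 'z) lex_category_scheme \<Rightarrow> 'o \<Rightarrow> 'a" where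
  "bang C x = (THE f. f \<in> Hom C x (One C))"

definition pair :: "('o, 'a, 'z) lex_category_scheme \<Rightarrow> 'a \<Rightarrow> 'a \<Rightarrow> 'a \<Rightarrow> 'a \<Rightarrow> 'a" where
  "pair C e p a b = (THE u. u \<in> Hom C (Dom C a) (Dom C (Pb C e p)) \<and>
     Pb C e p \<cdot>\<^bsub>C\<^esub> u = a \<and> Pt C e p \<cdot>\<^bsub>C\<^esub> u = b)"

text \<open>
  Arrows of the slice over \<open>I\<close> are triples \<open>(p, k, q)\<close> with \<open>q \<circ> k = p\<close>.  Chosen pullbacks in the
  slice are those of the base category, so that \<open>(C/I)/e\<close> and \<open>C/E\<close>, for \<open>e : E \<rightarrow> I\<close>, have the same
  pullback functors.
\<close>

definition slice :: "('o, 'a, 'z) category_scheme \<Rightarrow> 'o \<Rightarrow> ('a, 'a \<times> 'a \<times> 'a) category" where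
  "slice C I = \<lparr>
     Obj = {p \<in> Arr C. Cod C p = I},
     Arr = {(p, k, q). p \<in> Arr C \<and> Cod C p = I \<and> q \<in> Arr C \<and> Cod C q = I \<and>
              k \<in> Hom C (Dom C p) (Dom C q) \<and> q \<cdot>\<^bsub>C\<^esub> k = p},
     Dom = (\<lambda>(p, k, q). p),
     Cod = (\<lambda>(p, k, q). q),
     Idn = (\<lambda>p. (p, Idn C (Dom C p), p)),
     Comp = (\<lambda>(q', l, r) (p, k, q). (p, l \<cdot>\<^bsub>C\<^esub> k, r)) \<rparr>"

definition lex_slice ::
  "('o, 'a, 'z) lex_category_scheme \<Rightarrow> 'o \<Rightarrow> ('a, 'a \<times> 'a \<times> 'a) lex_category" where
  "lex_slice C I = \<lparr>
     Obj = Obj (slice C I), Arr = Arr (slice C I),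
     Dom = Dom (slice C I), Cod = Cod (slice C I),
     Idn = Idn (slice C I), Comp = Comp (slice C I),
     One = Idn C I,
     Pb = (\<lambda>(x, k, z) (y, l, z'). (x \<cdot>\<^bsub>C\<^esub> Pb C k l, Pb C k l, x)),
     Pt = (\<lambda>(x, k, z) (y, l, z'). (x \<cdot>\<^bsub>C\<^esub> Pb C k l, Pt C k l, y)) \<rparr>"

text \<open>
  The isomorphism from \<open>C/E\<close> to \<open>(C/I)/e\<close>, for \<open>e : E \<rightarrow> I\<close>, on objects and on arrows.
\<close>

definition over_obj :: "('o, 'a, 'z) category_scheme \<Rightarrow> 'a \<Rightarrow> 'a \<Rightarrow> 'a \<times> 'a \<times> 'a" where
  "over_obj C e p = (e \<cdot>\<^bsub>C\<^esub> p, p, e)"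

definition over_arr ::
  "('o, 'a, 'z) category_scheme \<Rightarrow> 'a \<Rightarrow> 'a \<times> 'a \<times> 'a \<Rightarrow>
   ('a \<times> 'a \<times> 'a) \<times> ('a \<times> 'a \<times> 'a) \<times> ('a \<times> 'a \<times> 'a)" where
  "over_arr C e = (\<lambda>(p, k, q). (over_obj C e p, (e \<cdot>\<^bsub>C\<^esub> p, k, e \<cdot>\<^bsub>C\<^esub> q), over_obj C e q))"


section \<open>Indexed categories\<close>

text \<open>
  Reindexing along \<open>e : E' \<rightarrow> E\<close> is the functor \<open>(ReO e, ReA e)\<close> from the fibre at \<open>E\<close> to the fibre at
  \<open>E'\<close>.  The structural isomorphisms of the pseudofunctor are
  \<open>ReUnit E x : ReO 1\<^sub>E x \<rightarrow> x\<close> and, for \<open>e' : E'' \<rightarrow> E'\<close>,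
  \<open>ReComp e e' x : ReO e' (ReO e x) \<rightarrow> ReO (e \<circ> e') x\<close>.
\<close>

record ('o, 'a, 'x, 'm) indexed_category =
  Fib :: "'o \<Rightarrow> ('x, 'm) category"
  ReO :: "'a \<Rightarrow> 'x \<Rightarrow> 'x"
  ReA :: "'a \<Rightarrow> 'm \<Rightarrow> 'm"
  ReUnit :: "'o \<Rightarrow> 'x \<Rightarrow> 'm"
  ReComp :: "'a \<Rightarrow> 'a \<Rightarrow> 'x \<Rightarrow> 'm"

definition is_indexed_category ::
  "('o, 'a, 'z) category_scheme \<Rightarrow> ('o, 'a, 'x, 'm) indexed_category \<Rightarrow> bool" where
  "is_indexed_category S A \<longleftrightarrow>
     (\<forall>E \<in> Obj S. category (Fib A E)) \<and>
     (\<forall>e \<in> Arr S. is_functor (Fib A (Cod S e)) (Fib A (Dom S e)) (ReO A e) (ReA A e)) \<and>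
     (\<forall>E \<in> Obj S. is_nat_iso (Fib A E) (Fib A E)
        (ReO A (Idn S E)) (ReA A (Idn S E)) id id (ReUnit A E)) \<and>
     (\<forall>e \<in> Arr S. \<forall>e' \<in> Arr S. Cod S e' = Dom S e \<longrightarrow>
        is_nat_iso (Fib A (Cod S e)) (Fib A (Dom S e'))
          (ReO A e' \<circ> ReO A e) (ReA A e' \<circ> ReA A e)
          (ReO A (e \<cdot>\<^bsub>S\<^esub> e')) (ReA A (e \<cdot>\<^bsub>S\<^esub> e')) (ReComp A e e')) \<and>
     (\<forall>e \<in> Arr S. \<forall>x \<in> Obj (Fib A (Cod S e)).
        ReComp A (Idn S (Cod S e)) e x = ReA A e (ReUnit A (Cod S e) x) \<and>
        ReComp A e (Idn S (Dom S e)) x = ReUnit A (Dom S e) (ReO A e x)) \<and>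
     (\<forall>e \<in> Arr S. \<forall>e' \<in> Arr S. \<forall>e'' \<in> Arr S.
        Cod S e' = Dom S e \<longrightarrow> Cod S e'' = Dom S e' \<longrightarrow>
        (\<forall>x \<in> Obj (Fib A (Cod S e)).
           ReComp A (e \<cdot>\<^bsub>S\<^esub> e') e'' x \<cdot>\<^bsub>Fib A (Dom S e'')\<^esub> ReA A e'' (ReComp A e e' x) =
           ReComp A e (e' \<cdot>\<^bsub>S\<^esub> e'') x \<cdot>\<^bsub>Fib A (Dom S e'')\<^esub> ReComp A e' e'' (ReO A e x)))"

text \<open>
  An indexed functor \<open>F : A \<rightarrow> B\<close> comes with its comparison isomorphisms
  \<open>Cmp e x : F\<^sub>E\<^sub>' (A\<^sub>e x) \<rightarrow> B\<^sub>e (F\<^sub>E x)\<close> for \<open>e : E' \<rightarrow> E\<close>.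
\<close>

record ('o, 'a, 'x, 'm, 'y, 'n) indexed_functor =
  FunO :: "'o \<Rightarrow> 'x \<Rightarrow> 'y"
  FunA :: "'o \<Rightarrow> 'm \<Rightarrow> 'n"
  Cmp :: "'a \<Rightarrow> 'x \<Rightarrow> 'n"

definition is_indexed_functor ::
  "('o, 'a, 'z) category_scheme \<Rightarrow> ('o, 'a, 'x, 'm) indexed_category \<Rightarrow>
   ('o, 'a, 'y, 'n) indexed_category \<Rightarrow> ('o, 'a, 'x, 'm, 'y, 'n) indexed_functor \<Rightarrow> bool" where
  "is_indexed_functor S A B F \<longleftrightarrow>
     (\<forall>E \<in> Obj S. is_functor (Fib A E) (Fib B E) (FunO F E) (FunA F E)) \<and>
     (\<forall>e \<in> Arr S. is_nat_iso (Fib A (Cod S e)) (Fib B (Dom S e))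
        (FunO F (Dom S e) \<circ> ReO A e) (FunA F (Dom S e) \<circ> ReA A e)
        (ReO B e \<circ> FunO F (Cod S e)) (ReA B e \<circ> FunA F (Cod S e)) (Cmp F e)) \<and>
     (\<forall>E \<in> Obj S. \<forall>x \<in> Obj (Fib A E).
        ReUnit B E (FunO F E x) \<cdot>\<^bsub>Fib B E\<^esub> Cmp F (Idn S E) x = FunA F E (ReUnit A E x)) \<and>
     (\<forall>e \<in> Arr S. \<forall>e' \<in> Arr S. Cod S e' = Dom S e \<longrightarrow>
        (\<forall>x \<in> Obj (Fib A (Cod S e)).
           Cmp F (e \<cdot>\<^bsub>S\<^esub> e') x \<cdot>\<^bsub>Fib B (Dom S e')\<^esub> FunA F (Dom S e') (ReComp A e e' x) =
           ReComp B e e' (FunO F (Cod S e) x) \<cdot>\<^bsub>Fib B (Dom S e')\<^esub>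
             (ReA B e' (Cmp F e x) \<cdot>\<^bsub>Fib B (Dom S e')\<^esub> Cmp F e' (ReO A e x))))"

definition id_indexed_functor ::
  "('o, 'a, 'z) category_scheme \<Rightarrow> ('o, 'a, 'x, 'm) indexed_category \<Rightarrow>
   ('o, 'a, 'x, 'm, 'x, 'm) indexed_functor" where
  "id_indexed_functor S A =
     \<lparr> FunO = (\<lambda>E x. x), FunA = (\<lambda>E g. g), Cmp = (\<lambda>e x. Idn (Fib A (Dom S e)) (ReO A e x)) \<rparr>"

definition comp_indexed_functor ::
  "('o, 'a, 'z) category_scheme \<Rightarrow> ('o, 'a, 'w, 'l) indexed_category \<Rightarrow>
   ('o, 'a, 'y, 'n, 'w, 'l) indexed_functor \<Rightarrow> ('o, 'a, 'x, 'm, 'y, 'n) indexed_functor \<Rightarrow>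
   ('o, 'a, 'x, 'm, 'w, 'l) indexed_functor" where
  "comp_indexed_functor S B G F = \<lparr>
     FunO = (\<lambda>E x. FunO G E (FunO F E x)),
     FunA = (\<lambda>E g. FunA G E (FunA F E g)),
     Cmp = (\<lambda>e x. Cmp G e (FunO F (Cod S e) x) \<cdot>\<^bsub>Fib B (Dom S e)\<^esub>
                    FunA G (Dom S e) (Cmp F e x)) \<rparr>"

definition is_indexed_nat_iso ::
  "('o, 'a, 'z) category_scheme \<Rightarrow> ('o, 'a, 'x, 'm) indexed_category \<Rightarrow>
   ('o, 'a, 'y, 'n) indexed_category \<Rightarrow> ('o, 'a, 'x, 'm, 'y, 'n) indexed_functor \<Rightarrow>
   ('o, 'a, 'x, 'm, 'y, 'n) indexed_functor \<Rightarrow> ('o \<Rightarrow> 'x \<Rightarrow> 'n) \<Rightarrow> bool" where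
  "is_indexed_nat_iso S A B F G \<theta> \<longleftrightarrow>
     (\<forall>E \<in> Obj S. is_nat_iso (Fib A E) (Fib B E)
        (FunO F E) (FunA F E) (FunO G E) (FunA G E) (\<theta> E)) \<and>
     (\<forall>e \<in> Arr S. \<forall>x \<in> Obj (Fib A (Cod S e)).
        Cmp G e x \<cdot>\<^bsub>Fib B (Dom S e)\<^esub> \<theta> (Dom S e) (ReO A e x) =
        ReA B e (\<theta> (Cod S e) x) \<cdot>\<^bsub>Fib B (Dom S e)\<^esub> Cmp F e x)"

definition equivalent_indexed_categories ::
  "('o, 'a, 'z) category_scheme \<Rightarrow> ('o, 'a, 'x, 'm) indexed_category \<Rightarrow>
   ('o, 'a, 'y, 'n) indexed_category \<Rightarrow> bool" where
  "equivalent_indexed_categories S A B \<longleftrightarrow>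
     (\<exists>F G \<eta> \<epsilon>.
        is_indexed_functor S A B F \<and> is_indexed_functor S B A G \<and>
        is_indexed_nat_iso S A A (comp_indexed_functor S A G F) (id_indexed_functor S A) \<eta> \<and>
        is_indexed_nat_iso S B B (comp_indexed_functor S B F G) (id_indexed_functor S B) \<epsilon>)"

definition self_indexing ::
  "('o, 'a, 'z) lex_category_scheme \<Rightarrow> ('o, 'a, 'a, 'a \<times> 'a \<times> 'a) indexed_category" where
  "self_indexing C = \<lparr>
     Fib = slice C,
     ReO = Pb C,
     ReA = (\<lambda>e (p, k, q). (Pb C e p, pair C e q (Pb C e p) (k \<cdot>\<^bsub>C\<^esub> Pt C e p), Pb C e q)),
     ReUnit = (\<lambda>E p. (Pb C (Idn C E) p, Pt C (Idn C E) p, p)),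
     ReComp = (\<lambda>e e' p.
       (Pb C e' (Pb C e p),
        pair C (e \<cdot>\<^bsub>C\<^esub> e') p (Pb C e' (Pb C e p)) (Pt C e p \<cdot>\<^bsub>C\<^esub> Pt C e' (Pb C e p)),
        Pb C (e \<cdot>\<^bsub>C\<^esub> e') p)) \<rparr>"


section \<open>Internal categories and their externalization\<close>

text \<open>
  The object of composable pairs is the chosen pullback of \<open>d1\<close> along \<open>d0\<close>; its two projections
  \<open>Pb d1 d0\<close> and \<open>Pt d1 d0\<close> give the first and the second arrow of the pair (in diagrammatic order).
\<close>

record ('o, 'a) internal_category =
  C0 :: 'o
  C1 :: 'o
  d0 :: 'a
  d1 :: 'a
  unt :: 'a
  mult :: 'a

definition is_internal_category ::
  "('o, 'a, 'z) lex_category_scheme \<Rightarrow> ('o, 'a) internal_category \<Rightarrow> bool" where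
  "is_internal_category C K \<longleftrightarrow>
     C0 K \<in> Obj C \<and> C1 K \<in> Obj C \<and>
     d0 K \<in> Hom C (C1 K) (C0 K) \<and> d1 K \<in> Hom C (C1 K) (C0 K) \<and> unt K \<in> Hom C (C0 K) (C1 K) \<and>
     mult K \<in> Hom C (Dom C (Pb C (d1 K) (d0 K))) (C1 K) \<and>
     d0 K \<cdot>\<^bsub>C\<^esub> unt K = Idn C (C0 K) \<and> d1 K \<cdot>\<^bsub>C\<^esub> unt K = Idn C (C0 K) \<and>
     d0 K \<cdot>\<^bsub>C\<^esub> mult K = d0 K \<cdot>\<^bsub>C\<^esub> Pb C (d1 K) (d0 K) \<and>
     d1 K \<cdot>\<^bsub>C\<^esub> mult K = d1 K \<cdot>\<^bsub>C\<^esub> Pt C (d1 K) (d0 K) \<and>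
     mult K \<cdot>\<^bsub>C\<^esub> pair C (d1 K) (d0 K) (unt K \<cdot>\<^bsub>C\<^esub> d0 K) (Idn C (C1 K)) = Idn C (C1 K) \<and>
     mult K \<cdot>\<^bsub>C\<^esub> pair C (d1 K) (d0 K) (Idn C (C1 K)) (unt K \<cdot>\<^bsub>C\<^esub> d1 K) = Idn C (C1 K) \<and>
     (let p = Pb C (d1 K) (d0 K);
          q = Pt C (d1 K) (d0 K);
          r = Pb C (d1 K \<cdot>\<^bsub>C\<^esub> q) (d0 K);
          f = p \<cdot>\<^bsub>C\<^esub> r;
          g = q \<cdot>\<^bsub>C\<^esub> r;
          h = Pt C (d1 K \<cdot>\<^bsub>C\<^esub> q) (d0 K)
      in mult K \<cdot>\<^bsub>C\<^esub> pair C (d1 K) (d0 K) (mult K \<cdot>\<^bsub>C\<^esub> pair C (d1 K) (d0 K) f g) h =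
         mult K \<cdot>\<^bsub>C\<^esub> pair C (d1 K) (d0 K) f (mult K \<cdot>\<^bsub>C\<^esub> pair C (d1 K) (d0 K) g h))"

definition externalization ::
  "('o, 'a, 'z) lex_category_scheme \<Rightarrow> ('o, 'a) internal_category \<Rightarrow>
   ('o, 'a, 'a, 'a) indexed_category" where
  "externalization C K = \<lparr>
     Fib = (\<lambda>E. \<lparr>
       Obj = Hom C E (C0 K),
       Arr = Hom C E (C1 K),
       Dom = (\<lambda>h. d0 K \<cdot>\<^bsub>C\<^esub> h),
       Cod = (\<lambda>h. d1 K \<cdot>\<^bsub>C\<^esub> h),
       Idn = (\<lambda>x. unt K \<cdot>\<^bsub>C\<^esub> x),
       Comp = (\<lambda>g f. mult K \<cdot>\<^bsub>C\<^esub> pair C (d1 K) (d0 K) f g) \<rparr>),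
     ReO = (\<lambda>e x. x \<cdot>\<^bsub>C\<^esub> e),
     ReA = (\<lambda>e h. h \<cdot>\<^bsub>C\<^esub> e),
     ReUnit = (\<lambda>E x. unt K \<cdot>\<^bsub>C\<^esub> x),
     ReComp = (\<lambda>e e' x. unt K \<cdot>\<^bsub>C\<^esub> (x \<cdot>\<^bsub>C\<^esub> (e \<cdot>\<^bsub>C\<^esub> e'))) \<rparr>"


section \<open>Indexed cocones and indexed colimits\<close>

text \<open>The functor \<open>!\<^sub>E\<^sup>*\<close> from \<open>C\<close> to \<open>C/E\<close>, on objects and on arrows.\<close>

definition const_obj :: "('o, 'a, 'z) lex_category_scheme \<Rightarrow> 'o \<Rightarrow> 'o \<Rightarrow> 'a" where
  "const_obj C E U = Pb C (bang C E) (bang C U)"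

definition const_arr :: "('o, 'a, 'z) lex_category_scheme \<Rightarrow> 'o \<Rightarrow> 'a \<Rightarrow> 'a \<times> 'a \<times> 'a" where
  "const_arr C E h =
     ReA (self_indexing C) (bang C E) (bang C (Dom C h), h, bang C (Cod C h))"

text \<open>
  The last clause is \<open>\<alpha>\<^sup>*(\<mu>\<^sub>E(x)) = \<mu>\<^sub>E\<^sub>'(A\<^sub>\<alpha>(x))\<close>, with the identifications
  \<open>D\<^sub>E\<^sub>'(A\<^sub>\<alpha>(x)) \<cong> \<alpha>\<^sup>*(D\<^sub>E(x))\<close> and \<open>\<alpha>\<^sup>*(!\<^sub>E\<^sup>*(U)) \<cong> !\<^sub>E\<^sub>'\<^sup>*(U)\<close> made explicit.
\<close>

definition indexed_cocone ::
  "('o, 'a, 'z) lex_category_scheme \<Rightarrow> ('o, 'a, 'x, 'm) indexed_category \<Rightarrow>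
   ('o, 'a, 'x, 'm, 'a, 'a \<times> 'a \<times> 'a) indexed_functor \<Rightarrow> 'o \<Rightarrow>
   ('o \<Rightarrow> 'x \<Rightarrow> 'a \<times> 'a \<times> 'a) \<Rightarrow> bool" where
  "indexed_cocone C A D U \<mu> \<longleftrightarrow> U \<in> Obj C \<and>
     (\<forall>E \<in> Obj C. \<forall>x \<in> Obj (Fib A E). \<mu> E x \<in> Hom (slice C E) (FunO D E x) (const_obj C E U)) \<and>
     (\<forall>E \<in> Obj C. \<forall>g \<in> Arr (Fib A E).
        \<mu> E (Cod (Fib A E) g) \<cdot>\<^bsub>slice C E\<^esub> FunA D E g = \<mu> E (Dom (Fib A E) g)) \<and>
     (\<forall>\<alpha> \<in> Arr C. \<forall>x \<in> Obj (Fib A (Cod C \<alpha>)).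
        ReComp (self_indexing C) (bang C (Cod C \<alpha>)) \<alpha> (bang C U) \<cdot>\<^bsub>slice C (Dom C \<alpha>)\<^esub>
          (ReA (self_indexing C) \<alpha> (\<mu> (Cod C \<alpha>) x) \<cdot>\<^bsub>slice C (Dom C \<alpha>)\<^esub> Cmp D \<alpha> x) =
        \<mu> (Dom C \<alpha>) (ReO A \<alpha> x))"

definition colimiting_cocone ::
  "('o, 'a, 'z) lex_category_scheme \<Rightarrow> ('o, 'a, 'x, 'm) indexed_category \<Rightarrow>
   ('o, 'a, 'x, 'm, 'a, 'a \<times> 'a \<times> 'a) indexed_functor \<Rightarrow> 'o \<Rightarrow>
   ('o \<Rightarrow> 'x \<Rightarrow> 'a \<times> 'a \<times> 'a) \<Rightarrow> bool" where
  "colimiting_cocone C A D U \<mu> \<longleftrightarrow> indexed_cocone C A D U \<mu> \<and>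
     (\<forall>V \<nu>. indexed_cocone C A D V \<nu> \<longrightarrow>
        (\<exists>!h. h \<in> Hom C U V \<and>
           (\<forall>E \<in> Obj C. \<forall>x \<in> Obj (Fib A E). const_arr C E h \<cdot>\<^bsub>slice C E\<^esub> \<mu> E x = \<nu> E x)))"

text \<open>
  Localization at \<open>I\<close>: the indexed category, functor and cocone over \<open>C/I\<close> whose components at
  \<open>e : E \<rightarrow> I\<close> are those at \<open>E\<close>, transported along the isomorphism of \<open>C/E\<close> with \<open>(C/I)/e\<close>.
\<close>

definition localize_category ::
  "('o, 'a, 'z) category_scheme \<Rightarrow> ('o, 'a, 'x, 'm) indexed_category \<Rightarrow>
   ('a, 'a \<times> 'a \<times> 'a, 'x, 'm) indexed_category" where
  "localize_category C A = \<lparr>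
     Fib = (\<lambda>e. Fib A (Dom C e)),
     ReO = (\<lambda>(e', k, e). ReO A k),
     ReA = (\<lambda>(e', k, e). ReA A k),
     ReUnit = (\<lambda>e. ReUnit A (Dom C e)),
     ReComp = (\<lambda>(e', k, e) (e'', l, e'''). ReComp A k l) \<rparr>"

definition localize_functor ::
  "('o, 'a, 'z) category_scheme \<Rightarrow> ('o, 'a, 'x, 'm, 'a, 'a \<times> 'a \<times> 'a) indexed_functor \<Rightarrow>
   ('a, 'a \<times> 'a \<times> 'a, 'x, 'm, 'a \<times> 'a \<times> 'a,
    ('a \<times> 'a \<times> 'a) \<times> ('a \<times> 'a \<times> 'a) \<times> ('a \<times> 'a \<times> 'a)) indexed_functor" where
  "localize_functor C D = \<lparr>
     FunO = (\<lambda>e x. over_obj C e (FunO D (Dom C e) x)),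
     FunA = (\<lambda>e g. over_arr C e (FunA D (Dom C e) g)),
     Cmp = (\<lambda>(e', k, e) x. over_arr C e' (Cmp D k x)) \<rparr>"

text \<open>
  The inverse structural isomorphism identifies the vertex \<open>!\<^sub>E\<^sup>*(U)\<close> with \<open>e\<^sup>*(!\<^sub>I\<^sup>*(U))\<close>.
\<close>

definition localize_cocone ::
  "('o, 'a, 'z) lex_category_scheme \<Rightarrow> 'o \<Rightarrow> 'o \<Rightarrow> ('o \<Rightarrow> 'x \<Rightarrow> 'a \<times> 'a \<times> 'a) \<Rightarrow>
   'a \<Rightarrow> 'x \<Rightarrow> ('a \<times> 'a \<times> 'a) \<times> ('a \<times> 'a \<times> 'a) \<times> ('a \<times> 'a \<times> 'a)" where
  "localize_cocone C I U \<mu> = (\<lambda>e x. over_arr C e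
     (inverse_arr (slice C (Dom C e)) (ReComp (self_indexing C) (bang C I) e (bang C U))
        \<cdot>\<^bsub>slice C (Dom C e)\<^esub> \<mu> (Dom C e) x))"

definition indexed_colimiting_cocone ::
  "('o, 'a, 'z) lex_category_scheme \<Rightarrow> ('o, 'a, 'x, 'm) indexed_category \<Rightarrow>
   ('o, 'a, 'x, 'm, 'a, 'a \<times> 'a \<times> 'a) indexed_functor \<Rightarrow> 'o \<Rightarrow>
   ('o \<Rightarrow> 'x \<Rightarrow> 'a \<times> 'a \<times> 'a) \<Rightarrow> bool" where
  "indexed_colimiting_cocone C A D U \<mu> \<longleftrightarrow> colimiting_cocone C A D U \<mu> \<and>
     (\<forall>I \<in> Obj C. colimiting_cocone (lex_slice C I) (localize_category C A)
        (localize_functor C D) (const_obj C I U) (localize_cocone C I U \<mu>))"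


section \<open>Generalized elements of an indexed diagram\<close>

definition elements ::
  "('o, 'a, 'z) category_scheme \<Rightarrow> ('o, 'a, 'x, 'm) indexed_category \<Rightarrow>
   ('o, 'a, 'x, 'm, 'a, 'a \<times> 'a \<times> 'a) indexed_functor \<Rightarrow> 'o \<Rightarrow>
   ('x \<times> ('a \<times> 'a \<times> 'a)) set" where
  "elements C A D R =
     {(x, y). x \<in> Obj (Fib A R) \<and> y \<in> Hom (slice C R) (Idn C R) (FunO D R x)}"

definition element_rel ::
  "('o, 'a, 'z) category_scheme \<Rightarrow> ('o, 'a, 'x, 'm) indexed_category \<Rightarrow>
   ('o, 'a, 'x, 'm, 'a, 'a \<times> 'a \<times> 'a) indexed_functor \<Rightarrow> 'o \<Rightarrow>
   (('x \<times> ('a \<times> 'a \<times> 'a)) \<times> ('x \<times> ('a \<times> 'a \<times> 'a))) set" where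
  "element_rel C A D R = \<Inter> {r. equiv (elements C A D R) r \<and>
     {((x, y), (x', y')). (x, y) \<in> elements C A D R \<and> (x', y') \<in> elements C A D R \<and>
        (\<exists>g \<in> Hom (Fib A R) x x'. y' = FunA D R g \<cdot>\<^bsub>slice C R\<^esub> y)} \<subseteq> r}"

text \<open>
  For \<open>y : f \<rightarrow> D\<^sub>E(x)\<close> in \<open>C/E\<close>, i.e. \<open>y = (f, k, D\<^sub>E(x))\<close>, and \<open>g\<close> into the domain of \<open>f\<close>, this is
  \<open>g\<^sup>*(y)\<close>: the section of \<open>(f \<circ> g)\<^sup>*(D\<^sub>E(x))\<close> induced by \<open>k \<circ> g\<close>, transported into
  \<open>D(A\<^sub>f\<^sub>g(x))\<close> by the comparison isomorphism of \<open>D\<close>.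
\<close>

definition restrict_element ::
  "('o, 'a, 'z) lex_category_scheme \<Rightarrow> ('o, 'a, 'x, 'm, 'a, 'a \<times> 'a \<times> 'a) indexed_functor \<Rightarrow>
   'a \<Rightarrow> 'x \<Rightarrow> 'a \<times> 'a \<times> 'a \<Rightarrow> 'a \<times> 'a \<times> 'a" where
  "restrict_element C D g x = (\<lambda>(f, k, d).
     inverse_arr (slice C (Dom C g)) (Cmp D (f \<cdot>\<^bsub>C\<^esub> g) x) \<cdot>\<^bsub>slice C (Dom C g)\<^esub>
     (Idn C (Dom C g),
      pair C (f \<cdot>\<^bsub>C\<^esub> g) d (Idn C (Dom C g)) (k \<cdot>\<^bsub>C\<^esub> g),
      Pb C (f \<cdot>\<^bsub>C\<^esub> g) d))"

text \<open>
  \<open>\<langle>h, 1\<^sub>F\<rangle> : 1\<^sub>C\<^sub>/\<^sub>F \<rightarrow> F\<^sup>*(U)\<close> in \<open>C/F\<close>, for \<open>h : F \<rightarrow> U\<close>.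
\<close>

definition graph_arr :: "('o, 'a, 'z) lex_category_scheme \<Rightarrow> 'a \<Rightarrow> 'a \<times> 'a \<times> 'a" where
  "graph_arr C h =
     (Idn C (Dom C h),
      pair C (bang C (Dom C h)) (bang C (Cod C h)) (Idn C (Dom C h)) h,
      const_obj C (Dom C h) (Cod C h))"

end

theory Submission
  imports Defs
begin

text \<open>
  A cocone over \<open>D\<close> with vertex \<open>V\<close> amounts to a compatible family of arrows \<open>n E x\<close> from \<open>D\<^sub>E(x)\<close> to \<open>V\<close>
  (\<open>indexed_cocone_iff\<close>).  Such a family is a function on elements: it sends an arrow
  \<open>k : S \<rightarrow> D\<^sub>E(x)\<close>, an element at stage \<open>S\<close>, to \<open>n E x \<cdot> k\<close>.  The element \<open>k\<close> corresponds to a section of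
  \<open>D(f\<^sup>*x)\<close>, where \<open>f : S \<rightarrow> E\<close> is the arrow under \<open>k\<close>, hence to a pair related to others by the generated
  equivalence relation at stage \<open>S\<close>.  Cocones take equal values at related elements (\<open>family_rel\<close>), and
  also at elements that are related on an epimorphic family only (\<open>family_sim\<close>); call these locally
  related.  The second condition says that \<open>\<mu>\<close> identifies no other elements, and the first one says that
  every arrow into \<open>U\<close> is, on an epimorphic family, a value of \<open>\<mu>\<close>.

  Suppose that both conditions hold, and let \<open>n\<close> be another cocone with vertex \<open>V\<close>.  On a cover of \<open>U\<close> the
  identity of \<open>U\<close> is a value of \<open>\<mu>\<close>, and the factorization \<open>U \<rightarrow> V\<close> has to take the value of \<open>n\<close> at the same
  elements.  Elements with the same value under \<open>\<mu>\<close> are locally related, so they have the same value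
  under \<open>n\<close>; therefore the prescribed values glue to a unique arrow (\<open>glue_universal\<close>).  For the
  localization at \<open>I\<close> the same argument is applied to \<open>I \<times> U\<close> in place of \<open>U\<close>
  (\<open>localized_colimiting\<close>, \<open>conditions_imp_colimiting\<close>).

  Conversely, let \<open>\<mu>\<close> be colimiting.  As the indexed category is an externalization up to equivalence, it
  has a generic object \<open>x\<^sub>0\<close>: every \<open>x\<close> has an arrow to a reindexing of \<open>x\<^sub>0\<close>
  (\<open>externalization_generic\<close>), hence every \<open>D\<^sub>E(x)\<close> has an arrow to \<open>D(x\<^sub>0)\<close> that preserves the classes of
  elements (\<open>generic_arrow\<close>).  Being locally related is an equivalence relation on the elements of \<open>D(x\<^sub>0)\<close>
  which is stable and local, so it has an effective quotient, and the maps to this quotient form a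
  cocone that identifies exactly the locally related elements (\<open>classifying_family\<close>).  Since this cocone
  factors through \<open>\<mu>\<close>, the second condition follows.  For the first one, the component \<open>D(x\<^sub>0) \<rightarrow> U\<close> of \<open>\<mu>\<close> is
  an epimorphism, because all other components factor through it, and its pullback along an arrow
  \<open>h : F \<rightarrow> U\<close> is a cover of \<open>F\<close> on which \<open>h\<close> is a value of \<open>\<mu>\<close> (\<open>colimiting_imp_conditions\<close>).

  What this uses of a Grothendieck topos is collected in the locale \<open>covering_category\<close>: pullback
  stability of epimorphic families, gluing along them, effective quotients, and the existence of small
  subfamilies.  These are proved with sections of sheaves (\<open>grothendieck_topos_covering\<close>).  The key fact
  is that a family is epimorphic if and only if every section of the target is locally in one of the
  images (\<open>cover_hit\<close>, \<open>cover_by_hits\<close>); power sheaves serve to prove this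
  and to construct quotients.
\<close>

section \<open>Small sets\<close>

lemma small_subset: "small TYPE('u) B \<Longrightarrow> A \<subseteq> B \<Longrightarrow> small TYPE('u) A"
  unfolding small_def by (meson card_of_mono1 ordLeq_ordLess_trans)

lemma small_image: "small TYPE('u) A \<Longrightarrow> small TYPE('u) (f ` A)"
  unfolding small_def by (meson card_of_image ordLeq_ordLess_trans)

lemma small_inj_on: "inj_on f A \<Longrightarrow> small TYPE('u) (f ` A) \<Longrightarrow> small TYPE('u) A"
  by (metis small_image the_inv_into_onto)

lemma small_encoding:
  assumes "small TYPE('u) (A :: 'b set)"
  obtains e :: "'b \<Rightarrow> 'u" where "inj_on e A"
proof -
  have "|A| \<le>o |UNIV :: 'u set|"
    using assms unfolding small_def by (rule ordLess_imp_ordLeq)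
  then show thesis using that card_of_ordLeq[of A "UNIV :: 'u set"] by blast
qed

lemma small_Pow:
  assumes "inaccessible TYPE('u)" "small TYPE('u) (A :: 'b set)"
  shows "small TYPE('u) (Pow A)"
proof -
  obtain e :: "'b \<Rightarrow> 'u" where e: "inj_on e A" by (rule small_encoding[OF assms(2)])
  have "small TYPE('u) (Pow (e ` A))"
    using assms small_image unfolding inaccessible_def by blast
  moreover have "(\<lambda>B. e ` B) ` Pow A = Pow (e ` A)" by (metis image_Pow_surj)
  ultimately show ?thesis
    using small_inj_on[OF inj_on_image_Pow[OF e]] by metis
qed

text \<open>
  Regularity of the cardinal is used here: an infinite regular cardinal is stable.
\<close>

lemma small_Sigma:
  assumes "inaccessible TYPE('u)" "small TYPE('u) A" "\<And>a. a \<in> A \<Longrightarrow> small TYPE('u) (B a)"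
  shows "small TYPE('u) (Sigma A B)"
proof -
  let ?r = "|UNIV :: 'u set|"
  have inf: "\<not> finite (Field ?r)"
    using assms(1) unfolding inaccessible_def
    by (metis Field_card_of card_of_ordLess infinite_iff_card_of_nat ordLess_imp_ordLeq)
  have st: "stable ?r"
    using assms(1) inf unfolding inaccessible_def
    by (auto intro!: regularCard_stable card_of_Card_order)
  show ?thesis
    using stable_elim[OF st] assms(2,3) unfolding small_def by blast
qed

section \<open>Categories\<close>

context category
begin

lemma comp_arr [simp]:
  assumes "f \<in> Arr C" "g \<in> Arr C" "Cod C f = Dom C g"
  shows "g \<cdot> f \<in> Arr C" "Dom C (g \<cdot> f) = Dom C f" "Cod C (g \<cdot> f) = Cod C g"
  using comp_hom[of f "Dom C f" "Cod C f" g "Cod C g"] assms by (auto simp: Hom_def)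

lemma idn_arr [simp]:
  assumes "x \<in> Obj C"
  shows "Idn C x \<in> Arr C" "Dom C (Idn C x) = x" "Cod C (Idn C x) = x"
  using idn_hom[OF assms] by (auto simp: Hom_def)

lemma comp_idn_arr [simp]: "f \<in> Arr C \<Longrightarrow> Dom C f = x \<Longrightarrow> f \<cdot> Idn C x = f"
  by (rule comp_idn) (auto simp: Hom_def)

lemma idn_comp_arr [simp]: "f \<in> Arr C \<Longrightarrow> Cod C f = x \<Longrightarrow> Idn C x \<cdot> f = f"
  by (rule idn_comp) (auto simp: Hom_def)

lemma assoc [simp]:
  "f \<in> Arr C \<Longrightarrow> g \<in> Arr C \<Longrightarrow> h \<in> Arr C \<Longrightarrow> Cod C f = Dom C g \<Longrightarrow> Cod C g = Dom C h \<Longrightarrow>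
   (h \<cdot> g) \<cdot> f = h \<cdot> (g \<cdot> f)"
  by (rule comp_assoc) (auto simp: Hom_def)

declare dom_obj [simp] cod_obj [simp]

lemma section_cancel:
  assumes "m \<in> Arr C" "l \<in> Arr C" "Cod C m = Dom C l" "l \<cdot> m = Idn C (Dom C m)"
    and "a \<in> Arr C" "b \<in> Arr C" "Cod C a = Dom C m" "Cod C b = Dom C m" "m \<cdot> a = m \<cdot> b"
  shows "a = b"
proof -
  have "a = (l \<cdot> m) \<cdot> a" using assms by (simp del: assoc)
  also have "\<dots> = l \<cdot> (m \<cdot> b)" using assms by (subst assoc) simp_all
  also have "\<dots> = (l \<cdot> m) \<cdot> b" using assms by (subst assoc) simp_all
  also have "\<dots> = b" using assms by (simp del: assoc)
  finally show ?thesis .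
qed

lemma inverse_pair_unique: "inverse_pair C f g \<Longrightarrow> inverse_pair C f g' \<Longrightarrow> g = g'"
  unfolding inverse_pair_def Hom_def
  by clarsimp (metis assoc idn_comp_arr comp_idn_arr)

lemma inverse_arr_eq: "inverse_pair C f g \<Longrightarrow> inverse_arr C f = g"
  unfolding inverse_arr_def using inverse_pair_unique by blast

lemma inverse_arr_pair: "is_iso C f \<Longrightarrow> inverse_pair C f (inverse_arr C f)"
  using inverse_arr_eq unfolding is_iso_def by metis

end

lemma HomD:
  assumes "f \<in> Hom C x y"
  shows "f \<in> Arr C" "Dom C f = x" "Cod C f = y"
  using assms by (simp_all add: Hom_def)

section \<open>Sheaves on a small site\<close>

definition presheaf_on ::
  "('c, 'b, 'z) category_scheme \<Rightarrow> ('c \<Rightarrow> 'w set) \<Rightarrow> ('b \<Rightarrow> 'w \<Rightarrow> 'w) \<Rightarrow> bool" where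
  "presheaf_on C X r \<longleftrightarrow>
     (\<forall>f \<in> Arr C. \<forall>s \<in> X (Cod C f). r f s \<in> X (Dom C f)) \<and>
     (\<forall>c \<in> Obj C. \<forall>s \<in> X c. r (Idn C c) s = s) \<and>
     (\<forall>f \<in> Arr C. \<forall>g \<in> Arr C. Cod C g = Dom C f \<longrightarrow>
        (\<forall>s \<in> X (Cod C f). r (f \<cdot>\<^bsub>C\<^esub> g) s = r g (r f s)))"

text \<open>
  The sections of pair sheaves and of power sheaves are pairs and sets, which are not elements of the
  universe type.  Therefore sheaves are first allowed to have values of any size in an arbitrary type,
  and are encoded in the universe type once their values are known to be small.
\<close>

definition sheaf_on ::
  "('c, 'b, 'z) category_scheme \<Rightarrow> ('c \<Rightarrow> 'b set set) \<Rightarrow> ('c \<Rightarrow> 'w set) \<Rightarrow> ('b \<Rightarrow> 'w \<Rightarrow> 'w) \<Rightarrow>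
   bool" where
  "sheaf_on C J X r \<longleftrightarrow> presheaf_on C X r \<and>
     (\<forall>c \<in> Obj C. \<forall>S \<in> J c. \<forall>s. matching_family C (X, r) S s \<longrightarrow>
        (\<exists>!t. t \<in> X c \<and> (\<forall>f \<in> S. r f t = s f)))"

lemma is_sheaf_iff:
  "is_sheaf C J (P :: ('c, 'b, 'u) presheaf) \<longleftrightarrow>
     sheaf_on C J (fst P) (snd P) \<and> (\<forall>c \<in> Obj C. small TYPE('u) (fst P c))"
  unfolding is_sheaf_def is_presheaf_def sheaf_on_def presheaf_on_def Pi_def by auto

lemma presheaf_onD:
  assumes "presheaf_on C X r"
  shows "f \<in> Arr C \<Longrightarrow> s \<in> X (Cod C f) \<Longrightarrow> r f s \<in> X (Dom C f)"
    and "c \<in> Obj C \<Longrightarrow> s \<in> X c \<Longrightarrow> r (Idn C c) s = s"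
    and "f \<in> Arr C \<Longrightarrow> g \<in> Arr C \<Longrightarrow> Cod C g = Dom C f \<Longrightarrow> s \<in> X (Cod C f) \<Longrightarrow>
         r (f \<cdot>\<^bsub>C\<^esub> g) s = r g (r f s)"
  using assms unfolding presheaf_on_def by auto

locale site = category C
  for C :: "('c, 'b, 'z) category_scheme" (structure) +
  fixes J :: "'c \<Rightarrow> 'b set set"
  assumes topology: "grothendieck_topology C J"
begin

lemma J_sieve: "c \<in> Obj C \<Longrightarrow> S \<in> J c \<Longrightarrow> sieve C c S"
  using topology unfolding grothendieck_topology_def by blast

lemma sieve_arr:
  assumes "c \<in> Obj C" "S \<in> J c" "f \<in> S"
  shows "f \<in> Arr C" "Cod C f = c" "g \<in> Arr C \<Longrightarrow> Cod C g = Dom C f \<Longrightarrow> f \<cdot> g \<in> S"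
  using J_sieve[OF assms(1,2)] assms(3) unfolding sieve_def by auto

lemma J_max: "c \<in> Obj C \<Longrightarrow> {f \<in> Arr C. Cod C f = c} \<in> J c"
  using topology unfolding grothendieck_topology_def by blast

lemma J_pullback: "h \<in> Arr C \<Longrightarrow> S \<in> J (Cod C h) \<Longrightarrow> pullback_sieve C h S \<in> J (Dom C h)"
  using topology unfolding grothendieck_topology_def by blast

lemma J_trans:
  "c \<in> Obj C \<Longrightarrow> S \<in> J c \<Longrightarrow> sieve C c R \<Longrightarrow>
   (\<And>h. h \<in> S \<Longrightarrow> pullback_sieve C h R \<in> J (Dom C h)) \<Longrightarrow> R \<in> J c"
  using topology unfolding grothendieck_topology_def by blast

lemma sieve_pullback:
  "sieve C c S \<Longrightarrow> h \<in> Arr C \<Longrightarrow> Cod C h = c \<Longrightarrow> sieve C (Dom C h) (pullback_sieve C h S)"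
  unfolding sieve_def pullback_sieve_def
  by (auto simp: assoc[symmetric] simp del: assoc)

lemma J_superset:
  assumes "c \<in> Obj C" "S \<in> J c" "sieve C c R" "S \<subseteq> R"
  shows "R \<in> J c"
proof (rule J_trans[OF assms(1-3)])
  fix h assume h: "h \<in> S"
  moreover have "pullback_sieve C h R = {f \<in> Arr C. Cod C f = Dom C h}"
    using sieve_arr(3)[OF assms(1,2) h] assms(4) unfolding pullback_sieve_def by auto
  ultimately show "pullback_sieve C h R \<in> J (Dom C h)"
    using J_max[of "Dom C h"] sieve_arr(1)[OF assms(1,2)] by simp
qed

text \<open>
  The property \<open>Q\<close> is not required to be stable under precomposition, so the arrows satisfying it need
  not form a sieve; it is enough that they contain a covering one.
\<close>

definition locally :: "'c \<Rightarrow> ('b \<Rightarrow> bool) \<Rightarrow> bool" where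
  "locally c Q \<longleftrightarrow> (\<exists>S \<in> J c. \<forall>g \<in> S. Q g)"

lemma locally_all: "c \<in> Obj C \<Longrightarrow> (\<And>g. g \<in> Arr C \<Longrightarrow> Cod C g = c \<Longrightarrow> Q g) \<Longrightarrow> locally c Q"
  unfolding locally_def by (rule bexI[OF _ J_max]) auto

lemma locally_mono:
  assumes "c \<in> Obj C" "locally c Q" "\<And>g. g \<in> Arr C \<Longrightarrow> Cod C g = c \<Longrightarrow> Q g \<Longrightarrow> Q' g"
  shows "locally c Q'"
proof -
  obtain S where S: "S \<in> J c" "\<forall>g \<in> S. Q g" using assms(2) unfolding locally_def by blast
  then have "\<forall>g \<in> S. Q' g"
    using assms(3) sieve_arr(1,2)[OF assms(1) S(1)] by auto
  with S(1) show ?thesis unfolding locally_def by blast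
qed

lemma locally_pullback:
  assumes "h \<in> Arr C" "Cod C h = c" "locally c Q"
  shows "locally (Dom C h) (\<lambda>g. Q (h \<cdot> g))"
proof -
  obtain S where S: "S \<in> J c" "\<forall>g \<in> S. Q g" using assms(3) unfolding locally_def by blast
  then have "pullback_sieve C h S \<in> J (Dom C h)" using J_pullback[OF assms(1)] assms(2) by simp
  moreover have "\<forall>g \<in> pullback_sieve C h S. Q (h \<cdot> g)"
    using S(2) unfolding pullback_sieve_def by simp
  ultimately show ?thesis unfolding locally_def by blast
qed

text \<open>
  A witness sieve for a property that is locally locally true consists of the arrows along which
  the property holds hereditarily.
\<close>

lemma locally_trans:
  assumes c: "c \<in> Obj C"
    and Q: "locally c (\<lambda>h. locally (Dom C h) (\<lambda>g. Q (h \<cdot> g)))"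
  shows "locally c Q"
proof -
  define R where "R = {g \<in> Arr C. Cod C g = c \<and> (\<forall>k \<in> Arr C. Cod C k = Dom C g \<longrightarrow> Q (g \<cdot> k))}"
  obtain S where S: "S \<in> J c" "\<forall>h \<in> S. locally (Dom C h) (\<lambda>g. Q (h \<cdot> g))"
    using Q unfolding locally_def[of c] by blast
  have R: "sieve C c R" unfolding sieve_def R_def by auto
  have "R \<in> J c"
  proof (rule J_trans[OF c S(1) R])
    fix h assume "h \<in> S"
    note h = sieve_arr[OF c S(1) this]
    obtain T where T: "T \<in> J (Dom C h)" "\<forall>g \<in> T. Q (h \<cdot> g)"
      using S(2) \<open>h \<in> S\<close> unfolding locally_def by blast
    show "pullback_sieve C h R \<in> J (Dom C h)"
    proof (rule J_superset[OF _ T(1)])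
      show "Dom C h \<in> Obj C" using h by simp
      show "sieve C (Dom C h) (pullback_sieve C h R)" using sieve_pullback R h by simp
      show "T \<subseteq> pullback_sieve C h R"
      proof
        fix g assume "g \<in> T"
        note g = sieve_arr[OF _ T(1) this]
        show "g \<in> pullback_sieve C h R"
          unfolding pullback_sieve_def R_def using g h T(2) by auto
      qed
    qed
  qed
  moreover have "Q g" if "g \<in> R" for g
  proof -
    have g: "g \<in> Arr C" "\<forall>k \<in> Arr C. Cod C k = Dom C g \<longrightarrow> Q (g \<cdot> k)"
      using that unfolding R_def by simp_all
    then show ?thesis using g(2)[rule_format, of "Idn C (Dom C g)"] by simp
  qed
  ultimately show ?thesis unfolding locally_def by blast
qed

text \<open>
  On a cover on which \<open>P\<close> holds, \<open>P\<close> persists under further restriction because it is stable, and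
  \<open>Q\<close> still holds locally.
\<close>

lemma locally_conj:
  assumes "c \<in> Obj C" "locally c P" "locally c Q"
    and "\<And>g k. g \<in> Arr C \<Longrightarrow> Cod C g = c \<Longrightarrow> k \<in> Arr C \<Longrightarrow> Cod C k = Dom C g \<Longrightarrow> P g \<Longrightarrow> P (g \<cdot> k)"
  shows "locally c (\<lambda>g. P g \<and> Q g)"
proof (rule locally_trans[OF assms(1)])
  show "locally c (\<lambda>h. locally (Dom C h) (\<lambda>g. P (h \<cdot> g) \<and> Q (h \<cdot> g)))"
  proof (rule locally_mono[OF assms(1,2)])
    fix h assume h: "h \<in> Arr C" "Cod C h = c" "P h"
    show "locally (Dom C h) (\<lambda>g. P (h \<cdot> g) \<and> Q (h \<cdot> g))"
    proof (rule locally_mono[OF _ locally_pullback[OF h(1,2) assms(3)]])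
      show "Dom C h \<in> Obj C" using h by simp
      show "P (h \<cdot> g) \<and> Q (h \<cdot> g)" if "g \<in> Arr C" "Cod C g = Dom C h" "Q (h \<cdot> g)" for g
        using assms(4)[OF h(1,2) that(1,2) h(3)] that(3) by blast
    qed
  qed
qed

text \<open>
  This moves a sheaf of pairs or of sets into the universe type.
\<close>

lemma sheaf_on_transport:
  fixes X :: "'c \<Rightarrow> 'w set" and Y :: "'c \<Rightarrow> 'v set"
  assumes X: "sheaf_on C J X r"
    and bij: "\<And>c. c \<in> Obj C \<Longrightarrow> bij_betw (b c) (X c) (Y c)"
    and nat: "\<And>f s. f \<in> Arr C \<Longrightarrow> s \<in> X (Cod C f) \<Longrightarrow> b (Dom C f) (r f s) = q f (b (Cod C f) s)"
  shows "sheaf_on C J Y q"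
proof -
  define i where "i c = the_inv_into (X c) (b c)" for c
  have inj: "inj_on (b c) (X c)" and img: "b c ` X c = Y c" if "c \<in> Obj C" for c
    using bij[OF that] by (simp_all add: bij_betw_def)
  have ib: "i c (b c s) = s" if "c \<in> Obj C" "s \<in> X c" for c s
    using that inj by (simp add: i_def the_inv_into_f_f)
  have bi: "b c (i c t) = t" if "c \<in> Obj C" "t \<in> Y c" for c t
    using that inj img by (simp add: i_def f_the_inv_into_f)
  have iX: "i c t \<in> X c" if "c \<in> Obj C" "t \<in> Y c" for c t
    using the_inv_into_into[OF inj[OF that(1)], of t "X c"] that img by (simp add: i_def)
  have bY: "b c s \<in> Y c" if "c \<in> Obj C" "s \<in> X c" for c s
    using that img by blast
  note Xp = presheaf_onD[of C X r]
  have preX: "presheaf_on C X r" using X by (simp add: sheaf_on_def)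
  have q: "q f t = b (Dom C f) (r f (i (Cod C f) t))" if "f \<in> Arr C" "t \<in> Y (Cod C f)" for f t
    using nat[of f "i (Cod C f) t"] that by (simp add: bi iX)
  have "presheaf_on C Y q"
    unfolding presheaf_on_def
  proof (intro conjI ballI impI)
    fix f s assume "f \<in> Arr C" "s \<in> Y (Cod C f)"
    then show "q f s \<in> Y (Dom C f)"
      by (simp add: q bY iX Xp(1)[OF preX])
  next
    fix c s assume "c \<in> Obj C" "s \<in> Y c"
    then show "q (Idn C c) s = s" by (simp add: q iX bi Xp(2)[OF preX])
  next
    fix f g s assume "f \<in> Arr C" "g \<in> Arr C" "Cod C g = Dom C f" "s \<in> Y (Cod C f)"
    moreover from this have "r f (i (Cod C f) s) \<in> X (Dom C f)"
      by (simp add: iX Xp(1)[OF preX])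
    ultimately show "q (f \<cdot>\<^bsub>C\<^esub> g) s = q g (q f s)"
      by (simp add: q iX ib bY Xp(3)[OF preX])
  qed
  moreover have "\<exists>!t. t \<in> Y c \<and> (\<forall>f \<in> S. q f t = s f)"
    if c: "c \<in> Obj C" and S: "S \<in> J c" and s: "matching_family C (Y, q) S s" for c S s
  proof -
    have SA: "f \<in> Arr C" "Cod C f = c" if "f \<in> S" for f
      using sieve_arr[OF c S that] by auto
    have sY: "s f \<in> Y (Dom C f)" if "f \<in> S" for f
      using that s unfolding matching_family_def by simp
    have "matching_family C (X, r) S (\<lambda>f. i (Dom C f) (s f))"
      unfolding matching_family_def
    proof (intro conjI ballI impI)
      fix f assume "f \<in> S"
      then show "i (Dom C f) (s f) \<in> fst (X, r) (Dom C f)" using SA sY by (simp add: iX)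
    next
      fix f g assume f: "f \<in> S" and g: "g \<in> Arr C" "Cod C g = Dom C f"
      have "s (f \<cdot>\<^bsub>C\<^esub> g) = q g (s f)" using s f g unfolding matching_family_def by simp
      also have "\<dots> = b (Dom C g) (r g (i (Dom C f) (s f)))"
        using q[of g "s f"] g sY[OF f] by simp
      finally show "i (Dom C (f \<cdot>\<^bsub>C\<^esub> g)) (s (f \<cdot>\<^bsub>C\<^esub> g)) = snd (X, r) g (i (Dom C f) (s f))"
        using SA[OF f] g sY[OF f] Xp(1)[OF preX, of g "i (Dom C f) (s f)"]
        by (simp add: ib iX)
    qed
    then have ex1: "\<exists>!t. t \<in> X c \<and> (\<forall>f \<in> S. r f t = i (Dom C f) (s f))"
      using X c S unfolding sheaf_on_def by blast
    then obtain t where t: "t \<in> X c" "\<forall>f \<in> S. r f t = i (Dom C f) (s f)" by blast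
    show ?thesis
    proof (intro ex1I[of _ "b c t"] conjI ballI)
      show "b c t \<in> Y c" using t c by (simp add: bY)
      fix f assume "f \<in> S"
      then show "q f (b c t) = s f"
        using nat[of f t] t SA sY by (simp add: bi)
    next
      fix u assume u: "u \<in> Y c \<and> (\<forall>f \<in> S. q f u = s f)"
      have "r f (i c u) = i (Dom C f) (s f)" if "f \<in> S" for f
        using q[of f u] u SA[OF that] that Xp(1)[OF preX, of f "i c u"] c
        by (metis dom_obj iX ib)
      then have "i c u = t" using ex1 t iX u c by blast
      then show "u = b c t" using bi u c by auto
    qed
  qed
  ultimately show ?thesis unfolding sheaf_on_def by blast
qed

lemma sheaf_separated:
  assumes "sheaf_on C J X r" "c \<in> Obj C" "s \<in> X c" "t \<in> X c" "locally c (\<lambda>g. r g s = r g t)"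
  shows "s = t"
proof -
  obtain S where S: "S \<in> J c" "\<forall>g \<in> S. r g s = r g t"
    using assms(5) unfolding locally_def by blast
  have "matching_family C (X, r) S (\<lambda>g. r g t)"
    using assms(1,4) sieve_arr[OF assms(2) S(1)]
    unfolding matching_family_def sheaf_on_def presheaf_on_def by auto
  then have "\<exists>!u. u \<in> X c \<and> (\<forall>f \<in> S. r f u = r f t)"
    using assms(1,2) S(1) unfolding sheaf_on_def by blast
  then show ?thesis using assms(3,4) S(2) by blast
qed

end

subsection \<open>Sheaves of pairs\<close>

context site
begin

definition pair_el ::
  "('c \<Rightarrow> 'v set) \<Rightarrow> ('c \<Rightarrow> 'w set) \<Rightarrow> ('c \<Rightarrow> 'v \<Rightarrow> 'w \<Rightarrow> bool) \<Rightarrow> 'c \<Rightarrow> ('v \<times> 'w) set" where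
  "pair_el X Y P c = {(s, t). s \<in> X c \<and> t \<in> Y c \<and> P c s t}"

text \<open>
  The two components of a matching family of pairs glue separately, and \<open>P\<close> holds of the result
  because it holds on a cover.  The cases of interest are fibre products, where \<open>P\<close> is an equality of
  images.
\<close>

lemma pair_sheaf:
  assumes X: "sheaf_on C J X r" and Y: "sheaf_on C J Y q"
    and stable: "\<And>g s t. g \<in> Arr C \<Longrightarrow> s \<in> X (Cod C g) \<Longrightarrow> t \<in> Y (Cod C g) \<Longrightarrow> P (Cod C g) s t \<Longrightarrow>
                   P (Dom C g) (r g s) (q g t)"
    and loc: "\<And>c s t. c \<in> Obj C \<Longrightarrow> s \<in> X c \<Longrightarrow> t \<in> Y c \<Longrightarrow>
                locally c (\<lambda>g. P (Dom C g) (r g s) (q g t)) \<Longrightarrow> P c s t"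
  shows "sheaf_on C J (pair_el X Y P) (\<lambda>g. map_prod (r g) (q g))"
proof -
  have pX: "presheaf_on C X r" and pY: "presheaf_on C Y q"
    using X Y by (simp_all add: sheaf_on_def)
  have "presheaf_on C (pair_el X Y P) (\<lambda>g. map_prod (r g) (q g))"
    using presheaf_onD[OF pX] presheaf_onD[OF pY] stable
    unfolding presheaf_on_def pair_el_def by auto
  moreover have "\<exists>!t. t \<in> pair_el X Y P c \<and> (\<forall>f \<in> S. map_prod (r f) (q f) t = s f)"
    if c: "c \<in> Obj C" and S: "S \<in> J c"
      and s: "matching_family C (pair_el X Y P, \<lambda>g. map_prod (r g) (q g)) S s" for c S s
  proof -
    have s1: "s f \<in> pair_el X Y P (Dom C f)" if "f \<in> S" for f
      using s that unfolding matching_family_def by simp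
    have s2: "s (f \<cdot> g) = map_prod (r g) (q g) (s f)"
      if "f \<in> S" "g \<in> Arr C" "Cod C g = Dom C f" for f g
      using s that unfolding matching_family_def by simp
    have mX: "matching_family C (X, r) S (fst \<circ> s)" and mY: "matching_family C (Y, q) S (snd \<circ> s)"
      using s1 s2 unfolding matching_family_def pair_el_def by (auto simp: case_prod_beta)
    have eX: "\<exists>!t. t \<in> X c \<and> (\<forall>f \<in> S. r f t = (fst \<circ> s) f)"
      using X c S mX unfolding sheaf_on_def by blast
    have eY: "\<exists>!t. t \<in> Y c \<and> (\<forall>f \<in> S. q f t = (snd \<circ> s) f)"
      using Y c S mY unfolding sheaf_on_def by blast
    obtain x where x: "x \<in> X c" "\<forall>f \<in> S. r f x = (fst \<circ> s) f" using eX by blast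
    obtain y where y: "y \<in> Y c" "\<forall>f \<in> S. q f y = (snd \<circ> s) f" using eY by blast
    have "P (Dom C f) (r f x) (q f y)" if "f \<in> S" for f
      using s1[OF that] x(2) y(2) that unfolding pair_el_def by auto
    then have "locally c (\<lambda>g. P (Dom C g) (r g x) (q g y))"
      unfolding locally_def using S by blast
    then have "P c x y" using loc c x(1) y(1) by blast
    then have xy: "(x, y) \<in> pair_el X Y P c" using x y unfolding pair_el_def by simp
    show ?thesis
    proof (intro ex1I[of _ "(x, y)"] conjI ballI)
      show "map_prod (r f) (q f) (x, y) = s f" if "f \<in> S" for f
        using x(2) y(2) that by simp
      fix u assume u: "u \<in> pair_el X Y P c \<and> (\<forall>f \<in> S. map_prod (r f) (q f) u = s f)"
      have "fst u \<in> X c" "snd u \<in> Y c" using u unfolding pair_el_def by auto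
      moreover have "r f (fst u) = (fst \<circ> s) f \<and> q f (snd u) = (snd \<circ> s) f" if "f \<in> S" for f
        using u that by (metis comp_apply fst_map_prod snd_map_prod)
      ultimately have "fst u = x" "snd u = y" using eX eY x y by blast+
      then show "u = (x, y)" by auto
    qed (rule xy)
  qed
  ultimately show ?thesis unfolding sheaf_on_def by blast
qed

subsection \<open>Power sheaves\<close>

text \<open>
  The sections over \<open>c\<close> of the power sheaf are the closed subsheaves of the restriction of \<open>X\<close> to
  the arrows into \<open>c\<close>.
\<close>

definition pow_el :: "('c \<Rightarrow> 'w set) \<Rightarrow> ('b \<Rightarrow> 'w \<Rightarrow> 'w) \<Rightarrow> 'c \<Rightarrow> ('b \<times> 'w) set set" where
  "pow_el X r c = {T.
     (\<forall>g t. (g, t) \<in> T \<longrightarrow> g \<in> Arr C \<and> Cod C g = c \<and> t \<in> X (Dom C g)) \<and>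
     (\<forall>g t k. (g, t) \<in> T \<longrightarrow> k \<in> Arr C \<longrightarrow> Cod C k = Dom C g \<longrightarrow> (g \<cdot> k, r k t) \<in> T) \<and>
     (\<forall>g t. g \<in> Arr C \<longrightarrow> Cod C g = c \<longrightarrow> t \<in> X (Dom C g) \<longrightarrow>
        locally (Dom C g) (\<lambda>k. (g \<cdot> k, r k t) \<in> T) \<longrightarrow> (g, t) \<in> T)}"

definition pow_res :: "'b \<Rightarrow> ('b \<times> 'w) set \<Rightarrow> ('b \<times> 'w) set" where
  "pow_res h T = {(g, t). g \<in> Arr C \<and> Cod C g = Dom C h \<and> (h \<cdot> g, t) \<in> T}"

lemma pow_elI:
  assumes "\<And>g t. (g, t) \<in> T \<Longrightarrow> g \<in> Arr C \<and> Cod C g = c \<and> t \<in> X (Dom C g)"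
    and "\<And>g t k. (g, t) \<in> T \<Longrightarrow> k \<in> Arr C \<Longrightarrow> Cod C k = Dom C g \<Longrightarrow> (g \<cdot> k, r k t) \<in> T"
    and "\<And>g t. g \<in> Arr C \<Longrightarrow> Cod C g = c \<Longrightarrow> t \<in> X (Dom C g) \<Longrightarrow>
           locally (Dom C g) (\<lambda>k. (g \<cdot> k, r k t) \<in> T) \<Longrightarrow> (g, t) \<in> T"
  shows "T \<in> pow_el X r c"
  unfolding pow_el_def mem_Collect_eq
  by (rule conjI, intro allI impI, erule assms(1), rule conjI; intro allI impI, rule assms)

lemma pow_elD:
  assumes "T \<in> pow_el X r c"
  shows "(g, t) \<in> T \<Longrightarrow> g \<in> Arr C" "(g, t) \<in> T \<Longrightarrow> Cod C g = c" "(g, t) \<in> T \<Longrightarrow> t \<in> X (Dom C g)"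
    and "(g, t) \<in> T \<Longrightarrow> k \<in> Arr C \<Longrightarrow> Cod C k = Dom C g \<Longrightarrow> (g \<cdot> k, r k t) \<in> T"
    and "g \<in> Arr C \<Longrightarrow> Cod C g = c \<Longrightarrow> t \<in> X (Dom C g) \<Longrightarrow>
           locally (Dom C g) (\<lambda>k. (g \<cdot> k, r k t) \<in> T) \<Longrightarrow> (g, t) \<in> T"
proof -
  note T = assms[unfolded pow_el_def mem_Collect_eq]
  note T1 = conjunct1[OF T] and T2 = conjunct1[OF conjunct2[OF T]]
    and T3 = conjunct2[OF conjunct2[OF T]]
  show "(g, t) \<in> T \<Longrightarrow> g \<in> Arr C" "(g, t) \<in> T \<Longrightarrow> Cod C g = c" "(g, t) \<in> T \<Longrightarrow> t \<in> X (Dom C g)"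
    using T1 by simp_all
  show "(g, t) \<in> T \<Longrightarrow> k \<in> Arr C \<Longrightarrow> Cod C k = Dom C g \<Longrightarrow> (g \<cdot> k, r k t) \<in> T"
    using T2 by simp
  show "g \<in> Arr C \<Longrightarrow> Cod C g = c \<Longrightarrow> t \<in> X (Dom C g) \<Longrightarrow>
        locally (Dom C g) (\<lambda>k. (g \<cdot> k, r k t) \<in> T) \<Longrightarrow> (g, t) \<in> T"
    using T3[rule_format, of g t] .
qed

text \<open>
  A matching family of closed subsheaves glues to the subsheaf of all sections that belong to the given
  subsheaves wherever those are defined.  Closedness forces this choice.
\<close>

lemma pow_sheaf:
  assumes X: "presheaf_on C X r"
  shows "sheaf_on C J (pow_el X r) pow_res"
proof -
  have "presheaf_on C (pow_el X r) pow_res"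
    unfolding presheaf_on_def
  proof (intro conjI ballI impI)
    fix h T assume h: "h \<in> Arr C" and T: "T \<in> pow_el X r (Cod C h)"
    show "pow_res h T \<in> pow_el X r (Dom C h)"
    proof (rule pow_elI)
      fix g t assume "(g, t) \<in> pow_res h T"
      then show "g \<in> Arr C \<and> Cod C g = Dom C h \<and> t \<in> X (Dom C g)"
        using pow_elD(3)[OF T, of "h \<cdot> g" t] h unfolding pow_res_def by simp
    next
      fix g t k assume "(g, t) \<in> pow_res h T" "k \<in> Arr C" "Cod C k = Dom C g"
      then show "(g \<cdot> k, r k t) \<in> pow_res h T"
        using pow_elD(4)[OF T, of "h \<cdot> g" t k] h unfolding pow_res_def by simp
    next
      fix g t assume g: "g \<in> Arr C" "Cod C g = Dom C h" and t: "t \<in> X (Dom C g)"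
        and "locally (Dom C g) (\<lambda>k. (g \<cdot> k, r k t) \<in> pow_res h T)"
      then have "locally (Dom C g) (\<lambda>k. ((h \<cdot> g) \<cdot> k, r k t) \<in> T)"
        by (elim locally_mono[rotated]) (use g h in \<open>auto simp: pow_res_def\<close>)
      then have "(h \<cdot> g, t) \<in> T" using pow_elD(5)[OF T, of "h \<cdot> g" t] g h t by simp
      then show "(g, t) \<in> pow_res h T" using g unfolding pow_res_def by simp
    qed
  next
    fix c T assume c: "c \<in> Obj C" and T: "T \<in> pow_el X r c"
    show "pow_res (Idn C c) T = T"
    proof (intro equalityI subrelI)
      show "(g, t) \<in> T" if "(g, t) \<in> pow_res (Idn C c) T" for g t
        using that c unfolding pow_res_def by auto
      show "(g, t) \<in> pow_res (Idn C c) T" if "(g, t) \<in> T" for g t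
        using that c pow_elD(1,2)[OF T that] unfolding pow_res_def by simp
    qed
  next
    fix f g T assume "f \<in> Arr C" "g \<in> Arr C" "Cod C g = Dom C f"
    then show "pow_res (f \<cdot> g) T = pow_res g (pow_res f T)"
      unfolding pow_res_def by (intro Collect_cong) (simp cong: conj_cong split: prod.split)
  qed
  moreover have "\<exists>!T. T \<in> pow_el X r c \<and> (\<forall>f \<in> S. pow_res f T = s f)"
    if c: "c \<in> Obj C" and S: "S \<in> J c" and s: "matching_family C (pow_el X r, pow_res) S s" for c S s
  proof -
    note SA = sieve_arr[OF c S]
    have s1: "s f \<in> pow_el X r (Dom C f)" if "f \<in> S" for f
      using s that unfolding matching_family_def by simp
    have s2: "s (f \<cdot> g) = pow_res g (s f)" if "f \<in> S" "g \<in> Arr C" "Cod C g = Dom C f" for f g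
      using s that unfolding matching_family_def by simp
    \<comment> \<open>the members of \<open>s f\<close> at \<open>k\<close> are those of \<open>s (f \<cdot> k)\<close> at the identity, where they are easiest to state\<close>
    have diag: "(Idn C (Dom C k), t) \<in> s (f \<cdot> k) \<longleftrightarrow> (k, t) \<in> s f"
      if "f \<in> S" "k \<in> Arr C" "Cod C k = Dom C f" for f k t
      using that s2[OF that] unfolding pow_res_def by simp
    \<comment> \<open>over an arrow into the covering sieve, \<open>t\<close> is compared with the given subsheaf at the identity\<close>
    define T where "T = {(g, t). g \<in> Arr C \<and> Cod C g = c \<and> t \<in> X (Dom C g) \<and>
      (\<forall>k \<in> Arr C. Cod C k = Dom C g \<longrightarrow> g \<cdot> k \<in> S \<longrightarrow> (Idn C (Dom C k), r k t) \<in> s (g \<cdot> k))}"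
    have TD: "g \<in> Arr C" "Cod C g = c" "t \<in> X (Dom C g)" if "(g, t) \<in> T" for g t
      using that unfolding T_def by simp_all
    have TD': "(Idn C (Dom C k), r k t) \<in> s (g \<cdot> k)"
      if "(g, t) \<in> T" "k \<in> Arr C" "Cod C k = Dom C g" "g \<cdot> k \<in> S" for g t k
      using that unfolding T_def by simp
    have T: "T \<in> pow_el X r c"
    proof (rule pow_elI)
      fix g t assume "(g, t) \<in> T"
      then show "g \<in> Arr C \<and> Cod C g = c \<and> t \<in> X (Dom C g)" by (simp add: TD)
    next
      fix g t k assume gt: "(g, t) \<in> T" and k: "k \<in> Arr C" "Cod C k = Dom C g"
      have g: "g \<in> Arr C" "Cod C g = c" "t \<in> X (Dom C g)" by (simp_all add: TD[OF gt])
      have "(Idn C (Dom C l), r l (r k t)) \<in> s ((g \<cdot> k) \<cdot> l)"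
        if l: "l \<in> Arr C" "Cod C l = Dom C k" "(g \<cdot> k) \<cdot> l \<in> S" for l
      proof -
        have "(Idn C (Dom C (k \<cdot> l)), r (k \<cdot> l) t) \<in> s (g \<cdot> (k \<cdot> l))"
          using TD'[OF gt, of "k \<cdot> l"] l k g by simp
        then show ?thesis using l k g by (simp add: presheaf_onD(3)[OF X])
      qed
      then show "(g \<cdot> k, r k t) \<in> T"
        unfolding T_def using g k presheaf_onD(1)[OF X, of k t] by simp
    next
      fix g t assume g: "g \<in> Arr C" "Cod C g = c" and t: "t \<in> X (Dom C g)"
        and l: "locally (Dom C g) (\<lambda>k. (g \<cdot> k, r k t) \<in> T)"
      have "(Idn C (Dom C k), r k t) \<in> s (g \<cdot> k)"
        if k: "k \<in> Arr C" "Cod C k = Dom C g" and gk: "g \<cdot> k \<in> S" for k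
      proof (rule pow_elD(5)[OF s1[OF gk]])
        show "Idn C (Dom C k) \<in> Arr C" "Cod C (Idn C (Dom C k)) = Dom C (g \<cdot> k)"
          using k g by simp_all
        show "r k t \<in> X (Dom C (Idn C (Dom C k)))" using k g t presheaf_onD(1)[OF X, of k t] by simp
        have "locally (Dom C k) (\<lambda>l. (g \<cdot> (k \<cdot> l), r (k \<cdot> l) t) \<in> T)"
          using locally_pullback[OF k l] .
        then have "locally (Dom C k) (\<lambda>l. (Idn C (Dom C k) \<cdot> l, r l (r k t)) \<in> s (g \<cdot> k))"
        proof (elim locally_mono[rotated])
          show "Dom C k \<in> Obj C" using k by simp
          fix m assume m: "m \<in> Arr C" "Cod C m = Dom C k" and mT: "(g \<cdot> (k \<cdot> m), r (k \<cdot> m) t) \<in> T"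
          have mS: "(g \<cdot> k) \<cdot> m \<in> S" using SA(3)[OF gk, of m] m k g by simp
          have "(Idn C (Dom C m), r (Idn C (Dom C m)) (r (k \<cdot> m) t)) \<in> s ((g \<cdot> (k \<cdot> m)) \<cdot> Idn C (Dom C m))"
            using TD'[OF mT, of "Idn C (Dom C m)"] m k g mS by simp
          moreover have "r (k \<cdot> m) t \<in> X (Dom C m)" using presheaf_onD(1)[OF X, of "k \<cdot> m" t] m k t by simp
          ultimately have "(Idn C (Dom C m), r (k \<cdot> m) t) \<in> s ((g \<cdot> k) \<cdot> m)"
            using m k g by (simp add: presheaf_onD(2)[OF X])
          then have "(m, r (k \<cdot> m) t) \<in> s (g \<cdot> k)"
            using diag[OF gk m(1), of "r (k \<cdot> m) t"] m k g by simp
          then show "(Idn C (Dom C k) \<cdot> m, r m (r k t)) \<in> s (g \<cdot> k)"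
            using m k t by (simp add: presheaf_onD(3)[OF X])
        qed
        then show "locally (Dom C (Idn C (Dom C k))) (\<lambda>l. (Idn C (Dom C k) \<cdot> l, r l (r k t)) \<in> s (g \<cdot> k))"
          using k by simp
      qed
      then show "(g, t) \<in> T" unfolding T_def using g t by simp
    qed
    have res: "pow_res f T = s f" if f: "f \<in> S" for f
    proof (intro equalityI subrelI)
      fix g t assume "(g, t) \<in> pow_res f T"
      then have g: "g \<in> Arr C" "Cod C g = Dom C f" and gt: "(f \<cdot> g, t) \<in> T"
        unfolding pow_res_def by simp_all
      have t: "t \<in> X (Dom C g)" using TD(3)[OF gt] g SA(1,2)[OF f] by simp
      have fg: "f \<cdot> g \<in> S" using SA(3)[OF f] g by simp
      have "(Idn C (Dom C g), t) \<in> s (f \<cdot> g)"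
        using TD'[OF gt, of "Idn C (Dom C g)"] g SA(1,2)[OF f] fg t
        by (simp add: presheaf_onD(2)[OF X])
      then show "(g, t) \<in> s f" using diag[OF f g] by simp
    next
      fix g t assume gt: "(g, t) \<in> s f"
      note g = pow_elD(1-4)[OF s1[OF f] gt]
      have "(Idn C (Dom C k), r k t) \<in> s ((f \<cdot> g) \<cdot> k)" if k: "k \<in> Arr C" "Cod C k = Dom C g" for k
        using g(4)[OF k] diag[OF f, of "g \<cdot> k" "r k t"] k g(1,2) SA(1)[OF f] by simp
      then show "(g, t) \<in> pow_res f T"
        unfolding pow_res_def T_def using g(1-3) SA(1,2)[OF f] by (simp del: assoc)
    qed
    have uniq: "T1 \<subseteq> T2"
      if T1: "T1 \<in> pow_el X r c" "\<forall>f \<in> S. pow_res f T1 = s f"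
        and T2: "T2 \<in> pow_el X r c" "\<forall>f \<in> S. pow_res f T2 = s f" for T1 T2
    proof (rule subrelI)
      fix g t assume gt: "(g, t) \<in> T1"
      note g = pow_elD(1-3)[OF T1(1) gt]
      show "(g, t) \<in> T2"
      proof (rule pow_elD(5)[OF T2(1) g])
        have "pullback_sieve C g S \<in> J (Dom C g)" using J_pullback[of g S] g S by simp
        moreover have "(g \<cdot> k, r k t) \<in> T2" if "k \<in> pullback_sieve C g S" for k
        proof -
          have k: "k \<in> Arr C" "Cod C k = Dom C g" and gk: "g \<cdot> k \<in> S"
            using that unfolding pullback_sieve_def by simp_all
          have "(Idn C (Dom C k), r k t) \<in> pow_res (g \<cdot> k) T1"
            using pow_elD(4)[OF T1(1) gt k] g k unfolding pow_res_def by simp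
          then have "(Idn C (Dom C k), r k t) \<in> pow_res (g \<cdot> k) T2" using T1(2) T2(2) gk by simp
          then show ?thesis using g k unfolding pow_res_def by simp
        qed
        ultimately show "locally (Dom C g) (\<lambda>k. (g \<cdot> k, r k t) \<in> T2)"
          unfolding locally_def by blast
      qed
    qed
    show ?thesis
    proof (intro ex1I[of _ T] conjI ballI)
      fix T' assume "T' \<in> pow_el X r c \<and> (\<forall>f \<in> S. pow_res f T' = s f)"
      then show "T' = T" using uniq[of T T'] uniq[of T' T] T res by blast
    qed (use T res in auto)
  qed
  ultimately show ?thesis unfolding sheaf_on_def by blast
qed

end

section \<open>Epimorphic families\<close>

text \<open>
  Epimorphic families are handled as sets of arrows; they are indexed by a small set only at the very
  end, by \<open>small_indexed_subcover\<close>.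
\<close>

abbreviation cover :: "('o, 'a, 'z) category_scheme \<Rightarrow> 'o \<Rightarrow> 'a set \<Rightarrow> bool" where
  "cover E F W \<equiv> epimorphic_family E F W (\<lambda>f. f)"

context category
begin

lemma cover_arr: "cover C F W \<Longrightarrow> f \<in> W \<Longrightarrow> f \<in> Arr C" "cover C F W \<Longrightarrow> f \<in> W \<Longrightarrow> Cod C f = F"
  unfolding epimorphic_family_def by simp_all

lemma cover_cancel:
  assumes "cover C F W" "g \<in> Hom C F Z" "h \<in> Hom C F Z" "\<And>f. f \<in> W \<Longrightarrow> g \<cdot> f = h \<cdot> f"
  shows "g = h"
proof -
  have "\<forall>z. \<forall>g \<in> Hom C F z. \<forall>h \<in> Hom C F z. (\<forall>i \<in> W. g \<cdot> i = h \<cdot> i) \<longrightarrow> g = h"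
    using assms(1) unfolding epimorphic_family_def by (elim conjE)
  from this[rule_format, OF assms(2,3)] show ?thesis using assms(4) by simp
qed

lemma coverI:
  assumes "\<And>f. f \<in> W \<Longrightarrow> f \<in> Arr C" "\<And>f. f \<in> W \<Longrightarrow> Cod C f = F"
    and "\<And>Z g h. g \<in> Hom C F Z \<Longrightarrow> h \<in> Hom C F Z \<Longrightarrow> (\<And>f. f \<in> W \<Longrightarrow> g \<cdot> f = h \<cdot> f) \<Longrightarrow> g = h"
  shows "cover C F W"
  unfolding epimorphic_family_def
proof (intro conjI ballI allI impI)
  fix Z g h assume "g \<in> Hom C F Z" "h \<in> Hom C F Z" and eq: "\<forall>f \<in> W. g \<cdot> f = h \<cdot> f"
  then show "g = h" using assms(3)[of g Z h] eq by simp
qed (simp_all add: assms(1,2))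

lemma cover_mono:
  assumes "cover C F W" "W \<subseteq> V" "\<And>g. g \<in> V \<Longrightarrow> g \<in> Arr C" "\<And>g. g \<in> V \<Longrightarrow> Cod C g = F"
  shows "cover C F V"
proof (rule coverI[OF assms(3,4)])
  fix Z g h assume g: "g \<in> Hom C F Z" "h \<in> Hom C F Z" and eq: "\<And>f. f \<in> V \<Longrightarrow> g \<cdot> f = h \<cdot> f"
  show "g = h" by (rule cover_cancel[OF assms(1) g]) (use eq assms(2) in blast)
qed

lemma cover_idn:
  assumes "F \<in> Obj C" "Idn C F \<in> W" "\<And>f. f \<in> W \<Longrightarrow> f \<in> Arr C" "\<And>f. f \<in> W \<Longrightarrow> Cod C f = F"
  shows "cover C F W"
proof (rule coverI[OF assms(3,4)])
  fix Z g h assume "g \<in> Hom C F Z" "h \<in> Hom C F Z" and eq: "\<And>f. f \<in> W \<Longrightarrow> g \<cdot> f = h \<cdot> f"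
  then show "g = h" using eq[OF assms(2)] by (simp add: Hom_def)
qed

lemma cover_trans:
  assumes W: "cover C F W" and V: "\<And>f. f \<in> W \<Longrightarrow> cover C (Dom C f) (V f)"
    and U: "\<And>f g. f \<in> W \<Longrightarrow> g \<in> V f \<Longrightarrow> f \<cdot> g \<in> U" "\<And>f. f \<in> U \<Longrightarrow> f \<in> Arr C" "\<And>f. f \<in> U \<Longrightarrow> Cod C f = F"
  shows "cover C F U"
proof (rule coverI[OF U(2,3)])
  fix Z g h assume g: "g \<in> Hom C F Z" and h: "h \<in> Hom C F Z" and eq: "\<And>f. f \<in> U \<Longrightarrow> g \<cdot> f = h \<cdot> f"
  note gD = HomD[OF g] and hD = HomD[OF h]
  show "g = h"
  proof (rule cover_cancel[OF W g h])
    fix f assume f: "f \<in> W"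
    note fD = cover_arr[OF W f]
    show "g \<cdot> f = h \<cdot> f"
    proof (rule cover_cancel[OF V[OF f]])
      show "g \<cdot> f \<in> Hom C (Dom C f) Z" "h \<cdot> f \<in> Hom C (Dom C f) Z" using fD gD hD by (simp_all add: Hom_def)
      fix l assume l: "l \<in> V f"
      show "(g \<cdot> f) \<cdot> l = (h \<cdot> f) \<cdot> l"
        using eq[OF U(1)[OF f l]] cover_arr[OF V[OF f] l] fD gD hD by simp
    qed
  qed
qed

end

section \<open>Objects of a Grothendieck topos as sheaves of sections\<close>

text \<open>
  A category seen through an equivalence with the category of sheaves on a small site: \<open>el X\<close> and
  \<open>res X\<close> are the sheaf of sections of the object \<open>X\<close>, and \<open>act f\<close> is the action of the arrow \<open>f\<close> on
  sections.  The last three assumptions say that the equivalence is faithful, full and essentially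
  surjective, so that arrows and objects can be built from sections without returning to it.
\<close>

locale sheaf_model = E: category E + site C J
  for E :: "('o, 'a, 'z) category_scheme" (structure)
    and C :: "('c, 'b, 'y) category_scheme" and J +
  fixes el :: "'o \<Rightarrow> 'c \<Rightarrow> 'u set" and res :: "'o \<Rightarrow> 'b \<Rightarrow> 'u \<Rightarrow> 'u" and act :: "'a \<Rightarrow> 'c \<Rightarrow> 'u \<Rightarrow> 'u"
  assumes inacc: "inaccessible TYPE('u)"
    and small_obj: "small TYPE('u) (Obj C)"
    and small_arr: "small TYPE('u) (Arr C)"
    and sheaf: "X \<in> Obj E \<Longrightarrow> sheaf_on C J (el X) (res X)"
    and small_el: "X \<in> Obj E \<Longrightarrow> c \<in> Obj C \<Longrightarrow> small TYPE('u) (el X c)"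
    and act_in: "f \<in> Arr E \<Longrightarrow> c \<in> Obj C \<Longrightarrow> s \<in> el (Dom E f) c \<Longrightarrow> act f c s \<in> el (Cod E f) c"
    and act_res: "f \<in> Arr E \<Longrightarrow> g \<in> Arr C \<Longrightarrow> s \<in> el (Dom E f) (Cod C g) \<Longrightarrow>
                    act f (Dom C g) (res (Dom E f) g s) = res (Cod E f) g (act f (Cod C g) s)"
    and act_comp: "f \<in> Arr E \<Longrightarrow> f' \<in> Arr E \<Longrightarrow> Cod E f = Dom E f' \<Longrightarrow> c \<in> Obj C \<Longrightarrow>
                    s \<in> el (Dom E f) c \<Longrightarrow> act (f' \<cdot> f) c s = act f' c (act f c s)"
    and act_idn: "X \<in> Obj E \<Longrightarrow> c \<in> Obj C \<Longrightarrow> s \<in> el X c \<Longrightarrow> act (Idn E X) c s = s"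
    and faithful: "f \<in> Hom E X Y \<Longrightarrow> f' \<in> Hom E X Y \<Longrightarrow>
                    (\<And>c s. c \<in> Obj C \<Longrightarrow> s \<in> el X c \<Longrightarrow> act f c s = act f' c s) \<Longrightarrow> f = f'"
    and full: "X \<in> Obj E \<Longrightarrow> Y \<in> Obj E \<Longrightarrow>
                    (\<And>c s. c \<in> Obj C \<Longrightarrow> s \<in> el X c \<Longrightarrow> \<theta> c s \<in> el Y c) \<Longrightarrow>
                    (\<And>g s. g \<in> Arr C \<Longrightarrow> s \<in> el X (Cod C g) \<Longrightarrow>
                       \<theta> (Dom C g) (res X g s) = res Y g (\<theta> (Cod C g) s)) \<Longrightarrow>
                    \<exists>f \<in> Hom E X Y. \<forall>c \<in> Obj C. \<forall>s \<in> el X c. act f c s = \<theta> c s"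
    and representable: "sheaf_on C J (V :: 'c \<Rightarrow> 'u set) q \<Longrightarrow> (\<And>c. c \<in> Obj C \<Longrightarrow> small TYPE('u) (V c)) \<Longrightarrow>
                    \<exists>X \<in> Obj E. \<exists>b. (\<forall>c \<in> Obj C. bij_betw (b c) (el X c) (V c)) \<and>
                      (\<forall>g \<in> Arr C. \<forall>s \<in> el X (Cod C g). b (Dom C g) (res X g s) = q g (b (Cod C g) s))"
begin

lemma presheaf: "X \<in> Obj E \<Longrightarrow> presheaf_on C (el X) (res X)"
  using sheaf by (simp add: sheaf_on_def)

lemma res_in: "X \<in> Obj E \<Longrightarrow> g \<in> Arr C \<Longrightarrow> s \<in> el X (Cod C g) \<Longrightarrow> res X g s \<in> el X (Dom C g)"
  and res_idn: "X \<in> Obj E \<Longrightarrow> c \<in> Obj C \<Longrightarrow> s \<in> el X c \<Longrightarrow> res X (Idn C c) s = s"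
  and res_comp: "X \<in> Obj E \<Longrightarrow> g \<in> Arr C \<Longrightarrow> k \<in> Arr C \<Longrightarrow> Cod C k = Dom C g \<Longrightarrow> s \<in> el X (Cod C g) \<Longrightarrow>
                   res X (g \<cdot>\<^bsub>C\<^esub> k) s = res X k (res X g s)"
  using presheaf_onD[OF presheaf] by simp_all

lemma represent:
  fixes Y :: "'c \<Rightarrow> 'w set"
  assumes Y: "sheaf_on C J Y q" and small: "\<And>c. c \<in> Obj C \<Longrightarrow> small TYPE('u) (Y c)"
  obtains X b where "X \<in> Obj E" "\<And>c. c \<in> Obj C \<Longrightarrow> bij_betw (b c) (el X c) (Y c)"
    "\<And>g s. g \<in> Arr C \<Longrightarrow> s \<in> el X (Cod C g) \<Longrightarrow> b (Dom C g) (res X g s) = q g (b (Cod C g) s)"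
proof -
  have "\<exists>e :: 'w \<Rightarrow> 'u. inj_on e (Y c)" if "c \<in> Obj C" for c
    by (rule small_encoding[OF small[OF that]]) blast
  then obtain e :: "'c \<Rightarrow> 'w \<Rightarrow> 'u" where e: "\<forall>c \<in> Obj C. inj_on (e c) (Y c)" by metis
  define d where "d c = the_inv_into (Y c) (e c)" for c
  have de: "d c (e c s) = s" if "c \<in> Obj C" "s \<in> Y c" for c s
    using e that by (simp add: d_def the_inv_into_f_f)
  define Y' where "Y' c = e c ` Y c" for c
  define q' where "q' g u = e (Dom C g) (q g (d (Cod C g) u))" for g u
  have "sheaf_on C J Y' q'"
  proof (rule sheaf_on_transport[OF Y, of e])
    show "bij_betw (e c) (Y c) (Y' c)" if "c \<in> Obj C" for c
      using e that by (simp add: bij_betw_def Y'_def)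
    show "e (Dom C f) (q f s) = q' f (e (Cod C f) s)" if "f \<in> Arr C" "s \<in> Y (Cod C f)" for f s
      using that by (simp add: q'_def de)
  qed
  moreover have "small TYPE('u) (Y' c)" if "c \<in> Obj C" for c
    unfolding Y'_def by (rule small_image[OF small[OF that]])
  ultimately obtain X b where X: "X \<in> Obj E" and b: "\<forall>c \<in> Obj C. bij_betw (b c) (el X c) (Y' c)"
    and nat: "\<forall>g \<in> Arr C. \<forall>s \<in> el X (Cod C g). b (Dom C g) (res X g s) = q' g (b (Cod C g) s)"
    using representable[of Y' q'] by blast
  have dY: "bij_betw (d c) (Y' c) (Y c)" if "c \<in> Obj C" for c
    unfolding d_def Y'_def by (rule bij_betw_the_inv_into) (use e that in \<open>simp add: bij_betw_def\<close>)
  have Yq: "q g t \<in> Y (Dom C g)" if "g \<in> Arr C" "t \<in> Y (Cod C g)" for g t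
    using Y that unfolding sheaf_on_def presheaf_on_def by blast
  show thesis
  proof (rule that[OF X, of "\<lambda>c. d c \<circ> b c"])
    show "bij_betw (d c \<circ> b c) (el X c) (Y c)" if "c \<in> Obj C" for c
      using b dY that bij_betw_trans by blast
    fix g s assume g: "g \<in> Arr C" and s: "s \<in> el X (Cod C g)"
    have "b (Cod C g) s \<in> Y' (Cod C g)" using bij_betw_apply[OF bspec[OF b], of "Cod C g" s] g s by simp
    then have "d (Cod C g) (b (Cod C g) s) \<in> Y (Cod C g)" using bij_betw_apply[OF dY] g by simp
    then show "(d (Dom C g) \<circ> b (Dom C g)) (res X g s) = q g ((d (Cod C g) \<circ> b (Cod C g)) s)"
      using nat g s by (simp add: q'_def de Yq)
  qed
qed

text \<open>
  A subsheaf of the product of two sheaves.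
\<close>

definition local_rel :: "'o \<Rightarrow> 'o \<Rightarrow> ('c \<Rightarrow> 'u \<Rightarrow> 'u \<Rightarrow> bool) \<Rightarrow> bool" where
  "local_rel X Y P \<longleftrightarrow>
     (\<forall>g \<in> Arr C. \<forall>s \<in> el X (Cod C g). \<forall>t \<in> el Y (Cod C g).
        P (Cod C g) s t \<longrightarrow> P (Dom C g) (res X g s) (res Y g t)) \<and>
     (\<forall>c \<in> Obj C. \<forall>s \<in> el X c. \<forall>t \<in> el Y c.
        locally c (\<lambda>g. P (Dom C g) (res X g s) (res Y g t)) \<longrightarrow> P c s t)"

lemma local_relI:
  assumes "\<And>g s t. g \<in> Arr C \<Longrightarrow> s \<in> el X (Cod C g) \<Longrightarrow> t \<in> el Y (Cod C g) \<Longrightarrow>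
      P (Cod C g) s t \<Longrightarrow> P (Dom C g) (res X g s) (res Y g t)"
    and "\<And>c s t. c \<in> Obj C \<Longrightarrow> s \<in> el X c \<Longrightarrow> t \<in> el Y c \<Longrightarrow>
      locally c (\<lambda>g. P (Dom C g) (res X g s) (res Y g t)) \<Longrightarrow> P c s t"
  shows "local_rel X Y P"
  unfolding local_rel_def using assms by simp

lemma local_relD:
  assumes "local_rel X Y P"
  shows "g \<in> Arr C \<Longrightarrow> s \<in> el X (Cod C g) \<Longrightarrow> t \<in> el Y (Cod C g) \<Longrightarrow>
      P (Cod C g) s t \<Longrightarrow> P (Dom C g) (res X g s) (res Y g t)"
    and "c \<in> Obj C \<Longrightarrow> s \<in> el X c \<Longrightarrow> t \<in> el Y c \<Longrightarrow>
      locally c (\<lambda>g. P (Dom C g) (res X g s) (res Y g t)) \<Longrightarrow> P c s t"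
  using assms unfolding local_rel_def by simp_all

text \<open>
  The object that represents a local relation, with its two projections.
\<close>

lemma pair_object:
  assumes XY: "X \<in> Obj E" "Y \<in> Obj E" and P: "local_rel X Y P"
  obtains W p q where "W \<in> Obj E" "p \<in> Hom E W X" "q \<in> Hom E W Y"
    "\<And>c w. c \<in> Obj C \<Longrightarrow> w \<in> el W c \<Longrightarrow> P c (act p c w) (act q c w)"
    "\<And>c s t. c \<in> Obj C \<Longrightarrow> s \<in> el X c \<Longrightarrow> t \<in> el Y c \<Longrightarrow> P c s t \<Longrightarrow>
       \<exists>w \<in> el W c. act p c w = s \<and> act q c w = t"
proof -
  let ?Y = "pair_el (el X) (el Y) P" and ?q = "\<lambda>g. map_prod (res X g) (res Y g)"
  have sh: "sheaf_on C J ?Y ?q" 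
    by (rule pair_sheaf[where P = P, OF sheaf[OF XY(1)] sheaf[OF XY(2)]]) (fact local_relD[OF P])+
  have "small TYPE('u) (?Y c)" if "c \<in> Obj C" for c
  proof (rule small_subset)
    show "small TYPE('u) (el X c \<times> el Y c)"
      by (intro small_Sigma[OF inacc] small_el XY that)
    show "?Y c \<subseteq> el X c \<times> el Y c" unfolding pair_el_def by auto
  qed
  then obtain W b where W: "W \<in> Obj E" and b: "\<And>c. c \<in> Obj C \<Longrightarrow> bij_betw (b c) (el W c) (?Y c)"
    and nat: "\<And>g s. g \<in> Arr C \<Longrightarrow> s \<in> el W (Cod C g) \<Longrightarrow> b (Dom C g) (res W g s) = ?q g (b (Cod C g) s)"
    using represent[OF sh] by metis
  have bY: "fst (b c w) \<in> el X c" "snd (b c w) \<in> el Y c" "P c (fst (b c w)) (snd (b c w))"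
    if "c \<in> Obj C" "w \<in> el W c" for c w
  proof -
    have "b c w \<in> ?Y c" using b[OF that(1)] that(2) by (auto simp: bij_betw_def)
    then show "fst (b c w) \<in> el X c" "snd (b c w) \<in> el Y c" "P c (fst (b c w)) (snd (b c w))"
      unfolding pair_el_def by auto
  qed
  obtain p where p: "p \<in> Hom E W X" "\<forall>c \<in> Obj C. \<forall>w \<in> el W c. act p c w = fst (b c w)"
    using full[OF W XY(1), of "\<lambda>c w. fst (b c w)"] bY(1) nat by auto
  obtain q where q: "q \<in> Hom E W Y" "\<forall>c \<in> Obj C. \<forall>w \<in> el W c. act q c w = snd (b c w)"
    using full[OF W XY(2), of "\<lambda>c w. snd (b c w)"] bY(2) nat by auto
  show thesis
  proof (rule that[OF W p(1) q(1)])
    show "P c (act p c w) (act q c w)" if "c \<in> Obj C" "w \<in> el W c" for c w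
      using bY(3)[OF that] p(2) q(2) that by simp
    fix c s t assume c: "c \<in> Obj C" and st: "s \<in> el X c" "t \<in> el Y c" "P c s t"
    then have "(s, t) \<in> ?Y c" unfolding pair_el_def by simp
    then have "(s, t) \<in> b c ` el W c" using b[OF c] by (simp add: bij_betw_def)
    then obtain w where "w \<in> el W c" "b c w = (s, t)" by auto
    then show "\<exists>w \<in> el W c. act p c w = s \<and> act q c w = t" using p(2) q(2) c by (intro bexI[of _ w]) simp_all
  qed
qed

text \<open>
  A local relation \<open>P\<close> from \<open>F\<close> to \<open>X\<close> is classified by the arrow \<open>\<chi> P\<close> into the power object of \<open>X\<close> that
  sends a section \<open>s\<close> to the closed subsheaf of the sections related to restrictions of \<open>s\<close>.  The power
  object serves all relations \<open>P\<close>, so that classifying arrows can be compared.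
\<close>

lemma power_object:
  assumes F: "F \<in> Obj E" and X: "X \<in> Obj E"
  obtains Z \<chi> where "\<And>P. local_rel F X P \<Longrightarrow> \<chi> P \<in> Hom E F Z"
    "\<And>P Q c s s'. local_rel F X P \<Longrightarrow> local_rel F X Q \<Longrightarrow> c \<in> Obj C \<Longrightarrow> s \<in> el F c \<Longrightarrow> s' \<in> el F c \<Longrightarrow>
       act (\<chi> P) c s = act (\<chi> Q) c s' \<longleftrightarrow>
         (\<forall>g \<in> Arr C. Cod C g = c \<longrightarrow> (\<forall>t \<in> el X (Dom C g).
            P (Dom C g) (res F g s) t \<longleftrightarrow> Q (Dom C g) (res F g s') t))"
proof -
  let ?Y = "pow_el (el X) (res X)"
  have sh: "sheaf_on C J ?Y pow_res" by (rule pow_sheaf[OF presheaf[OF X]])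
  have "small TYPE('u) (?Y c)" if "c \<in> Obj C" for c
  proof (rule small_subset)
    show "small TYPE('u) (Pow (SIGMA g:Arr C. el X (Dom C g)))"
      by (intro small_Pow[OF inacc] small_Sigma[OF inacc] small_arr small_el X dom_obj)
    show "?Y c \<subseteq> Pow (SIGMA g:Arr C. el X (Dom C g))"
      using pow_elD(1,3) by (force simp: subset_iff)
  qed
  then obtain Z b where Z: "Z \<in> Obj E" and b: "\<And>c. c \<in> Obj C \<Longrightarrow> bij_betw (b c) (el Z c) (?Y c)"
    and nat: "\<And>g s. g \<in> Arr C \<Longrightarrow> s \<in> el Z (Cod C g) \<Longrightarrow> b (Dom C g) (res Z g s) = pow_res g (b (Cod C g) s)"
    using represent[OF sh] by metis
  have inj: "inj_on (b c) (el Z c)" if "c \<in> Obj C" for c using b[OF that] by (simp add: bij_betw_def)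
  define T where "T P c s = {(g, t). g \<in> Arr C \<and> Cod C g = c \<and> t \<in> el X (Dom C g) \<and>
    P (Dom C g) (res F g s) t}" for P :: "'c \<Rightarrow> 'u \<Rightarrow> 'u \<Rightarrow> bool" and c s
  have ex: "\<exists>\<chi>. \<chi> \<in> Hom E F Z \<and> (\<forall>c \<in> Obj C. \<forall>s \<in> el F c. b c (act \<chi> c s) = T P c s)"
    if P: "local_rel F X P" for P
  proof -
    have T: "T P c s \<in> ?Y c" if c: "c \<in> Obj C" and s: "s \<in> el F c" for c s
    proof (rule pow_elI)
      fix g t assume "(g, t) \<in> T P c s"
      then show "g \<in> Arr C \<and> Cod C g = c \<and> t \<in> el X (Dom C g)" unfolding T_def by simp
    next
      fix g t k assume "(g, t) \<in> T P c s" and k: "k \<in> Arr C" "Cod C k = Dom C g"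
      then have g: "g \<in> Arr C" "Cod C g = c" "t \<in> el X (Dom C g)" "P (Dom C g) (res F g s) t"
        unfolding T_def by simp_all
      have "P (Dom C k) (res F k (res F g s)) (res X k t)"
        using local_relD(1)[OF P, of k "res F g s" t] g k res_in[OF F, of g s] s by simp
      then show "(g \<cdot>\<^bsub>C\<^esub> k, res X k t) \<in> T P c s"
        unfolding T_def using g k s res_in[OF X, of k t] by (simp add: res_comp[OF F])
    next
      fix g t assume g: "g \<in> Arr C" "Cod C g = c" and t: "t \<in> el X (Dom C g)"
        and l: "locally (Dom C g) (\<lambda>k. (g \<cdot>\<^bsub>C\<^esub> k, res X k t) \<in> T P c s)"
      have "locally (Dom C g) (\<lambda>k. P (Dom C k) (res F k (res F g s)) (res X k t))"
        by (rule locally_mono[OF _ l]) (use g s in \<open>auto simp: T_def res_comp[OF F]\<close>)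
      then have "P (Dom C g) (res F g s) t"
        using local_relD(2)[OF P, of "Dom C g" "res F g s" t] g t res_in[OF F, of g s] s by simp
      then show "(g, t) \<in> T P c s" unfolding T_def using g t by simp
    qed
    define \<theta> where "\<theta> c s = the_inv_into (el Z c) (b c) (T P c s)" for c s
    have \<theta>: "\<theta> c s \<in> el Z c" "b c (\<theta> c s) = T P c s" if "c \<in> Obj C" "s \<in> el F c" for c s
    proof -
      have "T P c s \<in> b c ` el Z c" using b[OF that(1)] T[OF that] by (simp add: bij_betw_def)
      moreover have "inj_on (b c) (el Z c)" using b[OF that(1)] by (simp add: bij_betw_def)
      ultimately show "\<theta> c s \<in> el Z c" "b c (\<theta> c s) = T P c s"
        unfolding \<theta>_def by (simp_all add: the_inv_into_into f_the_inv_into_f)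
    qed
    have "\<theta> (Dom C g) (res F g s) = res Z g (\<theta> (Cod C g) s)"
      if g: "g \<in> Arr C" and s: "s \<in> el F (Cod C g)" for g s
    proof -
      have "T P (Dom C g) (res F g s) = pow_res g (T P (Cod C g) s)"
        unfolding T_def pow_res_def
        by (rule Collect_cong) (use g s in \<open>auto simp: res_comp[OF F]\<close>)
      then have "b (Dom C g) (\<theta> (Dom C g) (res F g s)) = b (Dom C g) (res Z g (\<theta> (Cod C g) s))"
        using nat[of g "\<theta> (Cod C g) s"] g s \<theta> res_in[OF F] by simp
      moreover have "inj_on (b (Dom C g)) (el Z (Dom C g))" using b g by (simp add: bij_betw_def)
      ultimately show ?thesis
        using \<theta>(1)[of "Dom C g" "res F g s"] res_in[OF F g s] res_in[OF Z g, of "\<theta> (Cod C g) s"] \<theta>(1)[of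
            "Cod C g" s] g s
        by (auto dest: inj_onD)
    qed
    then obtain \<chi> where \<chi>: "\<chi> \<in> Hom E F Z" "\<forall>c \<in> Obj C. \<forall>s \<in> el F c. act \<chi> c s = \<theta> c s"
      using full[OF F Z, of \<theta>] \<theta>(1) by blast
    then show ?thesis using \<theta>(2) by auto
  qed
  define \<chi> where
    "\<chi> P = (SOME k. k \<in> Hom E F Z \<and> (\<forall>c \<in> Obj C. \<forall>s \<in> el F c. b c (act k c s) = T P c s))" for P
  have \<chi>: "\<chi> P \<in> Hom E F Z" "\<forall>c \<in> Obj C. \<forall>s \<in> el F c. b c (act (\<chi> P) c s) = T P c s"
    if "local_rel F X P" for P
    unfolding \<chi>_def using someI_ex[OF ex[OF that]] by blast+
  show thesis
  proof (rule that[OF \<chi>(1)])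
    fix P Q c s s'
    assume P: "local_rel F X P" and Q: "local_rel F X Q" and c: "c \<in> Obj C" and s: "s \<in> el F c" "s' \<in> el F c"
    have "act (\<chi> P) c s \<in> el Z c" "act (\<chi> Q) c s' \<in> el Z c"
      using act_in[of "\<chi> P" c s] act_in[of "\<chi> Q" c s'] HomD[OF \<chi>(1)[OF P]] HomD[OF \<chi>(1)[OF Q]] c s by simp_all
    then have "act (\<chi> P) c s = act (\<chi> Q) c s' \<longleftrightarrow> b c (act (\<chi> P) c s) = b c (act (\<chi> Q) c s')"
      using inj[OF c] by (auto dest: inj_onD)
    also have "\<dots> \<longleftrightarrow> T P c s = T Q c s'" using \<chi>(2)[OF P] \<chi>(2)[OF Q] c s by simp
    also have "\<dots> \<longleftrightarrow> (\<forall>g \<in> Arr C. Cod C g = c \<longrightarrow> (\<forall>t \<in> el X (Dom C g).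
        P (Dom C g) (res F g s) t \<longleftrightarrow> Q (Dom C g) (res F g s') t))"
      unfolding T_def by (auto simp: set_eq_iff)
    finally show "act (\<chi> P) c s = act (\<chi> Q) c s' \<longleftrightarrow> (\<forall>g \<in> Arr C. Cod C g = c \<longrightarrow> (\<forall>t \<in> el X (Dom C g).
        P (Dom C g) (res F g s) t \<longleftrightarrow> Q (Dom C g) (res F g s') t))" .
  qed
qed

definition hit :: "'a set \<Rightarrow> 'c \<Rightarrow> 'u \<Rightarrow> bool" where
  "hit W c s \<longleftrightarrow> (\<exists>f \<in> W. \<exists>v \<in> el (Dom E f) c. act f c v = s)"

lemma hit_res:
  assumes "hit W (Cod C g) s" "g \<in> Arr C" "\<And>f. f \<in> W \<Longrightarrow> f \<in> Arr E" "\<And>f. f \<in> W \<Longrightarrow> Cod E f = F"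
  shows "hit W (Dom C g) (res F g s)"
proof -
  obtain f v where f: "f \<in> W" and v: "v \<in> el (Dom E f) (Cod C g)" "act f (Cod C g) v = s"
    using assms(1) unfolding hit_def by blast
  have "act f (Dom C g) (res (Dom E f) g v) = res F g s"
    using act_res[of f g v] assms(2) assms(3,4)[OF f] v by simp
  moreover have "res (Dom E f) g v \<in> el (Dom E f) (Dom C g)"
    using res_in[of "Dom E f" g v] assms(2) assms(3)[OF f] v by simp
  ultimately show ?thesis unfolding hit_def using f by blast
qed

text \<open>
  An epimorphic family is jointly surjective on sections, up to a cover.  The sections that are locally
  in one of the images form a subsheaf of \<open>F\<close>.  This subsheaf and the whole of \<open>F\<close> are classified by two
  arrows out of \<open>F\<close> that agree after composition with every member of the family, hence are equal.
\<close>

lemma cover_hit: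
  assumes W: "cover E F W" and F: "F \<in> Obj E" and c: "c \<in> Obj C" and s: "s \<in> el F c"
  shows "locally c (\<lambda>g. hit W (Dom C g) (res F g s))"
proof -
  \<comment> \<open>a subsheaf of \<open>F\<close>, written as a relation that ignores its second argument\<close>
  define P where "P = (\<lambda>c s (t :: 'u). locally c (\<lambda>g. hit W (Dom C g) (res F g s)))"
  have WD: "f \<in> Arr E" "Cod E f = F" if "f \<in> W" for f using E.cover_arr[OF W that] .
  have P: "local_rel F F P"
  proof (rule local_relI)
    fix g s t assume g: "g \<in> Arr C" and s: "s \<in> el F (Cod C g)" and "P (Cod C g) s t"
    then have "locally (Dom C g) (\<lambda>k. hit W (Dom C (g \<cdot>\<^bsub>C\<^esub> k)) (res F (g \<cdot>\<^bsub>C\<^esub> k) s))"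
      unfolding P_def by (intro locally_pullback[OF g refl])
    then show "P (Dom C g) (res F g s) (res F g t)"
      unfolding P_def
      by (rule locally_mono[rotated]) (use g s in \<open>simp_all add: res_comp[OF F]\<close>)
  next
    fix c s t assume c: "c \<in> Obj C" and s: "s \<in> el F c"
      and l: "locally c (\<lambda>g. P (Dom C g) (res F g s) (res F g t))"
    have "locally c (\<lambda>g. locally (Dom C g) (\<lambda>k. hit W (Dom C (g \<cdot>\<^bsub>C\<^esub> k)) (res F (g \<cdot>\<^bsub>C\<^esub> k) s)))"
    proof (rule locally_mono[OF c l])
      fix g assume g: "g \<in> Arr C" "Cod C g = c" "P (Dom C g) (res F g s) (res F g t)"
      show "locally (Dom C g) (\<lambda>k. hit W (Dom C (g \<cdot>\<^bsub>C\<^esub> k)) (res F (g \<cdot>\<^bsub>C\<^esub> k) s))"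
        by (rule locally_mono[OF _ g(3)[unfolded P_def]]) (use g s in \<open>simp_all add: res_comp[OF F]\<close>)
    qed
    then show "P c s t" unfolding P_def by (rule locally_trans[OF c])
  qed
  let ?T = "\<lambda>_ _ _. True"
  have T: "local_rel F F ?T" by (simp add: local_rel_def)
  obtain Z k where k: "\<And>P. local_rel F F P \<Longrightarrow> k P \<in> Hom E F Z"
    and eq: "\<And>P Q c s s'. local_rel F F P \<Longrightarrow> local_rel F F Q \<Longrightarrow> c \<in> Obj C \<Longrightarrow> s \<in> el F c \<Longrightarrow> s' \<in> el F c \<Longrightarrow>
       act (k P) c s = act (k Q) c s' \<longleftrightarrow>
         (\<forall>g \<in> Arr C. Cod C g = c \<longrightarrow> (\<forall>t \<in> el F (Dom C g).
            P (Dom C g) (res F g s) t \<longleftrightarrow> Q (Dom C g) (res F g s') t))"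
    by (rule power_object[OF F F]) blast
  define \<chi> where "\<chi> = k P"
  define \<tau> where "\<tau> = k ?T"
  have \<chi>: "\<chi> \<in> Hom E F Z" and \<tau>: "\<tau> \<in> Hom E F Z" unfolding \<chi>_def \<tau>_def by (rule k[OF P], rule k[OF T])
  have \<chi>\<tau>: "act \<chi> c s = act \<tau> c s \<longleftrightarrow>
      (\<forall>g \<in> Arr C. Cod C g = c \<longrightarrow> (\<forall>t \<in> el F (Dom C g). P (Dom C g) (res F g s) t))"
    if "c \<in> Obj C" "s \<in> el F c" for c s
    unfolding \<chi>_def \<tau>_def using eq[OF P T that(1,2,2)] by simp
  have "\<chi> \<cdot> f = \<tau> \<cdot> f" if f: "f \<in> W" for f
  proof (rule faithful)
    show "\<chi> \<cdot> f \<in> Hom E (Dom E f) Z" "\<tau> \<cdot> f \<in> Hom E (Dom E f) Z"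
      using \<chi> \<tau> WD[OF f] by (simp_all add: Hom_def)
    fix c v assume c: "c \<in> Obj C" and v: "v \<in> el (Dom E f) c"
    define s where "s = act f c v"
    have s: "s \<in> el F c" unfolding s_def using act_in[of f c v] WD[OF f] c v by simp
    have h: "hit W c s" unfolding hit_def s_def using f v by blast
    have "P (Dom C g) (res F g s) t" if g: "g \<in> Arr C" "Cod C g = c" for g t
      unfolding P_def
    proof (rule locally_all)
      fix k assume k: "k \<in> Arr C" "Cod C k = Dom C g"
      have "hit W (Dom C g) (res F g s)" using hit_res[of W g s F] WD h g by simp
      then show "hit W (Dom C k) (res F k (res F g s))"
        using hit_res[of W k "res F g s" F] WD k by simp
    qed (use g in simp)
    then have "act \<chi> c s = act \<tau> c s" unfolding \<chi>\<tau>[OF c s] by blast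
    then show "act (\<chi> \<cdot> f) c v = act (\<tau> \<cdot> f) c v"
      using act_comp[of f \<chi> c v] act_comp[of f \<tau> c v] WD[OF f] \<chi> \<tau> c v
      by (simp add: Hom_def s_def)
  qed
  then have "\<chi> = \<tau>" by (rule E.cover_cancel[OF W \<chi> \<tau>])
  then have "\<forall>g \<in> Arr C. Cod C g = c \<longrightarrow> (\<forall>t \<in> el F (Dom C g). P (Dom C g) (res F g s) t)"
    using \<chi>\<tau>[OF c s] by simp
  from this[rule_format, of "Idn C c" s] have "P c (res F (Idn C c) s) s" using c s by simp
  then show ?thesis unfolding P_def using c s by (simp add: res_idn[OF F])
qed

text \<open>
  The converse of \<open>cover_hit\<close>: an arrow is determined by its action on sections, and an equality of
  sections may be checked locally.
\<close>

lemma cover_by_hits: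
  assumes W: "\<And>f. f \<in> W \<Longrightarrow> f \<in> Arr E" "\<And>f. f \<in> W \<Longrightarrow> Cod E f = F" and F: "F \<in> Obj E"
    and hit: "\<And>c s. c \<in> Obj C \<Longrightarrow> s \<in> el F c \<Longrightarrow> locally c (\<lambda>g. hit W (Dom C g) (res F g s))"
  shows "cover E F W"
proof -
  have "g = h" if g: "g \<in> Hom E F Z" and h: "h \<in> Hom E F Z"
    and eq: "\<forall>f \<in> W. g \<cdot> f = h \<cdot> f" for g h Z
  proof (rule faithful[OF g h])
    fix c s assume c: "c \<in> Obj C" and s: "s \<in> el F c"
    have Z: "Z \<in> Obj E" using E.cod_obj[OF HomD(1)[OF g]] HomD(3)[OF g] by simp
    note gD = HomD[OF g] and hD = HomD[OF h]
    show "act g c s = act h c s"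
    proof (rule sheaf_separated[OF sheaf[OF Z] c])
      show "act g c s \<in> el Z c" "act h c s \<in> el Z c"
        using act_in[of g c s] act_in[of h c s] gD hD c s by simp_all
      show "locally c (\<lambda>k. res Z k (act g c s) = res Z k (act h c s))"
      proof (rule locally_mono[OF c hit[OF c s]])
        fix k assume k: "k \<in> Arr C" "Cod C k = c" and "hit W (Dom C k) (res F k s)"
        then obtain f v where f: "f \<in> W" and v: "v \<in> el (Dom E f) (Dom C k)" "act f (Dom C k) v = res F k s"
          unfolding hit_def by blast
        have "act g (Dom C k) (res F k s) = act h (Dom C k) (res F k s)"
          using act_comp[of f g "Dom C k" v] act_comp[of f h "Dom C k" v] W[OF f] eq f v gD hD k by simp
        then show "res Z k (act g c s) = res Z k (act h c s)"
          using act_res[of g k s] act_res[of h k s] gD hD k s by simp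
      qed
    qed
  qed
  then show ?thesis unfolding epimorphic_family_def using W by simp
qed

end

section \<open>Gluing and quotients in a Grothendieck topos\<close>

context sheaf_model
begin

text \<open>
  A fibre product for two cospans with the same feet at once.  The pullback of a single cospan is the
  case of equal cospans; two of them are needed in \<open>effective_quotient\<close>, to find the part of an object
  on which a pair of arrows is a restriction of another pair.
\<close>

lemma fibre_product:
  assumes f: "f \<in> Hom E X F" "f' \<in> Hom E X F" and h: "h \<in> Hom E Y F" "h' \<in> Hom E Y F"
  obtains P p q where "p \<in> Hom E P X" "q \<in> Hom E P Y" "f \<cdot> p = h \<cdot> q" "f' \<cdot> p = h' \<cdot> q"
    "\<And>c s t. c \<in> Obj C \<Longrightarrow> s \<in> el X c \<Longrightarrow> t \<in> el Y c \<Longrightarrow> act f c s = act h c t \<Longrightarrow>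
       act f' c s = act h' c t \<Longrightarrow> \<exists>w \<in> el P c. act p c w = s \<and> act q c w = t"
proof -
  have XY: "X \<in> Obj E" "Y \<in> Obj E" and F: "F \<in> Obj E"
    using HomD[OF f(1)] HomD[OF h(1)] E.dom_obj E.cod_obj by blast+
  note fD = HomD[OF f(1)] HomD[OF f(2)] and hD = HomD[OF h(1)] HomD[OF h(2)]
  define eq where "eq c s t \<longleftrightarrow> act f c s = act h c t \<and> act f' c s = act h' c t" for c s t
  have nat: "res F g (act k (Cod C g) s) = act k (Dom C g) (res V g s)"
    if "k \<in> Hom E V F" "g \<in> Arr C" "s \<in> el V (Cod C g)" for k V g s
    using act_res[of k g s] that by (simp add: Hom_def)
  have inF: "act k c s \<in> el F c" if "k \<in> Hom E V F" "c \<in> Obj C" "s \<in> el V c" for k V c s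
    using act_in[of k c s] that by (simp add: Hom_def)
  have stable: "eq (Dom C g) (res X g s) (res Y g t)"
    if "g \<in> Arr C" "s \<in> el X (Cod C g)" "t \<in> el Y (Cod C g)" "eq (Cod C g) s t" for g s t
    using that unfolding eq_def by (simp flip: nat[OF f(1)] nat[OF f(2)] nat[OF h(1)] nat[OF h(2)])
  have loc: "eq c s t" if c: "c \<in> Obj C" and st: "s \<in> el X c" "t \<in> el Y c"
    and l: "locally c (\<lambda>g. eq (Dom C g) (res X g s) (res Y g t))" for c s t
    unfolding eq_def
  proof (intro conjI sheaf_separated[OF sheaf[OF F] c])
    show "locally c (\<lambda>g. res F g (act f c s) = res F g (act h c t))"
      by (rule locally_mono[OF c l]) (use st nat[OF f(1)] nat[OF h(1)] in \<open>auto simp: eq_def\<close>)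
    show "locally c (\<lambda>g. res F g (act f' c s) = res F g (act h' c t))"
      by (rule locally_mono[OF c l]) (use st nat[OF f(2)] nat[OF h(2)] in \<open>auto simp: eq_def\<close>)
  qed (use inF f h c st in blast)+
  have "local_rel X Y eq" by (rule local_relI) (fact stable, fact loc)
  then obtain P p q where P: "P \<in> Obj E" "p \<in> Hom E P X" "q \<in> Hom E P Y"
    and eq: "\<And>c w. c \<in> Obj C \<Longrightarrow> w \<in> el P c \<Longrightarrow> eq c (act p c w) (act q c w)"
    and ex: "\<And>c s t. c \<in> Obj C \<Longrightarrow> s \<in> el X c \<Longrightarrow> t \<in> el Y c \<Longrightarrow> eq c s t \<Longrightarrow>
       \<exists>w \<in> el P c. act p c w = s \<and> act q c w = t"
    using pair_object[OF XY, of eq] by metis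
  note pD = HomD[OF P(2)] and qD = HomD[OF P(3)]
  show thesis
  proof (rule that[OF P(2,3)])
    show "f \<cdot> p = h \<cdot> q"
    proof (rule faithful)
      show "act (f \<cdot> p) c w = act (h \<cdot> q) c w" if "c \<in> Obj C" "w \<in> el P c" for c w
        using eq[OF that] act_comp[of p f c w] act_comp[of q h c w] pD qD fD hD that
        by (simp add: eq_def)
    qed (use pD qD fD hD in \<open>simp_all add: Hom_def\<close>)
    show "f' \<cdot> p = h' \<cdot> q"
    proof (rule faithful)
      show "act (f' \<cdot> p) c w = act (h' \<cdot> q) c w" if "c \<in> Obj C" "w \<in> el P c" for c w
        using eq[OF that] act_comp[of p f' c w] act_comp[of q h' c w] pD qD fD hD that
        by (simp add: eq_def)
    qed (use pD qD fD hD in \<open>simp_all add: Hom_def\<close>)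
  qed (use ex in \<open>simp add: eq_def\<close>)
qed

text \<open>
  A section of \<open>G\<close> whose image in \<open>F\<close> comes from \<open>f\<close> lies in the image of the fibre product of \<open>h\<close>
  and \<open>f\<close>, so the family of these fibre products is again jointly surjective on sections.
\<close>

lemma cover_pullback:
  assumes W: "cover E F W" and h: "h \<in> Hom E G F"
  shows "cover E G {g \<in> Arr E. Cod E g = G \<and>
           (\<exists>f \<in> W. \<exists>k \<in> Hom E (Dom E g) (Dom E f). h \<cdot> g = f \<cdot> k)}" (is "cover E G ?V")
proof (rule cover_by_hits)
  have F: "F \<in> Obj E" and G: "G \<in> Obj E" using h unfolding Hom_def by auto
  show "G \<in> Obj E" by (rule G)
  fix c s assume c: "c \<in> Obj C" and s: "s \<in> el G c"
  have "act h c s \<in> el F c" using act_in[of h c s] h c s by (simp add: Hom_def)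
  from cover_hit[OF W F c this]
  show "locally c (\<lambda>g. hit ?V (Dom C g) (res G g s))"
  proof (rule locally_mono[OF c])
    fix g assume g: "g \<in> Arr C" "Cod C g = c" and "hit W (Dom C g) (res F g (act h c s))"
    then obtain f v where f: "f \<in> W" and v: "v \<in> el (Dom E f) (Dom C g)"
      "act f (Dom C g) v = res F g (act h c s)"
      unfolding hit_def by blast
    note fD = E.cover_arr[OF W f]
    have fH: "f \<in> Hom E (Dom E f) F" using fD by (simp add: Hom_def)
    obtain P p q where p: "p \<in> Hom E P G" and q: "q \<in> Hom E P (Dom E f)"
      and hpq: "h \<cdot> p = f \<cdot> q"
      and ex: "\<And>c s t. c \<in> Obj C \<Longrightarrow> s \<in> el G c \<Longrightarrow> t \<in> el (Dom E f) c \<Longrightarrow> act h c s = act f c t \<Longrightarrow>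
        \<exists>w \<in> el P c. act p c w = s \<and> act q c w = t"
      by (rule fibre_product[OF h h fH fH]) blast
    note hD = HomD[OF h] and pD = HomD[OF p]
    have "p \<in> ?V" using pD q f hpq by auto
    moreover have "\<exists>w \<in> el P (Dom C g). act p (Dom C g) w = res G g s"
      using ex[of "Dom C g" "res G g s" v] v act_res[of h g s] hD g s res_in[OF G, of g s] by auto
    ultimately show "hit ?V (Dom C g) (res G g s)" unfolding hit_def using pD by auto
  qed
qed simp_all

text \<open>
  The value of the glued arrow at a section \<open>s\<close> is itself obtained by gluing: \<open>s\<close> is hit by the family on a
  covering sieve, and there the value is prescribed by the arrows \<open>k f\<close>.  Two preimages of the same
  section give the same value by compatibility on fibre products.
\<close>

lemma cover_glue:
  assumes W: "cover E F W" and F: "F \<in> Obj E" and Z: "Z \<in> Obj E"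
    and k: "\<And>f. f \<in> W \<Longrightarrow> k f \<in> Hom E (Dom E f) Z"
    and compat: "\<And>f f' R a b. \<lbrakk>f \<in> W; f' \<in> W; a \<in> Hom E R (Dom E f); b \<in> Hom E R (Dom E f');
        f \<cdot> a = f' \<cdot> b\<rbrakk> \<Longrightarrow> k f \<cdot> a = k f' \<cdot> b"
  shows "\<exists>h \<in> Hom E F Z. \<forall>f \<in> W. h \<cdot> f = k f"
proof -
  note WD = E.cover_arr[OF W]
  have kD: "k f \<in> Arr E" "Dom E (k f) = Dom E f" "Cod E (k f) = Z" if "f \<in> W" for f
    using k[OF that] by (simp_all add: Hom_def)
  have val: "act (k f) c v = act (k f') c v'"
    if f: "f \<in> W" "f' \<in> W" and c: "c \<in> Obj C" and v: "v \<in> el (Dom E f) c" "v' \<in> el (Dom E f') c"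
      and eq: "act f c v = act f' c v'" for f f' c v v'
  proof -
    have fH: "f \<in> Hom E (Dom E f) F" "f' \<in> Hom E (Dom E f') F"
      using WD[OF f(1)] WD[OF f(2)] by (simp_all add: Hom_def)
    obtain P p q where p: "p \<in> Hom E P (Dom E f)" and q: "q \<in> Hom E P (Dom E f')"
      and fpq: "f \<cdot> p = f' \<cdot> q"
      and ex: "\<And>c s t. c \<in> Obj C \<Longrightarrow> s \<in> el (Dom E f) c \<Longrightarrow> t \<in> el (Dom E f') c \<Longrightarrow> act f c s = act f' c t \<Longrightarrow>
        \<exists>w \<in> el P c. act p c w = s \<and> act q c w = t"
      by (rule fibre_product[OF fH(1) fH(1) fH(2) fH(2)]) blast
    note pD = HomD[OF p] and qD = HomD[OF q]
    have kpq: "k f \<cdot> p = k f' \<cdot> q" by (rule compat[OF f p q fpq])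
    obtain w where w: "w \<in> el P c" "act p c w = v" "act q c w = v'" using ex[OF c v eq] by blast
    have "act (k f) c v = act (k f \<cdot> p) c w"
      using act_comp[of p "k f" c w] pD kD[OF f(1)] c w by simp
    also have "\<dots> = act (k f') c v'"
      unfolding kpq using act_comp[of q "k f'" c w] qD kD[OF f(2)] c w by simp
    finally show ?thesis .
  qed
  \<comment> \<open>\<open>t\<close> is a possible value at \<open>s\<close>: it restricts to the value prescribed at each preimage of a restriction
      of \<open>s\<close>\<close>
  define good where "good c s t \<longleftrightarrow> t \<in> el Z c \<and> (\<forall>g \<in> Arr C. Cod C g = c \<longrightarrow> (\<forall>f \<in> W. \<forall>v \<in> el (Dom E f) (Dom C
      g).
    act f (Dom C g) v = res F g s \<longrightarrow> res Z g t = act (k f) (Dom C g) v))" for c s t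
  have goodD: "res Z g t = act (k f) (Dom C g) v"
    if "good c s t" "g \<in> Arr C" "Cod C g = c" "f \<in> W" "v \<in> el (Dom E f) (Dom C g)"
      "act f (Dom C g) v = res F g s" for c s t g f v
    using that unfolding good_def by blast
  have uniq: "t = t'" if c: "c \<in> Obj C" and s: "s \<in> el F c" and t: "good c s t" "good c s t'" for c s t t'
  proof (rule sheaf_separated[OF sheaf[OF Z] c])
    show "t \<in> el Z c" "t' \<in> el Z c" using t unfolding good_def by simp_all
    show "locally c (\<lambda>g. res Z g t = res Z g t')"
    proof (rule locally_mono[OF c cover_hit[OF W F c s]])
      fix g assume g: "g \<in> Arr C" "Cod C g = c" and "hit W (Dom C g) (res F g s)"
      then obtain f v where "f \<in> W" "v \<in> el (Dom E f) (Dom C g)" "act f (Dom C g) v = res F g s"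
        unfolding hit_def by blast
      then show "res Z g t = res Z g t'" using goodD[OF t(1) g] goodD[OF t(2) g] by metis
    qed
  qed
  have ex: "\<exists>t. good c s t" if c: "c \<in> Obj C" and s: "s \<in> el F c" for c s
  proof -
    define S where "S = {g \<in> Arr C. Cod C g = c \<and> hit W (Dom C g) (res F g s)}"
    have hitS: "hit W (Dom C (g \<cdot>\<^bsub>C\<^esub> l)) (res F (g \<cdot>\<^bsub>C\<^esub> l) s)"
      if "g \<in> S" "l \<in> Arr C" "Cod C l = Dom C g" for g l
      using that hit_res[of W l "res F g s" F] WD s res_comp[OF F, of g l s] unfolding S_def by simp
    have sieve: "sieve C c S"
      unfolding sieve_def
    proof (intro conjI ballI impI)
      show "S \<subseteq> {f \<in> Arr C. Cod C f = c}" unfolding S_def by blast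
      fix g l assume g: "g \<in> S" "l \<in> Arr C" "Cod C l = Dom C g"
      then show "g \<cdot>\<^bsub>C\<^esub> l \<in> S" using hitS[OF g] unfolding S_def by simp
    qed
    obtain S' where S': "S' \<in> J c" "\<forall>g \<in> S'. hit W (Dom C g) (res F g s)"
      using cover_hit[OF W F c s] unfolding locally_def by blast
    have "S' \<subseteq> S" using S'(2) sieve_arr(1,2)[OF c S'(1)] unfolding S_def by auto
    then have SJ: "S \<in> J c" by (rule J_superset[OF c S'(1) sieve])
    have "\<forall>g \<in> S. \<exists>u. \<exists>f \<in> W. \<exists>v \<in> el (Dom E f) (Dom C g). act f (Dom C g) v = res F g s \<and> u = act (k f)
        (Dom C g) v"
      unfolding S_def hit_def by blast
    then obtain m where m: "\<forall>g \<in> S. \<exists>f \<in> W. \<exists>v \<in> el (Dom E f) (Dom C g).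
        act f (Dom C g) v = res F g s \<and> m g = act (k f) (Dom C g) v" by metis
    have mval: "m g = act (k f) (Dom C g) v"
      if "g \<in> S" "f \<in> W" "v \<in> el (Dom E f) (Dom C g)" "act f (Dom C g) v = res F g s" for g f v
    proof -
      have gO: "Dom C g \<in> Obj C" using that(1) unfolding S_def by simp
      show ?thesis using m that val[OF _ _ gO] by metis
    qed
    have "matching_family C (el Z, res Z) S m"
      unfolding matching_family_def
    proof (intro conjI ballI impI)
      fix g assume g: "g \<in> S"
      then obtain f v where f: "f \<in> W" and v: "v \<in> el (Dom E f) (Dom C g)"
        "act f (Dom C g) v = res F g s" "m g = act (k f) (Dom C g) v" using m by blast
      have gA: "g \<in> Arr C" "Cod C g = c" using g unfolding S_def by simp_all
      show "m g \<in> fst (el Z, res Z) (Dom C g)"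
        using act_in[of "k f" "Dom C g" v] kD[OF f] v gA by simp
      fix l assume l: "l \<in> Arr C" "Cod C l = Dom C g"
      have gl: "g \<cdot>\<^bsub>C\<^esub> l \<in> S" using sieve g l unfolding sieve_def by blast
      have "act f (Dom C l) (res (Dom E f) l v) = res F (g \<cdot>\<^bsub>C\<^esub> l) s"
        using act_res[of f l v] WD[OF f] v l gA s res_comp[OF F, of g l s] by simp
      moreover have "res (Dom E f) l v \<in> el (Dom E f) (Dom C l)"
        using res_in[of "Dom E f" l v] WD[OF f] l v by simp
      ultimately have "m (g \<cdot>\<^bsub>C\<^esub> l) = act (k f) (Dom C l) (res (Dom E f) l v)"
        using mval[OF gl f, of "res (Dom E f) l v"] l gA by simp
      then show "m (g \<cdot>\<^bsub>C\<^esub> l) = snd (el Z, res Z) l (m g)"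
        using act_res[of "k f" l v] kD[OF f] v l by simp
    qed
    then obtain t where t: "t \<in> el Z c" "\<forall>g \<in> S. res Z g t = m g"
      using sheaf[OF Z] c SJ unfolding sheaf_on_def by blast
    have "good c s t"
      unfolding good_def
    proof (intro conjI ballI impI)
      fix g f v assume g: "g \<in> Arr C" "Cod C g = c" and f: "f \<in> W" and v: "v \<in> el (Dom E f) (Dom C g)"
        "act f (Dom C g) v = res F g s"
      have "g \<in> S" unfolding S_def hit_def using g f v by blast
      then show "res Z g t = act (k f) (Dom C g) v" using t mval[OF _ f v] by simp
    qed (rule t(1))
    then show ?thesis ..
  qed
  define \<theta> where "\<theta> c s = (SOME t. good c s t)" for c s
  have \<theta>: "good c s (\<theta> c s)" if "c \<in> Obj C" "s \<in> el F c" for c s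
    unfolding \<theta>_def using ex[OF that] by (rule someI_ex)
  have \<theta>Z: "\<theta> c s \<in> el Z c" if "c \<in> Obj C" "s \<in> el F c" for c s
    using \<theta>[OF that] unfolding good_def by simp
  have "\<theta> (Dom C g) (res F g s) = res Z g (\<theta> (Cod C g) s)" if g: "g \<in> Arr C" and s: "s \<in> el F (Cod C g)" for
      g s
  proof (rule uniq[of "Dom C g" "res F g s"])
    show "Dom C g \<in> Obj C" "res F g s \<in> el F (Dom C g)" using g res_in[OF F g s] by simp_all
    then show "good (Dom C g) (res F g s) (\<theta> (Dom C g) (res F g s))" by (rule \<theta>)
    have c: "Cod C g \<in> Obj C" using g by simp
    show "good (Dom C g) (res F g s) (res Z g (\<theta> (Cod C g) s))"
      unfolding good_def
    proof (intro conjI ballI impI)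
      show "res Z g (\<theta> (Cod C g) s) \<in> el Z (Dom C g)" by (rule res_in[OF Z g \<theta>Z[OF c s]])
      fix l f v assume l: "l \<in> Arr C" "Cod C l = Dom C g" and f: "f \<in> W" and v: "v \<in> el (Dom E f) (Dom C l)"
        "act f (Dom C l) v = res F l (res F g s)"
      have "res Z (g \<cdot>\<^bsub>C\<^esub> l) (\<theta> (Cod C g) s) = act (k f) (Dom C l) v"
        using goodD[OF \<theta>[OF c s], of "g \<cdot>\<^bsub>C\<^esub> l" f v] l f v g s res_comp[OF F, of g l s] by simp
      then show "res Z l (res Z g (\<theta> (Cod C g) s)) = act (k f) (Dom C l) v"
        using res_comp[OF Z, of g l "\<theta> (Cod C g) s"] \<theta>Z[OF c s] g l by simp
    qed
  qed
  then obtain h where h: "h \<in> Hom E F Z" "\<forall>c \<in> Obj C. \<forall>s \<in> el F c. act h c s = \<theta> c s"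
    using full[OF F Z, of \<theta>] \<theta>Z by blast
  note hD = HomD[OF h(1)]
  have "h \<cdot> f = k f" if f: "f \<in> W" for f
  proof (rule faithful[OF _ k[OF f]])
    show "h \<cdot> f \<in> Hom E (Dom E f) Z" using hD WD[OF f] by (simp add: Hom_def)
    fix c v assume c: "c \<in> Obj C" and v: "v \<in> el (Dom E f) c"
    have s: "act f c v \<in> el F c" using act_in[of f c v] WD[OF f] c v by simp
    have kv: "act (k f) c v \<in> el Z c" using act_in[of "k f" c v] kD[OF f] c v by simp
    have "res Z (Idn C c) (\<theta> c (act f c v)) = act (k f) c v"
      using goodD[OF \<theta>[OF c s], of "Idn C c" f v] c f v res_idn[OF F c s] by simp
    then have "\<theta> c (act f c v) = act (k f) c v" using res_idn[OF Z c \<theta>Z[OF c s]] by simp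
    then show "act (h \<cdot> f) c v = act (k f) c v"
      using act_comp[of f h c v] hD WD[OF f] c v h(2) s by simp
  qed
  with h(1) show ?thesis by blast
qed

text \<open>
  One member of the family for each section that is hit suffices, and an object has only a small set of
  sections.
\<close>

lemma small_subcover:
  assumes W: "cover E F W" and F: "F \<in> Obj E"
  shows "\<exists>W' \<subseteq> W. small TYPE('u) W' \<and> cover E F W'"
proof -
  define H where "H = {(c, s) \<in> Sigma (Obj C) (el F). hit W c s}"
  have "\<forall>x \<in> H. \<exists>f \<in> W. \<exists>v \<in> el (Dom E f) (fst x). act f (fst x) v = snd x"
    unfolding H_def hit_def by auto
  then obtain m where m: "\<forall>x \<in> H. m x \<in> W \<and> (\<exists>v \<in> el (Dom E (m x)) (fst x). act (m x) (fst x) v = snd x)"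
    by metis
  have "small TYPE('u) (Sigma (Obj C) (el F))" by (intro small_Sigma[OF inacc] small_obj small_el F)
  moreover have "H \<subseteq> Sigma (Obj C) (el F)" unfolding H_def by blast
  ultimately have "small TYPE('u) (m ` H)" by (intro small_image) (rule small_subset)
  moreover have sub: "m ` H \<subseteq> W" using m by blast
  moreover have "cover E F (m ` H)"
  proof (rule cover_by_hits[OF _ _ F])
    show "f \<in> Arr E" "Cod E f = F" if "f \<in> m ` H" for f using E.cover_arr[OF W] sub that by blast+
    fix c s assume c: "c \<in> Obj C" and s: "s \<in> el F c"
    show "locally c (\<lambda>g. hit (m ` H) (Dom C g) (res F g s))"
    proof (rule locally_mono[OF c cover_hit[OF W F c s]])
      fix g assume g: "g \<in> Arr C" "Cod C g = c" and h: "hit W (Dom C g) (res F g s)"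
      have "(Dom C g, res F g s) \<in> H" unfolding H_def using g h res_in[OF F, of g s] s by simp
      then show "hit (m ` H) (Dom C g) (res F g s)" unfolding hit_def using m by force
    qed
  qed
  ultimately show ?thesis by blast
qed

text \<open>
  The relation \<open>R\<close> is given on arrows into \<open>X\<close>.  It induces a relation on sections of \<open>X\<close>: two sections
  are identified if they are locally the images of one section under two related arrows.  The quotient
  map sends a section to its equivalence class, which is a section of the power object of \<open>X\<close>.  If \<open>a\<close>
  and \<open>b\<close> become equal in the quotient, then they are restrictions of related pairs on a cover, hence
  related because \<open>R\<close> is local.
\<close>

lemma effective_quotient:
  assumes X: "X \<in> Obj E"
    and refl: "\<And>S a. a \<in> Hom E S X \<Longrightarrow> R a a"
    and sym: "\<And>S a b. \<lbrakk>a \<in> Hom E S X; b \<in> Hom E S X; R a b\<rbrakk> \<Longrightarrow> R b a"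
    and trans: "\<And>S a b c. \<lbrakk>a \<in> Hom E S X; b \<in> Hom E S X; c \<in> Hom E S X; R a b; R b c\<rbrakk> \<Longrightarrow> R a c"
    and stable: "\<And>S S' a b g. \<lbrakk>a \<in> Hom E S X; b \<in> Hom E S X; g \<in> Hom E S' S; R a b\<rbrakk> \<Longrightarrow> R (a \<cdot> g) (b \<cdot> g)"
    and loc: "\<And>S a b W. \<lbrakk>a \<in> Hom E S X; b \<in> Hom E S X; cover E S W; \<And>g. g \<in> W \<Longrightarrow> R (a \<cdot> g) (b \<cdot> g)\<rbrakk>
          \<Longrightarrow> R a b"
  shows "\<exists>Z. \<exists>\<chi> \<in> Hom E X Z. \<forall>S. \<forall>a \<in> Hom E S X. \<forall>b \<in> Hom E S X. \<chi> \<cdot> a = \<chi> \<cdot> b \<longleftrightarrow> R a b"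
proof -
  \<comment> \<open>\<open>link\<close> is stable under restriction but not local; \<open>\<rho>\<close> below is its local closure\<close>
  define link where "link c s t \<longleftrightarrow> (\<exists>S. \<exists>a \<in> Hom E S X. \<exists>b \<in> Hom E S X. \<exists>w \<in> el S c.
    R a b \<and> act a c w = s \<and> act b c w = t)" for c s t
  have link_res: "link (Dom C g) (res X g s) (res X g t)" if l: "link (Cod C g) s t" and g: "g \<in> Arr C" for
      g s t
  proof -
    obtain S a b w where a: "a \<in> Hom E S X" and b: "b \<in> Hom E S X" and w: "w \<in> el S (Cod C g)" and
      R: "R a b" and st: "act a (Cod C g) w = s" "act b (Cod C g) w = t"
      using l unfolding link_def by blast
    have S: "S \<in> Obj E" using a unfolding Hom_def by auto
    show ?thesis unfolding link_def
      using act_res[of a g w] act_res[of b g w] HomD[OF a] HomD[OF b] g w st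
      by (intro exI[of _ S] bexI[OF _ a] bexI[OF _ b] bexI[OF _ res_in[OF S g w]]) (use R in simp)
  qed
  have link_refl: "link c s s" if c: "c \<in> Obj C" and s: "s \<in> el X c" for c s
  proof -
    have i: "Idn E X \<in> Hom E X X" using X by (simp add: Hom_def)
    show ?thesis unfolding link_def
      by (intro exI[of _ X] bexI[OF _ i] bexI[OF _ s]) (use refl[OF i] act_idn[OF X c s] in simp)
  qed
  have link_sym: "link c t s" if "link c s t" for c s t
    using that sym unfolding link_def by blast
  have link_trans: "link c s u" if c: "c \<in> Obj C" and st: "link c s t" and tu: "link c t u" for c s t u
  proof -
    obtain S a b w where a: "a \<in> Hom E S X" and b: "b \<in> Hom E S X" and w: "w \<in> el S c" and
      ab: "R a b" and aw: "act a c w = s" "act b c w = t" using st unfolding link_def by blast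
    obtain S' a' b' w' where a': "a' \<in> Hom E S' X" and b': "b' \<in> Hom E S' X" and w': "w' \<in> el S' c" and
      ab': "R a' b'" and aw': "act a' c w' = t" "act b' c w' = u" using tu unfolding link_def by blast
    obtain P p q where p: "p \<in> Hom E P S" and q: "q \<in> Hom E P S'" and eq: "b \<cdot> p = a' \<cdot> q"
      and ex: "\<And>c s t. c \<in> Obj C \<Longrightarrow> s \<in> el S c \<Longrightarrow> t \<in> el S' c \<Longrightarrow> act b c s = act a' c t \<Longrightarrow>
       \<exists>w \<in> el P c. act p c w = s \<and> act q c w = t"
      by (rule fibre_product[OF b b a' a']) blast
    obtain z where z: "z \<in> el P c" "act p c z = w" "act q c z = w'"
      using ex[OF c w w'] aw aw' by metis
    note D = HomD[OF a] HomD[OF b'] HomD[OF p] HomD[OF q] HomD[OF b] HomD[OF a']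
    have ap: "a \<cdot> p \<in> Hom E P X" and bq: "b' \<cdot> q \<in> Hom E P X" and bp: "b \<cdot> p \<in> Hom E P X"
      using D by (simp_all add: Hom_def)
    have "R (a \<cdot> p) (b' \<cdot> q)"
      using trans[OF ap bp bq stable[OF a b p ab]] stable[OF a' b' q ab'] eq by simp
    then show ?thesis unfolding link_def
      using act_comp[of p a c z] act_comp[of q b' c z] D z c aw aw'
      by (intro exI[of _ P] bexI[OF _ ap] bexI[OF _ bq] bexI[OF _ z(1)]) simp
  qed
  define \<rho> where "\<rho> c s t \<longleftrightarrow> locally c (\<lambda>g. link (Dom C g) (res X g s) (res X g t))" for c s t
  have \<rho>_iff: "\<rho> (Dom C g) (res X g s) (res X g t) \<longleftrightarrow>
      locally (Dom C g) (\<lambda>k. link (Dom C (g \<cdot>\<^bsub>C\<^esub> k)) (res X (g \<cdot>\<^bsub>C\<^esub> k) s) (res X (g \<cdot>\<^bsub>C\<^esub> k) t))"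
    if g: "g \<in> Arr C" and st: "s \<in> el X (Cod C g)" "t \<in> el X (Cod C g)" for g s t
    unfolding \<rho>_def
    by (rule iffI; erule locally_mono[rotated]) (use g st in \<open>simp_all add: res_comp[OF X]\<close>)
  have \<rho>_res: "\<rho> (Dom C g) (res X g s) (res X g t)"
    if g: "g \<in> Arr C" and st: "s \<in> el X (Cod C g)" "t \<in> el X (Cod C g)" and l: "\<rho> (Cod C g) s t" for g s t
    unfolding \<rho>_iff[OF g st] using locally_pullback[OF g HOL.refl l[unfolded \<rho>_def]] .
  have \<rho>_loc: "\<rho> c s t" if c: "c \<in> Obj C" and st: "s \<in> el X c" "t \<in> el X c"
    and l: "locally c (\<lambda>g. \<rho> (Dom C g) (res X g s) (res X g t))" for c s t
    unfolding \<rho>_def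
  proof (rule locally_trans[OF c], rule locally_mono[OF c l])
    fix g assume "g \<in> Arr C" "Cod C g = c" "\<rho> (Dom C g) (res X g s) (res X g t)"
    then show "locally (Dom C g) (\<lambda>k. link (Dom C (g \<cdot>\<^bsub>C\<^esub> k)) (res X (g \<cdot>\<^bsub>C\<^esub> k) s) (res X (g \<cdot>\<^bsub>C\<^esub> k) t))"
      using \<rho>_iff st by blast
  qed
  have \<rho>_link: "\<rho> c s t" if c: "c \<in> Obj C" and l: "link c s t" for c s t
    unfolding \<rho>_def by (rule locally_all[OF c]) (use l link_res in blast)
  have \<rho>_sym: "\<rho> c t s" if c: "c \<in> Obj C" and l: "\<rho> c s t" for c s t
    unfolding \<rho>_def by (rule locally_mono[OF c l[unfolded \<rho>_def]]) (rule link_sym)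
  have \<rho>_trans: "\<rho> c s u"
    if c: "c \<in> Obj C" and s: "s \<in> el X c" "t \<in> el X c" "u \<in> el X c" and l: "\<rho> c s t" "\<rho> c t u" for c s t u
    unfolding \<rho>_def
  proof (rule locally_mono[OF c locally_conj[OF c l[unfolded \<rho>_def]]])
    fix g k assume g: "g \<in> Arr C" "Cod C g = c" and k: "k \<in> Arr C" "Cod C k = Dom C g"
      and "link (Dom C g) (res X g s) (res X g t)"
    then show "link (Dom C (g \<cdot>\<^bsub>C\<^esub> k)) (res X (g \<cdot>\<^bsub>C\<^esub> k) s) (res X (g \<cdot>\<^bsub>C\<^esub> k) t)"
      using link_res[of k "res X g s" "res X g t"] s by (simp add: res_comp[OF X])
  next
    fix g assume "g \<in> Arr C" and
      "link (Dom C g) (res X g s) (res X g t) \<and> link (Dom C g) (res X g t) (res X g u)"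
    then show "link (Dom C g) (res X g s) (res X g u)"
      using link_trans[of "Dom C g" "res X g s" "res X g t" "res X g u"] by simp
  qed
  have \<rho>: "local_rel X X \<rho>" by (rule local_relI) (fact \<rho>_res, fact \<rho>_loc)
  obtain Z k where k: "\<And>P. local_rel X X P \<Longrightarrow> k P \<in> Hom E X Z"
    and k_iff: "\<And>P Q c s s'. local_rel X X P \<Longrightarrow> local_rel X X Q \<Longrightarrow> c \<in> Obj C \<Longrightarrow> s \<in> el X c \<Longrightarrow> s' \<in> el X c \<Longrightarrow>
       act (k P) c s = act (k Q) c s' \<longleftrightarrow>
         (\<forall>g \<in> Arr C. Cod C g = c \<longrightarrow> (\<forall>t \<in> el X (Dom C g).
            P (Dom C g) (res X g s) t \<longleftrightarrow> Q (Dom C g) (res X g s') t))"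
    by (rule power_object[OF X X]) blast
  define \<chi> where "\<chi> = k \<rho>"
  have \<chi>: "\<chi> \<in> Hom E X Z" unfolding \<chi>_def by (rule k[OF \<rho>])
  note \<chi>_iff = k_iff[OF \<rho> \<rho>, folded \<chi>_def]
  note \<chi>D = HomD[OF \<chi>]
  have \<chi>_eq: "act \<chi> c s = act \<chi> c t \<longleftrightarrow> \<rho> c s t"
    if c: "c \<in> Obj C" and s: "s \<in> el X c" and t: "t \<in> el X c" for c s t
  proof
    assume "act \<chi> c s = act \<chi> c t"
    then have "\<rho> c (res X (Idn C c) s) t \<longleftrightarrow> \<rho> c (res X (Idn C c) t) t"
      using \<chi>_iff[OF c s t] idn_arr[OF c] t by metis
    then show "\<rho> c s t" using \<rho>_link[OF c link_refl[OF c t]] c s t by (simp add: res_idn[OF X])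
  next
    assume st: "\<rho> c s t"
    have "\<rho> (Dom C g) (res X g s) u \<longleftrightarrow> \<rho> (Dom C g) (res X g t) u"
      if g: "g \<in> Arr C" "Cod C g = c" and u: "u \<in> el X (Dom C g)" for g u
    proof -
      have gO: "Dom C g \<in> Obj C" and sg: "res X g s \<in> el X (Dom C g)" and tg: "res X g t \<in> el X (Dom C g)"
        using g s t res_in[OF X g(1)] by simp_all
      have l: "\<rho> (Dom C g) (res X g s) (res X g t)" using \<rho>_res[OF g(1)] g s t st by simp
      show ?thesis
        using \<rho>_trans[OF gO sg tg u l] \<rho>_trans[OF gO tg sg u \<rho>_sym[OF gO l]] by blast
    qed
    then show "act \<chi> c s = act \<chi> c t" unfolding \<chi>_iff[OF c s t] by blast
  qed
  have "\<chi> \<cdot> a = \<chi> \<cdot> b \<longleftrightarrow> R a b" if a: "a \<in> Hom E S X" and b: "b \<in> Hom E S X" for S a b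
  proof -
    note aD = HomD[OF a] and bD = HomD[OF b]
    have S: "S \<in> Obj E" using E.dom_obj[OF aD(1)] aD(2) by simp
    have in_X: "act a c w \<in> el X c" "act b c w \<in> el X c" if "c \<in> Obj C" "w \<in> el S c" for c w
      using act_in[of a c w] act_in[of b c w] aD bD that by simp_all
    have act_\<chi>: "act (\<chi> \<cdot> a) c w = act \<chi> c (act a c w)" "act (\<chi> \<cdot> b) c w = act \<chi> c (act b c w)"
      if "c \<in> Obj C" "w \<in> el S c" for c w
      using act_comp[of a \<chi> c w] act_comp[of b \<chi> c w] \<chi>D aD bD that by simp_all
    show ?thesis
    proof
      assume R: "R a b"
      show "\<chi> \<cdot> a = \<chi> \<cdot> b"
      proof (rule faithful)
        fix c w assume c: "c \<in> Obj C" and w: "w \<in> el S c"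
        have "link c (act a c w) (act b c w)" unfolding link_def using a b w R by blast
        then show "act (\<chi> \<cdot> a) c w = act (\<chi> \<cdot> b) c w"
          unfolding act_\<chi>[OF c w] using \<chi>_eq[OF c in_X[OF c w]] \<rho>_link[OF c] by blast
      qed (use \<chi>D aD bD in \<open>simp_all add: Hom_def\<close>)
    next
      assume eq: "\<chi> \<cdot> a = \<chi> \<cdot> b"
      define W where "W = {g \<in> Arr E. Cod E g = S \<and> R (a \<cdot> g) (b \<cdot> g)}"
      have "cover E S W"
      proof (rule cover_by_hits[OF _ _ S])
        show "g \<in> Arr E" "Cod E g = S" if "g \<in> W" for g using that unfolding W_def by simp_all
        fix c w assume c: "c \<in> Obj C" and w: "w \<in> el S c"
        have "\<rho> c (act a c w) (act b c w)"
          using \<chi>_eq[OF c in_X[OF c w]] act_\<chi>[OF c w] eq by simp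
        then show "locally c (\<lambda>g. hit W (Dom C g) (res S g w))"
          unfolding \<rho>_def
        proof (rule locally_mono[OF c])
          fix g assume g: "g \<in> Arr C" "Cod C g = c"
            and "link (Dom C g) (res X g (act a c w)) (res X g (act b c w))"
          then obtain S' a' b' w' where a': "a' \<in> Hom E S' X" and b': "b' \<in> Hom E S' X"
            and w': "w' \<in> el S' (Dom C g)" and R: "R a' b'"
            and aw: "act a' (Dom C g) w' = res X g (act a c w)" "act b' (Dom C g) w' = res X g (act b c w)"
            unfolding link_def by blast
          \<comment> \<open>arrows into \<open>S\<close> on which \<open>(a, b)\<close> restricts to a restriction of \<open>(a', b')\<close>\<close>
          obtain P p q where p: "p \<in> Hom E P S" and q: "q \<in> Hom E P S'"
            and eqs: "a \<cdot> p = a' \<cdot> q" "b \<cdot> p = b' \<cdot> q"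
            and ex: "\<And>c s t. c \<in> Obj C \<Longrightarrow> s \<in> el S c \<Longrightarrow> t \<in> el S' c \<Longrightarrow> act a c s = act a' c t \<Longrightarrow>
              act b c s = act b' c t \<Longrightarrow> \<exists>w \<in> el P c. act p c w = s \<and> act q c w = t"
            by (rule fibre_product[OF a b a' b']) blast
          have "p \<in> W" unfolding W_def using HomD[OF p] stable[OF a' b' q R] eqs by simp
          moreover have "\<exists>z \<in> el P (Dom C g). act p (Dom C g) z = res S g w"
            using ex[of "Dom C g" "res S g w" w'] w' aw act_res[of a g w] act_res[of b g w] aD bD g w
              res_in[OF S g(1), of w] by auto
          ultimately show "hit W (Dom C g) (res S g w)" unfolding hit_def using HomD[OF p] by auto
        qed
      qed
      then show "R a b" by (rule loc[OF a b]) (simp add: W_def)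
    qed
  qed
  then show ?thesis using \<chi> by blast
qed

end

section \<open>Epimorphic families in a Grothendieck topos\<close>

text \<open>
  The properties of epimorphic families in a Grothendieck topos on which the rest of the proof rests:
  they are stable under pullback, arrows glue along them, every equivalence relation on arrows that is
  local for them has an effective quotient, and each of them contains a small one.
\<close>

locale covering_category = category E
  for E :: "('o, 'a, 'z) category_scheme" (structure) +
  fixes univ :: "'u itself"
  assumes cover_pullback:
      "\<lbrakk>cover E F W; h \<in> Hom E G F\<rbrakk> \<Longrightarrow>
       cover E G {g \<in> Arr E. Cod E g = G \<and>
         (\<exists>f \<in> W. \<exists>k \<in> Hom E (Dom E g) (Dom E f). h \<cdot> g = f \<cdot> k)}"
    and cover_glue:
      "\<lbrakk>cover E F W; F \<in> Obj E; Z \<in> Obj E; \<And>f. f \<in> W \<Longrightarrow> k f \<in> Hom E (Dom E f) Z;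
        \<And>f f' R a b. \<lbrakk>f \<in> W; f' \<in> W; a \<in> Hom E R (Dom E f); b \<in> Hom E R (Dom E f'); f \<cdot> a = f' \<cdot> b\<rbrakk>
          \<Longrightarrow> k f \<cdot> a = k f' \<cdot> b\<rbrakk> \<Longrightarrow>
       \<exists>h \<in> Hom E F Z. \<forall>f \<in> W. h \<cdot> f = k f"
    and effective_quotient:
      "\<lbrakk>X \<in> Obj E;
        \<And>S a. a \<in> Hom E S X \<Longrightarrow> R a a;
        \<And>S a b. \<lbrakk>a \<in> Hom E S X; b \<in> Hom E S X; R a b\<rbrakk> \<Longrightarrow> R b a;
        \<And>S a b c. \<lbrakk>a \<in> Hom E S X; b \<in> Hom E S X; c \<in> Hom E S X; R a b; R b c\<rbrakk> \<Longrightarrow> R a c;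
        \<And>S S' a b g. \<lbrakk>a \<in> Hom E S X; b \<in> Hom E S X; g \<in> Hom E S' S; R a b\<rbrakk> \<Longrightarrow> R (a \<cdot> g) (b \<cdot> g);
        \<And>S a b W. \<lbrakk>a \<in> Hom E S X; b \<in> Hom E S X; cover E S W; \<And>g. g \<in> W \<Longrightarrow> R (a \<cdot> g) (b \<cdot> g)\<rbrakk>
          \<Longrightarrow> R a b\<rbrakk> \<Longrightarrow>
       \<exists>Z. \<exists>\<chi> \<in> Hom E X Z. \<forall>S. \<forall>a \<in> Hom E S X. \<forall>b \<in> Hom E S X. \<chi> \<cdot> a = \<chi> \<cdot> b \<longleftrightarrow> R a b"
    and small_subcover:
      "cover E F W \<Longrightarrow> F \<in> Obj E \<Longrightarrow> \<exists>W' \<subseteq> W. small univ W' \<and> cover E F W'"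

text \<open>
  Through an equivalence with a category of sheaves, every object acquires a sheaf of sections.  That
  the equivalence is faithful and full follows from its unit and counit in the usual way.
\<close>

theorem grothendieck_topos_covering:
  fixes E :: "('o, 'a, 'z) category_scheme"
  assumes inacc: "inaccessible TYPE('u)" and topos: "grothendieck_topos TYPE('u) E"
  shows "covering_category E TYPE('u)"
proof -
  obtain C :: "('u, 'u) category" and J where E: "category E" and C: "category C"
    and small: "small TYPE('u) (Obj C)" "small TYPE('u) (Arr C)" and J: "grothendieck_topology C J"
    and equiv: "equivalent_categories E (sheaf_category C J :: (('u, 'u, 'u) presheaf, _) category)"
    using topos unfolding grothendieck_topos_def by blast
  let ?Sh = "sheaf_category C J :: (('u, 'u, 'u) presheaf, _) category"
  interpret E: category E by (rule E)
  interpret C: site C J by (intro site.intro C site_axioms.intro J)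
  obtain FO FA GO GA \<eta> \<epsilon> where F: "is_functor E ?Sh FO FA" and G: "is_functor ?Sh E GO GA"
    and \<eta>: "is_nat_iso E E (GO \<circ> FO) (GA \<circ> FA) id id \<eta>"
    and \<epsilon>: "is_nat_iso ?Sh ?Sh (FO \<circ> GO) (FA \<circ> GA) id id \<epsilon>"
    using equiv unfolding equivalent_categories_def by blast
  interpret Sh: category ?Sh using F unfolding is_functor_def by blast
  have FO: "FO X \<in> Obj ?Sh" and F_idn: "FA (Idn E X) = Idn ?Sh (FO X)" if "X \<in> Obj E" for X
    using F that unfolding is_functor_def by simp_all
  have FA: "FA f \<in> Arr ?Sh" "Dom ?Sh (FA f) = FO (Dom E f)" "Cod ?Sh (FA f) = FO (Cod E f)" if "f \<in> Arr E"
      for f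
    using F that unfolding is_functor_def Hom_def by simp_all
  have F_comp: "FA (g \<cdot>\<^bsub>E\<^esub> f) = FA g \<cdot>\<^bsub>?Sh\<^esub> FA f" if "f \<in> Arr E" "g \<in> Arr E" "Dom E g = Cod E f" for f g
    using F that unfolding is_functor_def by simp
  have GO: "GO P \<in> Obj E" if "P \<in> Obj ?Sh" for P
    using G that unfolding is_functor_def by simp
  have GA: "GA f \<in> Arr E" "Dom E (GA f) = GO (Dom ?Sh f)" "Cod E (GA f) = GO (Cod ?Sh f)" if "f \<in> Arr ?Sh"
      for f
    using G that unfolding is_functor_def Hom_def by simp_all
  have G_comp: "GA (g \<cdot>\<^bsub>?Sh\<^esub> f) = GA g \<cdot>\<^bsub>E\<^esub> GA f" if "f \<in> Arr ?Sh" "g \<in> Arr ?Sh" "Dom ?Sh g = Cod ?Sh f" for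
      f g
    using G that unfolding is_functor_def by simp
  have \<eta>1: "\<eta> X \<in> Arr E" "Dom E (\<eta> X) = GO (FO X)" "Cod E (\<eta> X) = X" "\<exists>k. inverse_pair E (\<eta> X) k" if "X \<in>
      Obj E" for X
    using \<eta> that unfolding is_nat_iso_def Hom_def is_iso_def by simp_all
  have \<eta>2: "f \<cdot>\<^bsub>E\<^esub> \<eta> (Dom E f) = \<eta> (Cod E f) \<cdot>\<^bsub>E\<^esub> GA (FA f)" if "f \<in> Arr E" for f
    using \<eta> that unfolding is_nat_iso_def by simp
  have \<epsilon>1: "\<epsilon> P \<in> Arr ?Sh" "Dom ?Sh (\<epsilon> P) = FO (GO P)" "Cod ?Sh (\<epsilon> P) = P" "\<exists>k. inverse_pair ?Sh (\<epsilon> P) k" if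
      "P \<in> Obj ?Sh" for P
    using \<epsilon> that unfolding is_nat_iso_def Hom_def is_iso_def by simp_all
  have \<epsilon>2: "f \<cdot>\<^bsub>?Sh\<^esub> \<epsilon> (Dom ?Sh f) = \<epsilon> (Cod ?Sh f) \<cdot>\<^bsub>?Sh\<^esub> FA (GA f)" if "f \<in> Arr ?Sh" for f
    using \<epsilon> that unfolding is_nat_iso_def by simp
  have F_faithful: "f = g" if f: "f \<in> Hom E X Y" and g: "g \<in> Hom E X Y" and eq: "FA f = FA g" for f g X Y
  proof -
    note fD = HomD[OF f] and gD = HomD[OF g]
    have X: "X \<in> Obj E" using E.dom_obj[OF fD(1)] fD by simp
    obtain k where k: "inverse_pair E (\<eta> X) k" using \<eta>1(4)[OF X] by blast
    have kD: "k \<in> Arr E" "Dom E k = X" "Cod E k = GO (FO X)" "\<eta> X \<cdot>\<^bsub>E\<^esub> k = Idn E X"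
      using k \<eta>1[OF X] unfolding inverse_pair_def Hom_def by simp_all
    have "(f \<cdot>\<^bsub>E\<^esub> \<eta> X) \<cdot>\<^bsub>E\<^esub> k = (g \<cdot>\<^bsub>E\<^esub> \<eta> X) \<cdot>\<^bsub>E\<^esub> k"
      using \<eta>2[OF fD(1)] \<eta>2[OF gD(1)] fD gD eq by simp
    then show ?thesis using kD fD gD \<eta>1[OF X] by simp
  qed
  have G_faithful: "f = g" if f: "f \<in> Hom ?Sh P Q" and g: "g \<in> Hom ?Sh P Q" and eq: "GA f = GA g" for f g P Q
  proof -
    note fD = HomD[OF f] and gD = HomD[OF g]
    have P: "P \<in> Obj ?Sh" using Sh.dom_obj[OF fD(1)] fD by simp
    obtain k where k: "inverse_pair ?Sh (\<epsilon> P) k" using \<epsilon>1(4)[OF P] by blast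
    have kD: "k \<in> Arr ?Sh" "Dom ?Sh k = P" "Cod ?Sh k = FO (GO P)" "\<epsilon> P \<cdot>\<^bsub>?Sh\<^esub> k = Idn ?Sh P"
      using k \<epsilon>1[OF P] unfolding inverse_pair_def Hom_def by simp_all
    have "(f \<cdot>\<^bsub>?Sh\<^esub> \<epsilon> P) \<cdot>\<^bsub>?Sh\<^esub> k = (g \<cdot>\<^bsub>?Sh\<^esub> \<epsilon> P) \<cdot>\<^bsub>?Sh\<^esub> k"
      using \<epsilon>2[OF fD(1)] \<epsilon>2[OF gD(1)] fD gD eq by simp
    then show ?thesis using kD fD gD \<epsilon>1[OF P] by simp
  qed
  \<comment> \<open>the preimage of \<open>t\<close> is its image under the quasi-inverse, conjugated with \<open>\<eta>\<close>\<close>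
  have F_full: "\<exists>f \<in> Hom E X Y. FA f = t" if X: "X \<in> Obj E" and Y: "Y \<in> Obj E" and t: "t \<in> Hom ?Sh (FO X)
      (FO Y)" for X Y t
  proof -
    note tD = HomD[OF t]
    obtain k where k: "inverse_pair E (\<eta> X) k" using \<eta>1(4)[OF X] by blast
    have kD: "k \<in> Arr E" "Dom E k = X" "Cod E k = GO (FO X)" "k \<cdot>\<^bsub>E\<^esub> \<eta> X = Idn E (GO (FO X))"
      using k \<eta>1[OF X] unfolding inverse_pair_def Hom_def by simp_all
    obtain l where l: "inverse_pair E (\<eta> Y) l" using \<eta>1(4)[OF Y] by blast
    have lD: "l \<in> Arr E" "Dom E l = Y" "Cod E l = GO (FO Y)" "l \<cdot>\<^bsub>E\<^esub> \<eta> Y = Idn E (GO (FO Y))"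
      using l \<eta>1[OF Y] unfolding inverse_pair_def Hom_def by simp_all
    define f where "f = \<eta> Y \<cdot>\<^bsub>E\<^esub> (GA t \<cdot>\<^bsub>E\<^esub> k)"
    have fD: "f \<in> Arr E" "Dom E f = X" "Cod E f = Y"
      unfolding f_def using kD GA[OF tD(1)] tD \<eta>1[OF Y] by simp_all
    have "\<eta> Y \<cdot>\<^bsub>E\<^esub> GA (FA f) = f \<cdot>\<^bsub>E\<^esub> \<eta> X" using \<eta>2[OF fD(1)] fD by simp
    also have "\<dots> = \<eta> Y \<cdot>\<^bsub>E\<^esub> GA t" unfolding f_def using kD GA[OF tD(1)] tD \<eta>1[OF Y] \<eta>1[OF X] GO FO X by simp
    finally have eq: "\<eta> Y \<cdot>\<^bsub>E\<^esub> GA (FA f) = \<eta> Y \<cdot>\<^bsub>E\<^esub> GA t" .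
    have "GA (FA f) = GA t"
      by (rule E.section_cancel[OF \<eta>1(1)[OF Y] lD(1) _ _ _ _ _ _ eq])
        (use lD GA[OF tD(1)] GA[OF FA(1)[OF fD(1)]] FA[OF fD(1)] fD tD \<eta>1[OF Y] in simp_all)
    then have "FA f = t"
      by (rule G_faithful[OF _ t, rotated]) (use FA[OF fD(1)] fD in \<open>simp add: Hom_def\<close>)
    then show ?thesis using fD by (auto simp: Hom_def)
  qed
  have Sh_obj: "P \<in> Obj ?Sh \<longleftrightarrow> is_sheaf C J P" for P unfolding sheaf_category_def by simp
  define act where "act f = fst (snd (FA f))" for f
  have FA_eq: "FA f = (FO (Dom E f), act f, FO (Cod E f))" if "f \<in> Arr E" for f
    using FA[OF that] unfolding act_def sheaf_category_def by (auto simp: case_prod_beta prod_eq_iff)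
  have actD: "act f \<in> (\<Pi>\<^sub>E c \<in> Obj C. fst (FO (Dom E f)) c \<rightarrow>\<^sub>E fst (FO (Cod E f)) c)"
    "\<forall>g \<in> Arr C. \<forall>s \<in> fst (FO (Dom E f)) (Cod C g).
       act f (Dom C g) (snd (FO (Dom E f)) g s) = snd (FO (Cod E f)) g (act f (Cod C g) s)" if "f \<in> Arr E"
           for f
    using FA(1)[OF that] unfolding FA_eq[OF that] sheaf_category_def by simp_all
  have act_in: "act f c s \<in> fst (FO (Cod E f)) c" if "f \<in> Arr E" "c \<in> Obj C" "s \<in> fst (FO (Dom E f)) c" for
      f c s
    using actD(1)[OF that(1)] that by (auto simp: PiE_iff)
  have "sheaf_model E C J (\<lambda>X. fst (FO X)) (\<lambda>X. snd (FO X)) act"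
  proof (unfold_locales)
    show "inaccessible TYPE('u)" "small TYPE('u) (Obj C)" "small TYPE('u) (Arr C)" by fact+
    show "sheaf_on C J (fst (FO X)) (snd (FO X))" if "X \<in> Obj E" for X
      using FO[OF that] unfolding Sh_obj is_sheaf_iff by simp
    show "small TYPE('u) (fst (FO X) c)" if "X \<in> Obj E" "c \<in> Obj C" for X c
      using FO[OF that(1)] that(2) unfolding Sh_obj is_sheaf_iff by simp
    show "act f c s \<in> fst (FO (Cod E f)) c" if "f \<in> Arr E" "c \<in> Obj C" "s \<in> fst (FO (Dom E f)) c" for f c s
      using act_in[OF that] .
    show "act f (Dom C g) (snd (FO (Dom E f)) g s) = snd (FO (Cod E f)) g (act f (Cod C g) s)"
      if "f \<in> Arr E" "g \<in> Arr C" "s \<in> fst (FO (Dom E f)) (Cod C g)" for f g s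
      using actD(2)[OF that(1)] that by blast
    show "act (f' \<cdot>\<^bsub>E\<^esub> f) c s = act f' c (act f c s)"
      if "f \<in> Arr E" "f' \<in> Arr E" "Cod E f = Dom E f'" "c \<in> Obj C" "s \<in> fst (FO (Dom E f)) c" for f f' c s
      using F_comp[of f f'] FA_eq[of f] FA_eq[of f'] FA_eq[of "f' \<cdot>\<^bsub>E\<^esub> f"] that
      by (simp add: sheaf_category_def compose_def)
    show "act (Idn E X) c s = s" if "X \<in> Obj E" "c \<in> Obj C" "s \<in> fst (FO X) c" for X c s
      using F_idn[of X] FA_eq[of "Idn E X"] that by (simp add: sheaf_category_def)
    show "f = f'" if f: "f \<in> Hom E X Y" and f': "f' \<in> Hom E X Y"
      and eq: "\<And>c s. c \<in> Obj C \<Longrightarrow> s \<in> fst (FO X) c \<Longrightarrow> act f c s = act f' c s" for f f' X Y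
    proof (rule F_faithful[OF f f'])
      note fD = HomD[OF f] and f'D = HomD[OF f']
      have "act f = act f'"
      proof (rule PiE_ext[OF actD(1)[OF fD(1)]])
        show "act f' \<in> (\<Pi>\<^sub>E c \<in> Obj C. fst (FO (Dom E f)) c \<rightarrow>\<^sub>E fst (FO (Cod E f)) c)"
          using actD(1)[OF f'D(1)] fD f'D by simp
        fix c assume c: "c \<in> Obj C"
        show "act f c = act f' c"
        proof (rule PiE_ext)
          show "act f c \<in> fst (FO X) c \<rightarrow>\<^sub>E fst (FO Y) c" "act f' c \<in> fst (FO X) c \<rightarrow>\<^sub>E fst (FO Y) c"
            using actD(1)[OF fD(1)] actD(1)[OF f'D(1)] fD f'D c by (auto simp: PiE_iff)
        qed (use eq c in blast)
      qed
      then show "FA f = FA f'" using FA_eq fD f'D by simp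
    qed
    show "\<exists>f \<in> Hom E X Y. \<forall>c \<in> Obj C. \<forall>s \<in> fst (FO X) c. act f c s = \<theta> c s"
      if X: "X \<in> Obj E" and Y: "Y \<in> Obj E" and \<theta>: "\<And>c s. c \<in> Obj C \<Longrightarrow> s \<in> fst (FO X) c \<Longrightarrow> \<theta> c s \<in> fst (FO Y) c"
      and nat: "\<And>g s. g \<in> Arr C \<Longrightarrow> s \<in> fst (FO X) (Cod C g) \<Longrightarrow>
        \<theta> (Dom C g) (snd (FO X) g s) = snd (FO Y) g (\<theta> (Cod C g) s)" for X Y \<theta>
    proof -
      have shX: "sheaf_on C J (fst (FO X)) (snd (FO X))" using FO[OF X] unfolding Sh_obj is_sheaf_iff by simp
      define \<theta>' where "\<theta>' = (\<lambda>c \<in> Obj C. \<lambda>s \<in> fst (FO X) c. \<theta> c s)"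
      have 1: "\<theta>' \<in> (\<Pi>\<^sub>E c \<in> Obj C. fst (FO X) c \<rightarrow>\<^sub>E fst (FO Y) c)" unfolding \<theta>'_def using \<theta> by auto
      have 2: "\<theta>' (Dom C g) (snd (FO X) g s) = snd (FO Y) g (\<theta>' (Cod C g) s)"
        if "g \<in> Arr C" "s \<in> fst (FO X) (Cod C g)" for g s
        using that nat shX unfolding \<theta>'_def sheaf_on_def presheaf_on_def by simp
      have "(FO X, \<theta>', FO Y) \<in> Hom ?Sh (FO X) (FO Y)"
        using FO[OF X] FO[OF Y] 1 2 unfolding Sh_obj Hom_def sheaf_category_def by simp
      then obtain f where f: "f \<in> Hom E X Y" "FA f = (FO X, \<theta>', FO Y)" using F_full[OF X Y] by blast
      then have "act f = \<theta>'" unfolding act_def by simp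
      then show ?thesis by (intro bexI[OF _ f(1)]) (simp add: \<theta>'_def)
    qed
    show "\<exists>X \<in> Obj E. \<exists>b. (\<forall>c \<in> Obj C. bij_betw (b c) (fst (FO X) c) (V c)) \<and>
        (\<forall>g \<in> Arr C. \<forall>s \<in> fst (FO X) (Cod C g). b (Dom C g) (snd (FO X) g s) = q g (b (Cod C g) s))"
      if V: "sheaf_on C J V q" and small: "\<And>c. c \<in> Obj C \<Longrightarrow> small TYPE('u) (V c)" for V :: "'u \<Rightarrow> 'u set" and q
    proof -
      have P: "(V, q) \<in> Obj ?Sh" unfolding Sh_obj is_sheaf_iff using V small by simp
      obtain k where k: "inverse_pair ?Sh (\<epsilon> (V, q)) k" using \<epsilon>1(4)[OF P] by blast
      let ?b = "fst (snd (\<epsilon> (V, q)))" and ?i = "fst (snd k)" and ?X = "GO (V, q)"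
      have \<epsilon>_eq: "\<epsilon> (V, q) = (FO ?X, ?b, (V, q))"
        using \<epsilon>1(2,3)[OF P] unfolding sheaf_category_def by (auto simp: case_prod_beta prod_eq_iff)
      have kA: "k \<in> Arr ?Sh" "Dom ?Sh k = (V, q)" "Cod ?Sh k = FO ?X"
        and inv: "k \<cdot>\<^bsub>?Sh\<^esub> \<epsilon> (V, q) = Idn ?Sh (FO ?X)" "\<epsilon> (V, q) \<cdot>\<^bsub>?Sh\<^esub> k = Idn ?Sh (V, q)"
        using k \<epsilon>1[OF P] unfolding inverse_pair_def Hom_def by simp_all
      have k_eq: "k = ((V, q), ?i, FO ?X)"
        using kA(2,3) unfolding sheaf_category_def by (auto simp: case_prod_beta prod_eq_iff)
      have b: "?b \<in> (\<Pi>\<^sub>E c \<in> Obj C. fst (FO ?X) c \<rightarrow>\<^sub>E V c)"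
        "\<forall>g \<in> Arr C. \<forall>s \<in> fst (FO ?X) (Cod C g). ?b (Dom C g) (snd (FO ?X) g s) = q g (?b (Cod C g) s)"
        using \<epsilon>1(1)[OF P] by (subst (asm) \<epsilon>_eq, simp add: sheaf_category_def)+
      have i: "?i \<in> (\<Pi>\<^sub>E c \<in> Obj C. V c \<rightarrow>\<^sub>E fst (FO ?X) c)"
        using kA(1) by (subst (asm) k_eq, simp add: sheaf_category_def)
      have e1: "(\<lambda>c \<in> Obj C. compose (fst (FO ?X) c) (?i c) (?b c)) = (\<lambda>c \<in> Obj C. \<lambda>s \<in> fst (FO ?X) c. s)"
        using inv(1) by (subst (asm) (1) \<epsilon>_eq, subst (asm) (1) k_eq, simp add: sheaf_category_def)
      have ib: "?i c (?b c s) = s" if "c \<in> Obj C" "s \<in> fst (FO ?X) c" for c s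
        using fun_cong[OF fun_cong[OF e1, of c], of s] that by (simp add: compose_def)
      have e2: "(\<lambda>c \<in> Obj C. compose (V c) (?b c) (?i c)) = (\<lambda>c \<in> Obj C. \<lambda>s \<in> V c. s)"
        using inv(2) by (subst (asm) (1) \<epsilon>_eq, subst (asm) (1) k_eq, simp add: sheaf_category_def)
      have bi: "?b c (?i c s) = s" if "c \<in> Obj C" "s \<in> V c" for c s
        using fun_cong[OF fun_cong[OF e2, of c], of s] that by (simp add: compose_def)
      have "bij_betw (?b c) (fst (FO ?X) c) (V c)" if c: "c \<in> Obj C" for c
      proof (rule bij_betw_byWitness[where f' = "?i c"])
        show "?b c ` fst (FO ?X) c \<subseteq> V c" "?i c ` V c \<subseteq> fst (FO ?X) c"
          using b(1) i c by (auto simp: PiE_iff)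
      qed (use ib bi c in auto)
      then show ?thesis using GO[OF P] b(2) by blast
    qed
  qed
  then interpret sheaf_model E C J "\<lambda>X. fst (FO X)" "\<lambda>X. snd (FO X)" act .
  show ?thesis
  proof (unfold_locales, goal_cases)
    case 1
    then show ?case by (rule cover_pullback)
  next
    case 2
    then show ?case by (rule cover_glue)
  next
    case 3
    then show ?case by (rule effective_quotient)
  next
    case 4
    then show ?case by (rule small_subcover)
  qed
qed

section \<open>Chosen limits and slices\<close>

text \<open>
  Rewriting with an equation between composites inside a longer composite that is associated to the
  right.
\<close>

lemma (in category) comp_eq:
  assumes "h \<cdot> g = m" "f \<in> Arr C" "g \<in> Arr C" "h \<in> Arr C" "Cod C f = Dom C g" "Cod C g = Dom C h"
  shows "h \<cdot> (g \<cdot> f) = m \<cdot> f"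
  using assoc[OF assms(2-6)] assms(1) by simp

locale lex_cat = category C
  for C :: "('o, 'a, 'z) lex_category_scheme" (structure) +
  assumes limits: "chosen_finite_limits C"
begin

lemma One_obj [simp]: "One C \<in> Obj C"
  using limits unfolding chosen_finite_limits_def is_terminal_def by simp

lemma bang_ex1: "x \<in> Obj C \<Longrightarrow> \<exists>!f. f \<in> Hom C x (One C)"
  using limits unfolding chosen_finite_limits_def is_terminal_def by simp

lemma bang_arr [simp]:
  assumes "x \<in> Obj C"
  shows "bang C x \<in> Arr C" "Dom C (bang C x) = x" "Cod C (bang C x) = One C"
proof -
  have "bang C x \<in> Hom C x (One C)" unfolding bang_def by (rule theI'[OF bang_ex1[OF assms]])
  then show "bang C x \<in> Arr C" "Dom C (bang C x) = x" "Cod C (bang C x) = One C"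
    by (simp_all add: Hom_def)
qed

lemma bang_unique:
  assumes "f \<in> Arr C" "Cod C f = One C"
  shows "f = bang C (Dom C f)"
proof -
  have "f \<in> Hom C (Dom C f) (One C)" "bang C (Dom C f) \<in> Hom C (Dom C f) (One C)"
    using assms by (simp_all add: Hom_def)
  then show ?thesis using bang_ex1[OF dom_obj[OF assms(1)]] by blast
qed

lemma bang_comp [simp]:
  assumes "f \<in> Arr C" "Cod C f = x"
  shows "bang C x \<cdot> f = bang C (Dom C f)"
proof -
  have x: "x \<in> Obj C" using cod_obj[OF assms(1)] assms(2) by simp
  have D: "Dom C (bang C x \<cdot> f) = Dom C f" and "bang C x \<cdot> f \<in> Arr C" "Cod C (bang C x \<cdot> f) = One C"
    using assms x by simp_all
  then show ?thesis using bang_unique[of "bang C x \<cdot> f", unfolded D] by blast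
qed

lemma pullback: "e \<in> Arr C \<Longrightarrow> p \<in> Arr C \<Longrightarrow> Cod C e = Cod C p \<Longrightarrow> is_pullback C e p (Pb C e p) (Pt C e p)"
  using limits unfolding chosen_finite_limits_def by simp

lemma Pb_arr [simp]:
  assumes "e \<in> Arr C" "p \<in> Arr C" "Cod C e = Cod C p"
  shows "Pb C e p \<in> Arr C" "Pt C e p \<in> Arr C" "Cod C (Pb C e p) = Dom C e" "Cod C (Pt C e p) = Dom C p"
    "Dom C (Pt C e p) = Dom C (Pb C e p)"
  using pullback[OF assms] unfolding is_pullback_def by simp_all

lemma Pb_square: "e \<in> Arr C \<Longrightarrow> p \<in> Arr C \<Longrightarrow> Cod C e = Cod C p \<Longrightarrow> e \<cdot> Pb C e p = p \<cdot> Pt C e p"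
  using pullback unfolding is_pullback_def by blast

lemma Pb_square_comp:
  assumes "e \<in> Arr C" "p \<in> Arr C" "Cod C e = Cod C p" "u \<in> Arr C" "Cod C u = Dom C (Pb C e p)"
  shows "p \<cdot> (Pt C e p \<cdot> u) = e \<cdot> (Pb C e p \<cdot> u)"
  using assms comp_eq[OF Pb_square[OF assms(1-3), symmetric], of u] by simp

lemma pair_ex1:
  assumes "e \<in> Arr C" "p \<in> Arr C" "Cod C e = Cod C p"
    and "a \<in> Arr C" "b \<in> Arr C" "Dom C a = Dom C b" "Cod C a = Dom C e" "Cod C b = Dom C p" "e \<cdot> a = p \<cdot> b"
  shows "\<exists>!u. u \<in> Hom C (Dom C a) (Dom C (Pb C e p)) \<and> Pb C e p \<cdot> u = a \<and> Pt C e p \<cdot> u = b"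
proof -
  have "\<forall>z. \<forall>a \<in> Hom C z (Dom C e). \<forall>b \<in> Hom C z (Dom C p). e \<cdot> a = p \<cdot> b \<longrightarrow>
      (\<exists>!u. u \<in> Hom C z (Dom C (Pb C e p)) \<and> Pb C e p \<cdot> u = a \<and> Pt C e p \<cdot> u = b)"
    using pullback[OF assms(1-3)] unfolding is_pullback_def by (elim conjE)
  from this[rule_format, of a "Dom C a" b] show ?thesis using assms(4-9) by (simp add: Hom_def)
qed

lemma pair_arr [simp]:
  assumes "e \<in> Arr C" "p \<in> Arr C" "Cod C e = Cod C p"
    and "a \<in> Arr C" "b \<in> Arr C" "Dom C a = Dom C b" "Cod C a = Dom C e" "Cod C b = Dom C p" "e \<cdot> a = p \<cdot> b"
  shows "pair C e p a b \<in> Arr C" "Dom C (pair C e p a b) = Dom C a"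
    "Cod C (pair C e p a b) = Dom C (Pb C e p)"
    "Pb C e p \<cdot> pair C e p a b = a" "Pt C e p \<cdot> pair C e p a b = b"
proof -
  have "pair C e p a b \<in> Hom C (Dom C a) (Dom C (Pb C e p)) \<and>
      Pb C e p \<cdot> pair C e p a b = a \<and> Pt C e p \<cdot> pair C e p a b = b"
    unfolding pair_def by (rule theI'[OF pair_ex1[OF assms]])
  then show "pair C e p a b \<in> Arr C" "Dom C (pair C e p a b) = Dom C a"
    "Cod C (pair C e p a b) = Dom C (Pb C e p)"
    "Pb C e p \<cdot> pair C e p a b = a" "Pt C e p \<cdot> pair C e p a b = b"
    by (simp_all add: Hom_def)
qed

lemma pair_comp [simp]:
  assumes "e \<in> Arr C" "p \<in> Arr C" "Cod C e = Cod C p"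
    and "a \<in> Arr C" "b \<in> Arr C" "Dom C a = Dom C b" "Cod C a = Dom C e" "Cod C b = Dom C p" "e \<cdot> a = p \<cdot> b"
    and "g \<in> Arr C" "Cod C g = Dom C a"
  shows "Pb C e p \<cdot> (pair C e p a b \<cdot> g) = a \<cdot> g" "Pt C e p \<cdot> (pair C e p a b \<cdot> g) = b \<cdot> g"
  using assms by (simp_all add: comp_eq[OF pair_arr(4)] comp_eq[OF pair_arr(5)])

lemma pullback_eqI:
  assumes "e \<in> Arr C" "p \<in> Arr C" "Cod C e = Cod C p"
    and u: "u \<in> Arr C" "Cod C u = Dom C (Pb C e p)" and v: "v \<in> Arr C" "Cod C v = Dom C (Pb C e p)"
    and "Dom C u = Dom C v" "Pb C e p \<cdot> u = Pb C e p \<cdot> v" "Pt C e p \<cdot> u = Pt C e p \<cdot> v"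
  shows "u = v"
proof -
  note Pb = Pb_arr[OF assms(1-3)] Pb_square[OF assms(1-3)]
  have "e \<cdot> (Pb C e p \<cdot> u) = p \<cdot> (Pt C e p \<cdot> u)"
    using Pb assms(1-3) u
    by (simp add: comp_eq[OF Pb(6)])
  then have "\<exists>!w. w \<in> Hom C (Dom C (Pb C e p \<cdot> u)) (Dom C (Pb C e p)) \<and>
      Pb C e p \<cdot> w = Pb C e p \<cdot> u \<and> Pt C e p \<cdot> w = Pt C e p \<cdot> u"
    using Pb u assms(1-3) by (intro pair_ex1) auto
  moreover have "u \<in> Hom C (Dom C (Pb C e p \<cdot> u)) (Dom C (Pb C e p))"
    "v \<in> Hom C (Dom C (Pb C e p \<cdot> u)) (Dom C (Pb C e p))"
    using u v assms Pb by (simp_all add: Hom_def)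
  ultimately show ?thesis using assms(9,10) by metis
qed

end

text \<open>The underlying arrow of an arrow \<open>(p, k, q)\<close> of a slice.\<close>

definition und :: "'a \<times> 'a \<times> 'a \<Rightarrow> 'a" where
  "und t = fst (snd t)"

lemma und_simp [simp]: "und (p, k, q) = k"
  by (simp add: und_def)

lemma slice_simps [simp]:
  "p \<in> Obj (slice C I) \<longleftrightarrow> p \<in> Arr C \<and> Cod C p = I"
  "Dom (slice C I) (p, k, q) = p" "Cod (slice C I) (p, k, q) = q"
  "Idn (slice C I) p = (p, Idn C (Dom C p), p)"
  "(q', l, r) \<cdot>\<^bsub>slice C I\<^esub> (p, k, q) = (p, l \<cdot>\<^bsub>C\<^esub> k, r)"
  by (simp_all add: slice_def)

lemma slice_arr_iff:
  "(p, k, q) \<in> Arr (slice C I) \<longleftrightarrow> p \<in> Arr C \<and> Cod C p = I \<and> q \<in> Arr C \<and> Cod C q = I \<and>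
     k \<in> Arr C \<and> Dom C k = Dom C p \<and> Cod C k = Dom C q \<and> q \<cdot>\<^bsub>C\<^esub> k = p"
  by (auto simp: slice_def Hom_def)

lemma slice_hom_iff:
  "t \<in> Hom (slice C I) p q \<longleftrightarrow> (\<exists>k. t = (p, k, q) \<and> p \<in> Arr C \<and> Cod C p = I \<and> q \<in> Arr C \<and> Cod C q = I \<and>
     k \<in> Arr C \<and> Dom C k = Dom C p \<and> Cod C k = Dom C q \<and> q \<cdot>\<^bsub>C\<^esub> k = p)"
  by (cases t) (auto simp: Hom_def slice_arr_iff)

lemma slice_homI:
  "p \<in> Arr C \<Longrightarrow> Cod C p = I \<Longrightarrow> q \<in> Arr C \<Longrightarrow> Cod C q = I \<Longrightarrow> k \<in> Arr C \<Longrightarrow> Dom C k = Dom C p \<Longrightarrow>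
   Cod C k = Dom C q \<Longrightarrow> q \<cdot>\<^bsub>C\<^esub> k = p \<Longrightarrow> (p, k, q) \<in> Hom (slice C I) p q"
  by (simp add: slice_hom_iff)

lemma slice_homD:
  assumes "t \<in> Hom (slice C I) p q"
  shows "fst t = p" "snd (snd t) = q" "p \<in> Arr C" "Cod C p = I" "q \<in> Arr C" "Cod C q = I"
    "und t \<in> Arr C" "Dom C (und t) = Dom C p" "Cod C (und t) = Dom C q" "q \<cdot>\<^bsub>C\<^esub> und t = p"
  using assms by (auto simp: slice_hom_iff)

lemma slice_hom_eqI:
  assumes "t \<in> Hom (slice C I) p q" "t' \<in> Hom (slice C I) p q" "und t = und t'"
  shows "t = t'"
  using slice_homD(1,2)[OF assms(1)] slice_homD(1,2)[OF assms(2)] assms(3)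
  by (simp add: prod_eq_iff und_def)

lemma slice_comp:
  "t' \<cdot>\<^bsub>slice C I\<^esub> t = (fst t, und t' \<cdot>\<^bsub>C\<^esub> und t, snd (snd t'))"
  by (cases t; cases t') simp

lemma lex_slice_simps [simp]:
  "Obj (lex_slice C I) = Obj (slice C I)" "Arr (lex_slice C I) = Arr (slice C I)"
  "Dom (lex_slice C I) = Dom (slice C I)" "Cod (lex_slice C I) = Cod (slice C I)"
  "Idn (lex_slice C I) = Idn (slice C I)" "Comp (lex_slice C I) = Comp (slice C I)"
  "One (lex_slice C I) = Idn C I"
  "Pb (lex_slice C I) (x, k, z) (y, l, z') = (x \<cdot>\<^bsub>C\<^esub> Pb C k l, Pb C k l, x)"
  "Pt (lex_slice C I) (x, k, z) (y, l, z') = (x \<cdot>\<^bsub>C\<^esub> Pb C k l, Pt C k l, y)"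
  by (simp_all add: lex_slice_def)

lemma Hom_lex_slice [simp]: "Hom (lex_slice C I) p q = Hom (slice C I) p q"
  by (simp add: Hom_def)

context category
begin

lemma category_slice: "category (slice C I)"
proof
  fix f g h x y z w
  show "Idn (slice C I) x \<in> Hom (slice C I) x x" if "x \<in> Obj (slice C I)"
    using that by (simp add: slice_hom_iff)
  show "Dom (slice C I) f \<in> Obj (slice C I)" "Cod (slice C I) f \<in> Obj (slice C I)" if "f \<in> Arr (slice C I)"
    using that by (cases f; simp add: slice_arr_iff)+
  show "g \<cdot>\<^bsub>slice C I\<^esub> f \<in> Hom (slice C I) x z" if f: "f \<in> Hom (slice C I) x y" and g: "g \<in> Hom (slice C I)
      y z"
    unfolding slice_comp slice_homD(1)[OF f] slice_homD(2)[OF g]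
    using slice_homD[OF f] slice_homD[OF g]
    by (intro slice_homI) (simp_all add: comp_eq[OF slice_homD(10)[OF g]])
  show "f \<cdot>\<^bsub>slice C I\<^esub> Idn (slice C I) x = f" if f: "f \<in> Hom (slice C I) x y"
    using slice_homD[OF f] by (simp add: slice_comp prod_eq_iff und_def)
  show "Idn (slice C I) y \<cdot>\<^bsub>slice C I\<^esub> f = f" if f: "f \<in> Hom (slice C I) x y"
    using slice_homD[OF f] by (simp add: slice_comp prod_eq_iff und_def)
  show "(h \<cdot>\<^bsub>slice C I\<^esub> g) \<cdot>\<^bsub>slice C I\<^esub> f = h \<cdot>\<^bsub>slice C I\<^esub> (g \<cdot>\<^bsub>slice C I\<^esub> f)"
    if f: "f \<in> Hom (slice C I) w x" and g: "g \<in> Hom (slice C I) x y" and h: "h \<in> Hom (slice C I) y z"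
    using slice_homD[OF f] slice_homD[OF g] slice_homD[OF h] by (simp add: slice_comp)
qed

end

context lex_cat
begin

lemma category_lex_slice: "category (lex_slice C I)"
  using category_slice[of I] unfolding category_def by simp

text \<open>
  Pullbacks of a slice are computed in the base, and its terminal object is the identity.
\<close>

lemma chosen_limits_slice:
  assumes I: "I \<in> Obj C"
  shows "chosen_finite_limits (lex_slice C I)"
  unfolding chosen_finite_limits_def
proof (intro conjI ballI impI)
  have "\<exists>!f. f \<in> Hom (slice C I) p (Idn C I)" if "p \<in> Arr C" "Cod C p = I" for p
  proof (rule ex1I[of _ "(p, p, Idn C I)"])
    show "(p, p, Idn C I) \<in> Hom (slice C I) p (Idn C I)" using that I by (simp add: slice_hom_iff)
    show "f = (p, p, Idn C I)" if "f \<in> Hom (slice C I) p (Idn C I)" for f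
      using that I by (cases f) (auto simp: slice_hom_iff)
  qed
  then show "is_terminal (lex_slice C I) (One (lex_slice C I))"
    unfolding is_terminal_def using I by simp
next
  fix e p assume "e \<in> Arr (lex_slice C I)" "p \<in> Arr (lex_slice C I)" "Cod (lex_slice C I) e = Cod (lex_slice
      C I) p"
  moreover obtain x k z where e: "e = (x, k, z)" by (cases e)
  moreover obtain y l z' where p: "p = (y, l, z')" by (cases p)
  ultimately have x: "x \<in> Arr C" "Cod C x = I" "k \<in> Arr C" "Dom C k = Dom C x" "z \<cdot> k = x"
    and z: "z' = z" "z \<in> Arr C" "Cod C z = I" "Cod C k = Dom C z"
    and y: "y \<in> Arr C" "Cod C y = I" "l \<in> Arr C" "Dom C l = Dom C y" "Cod C l = Dom C z" "z \<cdot> l = y"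
    by (auto simp: slice_arr_iff)
  have y': "y \<cdot> Pt C k l = x \<cdot> Pb C k l"
  proof -
    have "y \<cdot> Pt C k l = z \<cdot> (l \<cdot> Pt C k l)" using x y z by (simp add: comp_eq[OF y(6)])
    also have "\<dots> = z \<cdot> (k \<cdot> Pb C k l)" using Pb_square[of k l] x y z by simp
    also have "\<dots> = x \<cdot> Pb C k l" using x y z by (simp add: comp_eq[OF x(5)])
    finally show ?thesis .
  qed
  have "\<exists>!u. u \<in> Hom (slice C I) w (x \<cdot> Pb C k l) \<and>
      (x \<cdot> Pb C k l, Pb C k l, x) \<cdot>\<^bsub>slice C I\<^esub> u = a \<and> (x \<cdot> Pb C k l, Pt C k l, y) \<cdot>\<^bsub>slice C I\<^esub> u = b"
    if a: "a \<in> Hom (slice C I) w x" and b: "b \<in> Hom (slice C I) w y"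
      and eq: "(x, k, z) \<cdot>\<^bsub>slice C I\<^esub> a = (y, l, z) \<cdot>\<^bsub>slice C I\<^esub> b" for w a b
  proof -
    obtain a' b' where ab: "a = (w, a', x)" "b = (w, b', y)"
      and w: "w \<in> Arr C" "Cod C w = I" "a' \<in> Arr C" "Dom C a' = Dom C w" "Cod C a' = Dom C x" "x \<cdot> a' = w"
        "b' \<in> Arr C" "Dom C b' = Dom C w" "Cod C b' = Dom C y" "y \<cdot> b' = w"
      using a b by (cases a; cases b) (auto simp: slice_hom_iff)
    have kl: "k \<cdot> a' = l \<cdot> b'" using eq unfolding ab by simp
    let ?u = "pair C k l a' b'"
    have u: "?u \<in> Arr C" "Dom C ?u = Dom C w" "Cod C ?u = Dom C (Pb C k l)" "Pb C k l \<cdot> ?u = a'" "Pt C k l \<cdot>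
        ?u = b'"
      using pair_arr[of k l a' b'] x y z w kl by simp_all
    show ?thesis
    proof (rule ex1I[of _ "(w, ?u, x \<cdot> Pb C k l)"])
      show "(w, ?u, x \<cdot> Pb C k l) \<in> Hom (slice C I) w (x \<cdot> Pb C k l) \<and>
        (x \<cdot> Pb C k l, Pb C k l, x) \<cdot>\<^bsub>slice C I\<^esub> (w, ?u, x \<cdot> Pb C k l) = a \<and>
        (x \<cdot> Pb C k l, Pt C k l, y) \<cdot>\<^bsub>slice C I\<^esub> (w, ?u, x \<cdot> Pb C k l) = b"
        using u w x y z ab by (simp add: slice_hom_iff)
    next
      fix v assume v: "v \<in> Hom (slice C I) w (x \<cdot> Pb C k l) \<and>
        (x \<cdot> Pb C k l, Pb C k l, x) \<cdot>\<^bsub>slice C I\<^esub> v = a \<and> (x \<cdot> Pb C k l, Pt C k l, y) \<cdot>\<^bsub>slice C I\<^esub> v = b"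
      then obtain v' where v': "v = (w, v', x \<cdot> Pb C k l)" "v' \<in> Arr C" "Dom C v' = Dom C w"
        "Cod C v' = Dom C (Pb C k l)" "Pb C k l \<cdot> v' = a'" "Pt C k l \<cdot> v' = b'"
        using x y z w ab by (cases v) (auto simp: slice_hom_iff)
      have "v' = ?u" by (rule pullback_eqI[of k l]) (use u v' x y z in simp_all)
      then show "v = (w, ?u, x \<cdot> Pb C k l)" using v' by simp
    qed
  qed
  then show "is_pullback (lex_slice C I) e p (Pb (lex_slice C I) e p) (Pt (lex_slice C I) e p)"
    unfolding is_pullback_def e p z(1) using x y z y' Pb_square[of k l] by (simp add: slice_arr_iff)
qed

lemma lex_cat_slice: "I \<in> Obj C \<Longrightarrow> lex_cat (lex_slice C I)"
  by (intro lex_cat.intro lex_cat_axioms.intro category_lex_slice chosen_limits_slice)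

end

section \<open>Indexed cocones as families of arrows\<close>

text \<open>
  Cocones see only the typing of the components of \<open>D\<close>.  Unlike the coherence of \<open>D\<close>, the typing is
  immediate for the localizations of \<open>D\<close>, so that everything said here about cocones also holds over
  slices.
\<close>

locale diagram = lex_cat C
  for C :: "('o, 'a, 'z) lex_category_scheme" (structure) +
  fixes A :: "('o, 'a, 'x, 'm) indexed_category"
    and D :: "('o, 'a, 'x, 'm, 'a, 'a \<times> 'a \<times> 'a) indexed_functor"
  assumes fib_dom: "E \<in> Obj C \<Longrightarrow> g \<in> Arr (Fib A E) \<Longrightarrow> Dom (Fib A E) g \<in> Obj (Fib A E)"
    and fib_cod: "E \<in> Obj C \<Longrightarrow> g \<in> Arr (Fib A E) \<Longrightarrow> Cod (Fib A E) g \<in> Obj (Fib A E)"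
    and ReO_obj: "\<alpha> \<in> Arr C \<Longrightarrow> x \<in> Obj (Fib A (Cod C \<alpha>)) \<Longrightarrow> ReO A \<alpha> x \<in> Obj (Fib A (Dom C \<alpha>))"
    and FunO_obj: "E \<in> Obj C \<Longrightarrow> x \<in> Obj (Fib A E) \<Longrightarrow> FunO D E x \<in> Obj (slice C E)"
    and FunA_hom: "E \<in> Obj C \<Longrightarrow> g \<in> Arr (Fib A E) \<Longrightarrow>
      FunA D E g \<in> Hom (slice C E) (FunO D E (Dom (Fib A E) g)) (FunO D E (Cod (Fib A E) g))"
    and Cmp_hom: "\<alpha> \<in> Arr C \<Longrightarrow> x \<in> Obj (Fib A (Cod C \<alpha>)) \<Longrightarrow>
      Cmp D \<alpha> x \<in> Hom (slice C (Dom C \<alpha>)) (FunO D (Dom C \<alpha>) (ReO A \<alpha> x)) (Pb C \<alpha> (FunO D (Cod C \<alpha>) x))"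
begin

abbreviation pr :: "'o \<Rightarrow> 'x \<Rightarrow> 'a" where
  "pr E x \<equiv> FunO D E x"

abbreviation tot :: "'o \<Rightarrow> 'x \<Rightarrow> 'o" where
  "tot E x \<equiv> Dom C (FunO D E x)"

abbreviation tr :: "'o \<Rightarrow> 'm \<Rightarrow> 'a" where
  "tr E g \<equiv> und (FunA D E g)"

text \<open>The cartesian arrow over \<open>\<alpha>\<close> from the total object of \<open>D(\<alpha>\<^sup>*x)\<close> to that of \<open>D(x)\<close>.\<close>

definition cart :: "'a \<Rightarrow> 'x \<Rightarrow> 'a" where
  "cart \<alpha> x = Pt C \<alpha> (FunO D (Cod C \<alpha>) x) \<cdot> und (Cmp D \<alpha> x)"

lemma pr_arr [simp]:
  assumes "E \<in> Obj C" "x \<in> Obj (Fib A E)"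
  shows "pr E x \<in> Arr C" "Cod C (pr E x) = E"
  using FunO_obj[OF assms] by simp_all

lemma tr_arr [simp]:
  assumes "E \<in> Obj C" "g \<in> Arr (Fib A E)"
  shows "tr E g \<in> Arr C" "Dom C (tr E g) = tot E (Dom (Fib A E) g)" "Cod C (tr E g) = tot E (Cod (Fib A E) g)"
    "pr E (Cod (Fib A E) g) \<cdot> tr E g = pr E (Dom (Fib A E) g)"
  using slice_homD[OF FunA_hom[OF assms]] by simp_all

lemma cart_arr [simp]:
  assumes \<alpha>: "\<alpha> \<in> Arr C" and x: "x \<in> Obj (Fib A (Cod C \<alpha>))"
  shows "cart \<alpha> x \<in> Arr C" "Dom C (cart \<alpha> x) = tot (Dom C \<alpha>) (ReO A \<alpha> x)"
    "Cod C (cart \<alpha> x) = tot (Cod C \<alpha>) x"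
  unfolding cart_def using slice_homD[OF Cmp_hom[OF \<alpha> x]] \<alpha> x by simp_all

lemma cart_square:
  assumes \<alpha>: "\<alpha> \<in> Arr C" and x: "x \<in> Obj (Fib A (Cod C \<alpha>))"
  shows "pr (Cod C \<alpha>) x \<cdot> cart \<alpha> x = \<alpha> \<cdot> pr (Dom C \<alpha>) (ReO A \<alpha> x)"
  unfolding cart_def
  using slice_homD[OF Cmp_hom[OF \<alpha> x]] \<alpha> x by (simp add: Pb_square_comp)

text \<open>
  An arrow over \<open>E\<close> into \<open>V \<times> E\<close> is an arrow into \<open>V\<close>.  In terms of these arrows, the vertex of a
  cocone is the same object \<open>V\<close> at every stage.
\<close>

definition cocone_family :: "'o \<Rightarrow> ('o \<Rightarrow> 'x \<Rightarrow> 'a) \<Rightarrow> bool" where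
  "cocone_family V n \<longleftrightarrow> V \<in> Obj C \<and>
     (\<forall>E \<in> Obj C. \<forall>x \<in> Obj (Fib A E). n E x \<in> Hom C (tot E x) V) \<and>
     (\<forall>E \<in> Obj C. \<forall>g \<in> Arr (Fib A E). n E (Cod (Fib A E) g) \<cdot> tr E g = n E (Dom (Fib A E) g)) \<and>
     (\<forall>\<alpha> \<in> Arr C. \<forall>x \<in> Obj (Fib A (Cod C \<alpha>)).
        n (Dom C \<alpha>) (ReO A \<alpha> x) = n (Cod C \<alpha>) x \<cdot> cart \<alpha> x)"

lemma cocone_familyD:
  assumes "cocone_family V n"
  shows "V \<in> Obj C"
    and "E \<in> Obj C \<Longrightarrow> x \<in> Obj (Fib A E) \<Longrightarrow> n E x \<in> Arr C"
    and "E \<in> Obj C \<Longrightarrow> x \<in> Obj (Fib A E) \<Longrightarrow> Dom C (n E x) = tot E x"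
    and "E \<in> Obj C \<Longrightarrow> x \<in> Obj (Fib A E) \<Longrightarrow> Cod C (n E x) = V"
    and "E \<in> Obj C \<Longrightarrow> g \<in> Arr (Fib A E) \<Longrightarrow> n E (Cod (Fib A E) g) \<cdot> tr E g = n E (Dom (Fib A E) g)"
    and "\<alpha> \<in> Arr C \<Longrightarrow> x \<in> Obj (Fib A (Cod C \<alpha>)) \<Longrightarrow> n (Dom C \<alpha>) (ReO A \<alpha> x) = n (Cod C \<alpha>) x \<cdot> cart \<alpha> x"
  using assms unfolding cocone_family_def Hom_def by simp_all

definition leg :: "'o \<Rightarrow> ('o \<Rightarrow> 'x \<Rightarrow> 'a \<times> 'a \<times> 'a) \<Rightarrow> 'o \<Rightarrow> 'x \<Rightarrow> 'a" where
  "leg V \<nu> E x = Pt C (bang C E) (bang C V) \<cdot> und (\<nu> E x)"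

lemma const_hom_eqI:
  assumes t: "t \<in> Hom (slice C E) p (const_obj C E V)" and t': "t' \<in> Hom (slice C E) p (const_obj C E V)"
    and E: "E \<in> Obj C" and V: "V \<in> Obj C"
    and eq: "Pt C (bang C E) (bang C V) \<cdot> und t = Pt C (bang C E) (bang C V) \<cdot> und t'"
  shows "t = t'"
proof (rule slice_hom_eqI[OF t t'])
  note D = slice_homD[OF t, unfolded const_obj_def] slice_homD[OF t', unfolded const_obj_def]
  show "und t = und t'"
    by (rule pullback_eqI[of "bang C E" "bang C V"]) (use D E V eq in simp_all)
qed

lemma ReA_self:
  assumes "\<alpha> \<in> Arr C" and t: "t \<in> Hom (slice C (Cod C \<alpha>)) p q"
  shows "ReA (self_indexing C) \<alpha> t \<in> Hom (slice C (Dom C \<alpha>)) (Pb C \<alpha> p) (Pb C \<alpha> q)"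
    and "Pt C \<alpha> q \<cdot> und (ReA (self_indexing C) \<alpha> t) = und t \<cdot> Pt C \<alpha> p"
proof -
  note D = slice_homD[OF t]
  have eq: "\<alpha> \<cdot> Pb C \<alpha> p = q \<cdot> (und t \<cdot> Pt C \<alpha> p)"
    using D assms(1) by (simp add: Pb_square comp_eq[OF D(10)])
  note pair = pair_arr[of \<alpha> q "Pb C \<alpha> p" "und t \<cdot> Pt C \<alpha> p"]
  have R: "ReA (self_indexing C) \<alpha> t = (Pb C \<alpha> p, pair C \<alpha> q (Pb C \<alpha> p) (und t \<cdot> Pt C \<alpha> p), Pb C \<alpha> q)"
    using D(1,2) by (cases t) (simp add: self_indexing_def)
  show "ReA (self_indexing C) \<alpha> t \<in> Hom (slice C (Dom C \<alpha>)) (Pb C \<alpha> p) (Pb C \<alpha> q)"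
    unfolding R using pair D assms(1) eq by (intro slice_homI) simp_all
  show "Pt C \<alpha> q \<cdot> und (ReA (self_indexing C) \<alpha> t) = und t \<cdot> Pt C \<alpha> p"
    unfolding R using pair D assms(1) eq by simp
qed

lemma ReComp_self:
  assumes e: "e \<in> Arr C" "e' \<in> Arr C" "Cod C e' = Dom C e" and p: "p \<in> Arr C" "Cod C p = Cod C e"
  shows "ReComp (self_indexing C) e e' p \<in> Hom (slice C (Dom C e')) (Pb C e' (Pb C e p)) (Pb C (e \<cdot> e') p)"
    and "Pt C (e \<cdot> e') p \<cdot> und (ReComp (self_indexing C) e e' p) = Pt C e p \<cdot> Pt C e' (Pb C e p)"
proof -
  have eq: "(e \<cdot> e') \<cdot> Pb C e' (Pb C e p) = p \<cdot> (Pt C e p \<cdot> Pt C e' (Pb C e p))"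
    using e p by (simp add: Pb_square_comp Pb_square[of e' "Pb C e p"])
  note pair = pair_arr[of "e \<cdot> e'" p "Pb C e' (Pb C e p)" "Pt C e p \<cdot> Pt C e' (Pb C e p)"]
  show "ReComp (self_indexing C) e e' p \<in> Hom (slice C (Dom C e')) (Pb C e' (Pb C e p)) (Pb C (e \<cdot> e') p)"
    unfolding self_indexing_def using pair e p eq by (simp del: assoc) (intro slice_homI; simp)
  show "Pt C (e \<cdot> e') p \<cdot> und (ReComp (self_indexing C) e e' p) = Pt C e p \<cdot> Pt C e' (Pb C e p)"
    unfolding self_indexing_def using pair(5) e p eq by simp
qed

lemma const_obj_arr:
  assumes "E \<in> Obj C" "V \<in> Obj C"
  shows "const_obj C E V \<in> Arr C" "Cod C (const_obj C E V) = E"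
  unfolding const_obj_def using assms by simp_all

text \<open>
  Both sides of each cocone equation are arrows into some \<open>V \<times> E\<close> over \<open>E\<close>, so they may be compared after
  projection to \<open>V\<close>; the structural isomorphisms become invisible there, and the comparison isomorphism
  of \<open>D\<close> is absorbed in the cartesian arrow.
\<close>

lemma indexed_cocone_iff:
  "indexed_cocone C A D V \<nu> \<longleftrightarrow>
     (\<forall>E \<in> Obj C. \<forall>x \<in> Obj (Fib A E). \<nu> E x \<in> Hom (slice C E) (pr E x) (const_obj C E V)) \<and>
     cocone_family V (leg V \<nu>)"
proof (cases "V \<in> Obj C \<and> (\<forall>E \<in> Obj C. \<forall>x \<in> Obj (Fib A E). \<nu> E x \<in> Hom (slice C E) (pr E x) (const_obj C E
    V))")
  case False
  then show ?thesis unfolding indexed_cocone_def cocone_family_def by blast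
next
  case True
  then have V: "V \<in> Obj C" and hom: "\<nu> E x \<in> Hom (slice C E) (pr E x) (const_obj C E V)"
    if "E \<in> Obj C" "x \<in> Obj (Fib A E)" for E x using that by blast+
  have V: "V \<in> Obj C" using True by blast
  note homD = slice_homD[OF hom]
  have leg: "leg V \<nu> E x \<in> Hom C (tot E x) V" if "E \<in> Obj C" "x \<in> Obj (Fib A E)" for E x
    using homD[OF that] that V by (simp add: Hom_def leg_def const_obj_def)
  have nat: "\<nu> E (Cod (Fib A E) g) \<cdot>\<^bsub>slice C E\<^esub> FunA D E g = \<nu> E (Dom (Fib A E) g) \<longleftrightarrow>
      leg V \<nu> E (Cod (Fib A E) g) \<cdot> tr E g = leg V \<nu> E (Dom (Fib A E) g)"
    if E: "E \<in> Obj C" and g: "g \<in> Arr (Fib A E)" for E g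
  proof -
    interpret S: category "slice C E" by (rule category_slice)
    note gO = fib_dom[OF E g] fib_cod[OF E g]
    have h: "\<nu> E (Cod (Fib A E) g) \<cdot>\<^bsub>slice C E\<^esub> FunA D E g \<in> Hom (slice C E) (pr E (Dom (Fib A E) g))
        (const_obj C E V)"
      by (rule S.comp_hom[OF FunA_hom[OF E g] hom[OF E gO(2)]])
    have u: "Pt C (bang C E) (bang C V) \<cdot> und (\<nu> E (Cod (Fib A E) g) \<cdot>\<^bsub>slice C E\<^esub> FunA D E g) =
        leg V \<nu> E (Cod (Fib A E) g) \<cdot> tr E g"
      unfolding leg_def using homD[OF E gO(2)] E g V by (simp add: slice_comp const_obj_def)
    show ?thesis
      using const_hom_eqI[OF h hom[OF E gO(1)] E V] u unfolding leg_def[of V \<nu> E "Dom (Fib A E) g"] by metis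
  qed
  have re: "ReComp (self_indexing C) (bang C (Cod C \<alpha>)) \<alpha> (bang C V) \<cdot>\<^bsub>slice C (Dom C \<alpha>)\<^esub>
          (ReA (self_indexing C) \<alpha> (\<nu> (Cod C \<alpha>) x) \<cdot>\<^bsub>slice C (Dom C \<alpha>)\<^esub> Cmp D \<alpha> x) =
        \<nu> (Dom C \<alpha>) (ReO A \<alpha> x) \<longleftrightarrow>
      leg V \<nu> (Dom C \<alpha>) (ReO A \<alpha> x) = leg V \<nu> (Cod C \<alpha>) x \<cdot> cart \<alpha> x"
    if \<alpha>: "\<alpha> \<in> Arr C" and x: "x \<in> Obj (Fib A (Cod C \<alpha>))" for \<alpha> x
  proof -
    let ?E = "Cod C \<alpha>" and ?E' = "Dom C \<alpha>"
    interpret S: category "slice C ?E'" by (rule category_slice)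
    note h = hom[OF cod_obj[OF \<alpha>] x]
    note R = ReA_self[OF \<alpha> h] and cmp = Cmp_hom[OF \<alpha> x]
    note x' = ReO_obj[OF \<alpha> x]
    have RC: "ReComp (self_indexing C) (bang C ?E) \<alpha> (bang C V) \<in>
        Hom (slice C ?E') (Pb C \<alpha> (const_obj C ?E V)) (const_obj C ?E' V)"
      "Pt C (bang C ?E') (bang C V) \<cdot> und (ReComp (self_indexing C) (bang C ?E) \<alpha> (bang C V)) =
        Pt C (bang C ?E) (bang C V) \<cdot> Pt C \<alpha> (const_obj C ?E V)"
      using ReComp_self[of "bang C ?E" \<alpha> "bang C V"] \<alpha> V by (simp_all add: const_obj_def)
    let ?L = "ReComp (self_indexing C) (bang C ?E) \<alpha> (bang C V) \<cdot>\<^bsub>slice C ?E'\<^esub>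
          (ReA (self_indexing C) \<alpha> (\<nu> ?E x) \<cdot>\<^bsub>slice C ?E'\<^esub> Cmp D \<alpha> x)"
    have L: "?L \<in> Hom (slice C ?E') (pr ?E' (ReO A \<alpha> x)) (const_obj C ?E' V)"
      by (rule S.comp_hom[OF S.comp_hom[OF cmp R(1)] RC(1)])
    note RD = slice_homD[OF R(1)] and RCD = slice_homD[OF RC(1)] and cD = slice_homD[OF cmp]
    note cO = const_obj_arr[OF cod_obj[OF \<alpha>] V]
    have "Pt C (bang C ?E') (bang C V) \<cdot> und ?L = (Pt C (bang C ?E') (bang C V) \<cdot>
        und (ReComp (self_indexing C) (bang C ?E) \<alpha> (bang C V))) \<cdot> (und (ReA (self_indexing C) \<alpha> (\<nu> ?E x)) \<cdot>
            und (Cmp D \<alpha> x))"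
      using RD RCD cD \<alpha> V x by (simp add: slice_comp const_obj_def)
    also have "\<dots> = Pt C (bang C ?E) (bang C V) \<cdot> ((Pt C \<alpha> (const_obj C ?E V) \<cdot> und (ReA (self_indexing C) \<alpha>
        (\<nu> ?E x))) \<cdot> und (Cmp D \<alpha> x))"
      unfolding RC(2) using RD cD \<alpha> V x cO by (simp add: const_obj_def)
    also have "\<dots> = leg V \<nu> ?E x \<cdot> cart \<alpha> x"
      unfolding R(2) leg_def cart_def using homD[OF cod_obj[OF \<alpha>] x] cD \<alpha> V x cO by (simp add: const_obj_def)
    finally have u: "Pt C (bang C ?E') (bang C V) \<cdot> und ?L = leg V \<nu> ?E x \<cdot> cart \<alpha> x" .
    show ?thesis
      using const_hom_eqI[OF L hom[OF dom_obj[OF \<alpha>] x'] dom_obj[OF \<alpha>] V] u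
      unfolding leg_def[of V \<nu> ?E' "ReO A \<alpha> x"] by metis
  qed
  show ?thesis
    unfolding indexed_cocone_def cocone_family_def using True V leg nat re by simp
qed

lemma indexed_coconeD:
  assumes "indexed_cocone C A D V \<nu>"
  shows "V \<in> Obj C" "cocone_family V (leg V \<nu>)"
    and "E \<in> Obj C \<Longrightarrow> x \<in> Obj (Fib A E) \<Longrightarrow> \<nu> E x \<in> Hom (slice C E) (pr E x) (const_obj C E V)"
  using assms unfolding indexed_cocone_iff by (simp_all add: cocone_family_def)

definition cocone_of :: "'o \<Rightarrow> ('o \<Rightarrow> 'x \<Rightarrow> 'a) \<Rightarrow> 'o \<Rightarrow> 'x \<Rightarrow> 'a \<times> 'a \<times> 'a" where
  "cocone_of V n E x = (pr E x, pair C (bang C E) (bang C V) (pr E x) (n E x), const_obj C E V)"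

lemma cocone_of:
  assumes n: "cocone_family V n"
  shows "indexed_cocone C A D V (cocone_of V n)"
    and "E \<in> Obj C \<Longrightarrow> x \<in> Obj (Fib A E) \<Longrightarrow> leg V (cocone_of V n) E x = n E x"
proof -
  note V = cocone_familyD(1)[OF n] and nD = cocone_familyD(2-4)[OF n]
  have leg: "leg V (cocone_of V n) E x = n E x" if "E \<in> Obj C" "x \<in> Obj (Fib A E)" for E x
    unfolding leg_def cocone_of_def using that V nD[OF that] by simp
  then show "E \<in> Obj C \<Longrightarrow> x \<in> Obj (Fib A E) \<Longrightarrow> leg V (cocone_of V n) E x = n E x" .
  have "cocone_of V n E x \<in> Hom (slice C E) (pr E x) (const_obj C E V)" if "E \<in> Obj C" "x \<in> Obj (Fib A E)"
      for E x
    unfolding cocone_of_def const_obj_def using that V nD[OF that] by (intro slice_homI) simp_all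
  moreover have "cocone_family V (leg V (cocone_of V n))"
    using n leg fib_dom fib_cod ReO_obj unfolding cocone_family_def by simp
  ultimately show "indexed_cocone C A D V (cocone_of V n)" unfolding indexed_cocone_iff by blast
qed

lemma const_arr_comp_iff:
  assumes \<mu>: "indexed_cocone C A D U \<mu>" and \<nu>: "indexed_cocone C A D V \<nu>" and h: "h \<in> Hom C U V"
    and E: "E \<in> Obj C" and x: "x \<in> Obj (Fib A E)"
  shows "const_arr C E h \<cdot>\<^bsub>slice C E\<^esub> \<mu> E x = \<nu> E x \<longleftrightarrow> h \<cdot> leg U \<mu> E x = leg V \<nu> E x"
proof -
  interpret S: category "slice C E" by (rule category_slice)
  have UV: "U \<in> Obj C" "V \<in> Obj C" using indexed_coconeD(1) \<mu> \<nu> by simp_all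
  note hD = HomD[OF h]
  have m: "\<mu> E x \<in> Hom (slice C E) (pr E x) (const_obj C E U)" by (rule indexed_coconeD(3)[OF \<mu> E x])
  have n: "\<nu> E x \<in> Hom (slice C E) (pr E x) (const_obj C E V)" by (rule indexed_coconeD(3)[OF \<nu> E x])
  have b: "(bang C U, h, bang C V) \<in> Hom (slice C (Cod C (bang C E))) (bang C U) (bang C V)"
    using hD UV E by (intro slice_homI) simp_all
  have k: "const_arr C E h = ReA (self_indexing C) (bang C E) (bang C U, h, bang C V)"
    unfolding const_arr_def using hD by simp
  have kh: "const_arr C E h \<in> Hom (slice C E) (const_obj C E U) (const_obj C E V)"
    "Pt C (bang C E) (bang C V) \<cdot> und (const_arr C E h) = h \<cdot> Pt C (bang C E) (bang C U)"
    unfolding k const_obj_def using ReA_self[OF _ b] E by simp_all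
  note mD = slice_homD[OF m] and kD = slice_homD[OF kh(1)]
  have "Pt C (bang C E) (bang C V) \<cdot> und (const_arr C E h \<cdot>\<^bsub>slice C E\<^esub> \<mu> E x) =
      (Pt C (bang C E) (bang C V) \<cdot> und (const_arr C E h)) \<cdot> und (\<mu> E x)"
    using mD kD E UV by (simp add: slice_comp const_obj_def)
  also have "\<dots> = h \<cdot> leg U \<mu> E x"
    unfolding kh(2) leg_def using mD E UV hD by (simp add: const_obj_def)
  finally have u: "Pt C (bang C E) (bang C V) \<cdot> und (const_arr C E h \<cdot>\<^bsub>slice C E\<^esub> \<mu> E x) = h \<cdot> leg U \<mu> E x" .
  show ?thesis
    using const_hom_eqI[OF S.comp_hom[OF m kh(1)] n E UV(2)] u unfolding leg_def[of V \<nu>] by metis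
qed

text \<open>
  Universality may thus be tested in the base category, on families of arrows into a fixed object.
\<close>

lemma colimiting_cocone_iff:
  assumes \<mu>: "indexed_cocone C A D U \<mu>"
  shows "colimiting_cocone C A D U \<mu> \<longleftrightarrow> (\<forall>V n. cocone_family V n \<longrightarrow>
    (\<exists>!h. h \<in> Hom C U V \<and> (\<forall>E \<in> Obj C. \<forall>x \<in> Obj (Fib A E). h \<cdot> leg U \<mu> E x = n E x)))"
    (is "_ \<longleftrightarrow> ?R")
proof
  assume c: "colimiting_cocone C A D U \<mu>"
  show ?R
  proof (intro allI impI)
    fix V n assume n: "cocone_family V n"
    note co = cocone_of[OF n]
    have eq: "(h \<in> Hom C U V \<and> (\<forall>E \<in> Obj C. \<forall>x \<in> Obj (Fib A E). const_arr C E h \<cdot>\<^bsub>slice C E\<^esub> \<mu> E x =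
        cocone_of V n E x)) \<longleftrightarrow>
        (h \<in> Hom C U V \<and> (\<forall>E \<in> Obj C. \<forall>x \<in> Obj (Fib A E). h \<cdot> leg U \<mu> E x = n E x))" for h
      using const_arr_comp_iff[OF \<mu> co(1), of h] co(2) by auto
    show "\<exists>!h. h \<in> Hom C U V \<and> (\<forall>E \<in> Obj C. \<forall>x \<in> Obj (Fib A E). h \<cdot> leg U \<mu> E x = n E x)"
      using conjunct2[OF c[unfolded colimiting_cocone_def], rule_format, OF co(1)] unfolding eq .
  qed
next
  assume R: ?R
  show "colimiting_cocone C A D U \<mu>"
    unfolding colimiting_cocone_def
  proof (intro conjI \<mu> allI impI)
    fix V \<nu> assume \<nu>: "indexed_cocone C A D V \<nu>"
    then have n: "cocone_family V (leg V \<nu>)" unfolding indexed_cocone_iff by blast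
    have eq: "(h \<in> Hom C U V \<and> (\<forall>E \<in> Obj C. \<forall>x \<in> Obj (Fib A E). const_arr C E h \<cdot>\<^bsub>slice C E\<^esub> \<mu> E x = \<nu> E x)) \<longleftrightarrow>
        (h \<in> Hom C U V \<and> (\<forall>E \<in> Obj C. \<forall>x \<in> Obj (Fib A E). h \<cdot> leg U \<mu> E x = leg V \<nu> E x))" for h
      using const_arr_comp_iff[OF \<mu> \<nu>, of h] by auto
    show "\<exists>!h. h \<in> Hom C U V \<and> (\<forall>E \<in> Obj C. \<forall>x \<in> Obj (Fib A E). const_arr C E h \<cdot>\<^bsub>slice C E\<^esub> \<mu> E x = \<nu> E x)"
      using R[rule_format, OF n] unfolding eq .
  qed
qed

end

section \<open>Localization\<close>

context diagram
begin

lemma over_arr_hom: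
  assumes e: "e \<in> Arr C" "Cod C e = I" and t: "t \<in> Hom (slice C (Dom C e)) p q"
  shows "over_arr C e t \<in> Hom (slice (lex_slice C I) e) (over_obj C e p) (over_obj C e q)"
    and "und (over_arr C e t) = (e \<cdot> p, und t, e \<cdot> q)"
proof -
  note D = slice_homD[OF t]
  have eq: "over_arr C e t = (over_obj C e p, (e \<cdot> p, und t, e \<cdot> q), over_obj C e q)"
    using D(1,2) by (cases t) (simp add: over_arr_def)
  then show "und (over_arr C e t) = (e \<cdot> p, und t, e \<cdot> q)" by simp
  show "over_arr C e t \<in> Hom (slice (lex_slice C I) e) (over_obj C e p) (over_obj C e q)"
    unfolding eq over_obj_def using D e by (intro slice_homI) (simp_all add: slice_arr_iff)
qed

lemma localize_simps [simp]:
  "Fib (localize_category C A) e = Fib A (Dom C e)"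
  "ReO (localize_category C A) (e', k, e) = ReO A k"
  "FunO (localize_functor C D) e x = over_obj C e (pr (Dom C e) x)"
  "FunA (localize_functor C D) e g = over_arr C e (FunA D (Dom C e) g)"
  "Cmp (localize_functor C D) (e', k, e) x = over_arr C e' (Cmp D k x)"
  by (simp_all add: localize_category_def localize_functor_def)

lemma diagram_slice:
  assumes I: "I \<in> Obj C"
  shows "diagram (lex_slice C I) (localize_category C A) (localize_functor C D)"
proof -
  interpret L: lex_cat "lex_slice C I" by (rule lex_cat_slice[OF I])
  show ?thesis
  proof
    fix e g assume e: "e \<in> Obj (lex_slice C I)" and g: "g \<in> Arr (Fib (localize_category C A) e)"
    then show "Dom (Fib (localize_category C A) e) g \<in> Obj (Fib (localize_category C A) e)"
      "Cod (Fib (localize_category C A) e) g \<in> Obj (Fib (localize_category C A) e)"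
      using fib_dom fib_cod by simp_all
    show "FunA (localize_functor C D) e g \<in> Hom (slice (lex_slice C I) e)
        (FunO (localize_functor C D) e (Dom (Fib (localize_category C A) e) g))
        (FunO (localize_functor C D) e (Cod (Fib (localize_category C A) e) g))"
      using over_arr_hom(1)[OF _ _ FunA_hom] e g by simp
  next
    fix e x assume "e \<in> Obj (lex_slice C I)" "x \<in> Obj (Fib (localize_category C A) e)"
    then show "FunO (localize_functor C D) e x \<in> Obj (slice (lex_slice C I) e)"
      by (simp add: over_obj_def slice_arr_iff)
  next
    fix \<alpha> x assume "\<alpha> \<in> Arr (lex_slice C I)" "x \<in> Obj (Fib (localize_category C A) (Cod (lex_slice C I) \<alpha>))"
    moreover obtain e' k e where \<alpha>: "\<alpha> = (e', k, e)" by (cases \<alpha>)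
    ultimately have e: "e' \<in> Arr C" "Cod C e' = I" "e \<in> Arr C" "Cod C e = I"
      and k: "k \<in> Arr C" "Dom C k = Dom C e'" "Cod C k = Dom C e" "e \<cdot> k = e'" and x: "x \<in> Obj (Fib A (Cod C
          k))"
      by (simp_all add: slice_arr_iff)
    show "ReO (localize_category C A) \<alpha> x \<in> Obj (Fib (localize_category C A) (Dom (lex_slice C I) \<alpha>))"
      unfolding \<alpha> using ReO_obj[OF k(1) x] k by simp
    have "over_arr C e' (Cmp D k x) \<in>
        Hom (slice (lex_slice C I) e') (over_obj C e' (pr (Dom C k) (ReO A k x))) (over_obj C e' (Pb C k (pr
            (Cod C k) x)))"
      using over_arr_hom(1)[OF e(1,2), of "Cmp D k x"] Cmp_hom[OF k(1) x] k by simp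
    then show "Cmp (localize_functor C D) \<alpha> x \<in> Hom (slice (lex_slice C I) (Dom (lex_slice C I) \<alpha>))
        (FunO (localize_functor C D) (Dom (lex_slice C I) \<alpha>) (ReO (localize_category C A) \<alpha> x))
        (Pb (lex_slice C I) \<alpha> (FunO (localize_functor C D) (Cod (lex_slice C I) \<alpha>) x))"
      unfolding \<alpha> using k by (simp add: over_obj_def)
  qed
qed

text \<open>
  A cocone over the localization at \<open>I\<close> with vertex \<open>v : V \<rightarrow> I\<close>, given by the components in \<open>V\<close>.
\<close>

definition slice_family :: "'o \<Rightarrow> 'a \<Rightarrow> ('a \<Rightarrow> 'x \<Rightarrow> 'a) \<Rightarrow> bool" where
  "slice_family I v n \<longleftrightarrow> v \<in> Arr C \<and> Cod C v = I \<and>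
     (\<forall>e \<in> Arr C. Cod C e = I \<longrightarrow> (\<forall>x \<in> Obj (Fib A (Dom C e)).
        n e x \<in> Hom C (tot (Dom C e) x) (Dom C v) \<and> v \<cdot> n e x = e \<cdot> pr (Dom C e) x)) \<and>
     (\<forall>e \<in> Arr C. Cod C e = I \<longrightarrow> (\<forall>g \<in> Arr (Fib A (Dom C e)).
        n e (Cod (Fib A (Dom C e)) g) \<cdot> tr (Dom C e) g = n e (Dom (Fib A (Dom C e)) g))) \<and>
     (\<forall>e \<in> Arr C. Cod C e = I \<longrightarrow> (\<forall>k \<in> Arr C. Cod C k = Dom C e \<longrightarrow> (\<forall>x \<in> Obj (Fib A (Cod C k)).
        n (e \<cdot> k) (ReO A k x) = n e x \<cdot> cart k x)))"

lemma slice_familyD: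
  assumes "slice_family I v n"
  shows "v \<in> Arr C" "Cod C v = I"
    and "e \<in> Arr C \<Longrightarrow> Cod C e = I \<Longrightarrow> x \<in> Obj (Fib A (Dom C e)) \<Longrightarrow> n e x \<in> Arr C"
    and "e \<in> Arr C \<Longrightarrow> Cod C e = I \<Longrightarrow> x \<in> Obj (Fib A (Dom C e)) \<Longrightarrow> Dom C (n e x) = tot (Dom C e) x"
    and "e \<in> Arr C \<Longrightarrow> Cod C e = I \<Longrightarrow> x \<in> Obj (Fib A (Dom C e)) \<Longrightarrow> Cod C (n e x) = Dom C v"
    and "e \<in> Arr C \<Longrightarrow> Cod C e = I \<Longrightarrow> x \<in> Obj (Fib A (Dom C e)) \<Longrightarrow> v \<cdot> n e x = e \<cdot> pr (Dom C e) x"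
    and "e \<in> Arr C \<Longrightarrow> Cod C e = I \<Longrightarrow> g \<in> Arr (Fib A (Dom C e)) \<Longrightarrow>
      n e (Cod (Fib A (Dom C e)) g) \<cdot> tr (Dom C e) g = n e (Dom (Fib A (Dom C e)) g)"
    and "e \<in> Arr C \<Longrightarrow> Cod C e = I \<Longrightarrow> k \<in> Arr C \<Longrightarrow> Cod C k = Dom C e \<Longrightarrow> x \<in> Obj (Fib A (Cod C k)) \<Longrightarrow>
      n (e \<cdot> k) (ReO A k x) = n e x \<cdot> cart k x"
  using assms unfolding slice_family_def Hom_def by simp_all

text \<open>
  An arrow of the slice over \<open>I\<close> with codomain \<open>e\<close> has the form \<open>(e \<cdot> k, k, e)\<close>, and it is determined by
  its underlying arrow \<open>k\<close>.
\<close>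

lemma slice_cocone_family_iff:
  assumes I: "I \<in> Obj C"
    and hom: "\<And>e x. e \<in> Arr C \<Longrightarrow> Cod C e = I \<Longrightarrow> x \<in> Obj (Fib A (Dom C e)) \<Longrightarrow>
       n e x \<in> Hom (slice C I) (e \<cdot> pr (Dom C e) x) v"
    and v: "v \<in> Arr C" "Cod C v = I"
  shows "diagram.cocone_family (lex_slice C I) (localize_category C A) (localize_functor C D) v n \<longleftrightarrow>
    slice_family I v (\<lambda>e x. und (n e x))"
proof -
  interpret L: diagram "lex_slice C I" "localize_category C A" "localize_functor C D"
    by (rule diagram_slice[OF I])
  note homD = slice_homD[OF hom]
  have 1: "n e (Cod (Fib A (Dom C e)) g) \<cdot>\<^bsub>slice C I\<^esub> L.tr e g = n e (Dom (Fib A (Dom C e)) g) \<longleftrightarrow>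
      und (n e (Cod (Fib A (Dom C e)) g)) \<cdot> tr (Dom C e) g = und (n e (Dom (Fib A (Dom C e)) g))"
    if e: "e \<in> Arr C" "Cod C e = I" and g: "g \<in> Arr (Fib A (Dom C e))" for e g
  proof -
    note gO = fib_dom[OF dom_obj[OF e(1)] g] fib_cod[OF dom_obj[OF e(1)] g]
    note dD = homD[OF e gO(1)] and cD = homD[OF e gO(2)]
    have "L.tr e g = (e \<cdot> pr (Dom C e) (Dom (Fib A (Dom C e)) g), tr (Dom C e) g, e \<cdot> pr (Dom C e) (Cod (Fib
        A (Dom C e)) g))"
      using over_arr_hom(2)[OF e FunA_hom[OF dom_obj[OF e(1)] g]] by simp
    then show ?thesis
      using dD(1,2) cD(1,2) by (simp add: slice_comp prod_eq_iff und_def)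
  qed
  have cart: "L.cart (e \<cdot> k, k, e) x = ((e \<cdot> k) \<cdot> pr (Dom C k) (ReO A k x), cart k x, e \<cdot> pr (Cod C k) x)"
    if e: "e \<in> Arr C" "Cod C e = I" and k: "k \<in> Arr C" "Cod C k = Dom C e" and x: "x \<in> Obj (Fib A (Cod C
        k))" for e k x
  proof -
    have ek: "e \<cdot> k \<in> Arr C" "Cod C (e \<cdot> k) = I" "Dom C (e \<cdot> k) = Dom C k" using e k by simp_all
    have "und (over_arr C (e \<cdot> k) (Cmp D k x)) =
        ((e \<cdot> k) \<cdot> pr (Dom C k) (ReO A k x), und (Cmp D k x), (e \<cdot> k) \<cdot> Pb C k (pr (Cod C k) x))"
      using over_arr_hom(2)[OF ek(1,2), of "Cmp D k x"] Cmp_hom[OF k(1) x] ek by simp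
    then show ?thesis unfolding L.cart_def cart_def using k by (simp add: over_obj_def)
  qed
  have 2: "n (e \<cdot> k) (ReO A k x) = n e x \<cdot>\<^bsub>slice C I\<^esub> L.cart (e \<cdot> k, k, e) x \<longleftrightarrow>
      und (n (e \<cdot> k) (ReO A k x)) = und (n e x) \<cdot> cart k x"
    if e: "e \<in> Arr C" "Cod C e = I" and k: "k \<in> Arr C" "Cod C k = Dom C e" and x: "x \<in> Obj (Fib A (Cod C
        k))" for e k x
  proof -
    have ek: "e \<cdot> k \<in> Arr C" "Cod C (e \<cdot> k) = I" "Dom C (e \<cdot> k) = Dom C k" using e k by simp_all
    have x': "ReO A k x \<in> Obj (Fib A (Dom C (e \<cdot> k)))" using ReO_obj[OF k(1) x] ek by simp
    have xe: "x \<in> Obj (Fib A (Dom C e))" using x k by simp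
    show ?thesis unfolding cart[OF that]
      using homD(1,2)[OF ek(1,2) x'] homD(1,2)[OF e xe] ek by (simp add: slice_comp prod_eq_iff und_def)
  qed
  have hom': "n e x \<in> Hom (slice C I) (e \<cdot> pr (Dom C e) x) v \<longleftrightarrow>
      und (n e x) \<in> Hom C (tot (Dom C e) x) (Dom C v) \<and> v \<cdot> und (n e x) = e \<cdot> pr (Dom C e) x"
    if e: "e \<in> Arr C" "Cod C e = I" "x \<in> Obj (Fib A (Dom C e))" for e x
    using hom[OF that] homD[OF that] e by (simp add: Hom_def)
  have 3: "(\<forall>\<alpha> \<in> Arr (slice C I). \<forall>x \<in> Obj (Fib A (Dom C (Cod (slice C I) \<alpha>))).
        n (Dom (slice C I) \<alpha>) (ReO (localize_category C A) \<alpha> x) = n (Cod (slice C I) \<alpha>) x \<cdot>\<^bsub>slice C I\<^esub>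
            L.cart \<alpha> x) \<longleftrightarrow>
      (\<forall>e \<in> Arr C. Cod C e = I \<longrightarrow> (\<forall>k \<in> Arr C. Cod C k = Dom C e \<longrightarrow> (\<forall>x \<in> Obj (Fib A (Cod C k)).
        n (e \<cdot> k) (ReO A k x) = n e x \<cdot>\<^bsub>slice C I\<^esub> L.cart (e \<cdot> k, k, e) x)))"
    (is "?P \<longleftrightarrow> ?Q")
  proof
    assume P: ?P
    show ?Q
    proof (intro ballI impI)
      fix e k x assume "e \<in> Arr C" "Cod C e = I" "k \<in> Arr C" "Cod C k = Dom C e" "x \<in> Obj (Fib A (Cod C k))"
      then show "n (e \<cdot> k) (ReO A k x) = n e x \<cdot>\<^bsub>slice C I\<^esub> L.cart (e \<cdot> k, k, e) x"
        using P[rule_format, of "(e \<cdot> k, k, e)" x] by (simp add: slice_arr_iff)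
    qed
  next
    assume Q: ?Q
    show ?P
    proof (intro ballI)
      fix \<alpha> x assume \<alpha>: "\<alpha> \<in> Arr (slice C I)" and x: "x \<in> Obj (Fib A (Dom C (Cod (slice C I) \<alpha>)))"
      obtain e' k e where \<alpha>': "\<alpha> = (e', k, e)" by (cases \<alpha>)
      have D: "e \<in> Arr C" "Cod C e = I" "k \<in> Arr C" "Cod C k = Dom C e" "e' = e \<cdot> k" "x \<in> Obj (Fib A (Cod C
          k))"
        using \<alpha> x unfolding \<alpha>' by (simp_all add: slice_arr_iff)
      show "n (Dom (slice C I) \<alpha>) (ReO (localize_category C A) \<alpha> x) = n (Cod (slice C I) \<alpha>) x \<cdot>\<^bsub>slice C I\<^esub>
          L.cart \<alpha> x"
        using Q[rule_format, OF D(1-4,6)] unfolding \<alpha>' D(5) by simp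
    qed
  qed
  show ?thesis
  proof
    assume L: "L.cocone_family v n"
    have L3: "n e (Cod (Fib A (Dom C e)) g) \<cdot>\<^bsub>slice C I\<^esub> L.tr e g = n e (Dom (Fib A (Dom C e)) g)"
      if "e \<in> Arr C" "Cod C e = I" "g \<in> Arr (Fib A (Dom C e))" for e g
      using L that unfolding L.cocone_family_def by simp
    have L4: "n (e \<cdot> k) (ReO A k x) = n e x \<cdot>\<^bsub>slice C I\<^esub> L.cart (e \<cdot> k, k, e) x"
      if "e \<in> Arr C" "Cod C e = I" "k \<in> Arr C" "Cod C k = Dom C e" "x \<in> Obj (Fib A (Cod C k))" for e k x
    proof -
      have "\<forall>\<alpha> \<in> Arr (slice C I). \<forall>x \<in> Obj (Fib A (Dom C (Cod (slice C I) \<alpha>))).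
        n (Dom (slice C I) \<alpha>) (ReO (localize_category C A) \<alpha> x) = n (Cod (slice C I) \<alpha>) x \<cdot>\<^bsub>slice C I\<^esub>
            L.cart \<alpha> x"
        using L unfolding L.cocone_family_def by simp
      then show ?thesis using 3 that by blast
    qed
    show "slice_family I v (\<lambda>e x. und (n e x))"
      unfolding slice_family_def
      by (intro conjI ballI impI v)
        (use hom' hom in blast, use hom' hom in blast, use 1 L3 in blast, use 2 L4 in blast)
  next
    assume S: "slice_family I v (\<lambda>e x. und (n e x))"
    note S3 = slice_familyD(7)[OF S] and S4 = slice_familyD(8)[OF S]
    have L4: "\<forall>\<alpha> \<in> Arr (slice C I). \<forall>x \<in> Obj (Fib A (Dom C (Cod (slice C I) \<alpha>))).
        n (Dom (slice C I) \<alpha>) (ReO (localize_category C A) \<alpha> x) = n (Cod (slice C I) \<alpha>) x \<cdot>\<^bsub>slice C I\<^esub>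
            L.cart \<alpha> x"
      unfolding 3 using 2 S4 by blast
    show "L.cocone_family v n"
      unfolding L.cocone_family_def
    proof (intro conjI ballI)
      fix e g assume "e \<in> Obj (lex_slice C I)" "g \<in> Arr (Fib (localize_category C A) e)"
      then show "n e (Cod (Fib (localize_category C A) e) g) \<cdot>\<^bsub>lex_slice C I\<^esub> L.tr e g =
          n e (Dom (Fib (localize_category C A) e) g)"
        using 1[of e g] S3[of e g] by simp
    qed (use v hom L4 in \<open>simp_all add: over_obj_def\<close>)
  qed
qed

text \<open>
  The localized cocone is defined through the inverse of this structural arrow from \<open>e\<^sup>*(!\<^sub>I\<^sup>*(U))\<close> to
  \<open>!\<^sub>E\<^sup>*(U)\<close>, which has to be shown to exist: arrows into either object over \<open>E\<close> are arrows into \<open>U\<close>.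
\<close>

lemma self_indexing_comp_inverse:
  assumes e: "e \<in> Arr C" "Cod C e = I" and U: "U \<in> Obj C"
  shows "is_iso (slice C (Dom C e)) (ReComp (self_indexing C) (bang C I) e (bang C U))"
proof -
  let ?E = "Dom C e" and ?Q = "const_obj C I U" and ?K = "const_obj C (Dom C e) U"
  let ?R = "ReComp (self_indexing C) (bang C I) e (bang C U)"
  interpret S: category "slice C ?E" by (rule category_slice)
  have I: "I \<in> Obj C" using e by auto
  note Q = const_obj_arr[OF I U] and K = const_obj_arr[OF dom_obj[OF e(1)] U]
  have RC: "?R \<in> Hom (slice C ?E) (Pb C e ?Q) ?K"
    "Pt C (bang C ?E) (bang C U) \<cdot> und ?R = Pt C (bang C I) (bang C U) \<cdot> Pt C e ?Q"
    using ReComp_self[of "bang C I" e "bang C U"] e I U by (simp_all add: const_obj_def)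
  note RD = slice_homD[OF RC(1)]
  define w where "w = pair C (bang C I) (bang C U) (e \<cdot> ?K) (Pt C (bang C ?E) (bang C U))"
  have w: "w \<in> Arr C" "Dom C w = Dom C ?K" "Cod C w = Dom C ?Q" "?Q \<cdot> w = e \<cdot> ?K"
    "Pt C (bang C I) (bang C U) \<cdot> w = Pt C (bang C ?E) (bang C U)"
    unfolding w_def using e I U K by (simp_all add: const_obj_def)
  define i where "i = pair C e ?Q ?K w"
  have i: "i \<in> Arr C" "Dom C i = Dom C ?K" "Cod C i = Dom C (Pb C e ?Q)" "Pb C e ?Q \<cdot> i = ?K" "Pt C e ?Q \<cdot> i
      = w"
    unfolding i_def using e w Q K by simp_all
  have iH: "(?K, i, Pb C e ?Q) \<in> Hom (slice C ?E) ?K (Pb C e ?Q)"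
    using i e Q K by (intro slice_homI) simp_all
  have "?R \<cdot>\<^bsub>slice C ?E\<^esub> (?K, i, Pb C e ?Q) = Idn (slice C ?E) ?K"
  proof (rule const_hom_eqI[OF S.comp_hom[OF iH RC(1)] S.idn_hom dom_obj[OF e(1)] U])
    have "Pt C (bang C ?E) (bang C U) \<cdot> (und ?R \<cdot> i) = (Pt C (bang C ?E) (bang C U) \<cdot> und ?R) \<cdot> i"
      using RD i e U by (simp add: const_obj_def)
    also have "\<dots> = Pt C (bang C I) (bang C U) \<cdot> (Pt C e ?Q \<cdot> i)"
      unfolding RC(2) using i e U I Q by (simp add: const_obj_def)
    finally show "Pt C (bang C ?E) (bang C U) \<cdot> und (?R \<cdot>\<^bsub>slice C ?E\<^esub> (?K, i, Pb C e ?Q)) =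
        Pt C (bang C ?E) (bang C U) \<cdot> und (Idn (slice C ?E) ?K)"
      using w i K e U by (simp add: slice_comp const_obj_def)
    show "?K \<in> Obj (slice C ?E)" using K by simp
  qed
  moreover have "(?K, i, Pb C e ?Q) \<cdot>\<^bsub>slice C ?E\<^esub> ?R = Idn (slice C ?E) (Pb C e ?Q)"
  proof (rule slice_hom_eqI[OF S.comp_hom[OF RC(1) iH] S.idn_hom])
    have iR: "Pt C e ?Q \<cdot> (i \<cdot> und ?R) = w \<cdot> und ?R" using comp_eq[OF i(5), of "und ?R"] RD i e Q by simp
    have "w \<cdot> und ?R = Pt C e ?Q"
    proof (rule pullback_eqI[of "bang C I" "bang C U"])
      have "Pb C (bang C I) (bang C U) \<cdot> (w \<cdot> und ?R) = e \<cdot> (?K \<cdot> und ?R)"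
        using comp_eq[OF w(4), of "und ?R"] w RD e Q K by (simp add: const_obj_def)
      also have "\<dots> = ?Q \<cdot> Pt C e ?Q" using RD e Q by (simp add: Pb_square)
      finally show "Pb C (bang C I) (bang C U) \<cdot> (w \<cdot> und ?R) = Pb C (bang C I) (bang C U) \<cdot> Pt C e ?Q"
        by (simp add: const_obj_def)
      show "Pt C (bang C I) (bang C U) \<cdot> (w \<cdot> und ?R) = Pt C (bang C I) (bang C U) \<cdot> Pt C e ?Q"
        using comp_eq[OF w(5), of "und ?R"] RC(2) w RD I U by (simp add: const_obj_def)
    qed (use w RD e I U Q in \<open>simp_all add: const_obj_def\<close>)
    with iR have iR': "Pt C e ?Q \<cdot> (i \<cdot> und ?R) = Pt C e ?Q" by simp
    have "i \<cdot> und ?R = Idn C (Dom C (Pb C e ?Q))"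
      by (rule pullback_eqI[of e ?Q]) (use iR' comp_eq[OF i(4), of "und ?R"] i RD e Q in simp_all)
    then show "und ((?K, i, Pb C e ?Q) \<cdot>\<^bsub>slice C ?E\<^esub> ?R) = und (Idn (slice C ?E) (Pb C e ?Q))"
      by (simp add: slice_comp)
    show "Pb C e ?Q \<in> Obj (slice C ?E)" using e Q by simp
  qed
  ultimately have "inverse_pair (slice C ?E) ?R (?K, i, Pb C e ?Q)"
    unfolding inverse_pair_def using HomD[OF RC(1)] iH by simp
  then show ?thesis unfolding is_iso_def by blast
qed

text \<open>The component of the localized cocone in \<open>I \<times> U\<close>.\<close>

definition slice_leg :: "'o \<Rightarrow> 'o \<Rightarrow> ('o \<Rightarrow> 'x \<Rightarrow> 'a \<times> 'a \<times> 'a) \<Rightarrow> 'a \<Rightarrow> 'x \<Rightarrow> 'a" where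
  "slice_leg I U \<mu> e x = pair C (bang C I) (bang C U) (e \<cdot> pr (Dom C e) x) (leg U \<mu> (Dom C e) x)"

lemmas leg_arr = cocone_familyD(2-4)[OF indexed_coconeD(2)]

lemma slice_leg:
  assumes \<mu>: "indexed_cocone C A D U \<mu>" and e: "e \<in> Arr C" "Cod C e = I" and x: "x \<in> Obj (Fib A (Dom C e))"
  shows "slice_leg I U \<mu> e x \<in> Arr C" "Dom C (slice_leg I U \<mu> e x) = tot (Dom C e) x"
    "Cod C (slice_leg I U \<mu> e x) = Dom C (const_obj C I U)"
    "const_obj C I U \<cdot> slice_leg I U \<mu> e x = e \<cdot> pr (Dom C e) x"
    "Pt C (bang C I) (bang C U) \<cdot> slice_leg I U \<mu> e x = leg U \<mu> (Dom C e) x"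
  using e x leg_arr[OF \<mu> dom_obj[OF e(1)] x] indexed_coconeD(1)[OF \<mu>] cod_obj[OF e(1)]
  unfolding slice_leg_def const_obj_def by simp_all

lemma slice_family_slice_leg:
  assumes \<mu>: "indexed_cocone C A D U \<mu>" and I: "I \<in> Obj C"
  shows "slice_family I (const_obj C I U) (slice_leg I U \<mu>)"
proof -
  have U: "U \<in> Obj C" by (rule indexed_coconeD(1)[OF \<mu>])
  note sl = slice_leg[OF \<mu>]
  note Q = const_obj_arr[OF I U]
  note fam = cocone_familyD(5)[OF indexed_coconeD(2)[OF \<mu>]] and fam' = cocone_familyD(6)[OF
      indexed_coconeD(2)[OF \<mu>]]
  show ?thesis
    unfolding slice_family_def
  proof (intro conjI ballI impI)
    show "const_obj C I U \<in> Arr C" "Cod C (const_obj C I U) = I" by fact+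
    fix e assume e: "e \<in> Arr C" "Cod C e = I"
    show "slice_leg I U \<mu> e x \<in> Hom C (tot (Dom C e) x) (Dom C (const_obj C I U))"
      "const_obj C I U \<cdot> slice_leg I U \<mu> e x = e \<cdot> pr (Dom C e) x" if "x \<in> Obj (Fib A (Dom C e))" for x
      using sl[OF e that] by (simp_all add: Hom_def)
    show "slice_leg I U \<mu> e (Cod (Fib A (Dom C e)) g) \<cdot> tr (Dom C e) g = slice_leg I U \<mu> e (Dom (Fib A (Dom
        C e)) g)"
      if g: "g \<in> Arr (Fib A (Dom C e))" for g
    proof -
      note gO = fib_dom[OF dom_obj[OF e(1)] g] fib_cod[OF dom_obj[OF e(1)] g] and t = tr_arr[OF dom_obj[OF
          e(1)] g]
      note s1 = sl[OF e gO(1)] and s2 = sl[OF e gO(2)]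
      show ?thesis
      proof (rule pullback_eqI[of "bang C I" "bang C U"])
        show "Pb C (bang C I) (bang C U) \<cdot> (slice_leg I U \<mu> e (Cod (Fib A (Dom C e)) g) \<cdot> tr (Dom C e) g) =
            Pb C (bang C I) (bang C U) \<cdot> slice_leg I U \<mu> e (Dom (Fib A (Dom C e)) g)"
          using comp_eq[OF s2(4), of "tr (Dom C e) g"] s1 s2 t Q e gO by (simp add: const_obj_def)
        show "Pt C (bang C I) (bang C U) \<cdot> (slice_leg I U \<mu> e (Cod (Fib A (Dom C e)) g) \<cdot> tr (Dom C e) g) =
            Pt C (bang C I) (bang C U) \<cdot> slice_leg I U \<mu> e (Dom (Fib A (Dom C e)) g)"
          using comp_eq[OF s2(5), of "tr (Dom C e) g"] s1 s2 t fam[OF dom_obj[OF e(1)] g] U I by (simp add: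
              const_obj_def)
      qed (use s1 s2 t U I in \<open>simp_all add: const_obj_def\<close>)
    qed
    show "slice_leg I U \<mu> (e \<cdot> k) (ReO A k x) = slice_leg I U \<mu> e x \<cdot> cart k x"
      if k: "k \<in> Arr C" "Cod C k = Dom C e" and x: "x \<in> Obj (Fib A (Cod C k))" for k x
    proof -
      have ek: "e \<cdot> k \<in> Arr C" "Cod C (e \<cdot> k) = I" "Dom C (e \<cdot> k) = Dom C k" using e k by simp_all
      have x': "ReO A k x \<in> Obj (Fib A (Dom C (e \<cdot> k)))" using ReO_obj[OF k(1) x] ek by simp
      have xe: "x \<in> Obj (Fib A (Dom C e))" using x k by simp
      note s1 = sl[OF ek(1,2) x'] and s2 = sl[OF e xe] and c = cart_arr[OF k(1) x]
      have xk: "ReO A k x \<in> Obj (Fib A (Dom C k))" by (rule ReO_obj[OF k(1) x])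
      show ?thesis
      proof (rule pullback_eqI[of "bang C I" "bang C U"])
        have "const_obj C I U \<cdot> (slice_leg I U \<mu> e x \<cdot> cart k x) = e \<cdot> (pr (Cod C k) x \<cdot> cart k x)"
          using comp_eq[OF s2(4), of "cart k x"] s2 c Q e k xe by simp
        also have "\<dots> = (e \<cdot> k) \<cdot> pr (Dom C k) (ReO A k x)"
          using cart_square[OF k(1) x] e k xk by simp
        also have "\<dots> = const_obj C I U \<cdot> slice_leg I U \<mu> (e \<cdot> k) (ReO A k x)" using s1(4) ek by simp
        finally show "Pb C (bang C I) (bang C U) \<cdot> slice_leg I U \<mu> (e \<cdot> k) (ReO A k x) =
            Pb C (bang C I) (bang C U) \<cdot> (slice_leg I U \<mu> e x \<cdot> cart k x)" by (simp add: const_obj_def)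
        show "Pt C (bang C I) (bang C U) \<cdot> slice_leg I U \<mu> (e \<cdot> k) (ReO A k x) =
            Pt C (bang C I) (bang C U) \<cdot> (slice_leg I U \<mu> e x \<cdot> cart k x)"
          using comp_eq[OF s2(5), of "cart k x"] s1 s2 c fam'[OF k(1) x] U I k ek by (simp add: const_obj_def)
      qed (use s1 s2 c U I k ek in \<open>simp_all add: const_obj_def\<close>)
    qed
  qed
qed

text \<open>
  The component of the localized cocone is found by undoing the structural isomorphism and comparing
  projections to \<open>I \<times> U\<close>.
\<close>

lemma localize_cocone:
  assumes \<mu>: "indexed_cocone C A D U \<mu>" and e: "e \<in> Arr C" "Cod C e = I" and x: "x \<in> Obj (Fib A (Dom C e))"
  shows "localize_cocone C I U \<mu> e x \<in> Hom (slice (lex_slice C I) e) (over_obj C e (pr (Dom C e) x))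
      (over_obj C e (Pb C e (const_obj C I U)))"
    and "\<exists>k. und (localize_cocone C I U \<mu> e x) = (e \<cdot> pr (Dom C e) x, k, e \<cdot> Pb C e (const_obj C I U)) \<and>
      Pt C e (const_obj C I U) \<cdot> k = slice_leg I U \<mu> e x"
proof -
  let ?E = "Dom C e" and ?Q = "const_obj C I U" and ?K = "const_obj C (Dom C e) U"
  let ?R = "ReComp (self_indexing C) (bang C I) e (bang C U)"
  let ?i = "inverse_arr (slice C ?E) ?R"
  interpret S: category "slice C ?E" by (rule category_slice)
  have U: "U \<in> Obj C" by (rule indexed_coconeD(1)[OF \<mu>])
  have I: "I \<in> Obj C" using e by auto
  note Q = const_obj_arr[OF I U] and K = const_obj_arr[OF dom_obj[OF e(1)] U]
  have RC: "?R \<in> Hom (slice C ?E) (Pb C e ?Q) ?K"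
    "Pt C (bang C ?E) (bang C U) \<cdot> und ?R = Pt C (bang C I) (bang C U) \<cdot> Pt C e ?Q"
    using ReComp_self[of "bang C I" e "bang C U"] e I U by (simp_all add: const_obj_def)
  note RD = slice_homD[OF RC(1)]
  have inv: "inverse_pair (slice C ?E) ?R ?i"
    by (rule S.inverse_arr_pair[OF self_indexing_comp_inverse[OF e U]])
  then have i: "?i \<in> Hom (slice C ?E) ?K (Pb C e ?Q)" and Ri: "?R \<cdot>\<^bsub>slice C ?E\<^esub> ?i = Idn (slice C ?E) ?K"
    unfolding inverse_pair_def using HomD[OF RC(1)] by simp_all
  note iD = slice_homD[OF i]
  have Ri': "und ?R \<cdot> und ?i = Idn C (Dom C ?K)" using arg_cong[OF Ri, of und] by (simp add: slice_comp)
  have m: "\<mu> ?E x \<in> Hom (slice C ?E) (pr ?E x) ?K" by (rule indexed_coconeD(3)[OF \<mu> dom_obj[OF e(1)] x])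
  note mD = slice_homD[OF m]
  note h = S.comp_hom[OF m i]
  have eq: "localize_cocone C I U \<mu> e x = over_arr C e (?i \<cdot>\<^bsub>slice C ?E\<^esub> \<mu> ?E x)"
    by (simp add: localize_cocone_def)
  show "localize_cocone C I U \<mu> e x \<in> Hom (slice (lex_slice C I) e) (over_obj C e (pr ?E x)) (over_obj C e
      (Pb C e ?Q))"
    unfolding eq by (rule over_arr_hom(1)[OF e h])
  have "und (localize_cocone C I U \<mu> e x) = (e \<cdot> pr ?E x, und ?i \<cdot> und (\<mu> ?E x), e \<cdot> Pb C e ?Q)"
    unfolding eq over_arr_hom(2)[OF e h] by (simp add: slice_comp)
  moreover have "Pt C e ?Q \<cdot> (und ?i \<cdot> und (\<mu> ?E x)) = slice_leg I U \<mu> e x"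
  proof (rule pullback_eqI[of "bang C I" "bang C U"])
    note sl = slice_leg[OF \<mu> e x]
    have "?Q \<cdot> (Pt C e ?Q \<cdot> (und ?i \<cdot> und (\<mu> ?E x))) = e \<cdot> ((Pb C e ?Q \<cdot> und ?i) \<cdot> und (\<mu> ?E x))"
      using comp_eq[OF iD(10), of "und (\<mu> ?E x)"] iD mD e Q K by (simp add: Pb_square_comp)
    also have "\<dots> = e \<cdot> pr ?E x" unfolding iD(10) using mD by simp
    finally show "Pb C (bang C I) (bang C U) \<cdot> (Pt C e ?Q \<cdot> (und ?i \<cdot> und (\<mu> ?E x))) =
        Pb C (bang C I) (bang C U) \<cdot> slice_leg I U \<mu> e x" using sl(4) by (simp add: const_obj_def)
    have "Pt C (bang C I) (bang C U) \<cdot> (Pt C e ?Q \<cdot> (und ?i \<cdot> und (\<mu> ?E x))) =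
        (Pt C (bang C I) (bang C U) \<cdot> Pt C e ?Q) \<cdot> (und ?i \<cdot> und (\<mu> ?E x))"
      using iD mD e Q K I U by (simp add: const_obj_def)
    also have "\<dots> = Pt C (bang C ?E) (bang C U) \<cdot> ((und ?R \<cdot> und ?i) \<cdot> und (\<mu> ?E x))"
      unfolding RC(2)[symmetric] using iD mD RD e U by (simp add: const_obj_def)
    also have "\<dots> = leg U \<mu> ?E x" unfolding Ri' leg_def using mD by simp
    finally show "Pt C (bang C I) (bang C U) \<cdot> (Pt C e ?Q \<cdot> (und ?i \<cdot> und (\<mu> ?E x))) =
        Pt C (bang C I) (bang C U) \<cdot> slice_leg I U \<mu> e x" using sl(5) by simp
  qed (use slice_leg[OF \<mu> e x] iD mD e Q I U in \<open>simp_all add: const_obj_def\<close>)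
  ultimately show "\<exists>k. und (localize_cocone C I U \<mu> e x) = (e \<cdot> pr ?E x, k, e \<cdot> Pb C e ?Q) \<and>
      Pt C e ?Q \<cdot> k = slice_leg I U \<mu> e x" by blast
qed

text \<open>
  The localization of a cocone is colimiting as soon as its components in \<open>I \<times> U\<close> are universal among the
  families over \<open>I\<close>.
\<close>

lemma localized_colimiting:
  assumes \<mu>: "indexed_cocone C A D U \<mu>" and I: "I \<in> Obj C"
    and univ: "\<And>v n. slice_family I v n \<Longrightarrow>
      \<exists>!h. h \<in> Hom C (Dom C (const_obj C I U)) (Dom C v) \<and> v \<cdot> h = const_obj C I U \<and>
        (\<forall>e \<in> Arr C. Cod C e = I \<longrightarrow> (\<forall>x \<in> Obj (Fib A (Dom C e)). h \<cdot> slice_leg I U \<mu> e x = n e x))"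
  shows "colimiting_cocone (lex_slice C I) (localize_category C A) (localize_functor C D)
    (const_obj C I U) (localize_cocone C I U \<mu>)"
proof -
  interpret L: diagram "lex_slice C I" "localize_category C A" "localize_functor C D"
    by (rule diagram_slice[OF I])
  let ?Q = "const_obj C I U" and ?\<mu> = "localize_cocone C I U \<mu>"
  have U: "U \<in> Obj C" by (rule indexed_coconeD(1)[OF \<mu>])
  note Q = const_obj_arr[OF I U]
  have bang: "bang (lex_slice C I) e = (e, e, Idn C I)" if "e \<in> Arr C" "Cod C e = I" for e
    using L.bang_unique[of "(e, e, Idn C I)"] that I by (simp add: slice_arr_iff)
  have const: "const_obj (lex_slice C I) e ?Q = over_obj C e (Pb C e ?Q)" if "e \<in> Arr C" "Cod C e = I" for e
    unfolding const_obj_def[of "lex_slice C I"] bang[OF that] bang[OF Q] by (simp add: over_obj_def)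
  have leg: "L.leg ?Q ?\<mu> e x = (e \<cdot> pr (Dom C e) x, slice_leg I U \<mu> e x, ?Q)"
    if e: "e \<in> Arr C" "Cod C e = I" and x: "x \<in> Obj (Fib A (Dom C e))" for e x
  proof -
    obtain k where "und (?\<mu> e x) = (e \<cdot> pr (Dom C e) x, k, e \<cdot> Pb C e ?Q)" "Pt C e ?Q \<cdot> k = slice_leg I U \<mu>
        e x"
      using localize_cocone(2)[OF \<mu> e x] by blast
    then show ?thesis unfolding L.leg_def bang[OF e] bang[OF Q] by simp
  qed
  have leg_hom: "L.leg ?Q ?\<mu> e x \<in> Hom (slice C I) (e \<cdot> pr (Dom C e) x) ?Q"
    if e: "e \<in> Arr C" "Cod C e = I" and x: "x \<in> Obj (Fib A (Dom C e))" for e x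
    unfolding leg[OF e x] using slice_leg[OF \<mu> e x] e x Q by (intro slice_homI) simp_all
  have "slice_family I ?Q (\<lambda>e x. und (L.leg ?Q ?\<mu> e x))"
    using slice_family_slice_leg[OF \<mu> I] leg ReO_obj fib_dom fib_cod unfolding slice_family_def by simp
  then have fam: "L.cocone_family ?Q (L.leg ?Q ?\<mu>)"
    using slice_cocone_family_iff[OF I leg_hom Q] by blast
  have cocone: "indexed_cocone (lex_slice C I) (localize_category C A) (localize_functor C D) ?Q ?\<mu>"
    unfolding L.indexed_cocone_iff using fam localize_cocone(1)[OF \<mu>] const by simp
  show ?thesis
    unfolding L.colimiting_cocone_iff[OF cocone]
  proof (intro allI impI)
    fix v n assume n: "L.cocone_family v n"
    have v: "v \<in> Arr C" "Cod C v = I" using n unfolding L.cocone_family_def by simp_all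
    have hom: "n e x \<in> Hom (slice C I) (e \<cdot> pr (Dom C e) x) v"
      if "e \<in> Arr C" "Cod C e = I" "x \<in> Obj (Fib A (Dom C e))" for e x
      using n that unfolding L.cocone_family_def by (simp add: over_obj_def)
    have sf: "slice_family I v (\<lambda>e x. und (n e x))" using n slice_cocone_family_iff[OF I hom v] by blast
    have n_eq: "n e x = (e \<cdot> pr (Dom C e) x, und (n e x), v)" if "e \<in> Arr C" "Cod C e = I" "x \<in> Obj (Fib A
        (Dom C e))" for e x
      using slice_homD(1,2)[OF hom[OF that]] by (simp add: prod_eq_iff und_def)
    define P where "P h \<longleftrightarrow> h \<in> Hom C (Dom C ?Q) (Dom C v) \<and> v \<cdot> h = ?Q \<and>
        (\<forall>e \<in> Arr C. Cod C e = I \<longrightarrow> (\<forall>x \<in> Obj (Fib A (Dom C e)). h \<cdot> slice_leg I U \<mu> e x = und (n e x)))" for h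
    define P' where "P' h \<longleftrightarrow> h \<in> Hom (lex_slice C I) ?Q v \<and> (\<forall>e \<in> Obj (lex_slice C I). \<forall>x \<in> Obj (Fib
        (localize_category C A) e).
        h \<cdot>\<^bsub>lex_slice C I\<^esub> L.leg ?Q ?\<mu> e x = n e x)" for h
    have P': "P' h \<longleftrightarrow> (\<exists>k. h = (?Q, k, v) \<and> P k)" for h
    proof
      assume h: "P' h"
      then obtain k where k: "h = (?Q, k, v)" "k \<in> Arr C" "Dom C k = Dom C ?Q" "Cod C k = Dom C v" "v \<cdot> k =
          ?Q"
        unfolding P'_def by (auto simp: slice_hom_iff)
      have "k \<cdot> slice_leg I U \<mu> e x = und (n e x)" if "e \<in> Arr C" "Cod C e = I" "x \<in> Obj (Fib A (Dom C e))"
          for e x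
      proof -
        have "h \<cdot>\<^bsub>slice C I\<^esub> L.leg ?Q ?\<mu> e x = n e x" using h that unfolding P'_def by simp
        from arg_cong[OF this, of und] show ?thesis unfolding k(1) leg[OF that] by simp
      qed
      then show "\<exists>k. h = (?Q, k, v) \<and> P k" unfolding P_def using k by (auto simp: Hom_def)
    next
      assume "\<exists>k. h = (?Q, k, v) \<and> P k"
      then obtain k where k: "h = (?Q, k, v)" and P: "P k" by blast
      have "h \<cdot>\<^bsub>slice C I\<^esub> L.leg ?Q ?\<mu> e x = n e x" if "e \<in> Arr C" "Cod C e = I" "x \<in> Obj (Fib A (Dom C e))"
          for e x
        unfolding k leg[OF that] using P that n_eq[OF that, symmetric] unfolding P_def by simp
      moreover have "h \<in> Hom (slice C I) ?Q v"
        unfolding k using P Q v unfolding P_def Hom_def[of C] by (intro slice_homI) simp_all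
      ultimately show "P' h" unfolding P'_def by simp
    qed
    have "\<exists>!k. P k" using univ[OF sf] unfolding P_def .
    then obtain k where k: "P k" "\<And>k'. P k' \<Longrightarrow> k' = k" by blast
    have "\<exists>!h. P' h"
    proof (rule ex1I[of _ "(?Q, k, v)"])
      show "P' (?Q, k, v)" unfolding P' using k(1) by blast
      show "h = (?Q, k, v)" if "P' h" for h using that k(2) unfolding P' by blast
    qed
    then show "\<exists>!h. h \<in> Hom (lex_slice C I) ?Q v \<and> (\<forall>e \<in> Obj (lex_slice C I). \<forall>x \<in> Obj (Fib
        (localize_category C A) e).
        h \<cdot>\<^bsub>lex_slice C I\<^esub> L.leg ?Q ?\<mu> e x = n e x)" unfolding P'_def .
  qed
qed

end

section \<open>Generalized elements\<close>

locale indexed_diagram = lex_cat C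
  for C :: "('o, 'a, 'z) lex_category_scheme" (structure) +
  fixes A :: "('o, 'a, 'x, 'm) indexed_category"
    and D :: "('o, 'a, 'x, 'm, 'a, 'a \<times> 'a \<times> 'a) indexed_functor"
  assumes indexed_category: "is_indexed_category C A"
    and indexed_functor: "is_indexed_functor C A (self_indexing C) D"
begin

lemma fib_category: "E \<in> Obj C \<Longrightarrow> category (Fib A E)"
  using indexed_category unfolding is_indexed_category_def by simp

lemma Re_functor: "\<alpha> \<in> Arr C \<Longrightarrow> is_functor (Fib A (Cod C \<alpha>)) (Fib A (Dom C \<alpha>)) (ReO A \<alpha>) (ReA A \<alpha>)"
  using indexed_category unfolding is_indexed_category_def by simp

lemma Fun_functor: "E \<in> Obj C \<Longrightarrow> is_functor (Fib A E) (slice C E) (FunO D E) (FunA D E)"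
  using indexed_functor unfolding is_indexed_functor_def by (simp add: self_indexing_def)

lemma Cmp_nat_iso: "\<alpha> \<in> Arr C \<Longrightarrow> is_nat_iso (Fib A (Cod C \<alpha>)) (slice C (Dom C \<alpha>))
    (FunO D (Dom C \<alpha>) \<circ> ReO A \<alpha>) (FunA D (Dom C \<alpha>) \<circ> ReA A \<alpha>)
    (Pb C \<alpha> \<circ> FunO D (Cod C \<alpha>)) (ReA (self_indexing C) \<alpha> \<circ> FunA D (Cod C \<alpha>)) (Cmp D \<alpha>)"
  using indexed_functor unfolding is_indexed_functor_def by (simp add: self_indexing_def)

sublocale diagram C A D
proof
  show "Dom (Fib A E) g \<in> Obj (Fib A E)" "Cod (Fib A E) g \<in> Obj (Fib A E)"
    if "E \<in> Obj C" "g \<in> Arr (Fib A E)" for E g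
    using category.dom_obj[OF fib_category] category.cod_obj[OF fib_category] that by simp_all
  show "ReO A \<alpha> x \<in> Obj (Fib A (Dom C \<alpha>))" if "\<alpha> \<in> Arr C" "x \<in> Obj (Fib A (Cod C \<alpha>))" for \<alpha> x
    using Re_functor[OF that(1)] that(2) unfolding is_functor_def by simp
  show "FunO D E x \<in> Obj (slice C E)" if "E \<in> Obj C" "x \<in> Obj (Fib A E)" for E x
    using Fun_functor[OF that(1)] that(2) unfolding is_functor_def by simp
  show "FunA D E g \<in> Hom (slice C E) (FunO D E (Dom (Fib A E) g)) (FunO D E (Cod (Fib A E) g))"
    if "E \<in> Obj C" "g \<in> Arr (Fib A E)" for E g
    using Fun_functor[OF that(1)] that(2) unfolding is_functor_def by simp
  show "Cmp D \<alpha> x \<in> Hom (slice C (Dom C \<alpha>)) (FunO D (Dom C \<alpha>) (ReO A \<alpha> x)) (Pb C \<alpha> (FunO D (Cod C \<alpha>) x))"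
    if "\<alpha> \<in> Arr C" "x \<in> Obj (Fib A (Cod C \<alpha>))" for \<alpha> x
    using Cmp_nat_iso[OF that(1)] that(2) unfolding is_nat_iso_def by simp
qed

lemma ReA_hom:
  assumes "\<alpha> \<in> Arr C" "g \<in> Arr (Fib A (Cod C \<alpha>))"
  shows "ReA A \<alpha> g \<in> Hom (Fib A (Dom C \<alpha>)) (ReO A \<alpha> (Dom (Fib A (Cod C \<alpha>)) g)) (ReO A \<alpha> (Cod (Fib A (Cod C
      \<alpha>)) g))"
  using Re_functor[OF assms(1)] assms(2) unfolding is_functor_def by simp

lemma ReComp_hom:
  assumes "e \<in> Arr C" "e' \<in> Arr C" "Cod C e' = Dom C e" "x \<in> Obj (Fib A (Cod C e))"
  shows "ReComp A e e' x \<in> Hom (Fib A (Dom C e')) (ReO A e' (ReO A e x)) (ReO A (e \<cdot> e') x)"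
proof -
  have "is_nat_iso (Fib A (Cod C e)) (Fib A (Dom C e'))
      (ReO A e' \<circ> ReO A e) (ReA A e' \<circ> ReA A e) (ReO A (e \<cdot> e')) (ReA A (e \<cdot> e')) (ReComp A e e')"
    using indexed_category assms unfolding is_indexed_category_def by simp
  then show ?thesis using assms(4) unfolding is_nat_iso_def by simp
qed

text \<open>
  Naturality, coherence and invertibility of the comparison isomorphisms of \<open>D\<close>, stated for the
  cartesian arrows between total objects.
\<close>

lemma cart_nat:
  assumes \<alpha>: "\<alpha> \<in> Arr C" and g: "g \<in> Arr (Fib A (Cod C \<alpha>))"
  shows "cart \<alpha> (Cod (Fib A (Cod C \<alpha>)) g) \<cdot> tr (Dom C \<alpha>) (ReA A \<alpha> g) =
    tr (Cod C \<alpha>) g \<cdot> cart \<alpha> (Dom (Fib A (Cod C \<alpha>)) g)"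
proof -
  let ?x = "Dom (Fib A (Cod C \<alpha>)) g" and ?x' = "Cod (Fib A (Cod C \<alpha>)) g"
  have E: "Cod C \<alpha> \<in> Obj C" "Dom C \<alpha> \<in> Obj C" using \<alpha> by simp_all
  note gO = fib_dom[OF E(1) g] fib_cod[OF E(1) g] and ga = HomD[OF ReA_hom[OF \<alpha> g]]
  have nat: "ReA (self_indexing C) \<alpha> (FunA D (Cod C \<alpha>) g) \<cdot>\<^bsub>slice C (Dom C \<alpha>)\<^esub> Cmp D \<alpha> ?x =
      Cmp D \<alpha> ?x' \<cdot>\<^bsub>slice C (Dom C \<alpha>)\<^esub> FunA D (Dom C \<alpha>) (ReA A \<alpha> g)"
    using Cmp_nat_iso[OF \<alpha>] g unfolding is_nat_iso_def by simp
  have nat': "und (ReA (self_indexing C) \<alpha> (FunA D (Cod C \<alpha>) g)) \<cdot> und (Cmp D \<alpha> ?x) =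
      und (Cmp D \<alpha> ?x') \<cdot> tr (Dom C \<alpha>) (ReA A \<alpha> g)"
    using arg_cong[OF nat, of und] by (simp add: slice_comp)
  note R = ReA_self[OF \<alpha> FunA_hom[OF E(1) g]]
  note RD = slice_homD[OF R(1)] and cD = slice_homD[OF Cmp_hom[OF \<alpha> gO(1)]] and c'D = slice_homD[OF
      Cmp_hom[OF \<alpha> gO(2)]]
  note t = tr_arr[OF E(2) ga(1)] and t' = tr_arr[OF E(1) g] and p = pr_arr[OF E(1) gO(1)] pr_arr[OF E(1)
      gO(2)]
  have "cart \<alpha> ?x' \<cdot> tr (Dom C \<alpha>) (ReA A \<alpha> g) =
      Pt C \<alpha> (pr (Cod C \<alpha>) ?x') \<cdot> (und (Cmp D \<alpha> ?x') \<cdot> tr (Dom C \<alpha>) (ReA A \<alpha> g))"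
    unfolding cart_def using c'D t ga \<alpha> p by simp
  also have "\<dots> = (Pt C \<alpha> (pr (Cod C \<alpha>) ?x') \<cdot> und (ReA (self_indexing C) \<alpha> (FunA D (Cod C \<alpha>) g))) \<cdot> und (Cmp
      D \<alpha> ?x)"
    unfolding nat'[symmetric] using RD cD \<alpha> p by simp
  also have "\<dots> = tr (Cod C \<alpha>) g \<cdot> cart \<alpha> ?x"
    unfolding R(2) cart_def using cD \<alpha> p t' by simp
  finally show ?thesis .
qed

lemma cart_comp:
  assumes e: "e \<in> Arr C" "e' \<in> Arr C" "Cod C e' = Dom C e" and x: "x \<in> Obj (Fib A (Cod C e))"
  shows "cart (e \<cdot> e') x \<cdot> tr (Dom C e') (ReComp A e e' x) = cart e x \<cdot> cart e' (ReO A e x)"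
proof -
  let ?d = "pr (Cod C e) x"
  have O: "Cod C e \<in> Obj C" "Dom C e \<in> Obj C" "Dom C e' \<in> Obj C" using e by simp_all
  have x': "ReO A e x \<in> Obj (Fib A (Dom C e))" by (rule ReO_obj[OF e(1) x])
  have xe: "x \<in> Obj (Fib A (Cod C (e \<cdot> e')))" using x e by simp
  have xe': "ReO A e x \<in> Obj (Fib A (Cod C e'))" using x' e by simp
  have coh: "Cmp D (e \<cdot> e') x \<cdot>\<^bsub>slice C (Dom C e')\<^esub> FunA D (Dom C e') (ReComp A e e' x) =
      ReComp (self_indexing C) e e' ?d \<cdot>\<^bsub>slice C (Dom C e')\<^esub>
        (ReA (self_indexing C) e' (Cmp D e x) \<cdot>\<^bsub>slice C (Dom C e')\<^esub> Cmp D e' (ReO A e x))"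
    using indexed_functor e x unfolding is_indexed_functor_def by (simp add: self_indexing_def)
  have coh': "und (Cmp D (e \<cdot> e') x) \<cdot> tr (Dom C e') (ReComp A e e' x) =
      und (ReComp (self_indexing C) e e' ?d) \<cdot> (und (ReA (self_indexing C) e' (Cmp D e x)) \<cdot> und (Cmp D e'
          (ReO A e x)))"
    using arg_cong[OF coh, of und] by (simp add: slice_comp)
  have ee: "e \<cdot> e' \<in> Arr C" "Dom C (e \<cdot> e') = Dom C e'" "Cod C (e \<cdot> e') = Cod C e" using e by simp_all
  note d = pr_arr[OF O(1) x] and d' = pr_arr[OF O(2) x']
  have cmp: "Cmp D e x \<in> Hom (slice C (Cod C e')) (pr (Dom C e) (ReO A e x)) (Pb C e ?d)"
    using Cmp_hom[OF e(1) x] e by simp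
  note R = ReA_self[OF e(2) cmp] and S = ReComp_self[OF e d(1)]
  have RC: "ReComp A e e' x \<in> Arr (Fib A (Dom C e'))" by (rule HomD(1)[OF ReComp_hom[OF e x]])
  note RD = slice_homD[OF R(1)] and SD = slice_homD[OF S(1)[OF d(2)]] and c1 = slice_homD[OF cmp]
    and c2 = slice_homD[OF Cmp_hom[OF e(2) xe']] and c3 = slice_homD[OF Cmp_hom[OF ee(1) xe]]
  note t = tr_arr[OF O(3) RC] and RCD = HomD[OF ReComp_hom[OF e x]]
  have "cart (e \<cdot> e') x \<cdot> tr (Dom C e') (ReComp A e e' x) =
      Pt C (e \<cdot> e') ?d \<cdot> (und (Cmp D (e \<cdot> e') x) \<cdot> tr (Dom C e') (ReComp A e e' x))"
    unfolding cart_def using c3 t RCD ee d by simp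
  also have "\<dots> = (Pt C (e \<cdot> e') ?d \<cdot> und (ReComp (self_indexing C) e e' ?d)) \<cdot>
      (und (ReA (self_indexing C) e' (Cmp D e x)) \<cdot> und (Cmp D e' (ReO A e x)))"
    unfolding coh' using SD RD c2 ee d e by simp
  also have "\<dots> = Pt C e ?d \<cdot> ((Pt C e' (Pb C e ?d) \<cdot> und (ReA (self_indexing C) e' (Cmp D e x))) \<cdot> und (Cmp
      D e' (ReO A e x)))"
    unfolding S(2)[OF d(2)] using RD c2 d e by simp
  also have "\<dots> = cart e x \<cdot> cart e' (ReO A e x)"
    unfolding R(2) cart_def using c1 c2 d d' e by simp
  finally show ?thesis .
qed

lemma cart_eqI:
  assumes \<alpha>: "\<alpha> \<in> Arr C" and x: "x \<in> Obj (Fib A (Cod C \<alpha>))"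
    and u: "u \<in> Arr C" "Cod C u = tot (Dom C \<alpha>) (ReO A \<alpha> x)" and v: "v \<in> Arr C" "Cod C v = tot (Dom C \<alpha>)
        (ReO A \<alpha> x)"
    and eq: "Dom C u = Dom C v" "pr (Dom C \<alpha>) (ReO A \<alpha> x) \<cdot> u = pr (Dom C \<alpha>) (ReO A \<alpha> x) \<cdot> v" "cart \<alpha> x \<cdot> u
        = cart \<alpha> x \<cdot> v"
  shows "u = v"
proof -
  interpret S: category "slice C (Dom C \<alpha>)" by (rule category_slice)
  have O: "Cod C \<alpha> \<in> Obj C" "Dom C \<alpha> \<in> Obj C" using \<alpha> by simp_all
  let ?c = "und (Cmp D \<alpha> x)"
  note c = slice_homD[OF Cmp_hom[OF \<alpha> x]] and p = pr_arr[OF O(1) x]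
  have "is_iso (slice C (Dom C \<alpha>)) (Cmp D \<alpha> x)"
    using Cmp_nat_iso[OF \<alpha>] x unfolding is_nat_iso_def by simp
  then obtain i where i: "inverse_pair (slice C (Dom C \<alpha>)) (Cmp D \<alpha> x) i" unfolding is_iso_def by blast
  then have iH: "i \<in> Hom (slice C (Dom C \<alpha>)) (Pb C \<alpha> (pr (Cod C \<alpha>) x)) (pr (Dom C \<alpha>) (ReO A \<alpha> x))"
    and ic: "i \<cdot>\<^bsub>slice C (Dom C \<alpha>)\<^esub> Cmp D \<alpha> x = Idn (slice C (Dom C \<alpha>)) (pr (Dom C \<alpha>) (ReO A \<alpha> x))"
    using HomD[OF Cmp_hom[OF \<alpha> x]] unfolding inverse_pair_def by simp_all
  note iD = slice_homD[OF iH]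
  have ic': "und i \<cdot> ?c = Idn C (tot (Dom C \<alpha>) (ReO A \<alpha> x))" using arg_cong[OF ic, of und] by (simp add:
      slice_comp)
  have cuv: "?c \<cdot> u = ?c \<cdot> v"
  proof (rule pullback_eqI[of \<alpha> "pr (Cod C \<alpha>) x"])
    show "Pb C \<alpha> (pr (Cod C \<alpha>) x) \<cdot> (?c \<cdot> u) = Pb C \<alpha> (pr (Cod C \<alpha>) x) \<cdot> (?c \<cdot> v)"
      using comp_eq[OF c(10), of u] comp_eq[OF c(10), of v] c u v \<alpha> p eq(2) by simp
    show "Pt C \<alpha> (pr (Cod C \<alpha>) x) \<cdot> (?c \<cdot> u) = Pt C \<alpha> (pr (Cod C \<alpha>) x) \<cdot> (?c \<cdot> v)"
      using eq(3) c u v \<alpha> p unfolding cart_def by simp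
  qed (use c u v \<alpha> p eq(1) in simp_all)
  show ?thesis
    by (rule section_cancel[OF c(7) iD(7) _ _ u(1) v(1) _ _ cuv]) (use iD c ic' u v in simp_all)
qed

text \<open>
  For \<open>k : S \<rightarrow> D(x)\<close> lying over \<open>f : S \<rightarrow> E\<close>, the section of \<open>D(f\<^sup>*x)\<close> induced by \<open>k\<close>, and the
  corresponding generalized element at stage \<open>S\<close>.
\<close>

definition sec :: "'o \<Rightarrow> 'x \<Rightarrow> 'a \<Rightarrow> 'a" where
  "sec E x k = und (inverse_arr (slice C (Dom C k)) (Cmp D (pr E x \<cdot> k) x)) \<cdot>
     pair C (pr E x \<cdot> k) (pr E x) (Idn C (Dom C k)) k"

definition elem :: "'o \<Rightarrow> 'x \<Rightarrow> 'a \<Rightarrow> 'x \<times> ('a \<times> 'a \<times> 'a)" where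
  "elem E x k = (ReO A (pr E x \<cdot> k) x, (Idn C (Dom C k), sec E x k, pr (Dom C k) (ReO A (pr E x \<cdot> k) x)))"

lemma sec:
  assumes E: "E \<in> Obj C" and x: "x \<in> Obj (Fib A E)" and k: "k \<in> Arr C" "Cod C k = tot E x"
  shows "sec E x k \<in> Arr C" "Dom C (sec E x k) = Dom C k"
    "Cod C (sec E x k) = tot (Dom C k) (ReO A (pr E x \<cdot> k) x)"
    "pr (Dom C k) (ReO A (pr E x \<cdot> k) x) \<cdot> sec E x k = Idn C (Dom C k)"
    "cart (pr E x \<cdot> k) x \<cdot> sec E x k = k"
    and "inverse_arr (slice C (Dom C k)) (Cmp D (pr E x \<cdot> k) x) \<in>
      Hom (slice C (Dom C k)) (Pb C (pr E x \<cdot> k) (pr E x)) (pr (Dom C k) (ReO A (pr E x \<cdot> k) x))"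
proof -
  let ?f = "pr E x \<cdot> k"
  note p = pr_arr[OF E x]
  have f: "?f \<in> Arr C" "Dom C ?f = Dom C k" "Cod C ?f = E" using p k by simp_all
  have xf: "x \<in> Obj (Fib A (Cod C ?f))" using x f by simp
  interpret S: category "slice C (Dom C k)" by (rule category_slice)
  let ?i = "inverse_arr (slice C (Dom C k)) (Cmp D ?f x)"
  note cH = Cmp_hom[OF f(1) xf, unfolded f]
  note c = slice_homD[OF cH]
  have "is_iso (slice C (Dom C k)) (Cmp D ?f x)"
    using Cmp_nat_iso[OF f(1)] xf f unfolding is_nat_iso_def by simp
  then have i: "inverse_pair (slice C (Dom C k)) (Cmp D ?f x) ?i" by (rule S.inverse_arr_pair)
  then show iH: "?i \<in> Hom (slice C (Dom C k)) (Pb C ?f (pr E x)) (pr (Dom C k) (ReO A ?f x))"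
    using HomD[OF cH] unfolding inverse_pair_def by simp
  have ci: "Cmp D ?f x \<cdot>\<^bsub>slice C (Dom C k)\<^esub> ?i = Idn (slice C (Dom C k)) (Pb C ?f (pr E x))"
    using i HomD[OF cH] unfolding inverse_pair_def by simp
  note iD = slice_homD[OF iH]
  have ci': "und (Cmp D ?f x) \<cdot> und ?i = Idn C (Dom C (Pb C ?f (pr E x)))"
    using arg_cong[OF ci, of und] by (simp add: slice_comp)
  let ?q = "pair C ?f (pr E x) (Idn C (Dom C k)) k"
  have q: "?q \<in> Arr C" "Dom C ?q = Dom C k" "Cod C ?q = Dom C (Pb C ?f (pr E x))"
    "Pb C ?f (pr E x) \<cdot> ?q = Idn C (Dom C k)" "Pt C ?f (pr E x) \<cdot> ?q = k"
    using pair_arr[of ?f "pr E x" "Idn C (Dom C k)" k] f p k by simp_all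
  show "sec E x k \<in> Arr C" "Dom C (sec E x k) = Dom C k"
    "Cod C (sec E x k) = tot (Dom C k) (ReO A ?f x)"
    unfolding sec_def using iD q by simp_all
  show "pr (Dom C k) (ReO A ?f x) \<cdot> sec E x k = Idn C (Dom C k)"
    unfolding sec_def using comp_eq[OF iD(10), of ?q] iD q by simp
  have "cart ?f x \<cdot> sec E x k = Pt C ?f (pr E x) \<cdot> ((und (Cmp D ?f x) \<cdot> und ?i) \<cdot> ?q)"
    unfolding cart_def sec_def f using iD q c f p by simp
  also have "\<dots> = k" unfolding ci' using q by simp
  finally show "cart ?f x \<cdot> sec E x k = k" .
qed

text \<open>
  Restriction of elements is composition of arrows.
\<close>

lemma restrict_element_elem:
  assumes E: "E \<in> Obj C" and x: "x \<in> Obj (Fib A E)" and y: "y \<in> Hom (slice C E) f (pr E x)"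
    and g: "g \<in> Arr C" "Cod C g = Dom C f"
  shows "(ReO A (f \<cdot> g) x, restrict_element C D g x y) = elem E x (und y \<cdot> g)"
proof -
  note yD = slice_homD[OF y]
  have f: "f \<cdot> g = pr E x \<cdot> (und y \<cdot> g)" using comp_eq[OF yD(10), of g] yD g by simp
  have y_eq: "y = (f, und y, pr E x)" using yD(1,2) by (simp add: prod_eq_iff und_def)
  have k: "und y \<cdot> g \<in> Arr C" "Cod C (und y \<cdot> g) = tot E x" "Dom C (und y \<cdot> g) = Dom C g" using yD g by
      simp_all
  note iD = slice_homD[OF sec(6)[OF E x k(1,2)]]
  have "restrict_element C D g x y = inverse_arr (slice C (Dom C g)) (Cmp D (f \<cdot> g) x) \<cdot>\<^bsub>slice C (Dom C g)\<^esub>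
      (Idn C (Dom C g), pair C (f \<cdot> g) (pr E x) (Idn C (Dom C g)) (und y \<cdot> g), Pb C (f \<cdot> g) (pr E x))"
    by (subst y_eq) (simp add: restrict_element_def)
  then show ?thesis unfolding f elem_def sec_def using iD(2) k(3) by (simp add: slice_comp)
qed

lemma elements_iff:
  "R \<in> Obj C \<Longrightarrow> (x, y) \<in> elements C A D R \<longleftrightarrow> x \<in> Obj (Fib A R) \<and> (\<exists>s. y = (Idn C R, s, pr R x) \<and>
     s \<in> Arr C \<and> Dom C s = R \<and> Cod C s = tot R x \<and> pr R x \<cdot> s = Idn C R)"
  unfolding elements_def by (auto simp: slice_hom_iff)

lemma elementsI:
  assumes "R \<in> Obj C" "x \<in> Obj (Fib A R)" "s \<in> Arr C" "Dom C s = R" "Cod C s = tot R x" "pr R x \<cdot> s = Idn C R"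
  shows "(x, (Idn C R, s, pr R x)) \<in> elements C A D R"
  using assms elements_iff by simp

lemma elementsE:
  assumes "p \<in> elements C A D R" "R \<in> Obj C"
  obtains x s where "p = (x, (Idn C R, s, pr R x))" "x \<in> Obj (Fib A R)" "s \<in> Arr C" "Dom C s = R"
    "Cod C s = tot R x" "pr R x \<cdot> s = Idn C R"
  using assms elements_iff[OF assms(2), of "fst p" "snd p"] by (cases p) auto

lemma elem_in:
  assumes E: "E \<in> Obj C" and x: "x \<in> Obj (Fib A E)" and k: "k \<in> Arr C" "Cod C k = tot E x"
  shows "elem E x k \<in> elements C A D (Dom C k)"
proof -
  have f: "pr E x \<cdot> k \<in> Arr C" "Dom C (pr E x \<cdot> k) = Dom C k" "Cod C (pr E x \<cdot> k) = E" using pr_arr[OF E x]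
      k by simp_all
  have "ReO A (pr E x \<cdot> k) x \<in> Obj (Fib A (Dom C k))" using ReO_obj[OF f(1)] x f by simp
  then show ?thesis unfolding elem_def using sec[OF E x k] k by (intro elementsI) simp_all
qed

abbreviation rel :: "'o \<Rightarrow> (('x \<times> ('a \<times> 'a \<times> 'a)) \<times> ('x \<times> ('a \<times> 'a \<times> 'a))) set" where
  "rel R \<equiv> element_rel C A D R"

lemma rel_refl: "p \<in> elements C A D R \<Longrightarrow> (p, p) \<in> rel R"
  unfolding element_rel_def by (auto dest: equiv_class_eq_iff[THEN iffD2])

lemma rel_sym: "(p, q) \<in> rel R \<Longrightarrow> (q, p) \<in> rel R"
  unfolding element_rel_def by (auto simp: equiv_def dest: symD)

lemma rel_trans: "(p, q) \<in> rel R \<Longrightarrow> (q, s) \<in> rel R \<Longrightarrow> (p, s) \<in> rel R"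
  unfolding element_rel_def equiv_def by (auto dest: transD)

lemma rel_least:
  assumes "equiv (elements C A D R) r"
    and "\<And>x y x' y' g. (x, y) \<in> elements C A D R \<Longrightarrow> (x', y') \<in> elements C A D R \<Longrightarrow> g \<in> Hom (Fib A R) x x' \<Longrightarrow>
      y' = FunA D R g \<cdot>\<^bsub>slice C R\<^esub> y \<Longrightarrow> ((x, y), (x', y')) \<in> r"
  shows "rel R \<subseteq> r"
  unfolding element_rel_def by (rule Inter_lower) (use assms in blast)

lemma rel_gen:
  assumes "(x, y) \<in> elements C A D R" "(x', y') \<in> elements C A D R" "g \<in> Hom (Fib A R) x x'"
    "y' = FunA D R g \<cdot>\<^bsub>slice C R\<^esub> y"
  shows "((x, y), (x', y')) \<in> rel R"
  unfolding element_rel_def using assms by blast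

text \<open>
  A morphism of the fibre relates an element to \<open>elem E x k\<close> as soon as it carries the section
  of the former to an arrow over \<open>k\<close>.
\<close>

lemma rel_elemI:
  assumes E: "E \<in> Obj C" and x: "x \<in> Obj (Fib A E)" and k: "k \<in> Arr C" "Cod C k = tot E x"
    and p: "(x1, (Idn C (Dom C k), s1, pr (Dom C k) x1)) \<in> elements C A D (Dom C k)"
    and g: "g \<in> Hom (Fib A (Dom C k)) x1 (ReO A (pr E x \<cdot> k) x)"
    and eq: "cart (pr E x \<cdot> k) x \<cdot> (tr (Dom C k) g \<cdot> s1) = k"
  shows "((x1, (Idn C (Dom C k), s1, pr (Dom C k) x1)), elem E x k) \<in> rel (Dom C k)"
proof -
  let ?S = "Dom C k" and ?f = "pr E x \<cdot> k"
  have S: "?S \<in> Obj C" using k by simp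
  have f: "?f \<in> Arr C" "Dom C ?f = ?S" "Cod C ?f = E" using pr_arr[OF E x] k by simp_all
  have xf: "x \<in> Obj (Fib A (Cod C ?f))" using x f by simp
  have s1: "x1 \<in> Obj (Fib A ?S)" "s1 \<in> Arr C" "Dom C s1 = ?S" "Cod C s1 = tot ?S x1" "pr ?S x1 \<cdot> s1 = Idn C
      ?S"
    using p unfolding elements_iff[OF S] by simp_all
  note gD = HomD[OF g]
  note t = tr_arr[OF S gD(1), unfolded gD] and s = sec[OF E x k]
  have x': "ReO A ?f x \<in> Obj (Fib A ?S)" using ReO_obj[OF f(1) xf] f by simp
  have "tr ?S g \<cdot> s1 = sec E x k"
    by (rule cart_eqI[OF f(1) xf])
      (use t s s1 f eq comp_eq[OF t(4), of s1] pr_arr[OF S x'] in simp_all)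
  then have "FunA D ?S g \<cdot>\<^bsub>slice C ?S\<^esub> (Idn C ?S, s1, pr ?S x1) = snd (elem E x k)"
    unfolding elem_def using slice_homD(2)[OF FunA_hom[OF S gD(1)]] gD by (simp add: slice_comp)
  then show ?thesis
    using rel_gen[OF p _ g, of "snd (elem E x k)"] elem_in[OF E x k] by (simp add: elem_def)
qed

text \<open>
  Neither \<open>D(g)\<close> for an arrow \<open>g\<close> of a fibre nor, by \<open>rel_cart\<close>, a cartesian arrow changes the class of an
  element.  A cocone is defined by its compatibility with these two moves.
\<close>

lemma rel_tr:
  assumes E: "E \<in> Obj C" and g: "g \<in> Arr (Fib A E)" and k: "k \<in> Arr C" "Cod C k = tot E (Dom (Fib A E) g)"
  shows "(elem E (Dom (Fib A E) g) k, elem E (Cod (Fib A E) g) (tr E g \<cdot> k)) \<in> rel (Dom C k)"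
proof -
  let ?x = "Dom (Fib A E) g" and ?x' = "Cod (Fib A E) g" and ?f = "pr E (Dom (Fib A E) g) \<cdot> k"
  note gO = fib_dom[OF E g] fib_cod[OF E g] and t = tr_arr[OF E g]
  have k': "tr E g \<cdot> k \<in> Arr C" "Cod C (tr E g \<cdot> k) = tot E ?x'" "Dom C (tr E g \<cdot> k) = Dom C k" using t k by
      simp_all
  have ff: "pr E ?x' \<cdot> (tr E g \<cdot> k) = ?f" using comp_eq[OF t(4), of k] t k pr_arr[OF E gO(2)] by simp
  have f: "?f \<in> Arr C" "Dom C ?f = Dom C k" "Cod C ?f = E" using pr_arr[OF E gO(1)] k by simp_all
  have gf: "g \<in> Arr (Fib A (Cod C ?f))" using g f by simp
  have xf: "?x \<in> Obj (Fib A (Cod C ?f))" using gO f by simp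
  have xf': "?x' \<in> Obj (Fib A (Cod C ?f))" using gO f by simp
  note R = ReA_hom[OF f(1) gf, unfolded f] and n = cart_nat[OF f(1) gf, unfolded f]
  note s = sec[OF E gO(1) k] and c = cart_arr[OF f(1) xf] and c' = cart_arr[OF f(1) xf']
  have S: "Dom C k \<in> Obj C" using k by simp
  note tR = tr_arr[OF S HomD(1)[OF R], unfolded HomD(2)[OF R] HomD(3)[OF R]]
  have "cart ?f ?x' \<cdot> (tr (Dom C k) (ReA A ?f g) \<cdot> sec E ?x k) = tr E g \<cdot> (cart ?f ?x \<cdot> sec E ?x k)"
    using comp_eq[OF n, of "sec E ?x k"] s c c' tR t f by simp
  also have "\<dots> = tr E g \<cdot> k" using s(5) by simp
  finally have eq: "cart ?f ?x' \<cdot> (tr (Dom C k) (ReA A ?f g) \<cdot> sec E ?x k) = tr E g \<cdot> k" .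
  show ?thesis
    using rel_elemI[OF E gO(2) k'(1,2), of "ReO A ?f ?x" "sec E ?x k" "ReA A ?f g"]
      elem_in[OF E gO(1) k] R eq unfolding ff k'(3) by (simp add: elem_def)
qed

lemma rel_cart:
  assumes \<alpha>: "\<alpha> \<in> Arr C" and x: "x \<in> Obj (Fib A (Cod C \<alpha>))"
    and k: "k \<in> Arr C" "Cod C k = tot (Dom C \<alpha>) (ReO A \<alpha> x)"
  shows "(elem (Dom C \<alpha>) (ReO A \<alpha> x) k, elem (Cod C \<alpha>) x (cart \<alpha> x \<cdot> k)) \<in> rel (Dom C k)"
proof -
  let ?x' = "ReO A \<alpha> x" and ?f = "pr (Dom C \<alpha>) (ReO A \<alpha> x) \<cdot> k"
  have O: "Dom C \<alpha> \<in> Obj C" "Cod C \<alpha> \<in> Obj C" "Dom C k \<in> Obj C" using \<alpha> k by simp_all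
  have x': "?x' \<in> Obj (Fib A (Dom C \<alpha>))" by (rule ReO_obj[OF \<alpha> x])
  note p' = pr_arr[OF O(1) x'] and c = cart_arr[OF \<alpha> x] and p = pr_arr[OF O(2) x]
  have f: "?f \<in> Arr C" "Dom C ?f = Dom C k" "Cod C ?f = Dom C \<alpha>" using p' k by simp_all
  have x'f: "?x' \<in> Obj (Fib A (Cod C ?f))" using x' f by simp
  have k': "cart \<alpha> x \<cdot> k \<in> Arr C" "Cod C (cart \<alpha> x \<cdot> k) = tot (Cod C \<alpha>) x" "Dom C (cart \<alpha> x \<cdot> k) = Dom C k"
    using c k by simp_all
  have ff: "pr (Cod C \<alpha>) x \<cdot> (cart \<alpha> x \<cdot> k) = \<alpha> \<cdot> ?f"
    using comp_eq[OF cart_square[OF \<alpha> x], of k] c p p' k \<alpha> by simp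
  note R = ReComp_hom[OF \<alpha> f(1,3) x, unfolded f] and n = cart_comp[OF \<alpha> f(1,3) x, unfolded f]
  note s = sec[OF O(1) x' k] and c' = cart_arr[OF f(1) x'f, unfolded f]
  note tR = tr_arr[OF O(3) HomD(1)[OF R], unfolded HomD(2)[OF R] HomD(3)[OF R]]
  have af: "\<alpha> \<cdot> ?f \<in> Arr C" "Cod C (\<alpha> \<cdot> ?f) = Cod C \<alpha>" "Dom C (\<alpha> \<cdot> ?f) = Dom C k" using \<alpha> f by simp_all
  have xa: "x \<in> Obj (Fib A (Cod C (\<alpha> \<cdot> ?f)))" unfolding af(2) by (rule x)
  note ca = cart_arr[OF af(1) xa, unfolded af(3)]
  have "cart (\<alpha> \<cdot> ?f) x \<cdot> (tr (Dom C k) (ReComp A \<alpha> ?f x) \<cdot> sec (Dom C \<alpha>) ?x' k) =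
      (cart \<alpha> x \<cdot> cart ?f ?x') \<cdot> sec (Dom C \<alpha>) ?x' k"
    by (rule comp_eq[OF n]) (use s ca tR in simp_all)
  also have "\<dots> = cart \<alpha> x \<cdot> (cart ?f ?x' \<cdot> sec (Dom C \<alpha>) ?x' k)"
    using s c c' by (intro assoc) simp_all
  also have "\<dots> = cart \<alpha> x \<cdot> k" unfolding s(5) ..
  finally have eq: "cart (\<alpha> \<cdot> ?f) x \<cdot> (tr (Dom C k) (ReComp A \<alpha> ?f x) \<cdot> sec (Dom C \<alpha>) ?x' k) = cart \<alpha> x \<cdot> k" .
  show ?thesis
    using rel_elemI[OF O(2) x k'(1,2), of "ReO A ?f ?x'" "sec (Dom C \<alpha>) ?x' k" "ReComp A \<alpha> ?f x"]
      elem_in[OF O(1) x' k] R eq unfolding ff k'(3) unfolding elem_def by blast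
qed

end

context indexed_diagram
begin

text \<open>
  The stage \<open>S\<close> of an element need not be the object \<open>E\<close> over which \<open>x\<close> lives; the pairs in
  \<open>elements C A D S\<close> are the case of a section over \<open>E = S\<close>.
\<close>

definition element_at :: "'o \<Rightarrow> 'o \<Rightarrow> 'x \<Rightarrow> 'a \<Rightarrow> bool" where
  "element_at S E x k \<longleftrightarrow> E \<in> Obj C \<and> x \<in> Obj (Fib A E) \<and> k \<in> Arr C \<and> Dom C k = S \<and> Cod C k = tot E x"

lemma element_atD:
  assumes "element_at S E x k"
  shows "E \<in> Obj C" "x \<in> Obj (Fib A E)" "k \<in> Arr C" "Dom C k = S" "Cod C k = tot E x" "S \<in> Obj C"
    "pr E x \<in> Arr C" "Cod C (pr E x) = E"
proof -
  show *: "E \<in> Obj C" "x \<in> Obj (Fib A E)" "k \<in> Arr C" "Dom C k = S" "Cod C k = tot E x"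
    using assms unfolding element_at_def by simp_all
  show "S \<in> Obj C" using dom_obj[OF *(3)] *(4) by simp
  show "pr E x \<in> Arr C" "Cod C (pr E x) = E" using pr_arr[OF *(1,2)] by simp_all
qed

lemma element_at_comp: "element_at S E x k \<Longrightarrow> h \<in> Hom C S' S \<Longrightarrow> element_at S' E x (k \<cdot> h)"
  unfolding element_at_def Hom_def by simp

lemma elem_in_elements: "element_at S E x k \<Longrightarrow> elem E x k \<in> elements C A D S"
  using elem_in unfolding element_at_def by auto

text \<open>
  The relation is generated at each stage separately.  It is stable under change of stage because
  restriction along \<open>h\<close> sends a generating pair to related elements, by \<open>rel_tr\<close>, and being related after
  restriction is an equivalence relation.
\<close>

lemma rel_lift:
  assumes k: "element_at S E x k" and k': "element_at S E' x' k'" and rel: "(elem E x k, elem E' x' k') \<in>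
      rel S"
    and h: "h \<in> Hom C S' S"
  shows "(elem E x (k \<cdot> h), elem E' x' (k' \<cdot> h)) \<in> rel S'"
proof -
  note hD = HomD[OF h] and S = element_atD(6)[OF k]
  \<comment> \<open>restriction of a pair \<open>p\<close>, regarded as an element over its own stage \<open>S\<close>\<close>
  define lift where "lift p = elem S (fst p) (und (snd p) \<cdot> h)" for p :: "'x \<times> 'a \<times> 'a \<times> 'a"
  have gen_lift: "element_at S' S (fst p) (und (snd p) \<cdot> h)" if "p \<in> elements C A D S" for p
    using that S by (rule elementsE) (use hD S in \<open>simp add: element_at_def\<close>)
  have lift_in: "lift p \<in> elements C A D S'" if "p \<in> elements C A D S" for p
    unfolding lift_def by (rule elem_in_elements[OF gen_lift[OF that]])
  let ?r = "{(p, q). p \<in> elements C A D S \<and> q \<in> elements C A D S \<and> (lift p, lift q) \<in> rel S'}"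
  have "rel S \<subseteq> ?r"
  proof (rule rel_least)
    show "equiv (elements C A D S) ?r"
    proof (rule equivI)
      show "refl_on (elements C A D S) ?r"
        using rel_refl[OF lift_in] by (auto simp: refl_on_def)
      show "sym ?r" using rel_sym by (auto simp: sym_def)
      show "trans ?r" unfolding trans_def using rel_trans by blast
    qed auto
    fix x1 y1 x2 y2 g
    assume y1: "(x1, y1) \<in> elements C A D S" and y2: "(x2, y2) \<in> elements C A D S"
      and g: "g \<in> Hom (Fib A S) x1 x2" and eq: "y2 = FunA D S g \<cdot>\<^bsub>slice C S\<^esub> y1"
    note gD = HomD[OF g] and G = element_atD[OF gen_lift[OF y1]]
    have s: "und y1 \<in> Arr C" "Cod C (und y1) = tot S x1" "Dom C (und y1) = S"
      using y1 unfolding elements_iff[OF S] by auto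
    have "(elem S x1 (und y1 \<cdot> h), elem S x2 (tr S g \<cdot> (und y1 \<cdot> h))) \<in> rel S'"
      using rel_tr[OF S gD(1), of "und y1 \<cdot> h"] G gD by simp
    moreover have "und y2 \<cdot> h = tr S g \<cdot> (und y1 \<cdot> h)"
      unfolding eq using tr_arr[OF S gD(1)] gD s hD by (simp add: slice_comp)
    ultimately show "((x1, y1), (x2, y2)) \<in> ?r" using y1 y2 by (simp add: lift_def)
  qed
  then have lifted: "(lift (elem E x k), lift (elem E' x' k')) \<in> rel S'" using rel by blast
  have restrict: "(lift (elem E x k), elem E x (k \<cdot> h)) \<in> rel S'" if k: "element_at S E x k" for E x k
  proof -
    note G = element_atD[OF k]
    let ?f = "pr E x \<cdot> k"
    have f: "?f \<in> Arr C" "Dom C ?f = S" "Cod C ?f = E" using G by simp_all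
    have xf: "x \<in> Obj (Fib A (Cod C ?f))" using G f by simp
    note s = sec[OF G(1,2,3,5), unfolded G(4)] and c = cart_arr[OF f(1) xf]
    have sh: "sec E x k \<cdot> h \<in> Arr C" "Cod C (sec E x k \<cdot> h) = tot S (ReO A ?f x)" "Dom C (sec E x k \<cdot> h) = S'"
      using s hD by simp_all
    have "cart ?f x \<cdot> (sec E x k \<cdot> h) = k \<cdot> h"
      using comp_eq[OF s(5), of h] s hD c f by simp
    then show ?thesis
      using rel_cart[OF f(1) xf, of "sec E x k \<cdot> h"] sh unfolding f G(4) by (simp add: lift_def elem_def G(4))
  qed
  show ?thesis
    using rel_trans[OF rel_sym[OF restrict[OF k]] rel_trans[OF lifted restrict[OF k']]] .
qed

text \<open>
  The value of a cocone at an element depends only on its class: having the same value is an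
  equivalence relation that contains the generating pairs.  The two elements lie over possibly different
  \<open>e\<close> and \<open>e'\<close>, but over the same arrow \<open>b\<close> from their stage to \<open>I\<close>, and all values are computed there.
\<close>

lemma family_rel:
  assumes n: "slice_family I v n" and k: "element_at S E x k" and k': "element_at S E' x' k'"
    and rel: "(elem E x k, elem E' x' k') \<in> rel S"
    and e: "e \<in> Hom C E I" and e': "e' \<in> Hom C E' I" and eq: "e \<cdot> (pr E x \<cdot> k) = e' \<cdot> (pr E' x' \<cdot> k')"
  shows "n e x \<cdot> k = n e' x' \<cdot> k'"
proof -
  note G = element_atD[OF k] and eD = HomD[OF e] and S = element_atD(6)[OF k]
  define b where "b = e \<cdot> (pr E x \<cdot> k)"
  have b: "b \<in> Arr C" "Dom C b = S" "Cod C b = I" unfolding b_def using G eD by simp_all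
  note nD = slice_familyD(3-5)[OF n]
  note n_tr = slice_familyD(7)[OF n b(1,3), unfolded b(2)] and n_cart = slice_familyD(8)[OF n]
  define val where "val p = n b (fst p) \<cdot> und (snd p)" for p :: "'x \<times> 'a \<times> 'a \<times> 'a"
  let ?r = "{(p, q). p \<in> elements C A D S \<and> q \<in> elements C A D S \<and> val p = val q}"
  have "rel S \<subseteq> ?r"
  proof (rule rel_least)
    show "equiv (elements C A D S) ?r"
      by (rule equivI) (auto simp: refl_on_def sym_def trans_def)
    fix x1 y1 x2 y2 g
    assume y1: "(x1, y1) \<in> elements C A D S" and y2: "(x2, y2) \<in> elements C A D S"
      and g: "g \<in> Hom (Fib A S) x1 x2" and eq: "y2 = FunA D S g \<cdot>\<^bsub>slice C S\<^esub> y1"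
    note gD = HomD[OF g]
    have s: "und y1 \<in> Arr C" "Cod C (und y1) = tot S x1" "Dom C (und y1) = S" "x1 \<in> Obj (Fib A S)" "x2 \<in> Obj
        (Fib A S)"
      using y1 y2 unfolding elements_iff[OF S] by auto
    have "n b x1 \<cdot> und y1 = n b x2 \<cdot> (tr S g \<cdot> und y1)"
      using comp_eq[OF n_tr[OF gD(1)], of "und y1"] tr_arr[OF S gD(1)] gD s nD[of b x2] b by simp
    then show "((x1, y1), (x2, y2)) \<in> ?r"
      using y1 y2 unfolding eq by (simp add: val_def slice_comp)
  qed
  then have vals: "val (elem E x k) = val (elem E' x' k')" using rel by blast
  have val_elem: "val (elem E x k) = n e x \<cdot> k"
    if k: "element_at S E x k" and e: "e \<in> Hom C E I" and b_eq: "b = e \<cdot> (pr E x \<cdot> k)" for E x k e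
  proof -
    note G = element_atD[OF k] and eD = HomD[OF e]
    let ?f = "pr E x \<cdot> k"
    have f: "?f \<in> Arr C" "Dom C ?f = S" "Cod C ?f = E" using G by simp_all
    have xf: "x \<in> Obj (Fib A (Cod C ?f))" using G f by simp
    note s = sec[OF G(1,2,3,5), unfolded G(4)] and c = cart_arr[OF f(1) xf]
    have "val (elem E x k) = (n e x \<cdot> cart ?f x) \<cdot> sec E x k"
      unfolding val_def elem_def b_eq using n_cart[OF eD(1,3) f(1) _ xf] f eD by simp
    also have "\<dots> = n e x \<cdot> (cart ?f x \<cdot> sec E x k)"
      using s c f nD[OF eD(1,3), of x] G eD by (intro assoc) simp_all
    also have "\<dots> = n e x \<cdot> k" unfolding s(5) ..
    finally show ?thesis .
  qed
  show ?thesis using vals val_elem[OF k e b_def] val_elem[OF k' e'] eq unfolding b_def by simp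
qed

text \<open>
  A cocone is a cocone over the terminal object, so that a cocone and its localizations can be treated
  at once.
\<close>

lemma cocone_family_slice_family:
  assumes n: "cocone_family V n"
  shows "slice_family (One C) (bang C V) (\<lambda>e. n (Dom C e))"
proof -
  note V = cocone_familyD(1)[OF n] and nD = cocone_familyD(2-4)[OF n]
  have bang: "e \<cdot> pr (Dom C e) x = bang C (tot (Dom C e) x)" if "e \<in> Arr C" "Cod C e = One C" "x \<in> Obj (Fib
      A (Dom C e))" for e x
  proof -
    note p = pr_arr[OF dom_obj[OF that(1)] that(3)]
    have "Dom C (e \<cdot> pr (Dom C e) x) = tot (Dom C e) x" using that p by simp
    then show ?thesis using bang_unique[of "e \<cdot> pr (Dom C e) x"] that p by simp
  qed
  show ?thesis
    unfolding slice_family_def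
  proof (intro conjI ballI impI)
    show "bang C V \<in> Arr C" "Cod C (bang C V) = One C" using V by simp_all
    fix e assume e: "e \<in> Arr C" "Cod C e = One C"
    show "n (Dom C e) x \<in> Hom C (tot (Dom C e) x) (Dom C (bang C V))" "bang C V \<cdot> n (Dom C e) x = e \<cdot> pr
        (Dom C e) x"
      if "x \<in> Obj (Fib A (Dom C e))" for x
      using nD[OF dom_obj[OF e(1)] that] bang[OF e that] V by (simp_all add: Hom_def)
    show "n (Dom C e) (Cod (Fib A (Dom C e)) g) \<cdot> tr (Dom C e) g = n (Dom C e) (Dom (Fib A (Dom C e)) g)"
      if "g \<in> Arr (Fib A (Dom C e))" for g
      using cocone_familyD(5)[OF n] that e by simp
    show "n (Dom C (e \<cdot> k)) (ReO A k x) = n (Dom C e) x \<cdot> cart k x"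
      if "k \<in> Arr C" "Cod C k = Dom C e" "x \<in> Obj (Fib A (Cod C k))" for k x
      using cocone_familyD(6)[OF n that(1,3)] that e by simp
  qed
qed

text \<open>
  The arrows \<open>g\<close> such that \<open>h \<cdot> g\<close> is the value of \<open>m\<close> at a pair in \<open>elements C A D (Dom C g)\<close>.
\<close>

definition attained :: "('o \<Rightarrow> 'x \<Rightarrow> 'a) \<Rightarrow> 'o \<Rightarrow> 'a \<Rightarrow> 'a set" where
  "attained m F h = {g \<in> Arr C. Cod C g = F \<and> (\<exists>x s. element_at (Dom C g) (Dom C g) x s \<and>
     pr (Dom C g) x \<cdot> s = Idn C (Dom C g) \<and> m (Dom C g) x \<cdot> s = h \<cdot> g)}"

end

section \<open>Elements that are locally equal in the diagram\<close>

locale topos_diagram = indexed_diagram C A D + covering_category C univ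
  for C :: "('o, 'a, 'z) lex_category_scheme" (structure)
    and A :: "('o, 'a, 'x, 'm) indexed_category"
    and D :: "('o, 'a, 'x, 'm, 'a, 'a \<times> 'a \<times> 'a) indexed_functor"
    and univ :: "'u itself"
begin

definition agree :: "'o \<Rightarrow> 'x \<Rightarrow> 'a \<Rightarrow> 'o \<Rightarrow> 'x \<Rightarrow> 'a \<Rightarrow> 'a set" where
  "agree E x k E' x' k' = {g \<in> Arr C. Cod C g = Dom C k \<and> (elem E x (k \<cdot> g), elem E' x' (k' \<cdot> g)) \<in> rel (Dom
      C g)}"

text \<open>
  The right-hand side of the second condition of the theorem, with the largest possible family.
\<close>

definition sim :: "'o \<Rightarrow> 'x \<Rightarrow> 'a \<Rightarrow> 'o \<Rightarrow> 'x \<Rightarrow> 'a \<Rightarrow> bool" where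
  "sim E x k E' x' k' \<longleftrightarrow> cover C (Dom C k) (agree E x k E' x' k')"

lemma agreeD:
  assumes "g \<in> agree E x k E' x' k'"
  shows "g \<in> Arr C" "Cod C g = Dom C k" "(elem E x (k \<cdot> g), elem E' x' (k' \<cdot> g)) \<in> rel (Dom C g)"
  using assms unfolding agree_def by simp_all

lemma agree_comp:
  assumes k: "element_at S E x k" and k': "element_at S E' x' k'" and g: "g \<in> agree E x k E' x' k'" and h:
      "h \<in> Hom C T (Dom C g)"
  shows "g \<cdot> h \<in> agree E x k E' x' k'"
proof -
  note G = element_atD[OF k] and G' = element_atD[OF k'] and gD = agreeD[OF g] and hD = HomD[OF h]
  have gH: "g \<in> Hom C (Dom C g) S" using gD G by (simp add: Hom_def)
  show ?thesis
    using rel_lift[OF element_at_comp[OF k gH] element_at_comp[OF k' gH] gD(3) h] G G' gD hD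
    unfolding agree_def by simp
qed

lemma sim_rel:
  assumes k: "element_at S E x k" and k': "element_at S E' x' k'" and rel: "(elem E x k, elem E' x' k') \<in>
      rel S"
  shows "sim E x k E' x' k'"
  unfolding sim_def
proof (rule cover_idn)
  note G = element_atD[OF k] and G' = element_atD[OF k']
  show "Dom C k \<in> Obj C" using G by simp
  show "Idn C (Dom C k) \<in> agree E x k E' x' k'" unfolding agree_def using G G' rel by simp
qed (rule agreeD, assumption)+

lemma sim_refl: "element_at S E x k \<Longrightarrow> sim E x k E x k"
  by (rule sim_rel) (auto intro: rel_refl elem_in_elements)

lemma sim_sym:
  assumes k: "element_at S E x k" and k': "element_at S E' x' k'" and "sim E x k E' x' k'"
  shows "sim E' x' k' E x k"
proof -
  have "agree E' x' k' E x k = agree E x k E' x' k'"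
    unfolding agree_def element_atD(4)[OF k] element_atD(4)[OF k']
    by (rule Collect_cong, intro conj_cong refl iffI; erule rel_sym)
  then show ?thesis using assms(3) element_atD(4)[OF k] element_atD(4)[OF k'] unfolding sim_def by simp
qed

lemma sim_local:
  assumes k: "element_at S E x k" and k': "element_at S E' x' k'" and W: "cover C S W"
    and sim: "\<And>g. g \<in> W \<Longrightarrow> sim E x (k \<cdot> g) E' x' (k' \<cdot> g)"
  shows "sim E x k E' x' k'"
  unfolding sim_def
proof (rule cover_trans)
  note G = element_atD[OF k] and G' = element_atD[OF k']
  show "cover C (Dom C k) W" using W G by simp
  fix f assume f: "f \<in> W"
  note fD = cover_arr[OF W f]
  show "cover C (Dom C f) (agree E x (k \<cdot> f) E' x' (k' \<cdot> f))"
    using sim[OF f] fD G unfolding sim_def by simp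
  fix g assume "g \<in> agree E x (k \<cdot> f) E' x' (k' \<cdot> f)"
  from agreeD[OF this] show "f \<cdot> g \<in> agree E x k E' x' k'"
    unfolding agree_def using fD G G' by simp
qed (rule agreeD, assumption)+

lemma sim_restrict:
  assumes k: "element_at S E x k" and k': "element_at S E' x' k'" and sim: "sim E x k E' x' k'" and h: "h \<in>
      Hom C T S"
  shows "sim E x (k \<cdot> h) E' x' (k' \<cdot> h)"
proof -
  note G = element_atD[OF k] and G' = element_atD[OF k'] and hD = HomD[OF h]
  have W: "cover C S (agree E x k E' x' k')" using sim G unfolding sim_def by simp
  note P = cover_pullback[OF W h]
  have d: "Dom C (k \<cdot> h) = T" using G hD by simp
  show ?thesis
    unfolding sim_def d
  proof (rule cover_mono[OF P])
    show "{g \<in> Arr C. Cod C g = T \<and> (\<exists>f \<in> agree E x k E' x' k'. \<exists>j \<in> Hom C (Dom C g) (Dom C f). h \<cdot> g = f \<cdot>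
        j)}
        \<subseteq> agree E x (k \<cdot> h) E' x' (k' \<cdot> h)"
    proof
      fix g assume "g \<in> {g \<in> Arr C. Cod C g = T \<and> (\<exists>f \<in> agree E x k E' x' k'. \<exists>j \<in> Hom C (Dom C g) (Dom C
          f). h \<cdot> g = f \<cdot> j)}"
      then obtain f j where g: "g \<in> Arr C" "Cod C g = T" and f: "f \<in> agree E x k E' x' k'"
        and j: "j \<in> Hom C (Dom C g) (Dom C f)" and eq: "h \<cdot> g = f \<cdot> j" by blast
      have "h \<cdot> g \<in> agree E x k E' x' k'" unfolding eq by (rule agree_comp[OF k k' f j])
      from agreeD[OF this] show "g \<in> agree E x (k \<cdot> h) E' x' (k' \<cdot> h)"
        unfolding agree_def using g G G' hD by simp
    qed
    show "\<And>g. g \<in> agree E x (k \<cdot> h) E' x' (k' \<cdot> h) \<Longrightarrow> g \<in> Arr C" by (rule agreeD)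
    show "\<And>g. g \<in> agree E x (k \<cdot> h) E' x' (k' \<cdot> h) \<Longrightarrow> Cod C g = T" using agreeD(2) d by metis
  qed
qed

text \<open>
  Restricted to the family on which \<open>k\<close> and \<open>k'\<close> are related, \<open>k'\<close> and \<open>k''\<close> are still locally related.
\<close>

lemma sim_trans:
  assumes k: "element_at S E x k" and k': "element_at S E' x' k'" and k'': "element_at S E'' x'' k''"
    and 1: "sim E x k E' x' k'" and 2: "sim E' x' k' E'' x'' k''"
  shows "sim E x k E'' x'' k''"
proof -
  note G = element_atD[OF k] and G' = element_atD[OF k'] and G'' = element_atD[OF k'']
  have W: "cover C S (agree E x k E' x' k')" using 1 G unfolding sim_def by simp
  have "sim E x (k \<cdot> f) E'' x'' (k'' \<cdot> f)" if f: "f \<in> agree E x k E' x' k'" for f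
  proof -
    note fD = agreeD[OF f]
    have fH: "f \<in> Hom C (Dom C f) S" using fD G by (simp add: Hom_def)
    note kf = element_at_comp[OF k fH] and kf' = element_at_comp[OF k' fH] and kf'' = element_at_comp[OF k''
        fH]
    have s: "sim E' x' (k' \<cdot> f) E'' x'' (k'' \<cdot> f)" by (rule sim_restrict[OF k' k'' 2 fH])
    have sub: "agree E' x' (k' \<cdot> f) E'' x'' (k'' \<cdot> f) \<subseteq> agree E x (k \<cdot> f) E'' x'' (k'' \<cdot> f)"
    proof
      fix g assume g: "g \<in> agree E' x' (k' \<cdot> f) E'' x'' (k'' \<cdot> f)"
      note gD = agreeD[OF g]
      have gH: "g \<in> Hom C (Dom C g) (Dom C f)" using gD fD G G' by (simp add: Hom_def)
      note r = rel_lift[OF kf kf' fD(3) gH]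
      show "g \<in> agree E x (k \<cdot> f) E'' x'' (k'' \<cdot> f)"
        unfolding agree_def using rel_trans[OF r gD(3)] gD fD G G' by simp
    qed
    have dd: "Dom C (k' \<cdot> f) = Dom C (k \<cdot> f)" using fD G G' by simp
    show ?thesis
      unfolding sim_def
      by (rule cover_mono[OF s[unfolded sim_def dd] sub]) (rule agreeD, assumption)+
  qed
  then show ?thesis by (rule sim_local[OF k k'' W])
qed

text \<open>
  The direction of the second condition that holds for every cocone.
\<close>

lemma family_sim:
  assumes n: "slice_family I v n" and k: "element_at S E x k" and k': "element_at S E' x' k'" and sim: "sim
      E x k E' x' k'"
    and e: "e \<in> Hom C E I" and e': "e' \<in> Hom C E' I" and eq: "e \<cdot> (pr E x \<cdot> k) = e' \<cdot> (pr E' x' \<cdot> k')"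
  shows "n e x \<cdot> k = n e' x' \<cdot> k'"
proof -
  note G = element_atD[OF k] and G' = element_atD[OF k'] and eD = HomD[OF e] and e'D = HomD[OF e']
  note nD = slice_familyD(3-5)[OF n]
  note N = nD[OF eD(1,3), of x] and N' = nD[OF e'D(1,3), of x']
  have W: "cover C S (agree E x k E' x' k')" using sim G unfolding sim_def by simp
  show ?thesis
  proof (rule cover_cancel[OF W])
    show "n e x \<cdot> k \<in> Hom C S (Dom C v)" "n e' x' \<cdot> k' \<in> Hom C S (Dom C v)"
      using N N' G G' eD e'D by (simp_all add: Hom_def)
    fix f assume f: "f \<in> agree E x k E' x' k'"
    note fD = agreeD[OF f]
    have fH: "f \<in> Hom C (Dom C f) S" using fD G by (simp add: Hom_def)
    have "e \<cdot> (pr E x \<cdot> (k \<cdot> f)) = (e \<cdot> (pr E x \<cdot> k)) \<cdot> f" using G eD fD by simp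
    also have "\<dots> = e' \<cdot> (pr E' x' \<cdot> (k' \<cdot> f))" unfolding eq using G G' e'D fD by simp
    finally have "n e x \<cdot> (k \<cdot> f) = n e' x' \<cdot> (k' \<cdot> f)"
      by (rule family_rel[OF n element_at_comp[OF k fH] element_at_comp[OF k' fH] fD(3) e e'])
    then show "(n e x \<cdot> k) \<cdot> f = (n e' x' \<cdot> k') \<cdot> f" using N N' G G' eD e'D fD by simp
  qed
qed

end

section \<open>The conditions imply universality\<close>

context topos_diagram
begin

text \<open>
  Here \<open>P\<close> is \<open>U\<close> over the terminal object, or \<open>I \<times> U\<close> over \<open>I\<close>; \<open>m\<close> is the given cocone, \<open>l\<close> its version
  with vertex \<open>P\<close>, and \<open>n\<close> another cocone over \<open>I\<close>.  On a cover of \<open>P\<close>, the arrow \<open>q\<close> is the value of \<open>m\<close>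
  at some element, and the arrow \<open>h\<close> must take the value of \<open>n\<close> at the same element.  These prescribed
  values do not depend on the element and are compatible: elements with the same value under \<open>m\<close> are
  locally related, so \<open>n\<close> does not distinguish them either.
\<close>

lemma glue_universal:
  assumes m: "cocone_family U m"
    and sep: "\<And>S E x k E' x' k'. element_at S E x k \<Longrightarrow> element_at S E' x' k' \<Longrightarrow> m E x \<cdot> k = m E' x' \<cdot> k' \<Longrightarrow> sim
        E x k E' x' k'"
    and surj: "\<And>F h. h \<in> Hom C F U \<Longrightarrow> cover C F (attained m F h)"
    and p: "p \<in> Hom C P I" and q: "q \<in> Hom C P U"
    and mono: "\<And>T u w. u \<in> Hom C T P \<Longrightarrow> w \<in> Hom C T P \<Longrightarrow> p \<cdot> u = p \<cdot> w \<Longrightarrow> q \<cdot> u = q \<cdot> w \<Longrightarrow> u = w"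
    and l: "\<And>e x. e \<in> Arr C \<Longrightarrow> Cod C e = I \<Longrightarrow> x \<in> Obj (Fib A (Dom C e)) \<Longrightarrow>
       l e x \<in> Hom C (tot (Dom C e) x) P \<and> p \<cdot> l e x = e \<cdot> pr (Dom C e) x \<and> q \<cdot> l e x = m (Dom C e) x"
    and n: "slice_family I v n"
  shows "\<exists>!h. h \<in> Hom C P (Dom C v) \<and> v \<cdot> h = p \<and>
    (\<forall>e \<in> Arr C. Cod C e = I \<longrightarrow> (\<forall>x \<in> Obj (Fib A (Dom C e)). h \<cdot> l e x = n e x))"
proof -
  note pD = HomD[OF p] and qD = HomD[OF q]
  have PO: "P \<in> Obj C" using dom_obj[OF pD(1)] pD by simp
  note v = slice_familyD(1,2)[OF n] and nD = slice_familyD(3-6)[OF n] and mD = cocone_familyD(2-4)[OF m]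
  have lD: "l e x \<in> Arr C" "Dom C (l e x) = tot (Dom C e) x" "Cod C (l e x) = P"
    "p \<cdot> l e x = e \<cdot> pr (Dom C e) x" "q \<cdot> l e x = m (Dom C e) x"
    if "e \<in> Arr C" "Cod C e = I" "x \<in> Obj (Fib A (Dom C e))" for e x
    using l[OF that] by (simp_all add: Hom_def)
  have eqn: "n e x \<cdot> k = n e' x' \<cdot> k'"
    if k: "element_at S E x k" and k': "element_at S E' x' k'" and e: "e \<in> Hom C E I" and e': "e' \<in> Hom C E'
        I"
      and "e \<cdot> (pr E x \<cdot> k) = e' \<cdot> (pr E' x' \<cdot> k')" "m E x \<cdot> k = m E' x' \<cdot> k'" for S E x k E' x' k' e e'
    by (rule family_sim[OF n k k' sep[OF k k' that(6)] e e' that(5)])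
  \<comment> \<open>the arrows on which \<open>q\<close> is a value of \<open>m\<close>\<close>
  define W where "W = attained m P q"
  have W: "cover C P W" unfolding W_def by (rule surj[OF q])
  note WD = cover_arr[OF W]
  have "\<forall>g \<in> W. \<exists>x s. element_at (Dom C g) (Dom C g) x s \<and> pr (Dom C g) x \<cdot> s = Idn C (Dom C g) \<and> m (Dom C
      g) x \<cdot> s = q \<cdot> g"
    unfolding W_def attained_def by simp
  then obtain xx ss where "\<forall>g \<in> W. element_at (Dom C g) (Dom C g) (xx g) (ss g) \<and>
      pr (Dom C g) (xx g) \<cdot> ss g = Idn C (Dom C g) \<and> m (Dom C g) (xx g) \<cdot> ss g = q \<cdot> g" by metis
  then have ss: "element_at (Dom C g) (Dom C g) (xx g) (ss g)" "pr (Dom C g) (xx g) \<cdot> ss g = Idn C (Dom C g)"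
    "m (Dom C g) (xx g) \<cdot> ss g = q \<cdot> g" if "g \<in> W" for g using that by simp_all
  have pg: "p \<cdot> g \<in> Hom C (Dom C g) I" "p \<cdot> g \<in> Arr C" "Cod C (p \<cdot> g) = I" "Dom C (p \<cdot> g) = Dom C g" if "g \<in>
      W" for g
    using WD[OF that] pD by (simp_all add: Hom_def)
  \<comment> \<open>the value prescribed for \<open>h\<close> on \<open>g\<close>\<close>
  define k where "k g = n (p \<cdot> g) (xx g) \<cdot> ss g" for g
  have ng: "n (p \<cdot> g) (xx g) \<in> Arr C" "Dom C (n (p \<cdot> g) (xx g)) = tot (Dom C g) (xx g)"
    "Cod C (n (p \<cdot> g) (xx g)) = Dom C v" "v \<cdot> n (p \<cdot> g) (xx g) = (p \<cdot> g) \<cdot> pr (Dom C g) (xx g)" if "g \<in> W"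
        for g
    using nD[OF pg(2,3)[OF that], of "xx g"] pg(4)[OF that] element_atD(2)[OF ss(1)[OF that]] by simp_all
  have kD: "k g \<in> Hom C (Dom C g) (Dom C v)" if "g \<in> W" for g
    unfolding k_def using ng[OF that] element_atD[OF ss(1)[OF that]] by (simp add: Hom_def)
  have sect: "(p \<cdot> g) \<cdot> (pr (Dom C g) (xx g) \<cdot> (ss g \<cdot> a)) = p \<cdot> (g \<cdot> a)" "m (Dom C g) (xx g) \<cdot> (ss g \<cdot> a) =
      q \<cdot> (g \<cdot> a)"
    if g: "g \<in> W" and a: "a \<in> Arr C" "Cod C a = Dom C g" for g a
  proof -
    note G = element_atD[OF ss(1)[OF g]] and gD = WD[OF g]
    note M = mD[OF G(1,2)]
    show "(p \<cdot> g) \<cdot> (pr (Dom C g) (xx g) \<cdot> (ss g \<cdot> a)) = p \<cdot> (g \<cdot> a)"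
      using comp_eq[OF ss(2)[OF g], of a] G a gD pD by simp
    show "m (Dom C g) (xx g) \<cdot> (ss g \<cdot> a) = q \<cdot> (g \<cdot> a)"
      using comp_eq[OF ss(3)[OF g], of a] G M a gD qD by simp
  qed
  have compat: "k f \<cdot> a = k f' \<cdot> b"
    if f: "f \<in> W" and f': "f' \<in> W" and a: "a \<in> Hom C R (Dom C f)" and b: "b \<in> Hom C R (Dom C f')"
      and eq: "f \<cdot> a = f' \<cdot> b" for f f' R a b
  proof -
    note aD = HomD[OF a] and bD = HomD[OF b]
    have "n (p \<cdot> f) (xx f) \<cdot> (ss f \<cdot> a) = n (p \<cdot> f') (xx f') \<cdot> (ss f' \<cdot> b)"
      by (rule eqn[OF element_at_comp[OF ss(1)[OF f] a] element_at_comp[OF ss(1)[OF f'] b] pg(1)[OF f]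
          pg(1)[OF f']])
        (use sect[OF f aD(1,3)] sect[OF f' bD(1,3)] eq in simp_all)
    then show ?thesis
      unfolding k_def using ng[OF f] ng[OF f'] element_atD[OF ss(1)[OF f]] element_atD[OF ss(1)[OF f']] aD
          bD by simp
  qed
  have vO: "Dom C v \<in> Obj C" using v by simp
  have "\<exists>h \<in> Hom C P (Dom C v). \<forall>f \<in> W. h \<cdot> f = k f"
    by (rule cover_glue[OF W PO vO]) (fact kD, fact compat)
  then obtain h where h: "h \<in> Hom C P (Dom C v)" and hk: "\<forall>f \<in> W. h \<cdot> f = k f" by blast
  note hD = HomD[OF h]
  have vh: "v \<cdot> h = p"
  proof (rule cover_cancel[OF W])
    show "v \<cdot> h \<in> Hom C P I" "p \<in> Hom C P I" using v hD p by (simp_all add: Hom_def)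
    fix g assume g: "g \<in> W"
    note G = element_atD[OF ss(1)[OF g]] and gD = WD[OF g] and N = ng[OF g]
    have "(v \<cdot> h) \<cdot> g = v \<cdot> k g" using hk g hD gD v by simp
    also have "\<dots> = ((p \<cdot> g) \<cdot> pr (Dom C g) (xx g)) \<cdot> ss g"
      unfolding k_def by (rule comp_eq[OF N(4)]) (use N G v in simp_all)
    also have "\<dots> = p \<cdot> g" using ss(2)[OF g] G gD pD by simp
    finally show "(v \<cdot> h) \<cdot> g = p \<cdot> g" .
  qed
  have hl: "h \<cdot> l e x = n e x" if e: "e \<in> Arr C" "Cod C e = I" and x: "x \<in> Obj (Fib A (Dom C e))" for e x
  proof -
    note L = lD[OF e x] and N = nD[OF e x] and O = dom_obj[OF e(1)] and M = mD[OF dom_obj[OF e(1)] x]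
      and prD = pr_arr[OF dom_obj[OF e(1)] x]
    have lH: "l e x \<in> Hom C (tot (Dom C e) x) P" using L by (simp add: Hom_def)
    have eH: "e \<in> Hom C (Dom C e) I" using e by (simp add: Hom_def)
    show ?thesis
    proof (rule cover_cancel[OF cover_pullback[OF W lH]])
      show "h \<cdot> l e x \<in> Hom C (tot (Dom C e) x) (Dom C v)" "n e x \<in> Hom C (tot (Dom C e) x) (Dom C v)"
        using L N hD by (simp_all add: Hom_def)
      fix t assume "t \<in> {g \<in> Arr C. Cod C g = tot (Dom C e) x \<and> (\<exists>f \<in> W. \<exists>k \<in> Hom C (Dom C g) (Dom C f). l e
          x \<cdot> g = f \<cdot> k)}"
      then obtain g b where t: "t \<in> Arr C" "Cod C t = tot (Dom C e) x" and g: "g \<in> W"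
        and b: "b \<in> Hom C (Dom C t) (Dom C g)" and eq: "l e x \<cdot> t = g \<cdot> b" by blast
      note bD = HomD[OF b] and G = element_atD[OF ss(1)[OF g]] and gD = WD[OF g]
      have gt: "element_at (Dom C t) (Dom C e) x t" using t O x by (simp add: element_at_def)
      have "e \<cdot> (pr (Dom C e) x \<cdot> t) = p \<cdot> (l e x \<cdot> t)" using comp_eq[OF L(4), of t] L t e prD pD by simp
      then have 1: "e \<cdot> (pr (Dom C e) x \<cdot> t) = (p \<cdot> g) \<cdot> (pr (Dom C g) (xx g) \<cdot> (ss g \<cdot> b))"
        unfolding eq sect(1)[OF g bD(1,3)] .
      have "m (Dom C e) x \<cdot> t = q \<cdot> (l e x \<cdot> t)" using comp_eq[OF L(5), of t] L t qD by simp
      then have 2: "m (Dom C e) x \<cdot> t = m (Dom C g) (xx g) \<cdot> (ss g \<cdot> b)" unfolding eq sect(2)[OF g bD(1,3)] .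
      have "n e x \<cdot> t = n (p \<cdot> g) (xx g) \<cdot> (ss g \<cdot> b)"
        by (rule eqn[OF gt element_at_comp[OF ss(1)[OF g] b] eH pg(1)[OF g] 1 2])
      also have "\<dots> = k g \<cdot> b" unfolding k_def using ng[OF g] G bD by simp
      also have "\<dots> = h \<cdot> (g \<cdot> b)" using comp_eq[OF bspec[OF hk g], of b] bD gD hD by simp
      also have "\<dots> = (h \<cdot> l e x) \<cdot> t" unfolding eq[symmetric] using hD L t by simp
      finally show "(h \<cdot> l e x) \<cdot> t = n e x \<cdot> t" by simp
    qed
  qed
  show ?thesis
  proof (rule ex1I[of _ h])
    show "h \<in> Hom C P (Dom C v) \<and> v \<cdot> h = p \<and>
        (\<forall>e \<in> Arr C. Cod C e = I \<longrightarrow> (\<forall>x \<in> Obj (Fib A (Dom C e)). h \<cdot> l e x = n e x))"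
      using h vh hl by simp
    fix h' assume h': "h' \<in> Hom C P (Dom C v) \<and> v \<cdot> h' = p \<and>
        (\<forall>e \<in> Arr C. Cod C e = I \<longrightarrow> (\<forall>x \<in> Obj (Fib A (Dom C e)). h' \<cdot> l e x = n e x))"
    then have h'H: "h' \<in> Hom C P (Dom C v)"
      and h'l: "\<And>e x. e \<in> Arr C \<Longrightarrow> Cod C e = I \<Longrightarrow> x \<in> Obj (Fib A (Dom C e)) \<Longrightarrow> h' \<cdot> l e x = n e x" by simp_all
    note h'D = HomD[OF h'H]
    show "h' = h"
    proof (rule cover_cancel[OF W h'H h])
      fix g assume g: "g \<in> W"
      note G = element_atD[OF ss(1)[OF g]] and gD = WD[OF g]
      have xg: "xx g \<in> Obj (Fib A (Dom C (p \<cdot> g)))" using G pg(4)[OF g] by simp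
      note L = lD[OF pg(2,3)[OF g] xg, unfolded pg(4)[OF g]]
      \<comment> \<open>each \<open>g\<close> in the cover is itself a value of \<open>l\<close>, so \<open>h'\<close> is prescribed on it by \<open>h'l\<close>\<close>
      have "l (p \<cdot> g) (xx g) \<cdot> ss g = g"
      proof (rule mono)
        show "l (p \<cdot> g) (xx g) \<cdot> ss g \<in> Hom C (Dom C g) P" "g \<in> Hom C (Dom C g) P"
          using L G gD by (simp_all add: Hom_def)
        have "p \<cdot> (l (p \<cdot> g) (xx g) \<cdot> ss g) = ((p \<cdot> g) \<cdot> pr (Dom C g) (xx g)) \<cdot> ss g"
          by (rule comp_eq[OF L(4)]) (use L G pD in simp_all)
        also have "\<dots> = p \<cdot> g" using ss(2)[OF g] G gD pD by simp
        finally show "p \<cdot> (l (p \<cdot> g) (xx g) \<cdot> ss g) = p \<cdot> g" .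
        have "q \<cdot> (l (p \<cdot> g) (xx g) \<cdot> ss g) = m (Dom C g) (xx g) \<cdot> ss g"
          by (rule comp_eq[OF L(5)]) (use L G qD in simp_all)
        then show "q \<cdot> (l (p \<cdot> g) (xx g) \<cdot> ss g) = q \<cdot> g" using ss(3)[OF g] by simp
      qed
      then have "h' \<cdot> g = h' \<cdot> (l (p \<cdot> g) (xx g) \<cdot> ss g)" by simp
      also have "\<dots> = k g"
        unfolding k_def by (rule comp_eq[OF h'l[OF pg(2,3)[OF g] xg]]) (use L G h'D in simp_all)
      finally show "h' \<cdot> g = h \<cdot> g" using hk g by simp
    qed
  qed
qed

text \<open>
  The second condition of the theorem compares elements over one object \<open>E\<close>.  Elements over two
  different objects are moved to their common stage \<open>S\<close>: the section of \<open>D(f\<^sup>*x)\<close> induced by \<open>k\<close> has the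
  same value and the same class as \<open>k\<close>.
\<close>

lemma separation:
  assumes m: "cocone_family U m"
    and sep: "\<And>E S x k x' k'. element_at S E x k \<Longrightarrow> element_at S E x' k' \<Longrightarrow> pr E x \<cdot> k = pr E x' \<cdot> k' \<Longrightarrow>
      m E x \<cdot> k = m E x' \<cdot> k' \<Longrightarrow> sim E x k E x' k'"
    and k: "element_at S E x k" and k': "element_at S E' x' k'" and eq: "m E x \<cdot> k = m E' x' \<cdot> k'"
  shows "sim E x k E' x' k'"
proof -
  note mD = cocone_familyD(2-4)[OF m] and m_cart = cocone_familyD(6)[OF m]
  have move: "element_at S S (ReO A (pr E x \<cdot> k) x) (sec E x k)" "pr S (ReO A (pr E x \<cdot> k) x) \<cdot> sec E x k =
      Idn C S"
    "m S (ReO A (pr E x \<cdot> k) x) \<cdot> sec E x k = m E x \<cdot> k" "sim S (ReO A (pr E x \<cdot> k) x) (sec E x k) E x k"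
    if k: "element_at S E x k" for E x k
  proof -
    note G = element_atD[OF k]
    let ?f = "pr E x \<cdot> k"
    have f: "?f \<in> Arr C" "Dom C ?f = S" "Cod C ?f = E" using G by simp_all
    have xf: "x \<in> Obj (Fib A (Cod C ?f))" using G f by simp
    have x': "ReO A ?f x \<in> Obj (Fib A S)" using ReO_obj[OF f(1) xf] f by simp
    note s = sec[OF G(1,2,3,5), unfolded G(4)] and c = cart_arr[OF f(1) xf, unfolded f]
    show g: "element_at S S (ReO A ?f x) (sec E x k)" using s x' G by (simp add: element_at_def)
    show "pr S (ReO A ?f x) \<cdot> sec E x k = Idn C S" by (rule s(4))
    have "m S (ReO A ?f x) \<cdot> sec E x k = (m E x \<cdot> cart ?f x) \<cdot> sec E x k" using m_cart[OF f(1) xf] f by simp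
    also have "\<dots> = m E x \<cdot> (cart ?f x \<cdot> sec E x k)" using mD[OF G(1,2)] c s by (intro assoc) simp_all
    finally show "m S (ReO A ?f x) \<cdot> sec E x k = m E x \<cdot> k" unfolding s(5) .
    show "sim S (ReO A ?f x) (sec E x k) E x k"
      by (rule sim_rel[OF g k]) (use rel_cart[OF f(1) xf, of "sec E x k"] s f in simp)
  qed
  have "sim S (ReO A (pr E x \<cdot> k) x) (sec E x k) S (ReO A (pr E' x' \<cdot> k') x') (sec E' x' k')"
    by (rule sep[OF move(1)[OF k] move(1)[OF k']])
      (use move(2,3)[OF k] move(2,3)[OF k'] eq in simp_all)
  from sim_trans[OF move(1)[OF k] move(1)[OF k'] k' this move(4)[OF k']]
  show ?thesis by (rule sim_trans[OF k move(1)[OF k] k' sim_sym[OF move(1)[OF k] k move(4)[OF k]]])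
qed

text \<open>
  Two applications of \<open>glue_universal\<close>: with \<open>P = U\<close> for the cocone itself, and with \<open>P = I \<times> U\<close> for its
  localization at \<open>I\<close>.
\<close>

lemma conditions_imp_colimiting:
  assumes \<mu>: "indexed_cocone C A D U \<mu>"
    and sep: "\<And>E S x k x' k'. element_at S E x k \<Longrightarrow> element_at S E x' k' \<Longrightarrow> pr E x \<cdot> k = pr E x' \<cdot> k' \<Longrightarrow>
      leg U \<mu> E x \<cdot> k = leg U \<mu> E x' \<cdot> k' \<Longrightarrow> sim E x k E x' k'"
    and surj: "\<And>F h. h \<in> Hom C F U \<Longrightarrow> cover C F (attained (leg U \<mu>) F h)"
  shows "indexed_colimiting_cocone C A D U \<mu>"
proof -
  note m = indexed_coconeD(2)[OF \<mu>] and U = indexed_coconeD(1)[OF \<mu>]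
  note sep' = separation[OF m sep]
  note lD = leg_arr[OF \<mu>]
  have "colimiting_cocone C A D U \<mu>"
    unfolding colimiting_cocone_iff[OF \<mu>]
  proof (intro allI impI)
    fix V n assume n: "cocone_family V n"
    note V = cocone_familyD(1)[OF n]
    note sf = cocone_family_slice_family[OF n]
    have iU: "Idn C U \<in> Hom C U U" and bU: "bang C U \<in> Hom C U (One C)" using U by (simp_all add: Hom_def)
    have "\<exists>!h. h \<in> Hom C U (Dom C (bang C V)) \<and> bang C V \<cdot> h = bang C U \<and>
        (\<forall>e \<in> Arr C. Cod C e = One C \<longrightarrow> (\<forall>x \<in> Obj (Fib A (Dom C e)). h \<cdot> leg U \<mu> (Dom C e) x = n (Dom C e) x))"
    proof (rule glue_universal[OF m sep' surj bU iU _ _ sf])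
      show "u = w" if "u \<in> Hom C T U" "w \<in> Hom C T U" "Idn C U \<cdot> u = Idn C U \<cdot> w" for T u w
        using that by (simp add: Hom_def)
      show "leg U \<mu> (Dom C e) x \<in> Hom C (tot (Dom C e) x) U \<and> bang C U \<cdot> leg U \<mu> (Dom C e) x = e \<cdot> pr (Dom C
          e) x \<and>
          Idn C U \<cdot> leg U \<mu> (Dom C e) x = leg U \<mu> (Dom C e) x"
        if e: "e \<in> Arr C" "Cod C e = One C" and x: "x \<in> Obj (Fib A (Dom C e))" for e x
      proof -
        note L = lD[OF dom_obj[OF e(1)] x] and p = pr_arr[OF dom_obj[OF e(1)] x]
        have d: "Dom C (e \<cdot> pr (Dom C e) x) = tot (Dom C e) x" using e p by simp
        have "e \<cdot> pr (Dom C e) x = bang C (tot (Dom C e) x)"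
          using bang_unique[of "e \<cdot> pr (Dom C e) x", unfolded d] e p by simp
        then show ?thesis using L by (simp add: Hom_def)
      qed
    qed
    moreover have "(h \<in> Hom C U (Dom C (bang C V)) \<and> bang C V \<cdot> h = bang C U \<and>
        (\<forall>e \<in> Arr C. Cod C e = One C \<longrightarrow> (\<forall>x \<in> Obj (Fib A (Dom C e)). h \<cdot> leg U \<mu> (Dom C e) x = n (Dom C e)
            x))) \<longleftrightarrow>
        (h \<in> Hom C U V \<and> (\<forall>E \<in> Obj C. \<forall>x \<in> Obj (Fib A E). h \<cdot> leg U \<mu> E x = n E x))" (is "?P h \<longleftrightarrow> ?Q h") for h
    proof
      assume P: "?P h"
      have "h \<cdot> leg U \<mu> E x = n E x" if "E \<in> Obj C" "x \<in> Obj (Fib A E)" for E x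
        using P[THEN conjunct2, THEN conjunct2, rule_format, of "bang C E" x] that by simp
      then show "?Q h" using P V by simp
    next
      assume Q: "?Q h"
      then have hD: "h \<in> Arr C" "Dom C h = U" "Cod C h = V" by (simp_all add: Hom_def)
      show "?P h" using Q V hD by (auto simp: Hom_def)
    qed
    ultimately show "\<exists>!h. h \<in> Hom C U V \<and> (\<forall>E \<in> Obj C. \<forall>x \<in> Obj (Fib A E). h \<cdot> leg U \<mu> E x = n E x)" by simp
  qed
  moreover have "colimiting_cocone (lex_slice C I) (localize_category C A) (localize_functor C D)
      (const_obj C I U) (localize_cocone C I U \<mu>)" if I: "I \<in> Obj C" for I
  proof (rule localized_colimiting[OF \<mu> I])
    fix v n assume n: "slice_family I v n"
    let ?Q = "const_obj C I U" and ?q = "Pt C (bang C I) (bang C U)"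
    note Q = const_obj_arr[OF I U]
    have p: "?Q \<in> Hom C (Dom C ?Q) I" and q: "?q \<in> Hom C (Dom C ?Q) U"
      using Q I U by (simp_all add: Hom_def const_obj_def)
    show "\<exists>!h. h \<in> Hom C (Dom C ?Q) (Dom C v) \<and> v \<cdot> h = ?Q \<and>
        (\<forall>e \<in> Arr C. Cod C e = I \<longrightarrow> (\<forall>x \<in> Obj (Fib A (Dom C e)). h \<cdot> slice_leg I U \<mu> e x = n e x))"
    proof (rule glue_universal[OF m sep' surj p q _ _ n])
      show "u = w" if "u \<in> Hom C T (Dom C ?Q)" "w \<in> Hom C T (Dom C ?Q)" "?Q \<cdot> u = ?Q \<cdot> w" "?q \<cdot> u = ?q \<cdot> w"
          for T u w
        by (rule pullback_eqI[of "bang C I" "bang C U"]) (use that I U in \<open>simp_all add: Hom_def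
            const_obj_def\<close>)
      show "slice_leg I U \<mu> e x \<in> Hom C (tot (Dom C e) x) (Dom C ?Q) \<and> ?Q \<cdot> slice_leg I U \<mu> e x = e \<cdot> pr
          (Dom C e) x \<and>
          ?q \<cdot> slice_leg I U \<mu> e x = leg U \<mu> (Dom C e) x"
        if "e \<in> Arr C" "Cod C e = I" "x \<in> Obj (Fib A (Dom C e))" for e x
        using slice_leg[OF \<mu> that] by (simp add: Hom_def)
    qed
  qed
  ultimately show ?thesis unfolding indexed_colimiting_cocone_def by blast
qed

end

section \<open>Universality implies the conditions\<close>

text \<open>
  It is enough to know an object \<open>x\<close> of a fibre up to an arrow, because every arrow of a fibre preserves
  the classes of elements.
\<close>

definition generic_object ::
  "('o, 'a, 'z) category_scheme \<Rightarrow> ('o, 'a, 'x, 'm) indexed_category \<Rightarrow> 'o \<Rightarrow> 'x \<Rightarrow> bool" where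
  "generic_object C A B x\<^sub>0 \<longleftrightarrow> B \<in> Obj C \<and> x\<^sub>0 \<in> Obj (Fib A B) \<and>
     (\<forall>E \<in> Obj C. \<forall>x \<in> Obj (Fib A E). \<exists>c \<in> Hom C E B. \<exists>\<theta>. \<theta> \<in> Hom (Fib A E) x (ReO A c x\<^sub>0))"

text \<open>
  The generic object of an externalization is the identity of the object of objects: an object
  \<open>E \<rightarrow> C0 K\<close> of the fibre at \<open>E\<close> is its reindexing along itself.  An equivalence carries this to \<open>A\<close>.
\<close>

lemma externalization_generic:
  assumes C: "category C" and A: "is_indexed_category C A" and K: "is_internal_category C K"
    and eq: "equivalent_indexed_categories C A (externalization C K)"
  shows "\<exists>B x\<^sub>0. generic_object C A B x\<^sub>0"
proof -
  interpret C: category C by (rule C)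
  let ?X = "externalization C K" and ?B = "C0 K"
  obtain F G \<eta> \<epsilon> where F: "is_indexed_functor C A ?X F" and G: "is_indexed_functor C ?X A G"
    and \<eta>: "is_indexed_nat_iso C A A (comp_indexed_functor C A G F) (id_indexed_functor C A) \<eta>"
    using eq unfolding equivalent_indexed_categories_def by blast
  have B: "?B \<in> Obj C" using K unfolding is_internal_category_def by simp
  have XO: "Obj (Fib ?X E) = Hom C E ?B" for E by (simp add: externalization_def)
  have i: "Idn C ?B \<in> Obj (Fib ?X ?B)" unfolding XO using B by (simp add: Hom_def)
  have x0: "FunO G ?B (Idn C ?B) \<in> Obj (Fib A ?B)"
    using G B i unfolding is_indexed_functor_def is_functor_def by simp
  have "generic_object C A ?B (FunO G ?B (Idn C ?B))"
    unfolding generic_object_def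
  proof (intro conjI ballI B x0)
    fix E x assume E: "E \<in> Obj C" and x: "x \<in> Obj (Fib A E)"
    interpret FE: category "Fib A E" using A E unfolding is_indexed_category_def by simp
    let ?c = "FunO F E x"
    have c: "?c \<in> Hom C E ?B" using F E x unfolding is_indexed_functor_def is_functor_def XO by simp
    note cD = HomD[OF c]
    have "\<eta> E x \<in> Hom (Fib A E) (FunO G E ?c) x" "is_iso (Fib A E) (\<eta> E x)"
      using \<eta> E x unfolding is_indexed_nat_iso_def is_nat_iso_def comp_indexed_functor_def
          id_indexed_functor_def by simp_all
    then obtain j where "inverse_pair (Fib A E) (\<eta> E x) j" and \<eta>H: "\<eta> E x \<in> Hom (Fib A E) (FunO G E ?c) x"
      unfolding is_iso_def by blast
    then have j: "j \<in> Hom (Fib A E) x (FunO G E ?c)"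
      using HomD[OF \<eta>H] unfolding inverse_pair_def by simp
    have "is_nat_iso (Fib ?X (Cod C ?c)) (Fib A (Dom C ?c))
        (FunO G (Dom C ?c) \<circ> ReO ?X ?c) (FunA G (Dom C ?c) \<circ> ReA ?X ?c)
        (ReO A ?c \<circ> FunO G (Cod C ?c)) (ReA A ?c \<circ> FunA G (Cod C ?c)) (Cmp G ?c)"
      using G cD(1) unfolding is_indexed_functor_def by simp
    then have "Cmp G ?c (Idn C ?B) \<in> Hom (Fib A E) (FunO G E (ReO ?X ?c (Idn C ?B))) (ReO A ?c (FunO G ?B
        (Idn C ?B)))"
      using i unfolding is_nat_iso_def cD by simp
    moreover have "ReO ?X ?c (Idn C ?B) = ?c" using cD by (simp add: externalization_def)
    ultimately have k: "Cmp G ?c (Idn C ?B) \<in> Hom (Fib A E) (FunO G E ?c) (ReO A ?c (FunO G ?B (Idn C ?B)))"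
        by simp
    show "\<exists>c \<in> Hom C E ?B. \<exists>\<theta>. \<theta> \<in> Hom (Fib A E) x (ReO A c (FunO G ?B (Idn C ?B)))"
      using c FE.comp_hom[OF j k] by blast
  qed
  then show ?thesis by blast
qed


context topos_diagram
begin

text \<open>
  The arrow from \<open>D(x)\<close> to \<open>D(x\<^sub>0)\<close> is \<open>D(\<theta>)\<close> followed by the cartesian arrow over \<open>c\<close>; both preserve the
  classes of elements.
\<close>

lemma generic_arrow:
  assumes B: "B \<in> Obj C" "x\<^sub>0 \<in> Obj (Fib A B)"
    and c: "c \<in> Hom C E B" and \<theta>: "\<theta> \<in> Hom (Fib A E) x (ReO A c x\<^sub>0)"
  shows "\<exists>a \<in> Hom C (tot E x) (tot B x\<^sub>0). \<forall>S k. element_at S E x k \<longrightarrow>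
    (elem E x k, elem B x\<^sub>0 (a \<cdot> k)) \<in> rel S \<and> c \<cdot> (pr E x \<cdot> k) = pr B x\<^sub>0 \<cdot> (a \<cdot> k)"
proof -
  note cD = HomD[OF c] and \<theta>D = HomD[OF \<theta>]
  have E: "E \<in> Obj C" using dom_obj[OF cD(1)] cD by simp
  have xc: "x\<^sub>0 \<in> Obj (Fib A (Cod C c))" using B cD by simp
  note t = tr_arr[OF E \<theta>D(1), unfolded \<theta>D] and ca = cart_arr[OF cD(1) xc, unfolded cD] and sq =
      cart_square[OF cD(1) xc, unfolded cD]
  have x: "x \<in> Obj (Fib A E)" using fib_dom[OF E \<theta>D(1)] \<theta>D by simp
  have x': "ReO A c x\<^sub>0 \<in> Obj (Fib A E)" using ReO_obj[OF cD(1) xc] cD by simp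
  define a where "a = cart c x\<^sub>0 \<cdot> tr E \<theta>"
  have a: "a \<in> Hom C (tot E x) (tot B x\<^sub>0)" unfolding a_def using t ca by (simp add: Hom_def)
  have "(elem E x k, elem B x\<^sub>0 (a \<cdot> k)) \<in> rel S" "c \<cdot> (pr E x \<cdot> k) = pr B x\<^sub>0 \<cdot> (a \<cdot> k)" if k: "element_at
      S E x k" for S k
  proof -
    note G = element_atD[OF k]
    have ak: "a \<cdot> k = cart c x\<^sub>0 \<cdot> (tr E \<theta> \<cdot> k)" unfolding a_def using t ca G by simp
    have "(elem E x k, elem E (ReO A c x\<^sub>0) (tr E \<theta> \<cdot> k)) \<in> rel S"
      using rel_tr[OF E \<theta>D(1), of k] G \<theta>D by simp
    moreover have "(elem E (ReO A c x\<^sub>0) (tr E \<theta> \<cdot> k), elem B x\<^sub>0 (cart c x\<^sub>0 \<cdot> (tr E \<theta> \<cdot> k))) \<in> rel S"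
      using rel_cart[OF cD(1) xc, of "tr E \<theta> \<cdot> k"] G t cD by simp
    ultimately show "(elem E x k, elem B x\<^sub>0 (a \<cdot> k)) \<in> rel S" unfolding ak by (rule rel_trans)
    have "pr B x\<^sub>0 \<cdot> (a \<cdot> k) = (c \<cdot> pr E (ReO A c x\<^sub>0)) \<cdot> (tr E \<theta> \<cdot> k)"
      unfolding ak by (rule comp_eq[OF sq]) (use ca t G pr_arr[OF B] in simp_all)
    also have "\<dots> = c \<cdot> ((pr E (ReO A c x\<^sub>0) \<cdot> tr E \<theta>) \<cdot> k)"
      using comp_eq[OF t(4), of k] t G cD pr_arr[OF E x'] by simp
    also have "\<dots> = c \<cdot> (pr E x \<cdot> k)" unfolding t(4) ..
    finally show "c \<cdot> (pr E x \<cdot> k) = pr B x\<^sub>0 \<cdot> (a \<cdot> k)" by simp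
  qed
  then show ?thesis using a by blast
qed

text \<open>
  The cocone that separates as many elements as a cocone can.  Local relatedness of elements of
  \<open>D(x\<^sub>0)\<close> is an equivalence relation to which \<open>effective_quotient\<close> applies, and every \<open>D(x)\<close> is mapped to
  the quotient through \<open>D(x\<^sub>0)\<close>.  The resulting arrows form a cocone because the values at locally related
  elements agree.
\<close>

lemma classifying_family:
  assumes B: "B \<in> Obj C" "x\<^sub>0 \<in> Obj (Fib A B)"
    and generic: "\<And>E x. E \<in> Obj C \<Longrightarrow> x \<in> Obj (Fib A E) \<Longrightarrow>
      \<exists>a \<in> Hom C (tot E x) (tot B x\<^sub>0). \<forall>S k. element_at S E x k \<longrightarrow> (elem E x k, elem B x\<^sub>0 (a \<cdot> k)) \<in> rel S"
  shows "\<exists>Z n. cocone_family Z n \<and> (\<forall>S E x k E' x' k'. element_at S E x k \<longrightarrow> element_at S E' x' k' \<longrightarrow>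
    n E x \<cdot> k = n E' x' \<cdot> k' \<longrightarrow> sim E x k E' x' k')"
proof -
  let ?X = "tot B x\<^sub>0"
  have X: "?X \<in> Obj C" using pr_arr[OF B] by simp
  have g: "element_at S B x\<^sub>0 a" if "a \<in> Hom C S ?X" for S a using that B by (simp add: element_at_def
      Hom_def)
  have gD: "a \<in> Hom C S ?X" if "element_at S B x\<^sub>0 a" for S a using that by (simp add: element_at_def Hom_def)
  have "\<exists>Z. \<exists>\<chi> \<in> Hom C ?X Z. \<forall>S. \<forall>a \<in> Hom C S ?X. \<forall>b \<in> Hom C S ?X. \<chi> \<cdot> a = \<chi> \<cdot> b \<longleftrightarrow> sim B x\<^sub>0 a B x\<^sub>0 b"
  proof (rule effective_quotient[OF X])
    show "sim B x\<^sub>0 a B x\<^sub>0 a" if "a \<in> Hom C S ?X" for S a by (rule sim_refl[OF g[OF that]])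
    show "sim B x\<^sub>0 b B x\<^sub>0 a" if "a \<in> Hom C S ?X" "b \<in> Hom C S ?X" "sim B x\<^sub>0 a B x\<^sub>0 b" for S a b
      by (rule sim_sym[OF g[OF that(1)] g[OF that(2)] that(3)])
    show "sim B x\<^sub>0 a B x\<^sub>0 c" if "a \<in> Hom C S ?X" "b \<in> Hom C S ?X" "c \<in> Hom C S ?X"
      "sim B x\<^sub>0 a B x\<^sub>0 b" "sim B x\<^sub>0 b B x\<^sub>0 c" for S a b c
      by (rule sim_trans[OF g[OF that(1)] g[OF that(2)] g[OF that(3)] that(4,5)])
    show "sim B x\<^sub>0 (a \<cdot> t) B x\<^sub>0 (b \<cdot> t)" if "a \<in> Hom C S ?X" "b \<in> Hom C S ?X" "t \<in> Hom C S' S" "sim B x\<^sub>0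
        a B x\<^sub>0 b" for S S' a b t
      by (rule sim_restrict[OF g[OF that(1)] g[OF that(2)] that(4,3)])
    show "sim B x\<^sub>0 a B x\<^sub>0 b" if "a \<in> Hom C S ?X" "b \<in> Hom C S ?X" "cover C S W" "\<And>t. t \<in> W \<Longrightarrow> sim B x\<^sub>0 (a
        \<cdot> t) B x\<^sub>0 (b \<cdot> t)" for S a b W
      by (rule sim_local[OF g[OF that(1)] g[OF that(2)] that(3,4)])
  qed
  then obtain Z \<chi> where \<chi>: "\<chi> \<in> Hom C ?X Z"
    and eq: "\<And>S a b. a \<in> Hom C S ?X \<Longrightarrow> b \<in> Hom C S ?X \<Longrightarrow> \<chi> \<cdot> a = \<chi> \<cdot> b \<longleftrightarrow> sim B x\<^sub>0 a B x\<^sub>0 b" by blast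
  note \<chi>D = HomD[OF \<chi>]
  \<comment> \<open>the choice does not matter, since \<open>\<chi>\<close> identifies all arrows that preserve the classes of elements\<close>
  define arr where "arr E x = (SOME a. a \<in> Hom C (tot E x) ?X \<and> (\<forall>S k. element_at S E x k \<longrightarrow> (elem E x k,
      elem B x\<^sub>0 (a \<cdot> k)) \<in> rel S))" for E x
  have arr: "arr E x \<in> Hom C (tot E x) ?X" "\<And>S k. element_at S E x k \<Longrightarrow> (elem E x k, elem B x\<^sub>0 (arr E x \<cdot>
      k)) \<in> rel S"
    if "E \<in> Obj C" "x \<in> Obj (Fib A E)" for E x
  proof -
    have "\<exists>a. a \<in> Hom C (tot E x) ?X \<and> (\<forall>S k. element_at S E x k \<longrightarrow> (elem E x k, elem B x\<^sub>0 (a \<cdot> k)) \<in> rel S)"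
      using generic[OF that] by blast
    from someI_ex[OF this] have "arr E x \<in> Hom C (tot E x) ?X \<and> (\<forall>S k. element_at S E x k \<longrightarrow> (elem E x k,
        elem B x\<^sub>0 (arr E x \<cdot> k)) \<in> rel S)"
      unfolding arr_def .
    then show "arr E x \<in> Hom C (tot E x) ?X" "\<And>S k. element_at S E x k \<Longrightarrow> (elem E x k, elem B x\<^sub>0 (arr E x \<cdot>
        k)) \<in> rel S"
      by blast+
  qed
  define n where "n E x = \<chi> \<cdot> arr E x" for E x
  have ak: "arr E x \<cdot> k \<in> Hom C S ?X" and nk: "n E x \<cdot> k = \<chi> \<cdot> (arr E x \<cdot> k)" if k: "element_at S E x k" for
      S E x k
    using HomD[OF arr(1)[OF element_atD(1,2)[OF k]]] element_atD[OF k] \<chi>D by (simp_all add: Hom_def n_def)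
  have s: "sim E x k B x\<^sub>0 (arr E x \<cdot> k)" if k: "element_at S E x k" for S E x k
    by (rule sim_rel[OF k g[OF ak[OF k]] arr(2)[OF element_atD(1,2)[OF k] k]])
  have key: "n E x \<cdot> k = n E' x' \<cdot> k' \<longleftrightarrow> sim E x k E' x' k'" if k: "element_at S E x k" and k': "element_at S
      E' x' k'" for S E x k E' x' k'
  proof -
    note a = g[OF ak[OF k]] and a' = g[OF ak[OF k']]
    have "sim B x\<^sub>0 (arr E x \<cdot> k) B x\<^sub>0 (arr E' x' \<cdot> k') \<longleftrightarrow> sim E x k E' x' k'"
    proof
      assume "sim B x\<^sub>0 (arr E x \<cdot> k) B x\<^sub>0 (arr E' x' \<cdot> k')"
      from sim_trans[OF a a' k' this sim_sym[OF k' a' s[OF k']]]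
      show "sim E x k E' x' k'" by (rule sim_trans[OF k a k' s[OF k]])
    next
      assume "sim E x k E' x' k'"
      from sim_trans[OF k k' a' this s[OF k']]
      show "sim B x\<^sub>0 (arr E x \<cdot> k) B x\<^sub>0 (arr E' x' \<cdot> k')" by (rule sim_trans[OF a k a' sim_sym[OF k a s[OF
          k]]])
    qed
    then show ?thesis unfolding nk[OF k] nk[OF k'] using eq[OF ak[OF k] ak[OF k']] by blast
  qed
  have nD: "n E x \<in> Arr C" "Dom C (n E x) = tot E x" "Cod C (n E x) = Z" if "E \<in> Obj C" "x \<in> Obj (Fib A E)"
      for E x
    unfolding n_def using HomD[OF arr(1)[OF that]] \<chi>D by simp_all
  have idn: "element_at (tot E x) E x (Idn C (tot E x))" if "E \<in> Obj C" "x \<in> Obj (Fib A E)" for E x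
    using pr_arr[OF that] that by (simp add: element_at_def)
  have "cocone_family Z n"
    unfolding cocone_family_def
  proof (intro conjI ballI)
    show "Z \<in> Obj C" using cod_obj[OF \<chi>D(1)] \<chi>D by simp
    show "n E x \<in> Hom C (tot E x) Z" if "E \<in> Obj C" "x \<in> Obj (Fib A E)" for E x
      using nD[OF that] by (simp add: Hom_def)
    show "n E (Cod (Fib A E) t) \<cdot> tr E t = n E (Dom (Fib A E) t)" if E: "E \<in> Obj C" and t: "t \<in> Arr (Fib A
        E)" for E t
    proof -
      note O = fib_dom[OF E t] fib_cod[OF E t] and tD = tr_arr[OF E t]
      note i = idn[OF E O(1)]
      have "element_at (tot E (Dom (Fib A E) t)) E (Cod (Fib A E) t) (tr E t)" using E O tD by (simp add:
          element_at_def)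
      moreover have "(elem E (Dom (Fib A E) t) (Idn C (tot E (Dom (Fib A E) t))), elem E (Cod (Fib A E) t)
          (tr E t)) \<in> rel (tot E (Dom (Fib A E) t))"
        using rel_tr[OF E t, of "Idn C (tot E (Dom (Fib A E) t))"] tD pr_arr[OF E O(1)] by simp
      ultimately have "n E (Dom (Fib A E) t) \<cdot> Idn C (tot E (Dom (Fib A E) t)) = n E (Cod (Fib A E) t) \<cdot> tr
          E t"
        using key[OF i] sim_rel[OF i] by blast
      then show ?thesis using nD[OF E O(1)] by simp
    qed
    show "n (Dom C \<alpha>) (ReO A \<alpha> x) = n (Cod C \<alpha>) x \<cdot> cart \<alpha> x"
      if \<alpha>: "\<alpha> \<in> Arr C" and x: "x \<in> Obj (Fib A (Cod C \<alpha>))" for \<alpha> x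
    proof -
      note x' = ReO_obj[OF \<alpha> x] and c = cart_arr[OF \<alpha> x] and i = idn[OF dom_obj[OF \<alpha>] ReO_obj[OF \<alpha> x]]
      have "element_at (tot (Dom C \<alpha>) (ReO A \<alpha> x)) (Cod C \<alpha>) x (cart \<alpha> x)" using c x \<alpha> by (simp add:
          element_at_def)
      moreover have "(elem (Dom C \<alpha>) (ReO A \<alpha> x) (Idn C (tot (Dom C \<alpha>) (ReO A \<alpha> x))), elem (Cod C \<alpha>) x (cart
          \<alpha> x)) \<in> rel (tot (Dom C \<alpha>) (ReO A \<alpha> x))"
        using rel_cart[OF \<alpha> x, of "Idn C (tot (Dom C \<alpha>) (ReO A \<alpha> x))"] c pr_arr[OF dom_obj[OF \<alpha>] x'] by simp
      ultimately have "n (Dom C \<alpha>) (ReO A \<alpha> x) \<cdot> Idn C (tot (Dom C \<alpha>) (ReO A \<alpha> x)) = n (Cod C \<alpha>) x \<cdot> cart \<alpha> x"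
        using key[OF i] sim_rel[OF i] by blast
      then show ?thesis using nD[OF dom_obj[OF \<alpha>] x'] by simp
    qed
  qed
  then show ?thesis using key by blast
qed

text \<open>
  The classifying cocone factors through \<open>\<mu>\<close>, so elements with equal values under \<open>\<mu>\<close> are locally
  related.  All components of \<open>\<mu>\<close> factor through the one at \<open>x\<^sub>0\<close>, which is therefore epimorphic by the
  uniqueness of factorizations; its pullback along an arrow into \<open>U\<close> is a cover on which that arrow is a
  value of \<open>\<mu>\<close>.
\<close>

lemma colimiting_imp_conditions:
  assumes \<mu>: "indexed_cocone C A D U \<mu>" and col: "colimiting_cocone C A D U \<mu>"
    and x0: "generic_object C A B x\<^sub>0"
  shows "\<And>S E x k E' x' k'. element_at S E x k \<Longrightarrow> element_at S E' x' k' \<Longrightarrow> leg U \<mu> E x \<cdot> k = leg U \<mu> E' x' \<cdot>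
      k' \<Longrightarrow> sim E x k E' x' k'"
    and "\<And>F h. h \<in> Hom C F U \<Longrightarrow> cover C F (attained (leg U \<mu>) F h)"
proof -
  have B: "B \<in> Obj C" "x\<^sub>0 \<in> Obj (Fib A B)"
    and generic: "\<And>E x. E \<in> Obj C \<Longrightarrow> x \<in> Obj (Fib A E) \<Longrightarrow>
      \<exists>c \<in> Hom C E B. \<exists>\<theta>. \<theta> \<in> Hom (Fib A E) x (ReO A c x\<^sub>0)"
    using x0 unfolding generic_object_def by simp_all
  note m = indexed_coconeD(2)[OF \<mu>] and U = indexed_coconeD(1)[OF \<mu>]
  note lD = leg_arr[OF \<mu>]
  note univ = col[unfolded colimiting_cocone_iff[OF \<mu>], rule_format]
  have gen_arr: "\<exists>a \<in> Hom C (tot E x) (tot B x\<^sub>0). \<forall>S k. element_at S E x k \<longrightarrow> (elem E x k, elem B x\<^sub>0 (a \<cdot>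
      k)) \<in> rel S"
    if E: "E \<in> Obj C" and x: "x \<in> Obj (Fib A E)" for E x
  proof -
    obtain c \<theta> where "c \<in> Hom C E B" "\<theta> \<in> Hom (Fib A E) x (ReO A c x\<^sub>0)" using generic[OF E x] by blast
    from generic_arrow[OF B this] show ?thesis by blast
  qed
  obtain Z n where n: "cocone_family Z n"
    and classify: "\<And>S E x k E' x' k'. element_at S E x k \<Longrightarrow> element_at S E' x' k' \<Longrightarrow> n E x \<cdot> k = n E' x' \<cdot> k'
        \<Longrightarrow> sim E x k E' x' k'"
    using classifying_family[OF B gen_arr] by blast
  obtain h where h: "h \<in> Hom C U Z" and hn: "\<forall>E \<in> Obj C. \<forall>x \<in> Obj (Fib A E). h \<cdot> leg U \<mu> E x = n E x"
    using univ[OF n] by blast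
  note hD = HomD[OF h]
  show "sim E x k E' x' k'"
    if k: "element_at S E x k" and k': "element_at S E' x' k'" and eq: "leg U \<mu> E x \<cdot> k = leg U \<mu> E' x' \<cdot>
        k'" for S E x k E' x' k'
  proof (rule classify[OF k k'])
    note G = element_atD[OF k] and G' = element_atD[OF k']
    note L = lD[OF G(1,2)] and L' = lD[OF G'(1,2)]
    have "n E x \<cdot> k = h \<cdot> (leg U \<mu> E x \<cdot> k)" using comp_eq[OF bspec[OF bspec[OF hn G(1)] G(2)], of k] L G hD
        by simp
    also have "\<dots> = n E' x' \<cdot> k'"
      unfolding eq using comp_eq[OF bspec[OF bspec[OF hn G'(1)] G'(2)], of k'] L' G' hD by simp
    finally show "n E x \<cdot> k = n E' x' \<cdot> k'" .
  qed
  let ?m = "leg U \<mu> B x\<^sub>0" and ?X = "tot B x\<^sub>0"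
  note M = lD[OF B]
  have factor: "\<exists>a \<in> Hom C (tot E x) ?X. leg U \<mu> E x = ?m \<cdot> a" if E: "E \<in> Obj C" and x: "x \<in> Obj (Fib A E)"
      for E x
  proof -
    obtain c \<theta> where c: "c \<in> Hom C E B" "\<theta> \<in> Hom (Fib A E) x (ReO A c x\<^sub>0)" using generic[OF E x] by blast
    from generic_arrow[OF B this] obtain a where a: "a \<in> Hom C (tot E x) ?X"
      and r: "\<And>S k. element_at S E x k \<Longrightarrow> (elem E x k, elem B x\<^sub>0 (a \<cdot> k)) \<in> rel S" by blast
    note aD = HomD[OF a] and p = pr_arr[OF E x]
    have i: "element_at (tot E x) E x (Idn C (tot E x))" using E x p by (simp add: element_at_def)
    have i': "element_at (tot E x) B x\<^sub>0 (a \<cdot> Idn C (tot E x))" using B aD p by (simp add: element_at_def)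
    have bE: "bang C E \<in> Hom C E (One C)" "bang C B \<in> Hom C B (One C)" using E B by (simp_all add: Hom_def)
    have "leg U \<mu> (Dom C (bang C E)) x \<cdot> Idn C (tot E x) = leg U \<mu> (Dom C (bang C B)) x\<^sub>0 \<cdot> (a \<cdot> Idn C (tot
        E x))"
      by (rule family_rel[OF cocone_family_slice_family[OF m] i i' r[OF i] bE])
        (use p aD pr_arr[OF B] E B in simp)
    then show ?thesis using a aD lD[OF E x] E B p by auto
  qed
  have epi: "cover C U {?m}"
  proof (rule coverI)
    show "f \<in> Arr C" "Cod C f = U" if "f \<in> {?m}" for f using that M by simp_all
    fix V u w assume u: "u \<in> Hom C U V" and w: "w \<in> Hom C U V" and eq: "\<And>f. f \<in> {?m} \<Longrightarrow> u \<cdot> f = w \<cdot> f"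
    note uD = HomD[OF u] and wD = HomD[OF w]
    have V: "V \<in> Obj C" using cod_obj[OF uD(1)] uD by simp
    have agree: "w \<cdot> leg U \<mu> E x = u \<cdot> leg U \<mu> E x" if E: "E \<in> Obj C" and x: "x \<in> Obj (Fib A E)" for E x
    proof -
      obtain a where a: "a \<in> Hom C (tot E x) ?X" and l: "leg U \<mu> E x = ?m \<cdot> a" using factor[OF E x] by blast
      show ?thesis
        unfolding l using comp_eq[OF eq[OF singletonI], of a] HomD[OF a] M uD wD by simp
    qed
    note m_tr = cocone_familyD(5)[OF m] and m_cart = cocone_familyD(6)[OF m]
    have "cocone_family V (\<lambda>E x. u \<cdot> leg U \<mu> E x)"
      unfolding cocone_family_def
    proof (intro conjI ballI V)
      show "u \<cdot> leg U \<mu> E x \<in> Hom C (tot E x) V" if "E \<in> Obj C" "x \<in> Obj (Fib A E)" for E x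
        using lD[OF that] uD by (simp add: Hom_def)
      show "(u \<cdot> leg U \<mu> E (Cod (Fib A E) g)) \<cdot> tr E g = u \<cdot> leg U \<mu> E (Dom (Fib A E) g)"
        if E: "E \<in> Obj C" and g: "g \<in> Arr (Fib A E)" for E g
        using m_tr[OF E g] lD[OF E fib_cod[OF E g]] tr_arr[OF E g] uD by simp
      show "u \<cdot> leg U \<mu> (Dom C \<alpha>) (ReO A \<alpha> x) = (u \<cdot> leg U \<mu> (Cod C \<alpha>) x) \<cdot> cart \<alpha> x"
        if \<alpha>: "\<alpha> \<in> Arr C" and x: "x \<in> Obj (Fib A (Cod C \<alpha>))" for \<alpha> x
        using m_cart[OF \<alpha> x] lD[OF cod_obj[OF \<alpha>] x] cart_arr[OF \<alpha> x] uD by simp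
    qed
    \<comment> \<open>\<open>u\<close> and \<open>w\<close> both factor this cocone through \<open>\<mu>\<close>\<close>
    from univ[OF this] show "u = w" using u w agree by blast
  qed
  show "cover C F (attained (leg U \<mu>) F h)" if h: "h \<in> Hom C F U" for F h
  proof (rule cover_mono[OF cover_pullback[OF epi h]])
    show "{g \<in> Arr C. Cod C g = F \<and> (\<exists>f \<in> {?m}. \<exists>k \<in> Hom C (Dom C g) (Dom C f). h \<cdot> g = f \<cdot> k)} \<subseteq>
      attained (leg U \<mu>) F h"
    proof
      fix g assume "g \<in> {g \<in> Arr C. Cod C g = F \<and> (\<exists>f \<in> {?m}. \<exists>k \<in> Hom C (Dom C g) (Dom C f). h \<cdot> g = f \<cdot> k)}"
      then obtain k where g: "g \<in> Arr C" "Cod C g = F" and k: "k \<in> Hom C (Dom C g) (Dom C ?m)" and eq: "h \<cdot>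
          g = ?m \<cdot> k" by blast
      have k: "element_at (Dom C g) B x\<^sub>0 k" using k B M by (simp add: element_at_def Hom_def)
      note G = element_atD[OF k]
      let ?f = "pr B x\<^sub>0 \<cdot> k"
      have f: "?f \<in> Arr C" "Dom C ?f = Dom C g" "Cod C ?f = B" using G by simp_all
      have xf: "x\<^sub>0 \<in> Obj (Fib A (Cod C ?f))" using G f by simp
      have x': "ReO A ?f x\<^sub>0 \<in> Obj (Fib A (Dom C g))" using ReO_obj[OF f(1) xf] f by simp
      note s = sec[OF G(1,2,3,5), unfolded G(4)] and c = cart_arr[OF f(1) xf, unfolded f]
      have "element_at (Dom C g) (Dom C g) (ReO A ?f x\<^sub>0) (sec B x\<^sub>0 k)" using s x' G by (simp add:
          element_at_def)
      moreover have "leg U \<mu> (Dom C g) (ReO A ?f x\<^sub>0) \<cdot> sec B x\<^sub>0 k = h \<cdot> g"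
      proof -
        have "leg U \<mu> (Dom C g) (ReO A ?f x\<^sub>0) \<cdot> sec B x\<^sub>0 k = (?m \<cdot> cart ?f x\<^sub>0) \<cdot> sec B x\<^sub>0 k"
          using cocone_familyD(6)[OF m f(1) xf] f by simp
        also have "\<dots> = ?m \<cdot> (cart ?f x\<^sub>0 \<cdot> sec B x\<^sub>0 k)" using M c s by (intro assoc) simp_all
        finally show ?thesis unfolding s(5) eq .
      qed
      ultimately show "g \<in> attained (leg U \<mu>) F h" unfolding attained_def using g s(4) by blast
    qed
  qed (simp_all add: attained_def)
qed

end

section \<open>The conditions in terms of small families\<close>

context topos_diagram
begin

lemma small_univ: "small univ X \<longleftrightarrow> small TYPE('u) X"
  by (simp add: small_def)

lemma small_indexed_subcover:
  assumes W: "cover C F W" and F: "F \<in> Obj C"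
  obtains J :: "'u set" and f where "small univ J" "epimorphic_family C F J f" "\<And>i. i \<in> J \<Longrightarrow> f i \<in> W"
proof -
  obtain W' where W': "W' \<subseteq> W" "small TYPE('u) W'" "cover C F W'"
    using small_subcover[OF W F] unfolding small_univ by blast
  obtain e :: "'a \<Rightarrow> 'u" where e: "inj_on e W'" by (rule small_encoding[OF W'(2)])
  define f where "f = the_inv_into W' e"
  have f: "f (e w) = w" if "w \<in> W'" for w using e that by (simp add: f_def the_inv_into_f_f)
  have "small univ (e ` W')" unfolding small_univ by (rule small_image[OF W'(2)])
  moreover have "epimorphic_family C F (e ` W') f"
    using W'(3) f unfolding epimorphic_family_def by simp
  moreover have "f i \<in> W" if "i \<in> e ` W'" for i using that f W'(1) by auto
  ultimately show thesis by (rule that)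
qed

lemma epimorphic_family_cover: "epimorphic_family C F J f \<Longrightarrow> cover C F (f ` J)"
  unfolding epimorphic_family_def by simp

text \<open>
  The equations between arrows over \<open>S\<close> in the two conditions are equations between their components in
  \<open>U\<close>.
\<close>

lemma graph_arr_iff:
  assumes \<mu>: "indexed_cocone C A D U \<mu>" and h: "h \<in> Hom C S U" and x: "x \<in> Obj (Fib A S)"
    and \<alpha>: "\<alpha> \<in> Hom (slice C S) (Idn C S) (pr S x)"
  shows "graph_arr C h = \<mu> S x \<cdot>\<^bsub>slice C S\<^esub> \<alpha> \<longleftrightarrow> leg U \<mu> S x \<cdot> und \<alpha> = h"
proof -
  interpret S: category "slice C S" by (rule category_slice)
  note hD = HomD[OF h] and U = indexed_coconeD(1)[OF \<mu>]
  have S: "S \<in> Obj C" using dom_obj[OF hD(1)] hD by simp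
  note m = indexed_coconeD(3)[OF \<mu> S x]
  note mD = slice_homD[OF m] and aD = slice_homD[OF \<alpha>]
  have g: "graph_arr C h \<in> Hom (slice C S) (Idn C S) (const_obj C S U)"
    and gu: "Pt C (bang C S) (bang C U) \<cdot> und (graph_arr C h) = h"
    unfolding graph_arr_def hD const_obj_def using S U hD by (auto intro!: slice_homI)
  have "Pt C (bang C S) (bang C U) \<cdot> und (\<mu> S x \<cdot>\<^bsub>slice C S\<^esub> \<alpha>) = leg U \<mu> S x \<cdot> und \<alpha>"
    unfolding leg_def using mD aD S U by (simp add: slice_comp const_obj_def)
  then show ?thesis using const_hom_eqI[OF g S.comp_hom[OF \<alpha> m] S U] gu by metis
qed

lemma slice_cocone_eq_iff:
  assumes \<mu>: "indexed_cocone C A D U \<mu>" and E: "E \<in> Obj C" and x: "x \<in> Obj (Fib A E)" "x' \<in> Obj (Fib A E)"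
    and y: "y \<in> Hom (slice C E) f (pr E x)" "y' \<in> Hom (slice C E) f (pr E x')"
  shows "\<mu> E x \<cdot>\<^bsub>slice C E\<^esub> y = \<mu> E x' \<cdot>\<^bsub>slice C E\<^esub> y' \<longleftrightarrow> leg U \<mu> E x \<cdot> und y = leg U \<mu> E x' \<cdot> und y'"
proof -
  interpret S: category "slice C E" by (rule category_slice)
  note U = indexed_coconeD(1)[OF \<mu>] and m = indexed_coconeD(3)[OF \<mu> E x(1)] and m' = indexed_coconeD(3)[OF \<mu>
      E x(2)]
  have 1: "Pt C (bang C E) (bang C U) \<cdot> und (\<mu> E x \<cdot>\<^bsub>slice C E\<^esub> y) = leg U \<mu> E x \<cdot> und y"
    unfolding leg_def using slice_homD[OF m] slice_homD[OF y(1)] E U by (simp add: slice_comp const_obj_def)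
  have 2: "Pt C (bang C E) (bang C U) \<cdot> und (\<mu> E x' \<cdot>\<^bsub>slice C E\<^esub> y') = leg U \<mu> E x' \<cdot> und y'"
    unfolding leg_def using slice_homD[OF m'] slice_homD[OF y(2)] E U by (simp add: slice_comp const_obj_def)
  show ?thesis using const_hom_eqI[OF S.comp_hom[OF y(1) m] S.comp_hom[OF y(2) m'] E U] 1 2 by metis
qed

text \<open>
  The family of all arrows along which two elements become related may be large; a small subfamily is
  still epimorphic.
\<close>

lemma sim_iff_small_family:
  assumes E: "E \<in> Obj C" and x: "x \<in> Obj (Fib A E)" "x' \<in> Obj (Fib A E)"
    and y: "y \<in> Hom (slice C E) f (pr E x)" "y' \<in> Hom (slice C E) f (pr E x')"
  shows "sim E x (und y) E x' (und y') \<longleftrightarrow> (\<exists>(I :: 'u set) g. small TYPE('u) I \<and> epimorphic_family C (Dom C f)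
      I g \<and>
    (\<forall>i \<in> I. ((ReO A (f \<cdot> g i) x, restrict_element C D (g i) x y),
       (ReO A (f \<cdot> g i) x', restrict_element C D (g i) x' y')) \<in> rel (Dom C (g i))))"
proof -
  note yD = slice_homD[OF y(1)] and y'D = slice_homD[OF y(2)]
  have F: "Dom C f \<in> Obj C" using yD by simp
  have agree: "g \<in> agree E x (und y) E x' (und y') \<longleftrightarrow>
      ((ReO A (f \<cdot> g) x, restrict_element C D g x y), (ReO A (f \<cdot> g) x', restrict_element C D g x' y')) \<in>
          rel (Dom C g)"
    if "g \<in> Arr C" "Cod C g = Dom C f" for g
    unfolding restrict_element_elem[OF E x(1) y(1) that] restrict_element_elem[OF E x(2) y(2) that] agree_def
    using that yD by simp
  show ?thesis
  proof
    assume "sim E x (und y) E x' (und y')"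
    then have "cover C (Dom C f) (agree E x (und y) E x' (und y'))" unfolding sim_def using yD by simp
    then obtain I :: "'u set" and g where "small univ I" "epimorphic_family C (Dom C f) I g"
      "\<And>i. i \<in> I \<Longrightarrow> g i \<in> agree E x (und y) E x' (und y')"
      by (rule small_indexed_subcover[OF _ F]) blast
    moreover from this have "g i \<in> Arr C" "Cod C (g i) = Dom C f" if "i \<in> I" for i
      using that unfolding epimorphic_family_def by simp_all
    ultimately show "\<exists>(I :: 'u set) g. small TYPE('u) I \<and> epimorphic_family C (Dom C f) I g \<and>
      (\<forall>i \<in> I. ((ReO A (f \<cdot> g i) x, restrict_element C D (g i) x y),
       (ReO A (f \<cdot> g i) x', restrict_element C D (g i) x' y')) \<in> rel (Dom C (g i)))"
      using agree unfolding small_univ by blast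
  next
    assume "\<exists>(I :: 'u set) g. small TYPE('u) I \<and> epimorphic_family C (Dom C f) I g \<and>
      (\<forall>i \<in> I. ((ReO A (f \<cdot> g i) x, restrict_element C D (g i) x y),
       (ReO A (f \<cdot> g i) x', restrict_element C D (g i) x' y')) \<in> rel (Dom C (g i)))"
    then obtain I :: "'u set" and g where ep: "epimorphic_family C (Dom C f) I g"
      and r: "\<And>i. i \<in> I \<Longrightarrow> ((ReO A (f \<cdot> g i) x, restrict_element C D (g i) x y),
       (ReO A (f \<cdot> g i) x', restrict_element C D (g i) x' y')) \<in> rel (Dom C (g i))" by blast
    have gA: "g i \<in> Arr C" "Cod C (g i) = Dom C f" if "i \<in> I" for i
      using ep that unfolding epimorphic_family_def by simp_all
    show "sim E x (und y) E x' (und y')"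
      unfolding sim_def
    proof (rule cover_mono)
      show "cover C (Dom C (und y)) (g ` I)" using epimorphic_family_cover[OF ep] yD by simp
      show "g ` I \<subseteq> agree E x (und y) E x' (und y')" using agree gA r by blast
    qed (rule agreeD, assumption)+
  qed
qed

lemma cover_attained_iff:
  assumes \<mu>: "indexed_cocone C A D U \<mu>" and h: "h \<in> Hom C F U"
  shows "cover C F (attained (leg U \<mu>) F h) \<longleftrightarrow> (\<exists>(I :: 'u set) f x \<alpha>.
    small TYPE('u) I \<and> epimorphic_family C F I f \<and>
    (\<forall>i \<in> I. x i \<in> Obj (Fib A (Dom C (f i))) \<and>
       \<alpha> i \<in> Hom (slice C (Dom C (f i))) (Idn C (Dom C (f i))) (FunO D (Dom C (f i)) (x i)) \<and>
       graph_arr C (h \<cdot> f i) = \<mu> (Dom C (f i)) (x i) \<cdot>\<^bsub>slice C (Dom C (f i))\<^esub> \<alpha> i))"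
proof -
  note hD = HomD[OF h]
  have F: "F \<in> Obj C" using dom_obj[OF hD(1)] hD by simp
  have graph: "graph_arr C (h \<cdot> f) = \<mu> (Dom C f) x \<cdot>\<^bsub>slice C (Dom C f)\<^esub> \<alpha> \<longleftrightarrow>
      leg U \<mu> (Dom C f) x \<cdot> und \<alpha> = h \<cdot> f"
    if "f \<in> Arr C" "Cod C f = F" "x \<in> Obj (Fib A (Dom C f))"
      "\<alpha> \<in> Hom (slice C (Dom C f)) (Idn C (Dom C f)) (pr (Dom C f) x)" for f x \<alpha>
    by (rule graph_arr_iff[OF \<mu> _ that(3,4)]) (use that(1,2) hD in \<open>simp add: Hom_def\<close>)
  have attained: "f \<in> attained (leg U \<mu>) F h \<longleftrightarrow> (\<exists>x \<alpha>. x \<in> Obj (Fib A (Dom C f)) \<and>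
       \<alpha> \<in> Hom (slice C (Dom C f)) (Idn C (Dom C f)) (pr (Dom C f) x) \<and>
       graph_arr C (h \<cdot> f) = \<mu> (Dom C f) x \<cdot>\<^bsub>slice C (Dom C f)\<^esub> \<alpha>)"
    if f: "f \<in> Arr C" "Cod C f = F" for f
  proof
    assume "f \<in> attained (leg U \<mu>) F h"
    then obtain x s where s: "element_at (Dom C f) (Dom C f) x s" "pr (Dom C f) x \<cdot> s = Idn C (Dom C f)"
      "leg U \<mu> (Dom C f) x \<cdot> s = h \<cdot> f" unfolding attained_def by blast
    note G = element_atD[OF s(1)]
    have "(Idn C (Dom C f), s, pr (Dom C f) x) \<in> Hom (slice C (Dom C f)) (Idn C (Dom C f)) (pr (Dom C f) x)"
      using G s(2) by (intro slice_homI) simp_all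
    then show "\<exists>x \<alpha>. x \<in> Obj (Fib A (Dom C f)) \<and>
       \<alpha> \<in> Hom (slice C (Dom C f)) (Idn C (Dom C f)) (pr (Dom C f) x) \<and>
       graph_arr C (h \<cdot> f) = \<mu> (Dom C f) x \<cdot>\<^bsub>slice C (Dom C f)\<^esub> \<alpha>"
      using graph[OF f G(2)] G(2) s(3) by fastforce
  next
    assume "\<exists>x \<alpha>. x \<in> Obj (Fib A (Dom C f)) \<and>
       \<alpha> \<in> Hom (slice C (Dom C f)) (Idn C (Dom C f)) (pr (Dom C f) x) \<and>
       graph_arr C (h \<cdot> f) = \<mu> (Dom C f) x \<cdot>\<^bsub>slice C (Dom C f)\<^esub> \<alpha>"
    then obtain x \<alpha> where x: "x \<in> Obj (Fib A (Dom C f))"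
      and \<alpha>: "\<alpha> \<in> Hom (slice C (Dom C f)) (Idn C (Dom C f)) (pr (Dom C f) x)"
      and gr: "graph_arr C (h \<cdot> f) = \<mu> (Dom C f) x \<cdot>\<^bsub>slice C (Dom C f)\<^esub> \<alpha>" by blast
    note aD = slice_homD[OF \<alpha>]
    have "element_at (Dom C f) (Dom C f) x (und \<alpha>)" using aD x f by (simp add: element_at_def)
    then show "f \<in> attained (leg U \<mu>) F h"
      unfolding attained_def using graph[OF f x \<alpha>] gr aD(10) f by blast
  qed
  show ?thesis
  proof
    assume "cover C F (attained (leg U \<mu>) F h)"
    then obtain I :: "'u set" and f where I: "small univ I" "epimorphic_family C F I f"
      and "\<And>i. i \<in> I \<Longrightarrow> f i \<in> attained (leg U \<mu>) F h"
      by (rule small_indexed_subcover[OF _ F]) blast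
    moreover from I(2) have "f i \<in> Arr C" "Cod C (f i) = F" if "i \<in> I" for i
      using that unfolding epimorphic_family_def by simp_all
    ultimately have "\<forall>i \<in> I. \<exists>x \<alpha>. x \<in> Obj (Fib A (Dom C (f i))) \<and>
       \<alpha> \<in> Hom (slice C (Dom C (f i))) (Idn C (Dom C (f i))) (pr (Dom C (f i)) x) \<and>
       graph_arr C (h \<cdot> f i) = \<mu> (Dom C (f i)) x \<cdot>\<^bsub>slice C (Dom C (f i))\<^esub> \<alpha>"
      using attained by blast
    then obtain x \<alpha> where "\<forall>i \<in> I. x i \<in> Obj (Fib A (Dom C (f i))) \<and>
       \<alpha> i \<in> Hom (slice C (Dom C (f i))) (Idn C (Dom C (f i))) (pr (Dom C (f i)) (x i)) \<and>
       graph_arr C (h \<cdot> f i) = \<mu> (Dom C (f i)) (x i) \<cdot>\<^bsub>slice C (Dom C (f i))\<^esub> \<alpha> i" by metis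
    then show "\<exists>(I :: 'u set) f x \<alpha>. small TYPE('u) I \<and> epimorphic_family C F I f \<and>
      (\<forall>i \<in> I. x i \<in> Obj (Fib A (Dom C (f i))) \<and>
       \<alpha> i \<in> Hom (slice C (Dom C (f i))) (Idn C (Dom C (f i))) (pr (Dom C (f i)) (x i)) \<and>
       graph_arr C (h \<cdot> f i) = \<mu> (Dom C (f i)) (x i) \<cdot>\<^bsub>slice C (Dom C (f i))\<^esub> \<alpha> i)"
      using I unfolding small_univ by blast
  next
    assume "\<exists>(I :: 'u set) f x \<alpha>. small TYPE('u) I \<and> epimorphic_family C F I f \<and>
      (\<forall>i \<in> I. x i \<in> Obj (Fib A (Dom C (f i))) \<and>
       \<alpha> i \<in> Hom (slice C (Dom C (f i))) (Idn C (Dom C (f i))) (pr (Dom C (f i)) (x i)) \<and>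
       graph_arr C (h \<cdot> f i) = \<mu> (Dom C (f i)) (x i) \<cdot>\<^bsub>slice C (Dom C (f i))\<^esub> \<alpha> i)"
    then obtain I :: "'u set" and f x \<alpha> where ep: "epimorphic_family C F I f"
      and x\<alpha>: "\<forall>i \<in> I. x i \<in> Obj (Fib A (Dom C (f i))) \<and>
       \<alpha> i \<in> Hom (slice C (Dom C (f i))) (Idn C (Dom C (f i))) (pr (Dom C (f i)) (x i)) \<and>
       graph_arr C (h \<cdot> f i) = \<mu> (Dom C (f i)) (x i) \<cdot>\<^bsub>slice C (Dom C (f i))\<^esub> \<alpha> i" by blast
    show "cover C F (attained (leg U \<mu>) F h)"
    proof (rule cover_mono[OF epimorphic_family_cover[OF ep]])
      have "f i \<in> attained (leg U \<mu>) F h" if "i \<in> I" for i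
        using attained[of "f i"] x\<alpha> ep that unfolding epimorphic_family_def by blast
      then show "f ` I \<subseteq> attained (leg U \<mu>) F h" by blast
    qed (simp_all add: attained_def)
  qed
qed

lemma indexed_colimiting_iff_covered_separated:
  assumes \<mu>: "indexed_cocone C A D U \<mu>" and x0: "generic_object C A B x\<^sub>0"
  shows "indexed_colimiting_cocone C A D U \<mu> \<longleftrightarrow>
    (\<forall>F \<in> Obj C. \<forall>h \<in> Hom C F U. cover C F (attained (leg U \<mu>) F h)) \<and>
    (\<forall>E \<in> Obj C. \<forall>F \<in> Obj C. \<forall>f \<in> Hom C F E. \<forall>x \<in> Obj (Fib A E). \<forall>x' \<in> Obj (Fib A E).
       \<forall>y \<in> Hom (slice C E) f (FunO D E x). \<forall>y' \<in> Hom (slice C E) f (FunO D E x').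
         leg U \<mu> E x \<cdot> und y = leg U \<mu> E x' \<cdot> und y' \<longleftrightarrow> sim E x (und y) E x' (und y'))"
    (is "_ \<longleftrightarrow> ?i \<and> ?ii")
proof
  assume "indexed_colimiting_cocone C A D U \<mu>"
  then have col: "colimiting_cocone C A D U \<mu>" unfolding indexed_colimiting_cocone_def by simp
  note conds = colimiting_imp_conditions[OF \<mu> col x0]
  have ?ii
  proof (intro ballI)
    fix E F f x x' y y'
    assume E: "E \<in> Obj C" and f: "f \<in> Hom C F E" and x: "x \<in> Obj (Fib A E)" "x' \<in> Obj (Fib A E)"
      and y: "y \<in> Hom (slice C E) f (pr E x)" "y' \<in> Hom (slice C E) f (pr E x')"
    note yD = slice_homD[OF y(1)] and y'D = slice_homD[OF y(2)] and fD = HomD[OF f]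
    have g: "element_at F E x (und y)" and g': "element_at F E x' (und y')" using yD y'D x E fD by (simp_all
        add: element_at_def)
    have b: "bang C E \<in> Hom C E (One C)" using E by (simp add: Hom_def)
    have "sim E x (und y) E x' (und y') \<Longrightarrow> leg U \<mu> E x \<cdot> und y = leg U \<mu> E x' \<cdot> und y'"
      using family_sim[OF cocone_family_slice_family[OF indexed_coconeD(2)[OF \<mu>]] g g' _ b b] yD y'D E by simp
    then show "leg U \<mu> E x \<cdot> und y = leg U \<mu> E x' \<cdot> und y' \<longleftrightarrow> sim E x (und y) E x' (und y')"
      using conds(1)[OF g g'] by blast
  qed
  then show "?i \<and> ?ii" using conds(2) by simp
next
  assume "?i \<and> ?ii"
  then have i: ?i and ii: ?ii by (rule conjunct1, rule conjunct2)
  show "indexed_colimiting_cocone C A D U \<mu>"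
  proof (rule conditions_imp_colimiting[OF \<mu>])
    fix E S x k x' k'
    assume k: "element_at S E x k" and k': "element_at S E x' k'"
      and eq: "pr E x \<cdot> k = pr E x' \<cdot> k'" "leg U \<mu> E x \<cdot> k = leg U \<mu> E x' \<cdot> k'"
    note G = element_atD[OF k] and G' = element_atD[OF k']
    let ?f = "pr E x \<cdot> k" and ?y = "(pr E x \<cdot> k, k, pr E x)" and ?y' = "(pr E x \<cdot> k, k', pr E x')"
    have f: "?f \<in> Hom C S E" using G by (simp add: Hom_def)
    have y: "?y \<in> Hom (slice C E) ?f (pr E x)" using G by (intro slice_homI) simp_all
    have y': "?y' \<in> Hom (slice C E) ?f (pr E x')"
      by (intro slice_homI) (use G G' eq(1) f in \<open>simp_all add: Hom_def\<close>)
    show "sim E x k E x' k'" using ii[rule_format, OF G(1,6) f G(2) G'(2) y y'] eq(2) by simp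
  next
    fix F h assume h: "h \<in> Hom C F U"
    show "cover C F (attained (leg U \<mu>) F h)"
      using i h dom_obj[OF HomD(1)[OF h]] HomD(2)[OF h] by blast
  qed
qed

end

theorem theorem2p19:
  fixes \<E> :: "('o, 'a) lex_category"
    and A :: "('o, 'a, 'x, 'm) indexed_category"
    and D :: "('o, 'a, 'x, 'm, 'a, 'a \<times> 'a \<times> 'a) indexed_functor"
    and K :: "('o, 'a) internal_category"
    and U :: 'o
    and \<mu> :: "'o \<Rightarrow> 'x \<Rightarrow> 'a \<times> 'a \<times> 'a"
  assumes "inaccessible TYPE('u)"
    and "grothendieck_topos TYPE('u) \<E>"
    and "chosen_finite_limits \<E>"
    and "is_indexed_category \<E> A"
    and "is_internal_category \<E> K"
    and "equivalent_indexed_categories \<E> A (externalization \<E> K)"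
    and "is_indexed_functor \<E> A (self_indexing \<E>) D"
    and "indexed_cocone \<E> A D U \<mu>"
  shows "indexed_colimiting_cocone \<E> A D U \<mu> \<longleftrightarrow>
    (\<forall>F \<in> Obj \<E>. \<forall>h \<in> Hom \<E> F U.
       \<exists>(I :: 'u set) f x \<alpha>.
         small TYPE('u) I \<and> epimorphic_family \<E> F I f \<and>
         (\<forall>i \<in> I. x i \<in> Obj (Fib A (Dom \<E> (f i))) \<and>
            \<alpha> i \<in> Hom (slice \<E> (Dom \<E> (f i)))
                    (Idn \<E> (Dom \<E> (f i))) (FunO D (Dom \<E> (f i)) (x i)) \<and>
            graph_arr \<E> (h \<cdot>\<^bsub>\<E>\<^esub> f i) =
              \<mu> (Dom \<E> (f i)) (x i) \<cdot>\<^bsub>slice \<E> (Dom \<E> (f i))\<^esub> \<alpha> i)) \<and>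
    (\<forall>E \<in> Obj \<E>. \<forall>F \<in> Obj \<E>. \<forall>f \<in> Hom \<E> F E.
       \<forall>x \<in> Obj (Fib A E). \<forall>x' \<in> Obj (Fib A E).
       \<forall>y \<in> Hom (slice \<E> E) f (FunO D E x). \<forall>y' \<in> Hom (slice \<E> E) f (FunO D E x').
         \<mu> E x \<cdot>\<^bsub>slice \<E> E\<^esub> y = \<mu> E x' \<cdot>\<^bsub>slice \<E> E\<^esub> y' \<longleftrightarrow>
         (\<exists>(I :: 'u set) g.
            small TYPE('u) I \<and> epimorphic_family \<E> F I g \<and>
            (\<forall>i \<in> I.
               ((ReO A (f \<cdot>\<^bsub>\<E>\<^esub> g i) x, restrict_element \<E> D (g i) x y),
                (ReO A (f \<cdot>\<^bsub>\<E>\<^esub> g i) x', restrict_element \<E> D (g i) x' y'))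
               \<in> element_rel \<E> A D (Dom \<E> (g i)))))"
proof -
  interpret covering_category \<E> "TYPE('u)" by (rule grothendieck_topos_covering[OF assms(1,2)])
  interpret topos_diagram \<E> A D "TYPE('u)"
    by unfold_locales (fact assms)+
  obtain B x\<^sub>0 where x0: "generic_object \<E> A B x\<^sub>0"
    using externalization_generic[OF category_axioms assms(4-6)] by blast
  note \<mu> = assms(8)
  show ?thesis
    unfolding indexed_colimiting_iff_covered_separated[OF \<mu> x0]
  proof (intro arg_cong2[where f = "(\<and>)"] ball_cong refl)
    fix F h assume "h \<in> Hom \<E> F U"
    then show "cover \<E> F (attained (leg U \<mu>) F h) \<longleftrightarrow> (\<exists>(I :: 'u set) f x \<alpha>.
         small TYPE('u) I \<and> epimorphic_family \<E> F I f \<and>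
         (\<forall>i \<in> I. x i \<in> Obj (Fib A (Dom \<E> (f i))) \<and>
            \<alpha> i \<in> Hom (slice \<E> (Dom \<E> (f i)))
                    (Idn \<E> (Dom \<E> (f i))) (FunO D (Dom \<E> (f i)) (x i)) \<and>
            graph_arr \<E> (h \<cdot>\<^bsub>\<E>\<^esub> f i) =
              \<mu> (Dom \<E> (f i)) (x i) \<cdot>\<^bsub>slice \<E> (Dom \<E> (f i))\<^esub> \<alpha> i))"
      by (rule cover_attained_iff[OF \<mu>])
  next
    fix E F f x x' y y'
    assume E: "E \<in> Obj \<E>" and f: "f \<in> Hom \<E> F E" and x: "x \<in> Obj (Fib A E)" "x' \<in> Obj (Fib A E)"
      and y: "y \<in> Hom (slice \<E> E) f (FunO D E x)" "y' \<in> Hom (slice \<E> E) f (FunO D E x')"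
    show "(leg U \<mu> E x \<cdot>\<^bsub>\<E>\<^esub> und y = leg U \<mu> E x' \<cdot>\<^bsub>\<E>\<^esub> und y' \<longleftrightarrow> sim E x (und y) E x' (und y')) \<longleftrightarrow>
      (\<mu> E x \<cdot>\<^bsub>slice \<E> E\<^esub> y = \<mu> E x' \<cdot>\<^bsub>slice \<E> E\<^esub> y' \<longleftrightarrow>
         (\<exists>(I :: 'u set) g.
            small TYPE('u) I \<and> epimorphic_family \<E> F I g \<and>
            (\<forall>i \<in> I.
               ((ReO A (f \<cdot>\<^bsub>\<E>\<^esub> g i) x, restrict_element \<E> D (g i) x y),
                (ReO A (f \<cdot>\<^bsub>\<E>\<^esub> g i) x', restrict_element \<E> D (g i) x' y'))
               \<in> element_rel \<E> A D (Dom \<E> (g i)))))"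
      unfolding slice_cocone_eq_iff[OF \<mu> E x y] sim_iff_small_family[OF E x y] HomD(2)[OF f] ..
  qed
qed

end
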